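(* Let $B(t)$, $t\in\mathbb{R}$, be a real-valued, measurable, stochastically continuous process with wide-sense stationary increments, $B(0)=0$, with spectral representation $B(t)=D_0t+\int_{\mathbb{R}\setminus\{0\}}(e^{itu}-1)X(du)$ and spectral measure $\mu_B$. For $T>0$ let $f_T$ be the minimizer of $\mathcal{E}_T(f,B)=\int_0^T\left[(f(s)-B(s))^2+f'(s)^2\right]ds$ over $f\in\mathbb{W}_2^1[0,T]$, and let \[ Z:=|D_0|^2+\int_{\mathbb{R}\setminus\{0\}}\frac{u^2}{1+u^2}\,\mu_B(du). \] If the process $B$ is Gaussian and its spectral measure $\mu_B$ has no atoms, then \[ T^{-1}\mathcal{E}_T(f_T,B)\to Z\qquad\text{as }T\to\infty, \] in $L_1$ and almost surely.
   Context: A process $B(t)$, $t\in\mathbb{R}$, has stationary increments in the wide sense if it has finite second moments and the mean and the covariance of the process $t\mapsto B(t_0+t)-B(t_0)$ are the same for all $t_0\in\mathbb{R}$. A stochastically continuous such process with $B(0)=0$ admits the spectral representation $B(t)=D_0t+\int_{\mathbb{R}\setminus\{0\}}(e^{itu}-1)X(du)$, where $D_0$ is a (real) random variable with finite second moment and $X$ is a complex-valued zero-mean uncorrelated random measure on $\mathbb{R}\setminus\{0\}$, uncorrelated with $D_0$; since $B$ is real-valued, $X(-A)=\overline{X(A)}$. The spectral measure $\mu_B$ on $\mathbb{R}\setminus\{0\}$ is defined by $\mu_B(A):=\mathbb{E}|X(A)|^2$; it may be infinite but satisfies $\int_{\mathbb{R}\setminus\{0\}}\min(u^2,1)\,\mu_B(du)<\infty$.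 A measurable version of $B$ is always used; its paths belong to $L_2[0,T]$ almost surely for every $T>0$. $\mathbb{W}_2^1[0,T]$ denotes the space of absolutely continuous functions $f:[0,T]\to\mathbb{R}$ with square integrable derivative. For each path in $L_2[0,T]$ the minimizer $f_T$ exists and is unique; it is taken path by path. *)

theory Defs
  imports "HOL-Probability.Probability"
begin

subsection \<open>The Sobolev space and the penalized energy\<close>

definition AC_on :: "real \<Rightarrow> real \<Rightarrow> (real \<Rightarrow> real) \<Rightarrow> bool" where
  "AC_on a b f \<longleftrightarrow>
     (\<forall>\<epsilon>>0. \<exists>\<delta>>0. \<forall>\<D> S. \<D> division_of S \<and> S \<subseteq> {a..b} \<and> (\<Sum>K\<in>\<D>. Sup K - Inf K) < \<delta>
        \<longrightarrow> (\<Sum>K\<in>\<D>. \<bar>f (Sup K) - f (Inf K)\<bar>) < \<epsilon>)"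

definition square_integrable :: "real set \<Rightarrow> (real \<Rightarrow> real) \<Rightarrow> bool" where
  "square_integrable S g \<longleftrightarrow>
     set_borel_measurable lebesgue S g \<and> set_integrable lebesgue S (\<lambda>s. (g s)\<^sup>2)"

text \<open>
  Elements are total functions, but only their values on the interval \<open>{0..T}\<close> matter: values
  outside affect \<^const>\<open>deriv\<close> at most at the two end points, a null set. The
  differentiability clause makes explicit that \<^const>\<open>deriv\<close> is the genuine derivative
  almost everywhere (for absolutely continuous functions this is Lebesgue's theorem).
\<close>
definition W21 :: "real \<Rightarrow> (real \<Rightarrow> real) set" where
  "W21 T = {f. AC_on 0 T f
             \<and> (AE s in lebesgue_on {0..T}. f differentiable (at s))
             \<and> square_integrable {0..T} (deriv f)}"

text \<open>
  Intended for paths \<open>w\<close> in \<open>L\<^sub>2[0,T]\<close>; for any other measurable path and any \<open>f\<close> in \<^term>\<open>W21 T\<close>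
  the integrand is not integrable and the Bochner integral is 0 by convention.
\<close>
definition energy :: "real \<Rightarrow> (real \<Rightarrow> real) \<Rightarrow> (real \<Rightarrow> real) \<Rightarrow> real" where
  "energy T f w = (LINT s:{0..T}|lebesgue. (f s - w s)\<^sup>2 + (deriv f s)\<^sup>2)"

text \<open>
  For a path \<open>w\<close> in \<open>L\<^sub>2[0,T]\<close> the minimizer is unique on \<open>{0..T}\<close>; the choice made by
  \<^const>\<open>arg_min\<close> concerns only the irrelevant values outside.
\<close>
definition minimizer :: "real \<Rightarrow> (real \<Rightarrow> real) \<Rightarrow> real \<Rightarrow> real" where
  "minimizer T w = arg_min (\<lambda>f. energy T f w) (\<lambda>f. f \<in> W21 T)"

subsection \<open>Processes with wide-sense stationary increments\<close>

definition covariance :: "'a measure \<Rightarrow> ('a \<Rightarrow> real) \<Rightarrow> ('a \<Rightarrow> real) \<Rightarrow> real" where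
  "covariance M Y Y' =
     (\<integral>\<omega>. (Y \<omega> - (\<integral>\<omega>. Y \<omega> \<partial>M)) * (Y' \<omega> - (\<integral>\<omega>. Y' \<omega> \<partial>M)) \<partial>M)"

definition wide_sense_stationary_increments :: "'a measure \<Rightarrow> (real \<Rightarrow> 'a \<Rightarrow> real) \<Rightarrow> bool" where
  "wide_sense_stationary_increments M B \<longleftrightarrow>
     (\<forall>t. B t \<in> borel_measurable M \<and> integrable M (\<lambda>\<omega>. (B t \<omega>)\<^sup>2)) \<and>
     (\<forall>t\<^sub>0 t\<^sub>1 t. (\<integral>\<omega>. B (t\<^sub>0 + t) \<omega> - B t\<^sub>0 \<omega> \<partial>M) = (\<integral>\<omega>. B (t\<^sub>1 + t) \<omega> - B t\<^sub>1 \<omega> \<partial>M)) \<and>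
     (\<forall>t\<^sub>0 t\<^sub>1 s t.
        covariance M (\<lambda>\<omega>. B (t\<^sub>0 + s) \<omega> - B t\<^sub>0 \<omega>) (\<lambda>\<omega>. B (t\<^sub>0 + t) \<omega> - B t\<^sub>0 \<omega>) =
        covariance M (\<lambda>\<omega>. B (t\<^sub>1 + s) \<omega> - B t\<^sub>1 \<omega>) (\<lambda>\<omega>. B (t\<^sub>1 + t) \<omega> - B t\<^sub>1 \<omega>))"

definition stochastically_continuous :: "'a measure \<Rightarrow> (real \<Rightarrow> 'a \<Rightarrow> real) \<Rightarrow> bool" where
  "stochastically_continuous M B \<longleftrightarrow>
     (\<forall>t. \<forall>\<epsilon>>0. ((\<lambda>s. measure M {\<omega> \<in> space M. \<bar>B s \<omega> - B t \<omega>\<bar> > \<epsilon>}) \<longlongrightarrow> 0) (at t))"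

definition measurable_process :: "'a measure \<Rightarrow> (real \<Rightarrow> 'a \<Rightarrow> real) \<Rightarrow> bool" where
  "measurable_process M B \<longleftrightarrow> (\<lambda>(t, \<omega>). B t \<omega>) \<in> borel_measurable (borel \<Otimes>\<^sub>M M)"

text \<open>Constants count as (degenerate) Gaussian random variables.\<close>
definition gaussian_rv :: "'a measure \<Rightarrow> ('a \<Rightarrow> real) \<Rightarrow> bool" where
  "gaussian_rv M Y \<longleftrightarrow> Y \<in> borel_measurable M \<and>
     ((\<exists>m \<sigma>. \<sigma> > 0 \<and> distributed M lborel Y (\<lambda>x. ennreal (normal_density m \<sigma> x))) \<or>
      (\<exists>c. AE \<omega> in M. Y \<omega> = c))"

definition gaussian_process :: "'a measure \<Rightarrow> (real \<Rightarrow> 'a \<Rightarrow> real) \<Rightarrow> bool" where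
  "gaussian_process M B \<longleftrightarrow>
     (\<forall>I a. finite I \<longrightarrow> gaussian_rv M (\<lambda>\<omega>. \<Sum>t\<in>I. a t * B t \<omega>))"

subsection \<open>Uncorrelated random measures and the spectral representation\<close>

text \<open>
  \<open>X A\<close> is meaningful for the Borel sets \<open>A \<subseteq> - {0}\<close> of finite measure \<open>\<mu> A = E |X A|\<^sup>2\<close>;
  its values on other sets are not constrained. The measure \<open>\<mu>\<close> itself may be infinite.
\<close>
definition uncorrelated_random_measure ::
    "'a measure \<Rightarrow> real measure \<Rightarrow> (real set \<Rightarrow> 'a \<Rightarrow> complex) \<Rightarrow> bool" where
  "uncorrelated_random_measure M \<mu> X \<longleftrightarrow>
     sets \<mu> = sets (restrict_space borel (- {0})) \<and>
     (\<forall>A\<in>fmeasurable \<mu>. X A \<in> borel_measurable M \<and> integrable M (\<lambda>\<omega>. (cmod (X A \<omega>))\<^sup>2)) \<and>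
     (\<forall>A\<in>fmeasurable \<mu>. (\<integral>\<omega>. X A \<omega> \<partial>M) = 0) \<and>
     (\<forall>A\<in>fmeasurable \<mu>. (\<integral>\<omega>. (cmod (X A \<omega>))\<^sup>2 \<partial>M) = measure \<mu> A) \<and>
     (\<forall>A\<in>fmeasurable \<mu>. \<forall>A'\<in>fmeasurable \<mu>. A \<inter> A' = {} \<longrightarrow>
        (\<integral>\<omega>. X A \<omega> * cnj (X A' \<omega>) \<partial>M) = 0) \<and>
     (\<forall>A::nat \<Rightarrow> real set. range A \<subseteq> sets \<mu> \<and> disjoint_family A \<and> (\<Union>i. A i) \<in> fmeasurable \<mu> \<longrightarrow>
        (\<lambda>n. \<integral>\<^sup>+\<omega>. ennreal ((cmod (X (\<Union>i. A i) \<omega> - (\<Sum>i<n. X (A i) \<omega>)))\<^sup>2) \<partial>M) \<longlonglongrightarrow> 0)"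

text \<open>
  \<open>Y\<close> is (a version of) the integral of \<open>g\<close> with respect to \<open>X\<close>, i.e. the mean-square limit of
  the integrals of simple functions converging to \<open>g\<close> in \<open>L\<^sub>2(\<mu>)\<close>. The list of pairs \<open>(c, A)\<close>
  stands for the simple function that sums \<open>c * indicator A\<close>.
\<close>
definition has_stochastic_integral ::
    "'a measure \<Rightarrow> real measure \<Rightarrow> (real set \<Rightarrow> 'a \<Rightarrow> complex) \<Rightarrow> (real \<Rightarrow> complex) \<Rightarrow> ('a \<Rightarrow> complex) \<Rightarrow> bool"
  where
  "has_stochastic_integral M \<mu> X g Y \<longleftrightarrow>
     g \<in> borel_measurable \<mu> \<and> Y \<in> borel_measurable M \<and>
     (\<exists>S :: nat \<Rightarrow> (complex \<times> real set) list.
        (\<forall>n. \<forall>(c, A)\<in>set (S n). A \<in> fmeasurable \<mu>) \<and>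
        (\<lambda>n. \<integral>\<^sup>+u. ennreal ((cmod ((\<Sum>(c, A)\<leftarrow>S n. c * indicator A u) - g u))\<^sup>2) \<partial>\<mu>) \<longlonglongrightarrow> 0 \<and>
        (\<lambda>n. \<integral>\<^sup>+\<omega>. ennreal ((cmod ((\<Sum>(c, A)\<leftarrow>S n. c * X A \<omega>) - Y \<omega>))\<^sup>2) \<partial>M) \<longlonglongrightarrow> 0)"

text \<open>
  \<open>B t = D\<^sub>0 t + \<integral> (e\<^sup>i\<^sup>t\<^sup>u - 1) X(du)\<close> almost surely for every \<open>t\<close>, with spectral measure \<open>\<mu>\<close>.
\<close>
definition spectral_representation ::
    "'a measure \<Rightarrow> (real \<Rightarrow> 'a \<Rightarrow> real) \<Rightarrow> ('a \<Rightarrow> real) \<Rightarrow> (real set \<Rightarrow> 'a \<Rightarrow> complex) \<Rightarrow> real measure \<Rightarrow> bool"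
  where
  "spectral_representation M B D\<^sub>0 X \<mu> \<longleftrightarrow>
     D\<^sub>0 \<in> borel_measurable M \<and> integrable M (\<lambda>\<omega>. (D\<^sub>0 \<omega>)\<^sup>2) \<and>
     uncorrelated_random_measure M \<mu> X \<and>
     (\<forall>A\<in>fmeasurable \<mu>. uminus ` A \<in> fmeasurable \<mu> \<and> (AE \<omega> in M. X (uminus ` A) \<omega> = cnj (X A \<omega>))) \<and>
     (\<forall>A\<in>fmeasurable \<mu>.
        (\<integral>\<omega>. complex_of_real (D\<^sub>0 \<omega> - (\<integral>\<omega>. D\<^sub>0 \<omega> \<partial>M)) * X A \<omega> \<partial>M) = 0) \<and>
     (\<integral>\<^sup>+u. ennreal (min (u\<^sup>2) 1) \<partial>\<mu>) < \<infinity> \<and>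
     (\<forall>t. has_stochastic_integral M \<mu> X (\<lambda>u. exp (\<i> * complex_of_real (t * u)) - 1)
            (\<lambda>\<omega>. complex_of_real (B t \<omega> - D\<^sub>0 \<omega> * t)))"

definition no_atoms :: "real measure \<Rightarrow> bool" where
  "no_atoms \<mu> \<longleftrightarrow> (\<forall>u\<in>space \<mu>. emeasure \<mu> {u} = 0)"

subsection \<open>Convergence\<close>

text \<open>Integrability is required separately, since the Bochner integral is 0 without it.\<close>
definition tendsto_L1 :: "'a measure \<Rightarrow> ('i \<Rightarrow> 'a \<Rightarrow> real) \<Rightarrow> ('a \<Rightarrow> real) \<Rightarrow> 'i filter \<Rightarrow> bool" where
  "tendsto_L1 M Y Z F \<longleftrightarrow>
     integrable M Z \<and> (\<forall>\<^sub>F i in F. integrable M (Y i)) \<and>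
     ((\<lambda>i. \<integral>\<omega>. \<bar>Y i \<omega> - Z \<omega>\<bar> \<partial>M) \<longlongrightarrow> 0) F"

end

theory Submission
  imports Defs
begin

text \<open>
  The minimizer solves \<open>f - f'' = w\<close> on \<open>[0, T]\<close> with \<open>f' = 0\<close> at both ends, so it differs from
  the convolution of the whole path with the Green kernel \<open>exp (- \<bar>r\<bar>) / 2\<close> by a combination of \<open>cosh\<close>
  functions, and the minimal energy is \<open>\<integral> (q\<^sup>2 + (D\<^sub>0 + p)\<^sup>2)\<close> over \<open>[0, T]\<close> minus a boundary term. Here \<open>q\<close> and
  \<open>p\<close> are linear filters of the increments of \<open>B\<close>: stationary Gaussian processes with spectral measures
  \<open>u\<^sup>4 / (1 + u\<^sup>2)\<^sup>2 \<mu>(du)\<close> and \<open>u\<^sup>2 / (1 + u\<^sup>2)\<^sup>2 \<mu>(du)\<close>, whose masses add up to the integral in \<open>Z\<close>. Since there are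
  no atoms, Wiener's lemma makes the covariances of \<open>q\<close> and \<open>p\<close> small on average; for Gaussian processes this
  gives \<open>L\<^sub>2\<close> convergence of the time averages of \<open>q\<^sup>2\<close>, \<open>p\<^sup>2\<close> and \<open>p\<close>, and a maximal inequality turns it
  into almost sure convergence along the integers. The minimal energy is monotone in \<open>T\<close>, which fills the gaps.
\<close>

subsection \<open>Absolutely continuous functions\<close>

text \<open>Wiener's lemma comes without a rate, so the variances of the time averages need not be
  summable over the integers, and a sparse subsequence leaves gaps that monotonicity cannot close.
  Hence the maximal inequality, and with it strict stationarity of integrals over unit blocks. For
  this Gaussianity is used a second time: covariances determine the law of finitely many values.
  Expanding (D + p)^2 with D = \<open>D\<^sub>0\<close>, which is random but constant in time,
  produces 2 D p, so averages of p are needed besides those of squares. The filters act on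
  increments because the even kernel has mass 1 and first moment 0, the odd one mass 0 and first
  moment 1: this removes the current value of the path and splits off the drift. Joint Gaussianity
  of \<open>D\<^sub>0\<close> and \<open>B\<close> is not given; it is recovered from the
  mean-square limit B(n) / n. Finally, the minimizer is picked by a choice operator, so
  measurability of the minimal energy in \<omega> has to come from the explicit formula, on every
  path and not just almost every one.\<close>

text \<open>Gauge argument. Tags in the null set of non-differentiability carry intervals of small
  total length, where absolute continuity controls the increments of \<open>g\<close>; at all other
  tags the derivative approximates them. \<open>G\<close> is \<open>deriv g\<close> set to 0 on that
  null set.\<close>

lemma AC_on_has_integral_deriv:
  assumes ac: "AC_on a b g" and ab: "a \<le> b"
    and diff: "AE s in lebesgue_on {a..b}. g differentiable (at s)"
  shows "(deriv g has_integral (g b - g a)) {a..b}"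
proof -
  define N where "N = {s\<in>{a..b}. \<not> g differentiable (at s)}"
  have "AE s in lebesgue. s \<in> {a..b} \<longrightarrow> g differentiable (at s)"
    using diff by (subst (asm) AE_restrict_space_iff) auto
  then obtain N' where N': "N' \<in> null_sets lebesgue" "{x\<in>space lebesgue. \<not> (x \<in> {a..b} \<longrightarrow> g differentiable (at x))} \<subseteq> N'"
    unfolding eventually_ae_filter by blast
  have neg: "negligible N"
    by (rule negligible_subset[of N']) (use N' in \<open>auto simp: negligible_iff_null_sets N_def\<close>)
  define G where "G x = (if x \<in> N then 0 else deriv g x)" for x
  have "(G has_integral (g b - g a)) (cbox a b)"
    unfolding has_integral
  proof (intro allI impI)
    fix e :: real assume e: "e > 0"
    obtain \<delta> where \<delta>: "\<delta> > 0"
      "\<And>\<D> S. \<D> division_of S \<Longrightarrow> S \<subseteq> {a..b} \<Longrightarrow> (\<Sum>K\<in>\<D>. Sup K - Inf K) < \<delta> \<Longrightarrow>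
          (\<Sum>K\<in>\<D>. \<bar>g (Sup K) - g (Inf K)\<bar>) < e / 2"
      using ac e unfolding AC_on_def by (meson half_gt_zero)
    have Nl: "N \<in> sets lebesgue" using neg by (simp add: negligible_iff_null_sets null_sets_def)
    obtain O' where O': "open O'" "N \<subseteq> O'" "emeasure lebesgue (O' - N) < ennreal \<delta>" "(O' - N) \<in> lmeasurable"
      using sets_lebesgue_outer_open[OF Nl \<delta>(1)] by metis
    have Ol: "O' \<in> lmeasurable" "measure lebesgue O' < \<delta>"
    proof -
      have e1: "emeasure lebesgue O' = emeasure lebesgue (O' - N)"
        using neg O'(1) by (intro emeasure_Diff_null_set[symmetric]) (auto simp: negligible_iff_null_sets)
      show ol: "O' \<in> lmeasurable"
        using O'(1,3) e1 by (intro fmeasurableI) (auto simp: less_top[symmetric] order.strict_trans[OF _ ennreal_less_top])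
      show "measure lebesgue O' < \<delta>"
        using O'(3) e1 \<delta>(1) emeasure_eq_measure2[OF ol] by (metis ennreal_less_iff measure_nonneg)
    qed
    \<comment> \<open>The first-order errors add up to \<open>e' * (b - a)\<close>, which must stay
      below e / 2; the \<open>+ 1\<close> keeps the denominator positive when a = b.\<close>
    define e' where "e' = e / (2 * (b - a + 1))"
    have e': "e' > 0" using e ab by (auto simp: e'_def)
    have "\<exists>d>0. \<forall>y. \<bar>y - x\<bar> < d \<longrightarrow> \<bar>g y - g x - deriv g x * (y - x)\<bar> \<le> e' * \<bar>y - x\<bar>"
      if x: "x \<in> {a..b} - N" for x
    proof -
      have "g differentiable (at x)" using x by (auto simp: N_def)
      then have "(g has_derivative (\<lambda>h. deriv g x * h)) (at x)"
        using DERIV_deriv_iff_real_differentiable has_field_derivative_def by blast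
      then show ?thesis
        unfolding has_derivative_within_alt using e' by (auto simp: algebra_simps)
    qed
    then obtain d where d: "\<And>x. x \<in> {a..b} - N \<Longrightarrow> d x > 0"
      "\<And>x y. x \<in> {a..b} - N \<Longrightarrow> \<bar>y - x\<bar> < d x \<Longrightarrow> \<bar>g y - g x - deriv g x * (y - x)\<bar> \<le> e' * \<bar>y - x\<bar>"
      by metis
    \<comment> \<open>At tags in \<open>N\<close> the gauge confines intervals to the open set
      \<open>O'\<close> of small measure, at the others to the ball where the difference quotient
      estimate holds.\<close>
    define \<gamma> where "\<gamma> x = (if x \<in> N then O' else if x \<in> {a..b} then ball x (d x) else UNIV)" for x
    show "\<exists>\<gamma>. gauge \<gamma> \<and> (\<forall>\<D>. \<D> tagged_division_of cbox a b \<and> \<gamma> fine \<D> \<longrightarrow>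
             norm ((\<Sum>(x, k)\<in>\<D>. measure lborel k *\<^sub>R G x) - (g b - g a)) < e)"
    proof (intro exI[of _ \<gamma>] conjI allI impI)
      show "gauge \<gamma>" using O' d(1) by (auto simp: gauge_def \<gamma>_def)
      fix \<D> assume D: "\<D> tagged_division_of cbox a b \<and> \<gamma> fine \<D>"
      note td = tagged_division_ofD[OF conjunct1[OF D]]
      have fin: "finite \<D>" using td by auto
      define D1 where "D1 = {xk\<in>\<D>. fst xk \<in> N}"
      define D2 where "D2 = {xk\<in>\<D>. fst xk \<notin> N}"
      have split: "sum f \<D> = sum f D1 + sum f D2" for f :: "_ \<Rightarrow> real"
        using fin by (subst sum.union_disjoint[symmetric]) (auto simp: D1_def D2_def intro!: sum.cong)
      have kk: "\<exists>c d. k = {c..d} \<and> c \<le> x \<and> x \<le> d \<and> a \<le> c \<and> d \<le> b" if kD: "(x,k) \<in> \<D>" for x k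
      proof -
        obtain c d where "k = cbox c d" using td(4)[OF kD] by auto
        then show ?thesis using td(2,3)[OF kD] by auto
      qed
      have D1p: "D1 tagged_partial_division_of cbox a b"
        using D tagged_partial_division_subset[of \<D> "cbox a b" D1] unfolding tagged_division_of_def D1_def by auto
      have S1: "\<Union>(snd ` D1) \<subseteq> {a..b}" "\<Union>(snd ` D1) \<subseteq> O'"
        using D td(3) by (auto simp: D1_def fine_def \<gamma>_def; fastforce)+
      have ne: "K \<noteq> {}" if "K \<in> snd ` D1" for K
        using that td(2) by (force simp: D1_def)
      \<comment> \<open>Absolute continuity speaks of a set of intervals, the division of tagged
        pairs. Two pairs can share an interval only if it is degenerate, where \<open>f\<close>
        vanishes; \<open>f'\<close> also fixes the value on the empty set, where \<open>Sup\<close>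
        and \<open>Inf\<close> are unspecified.\<close>
      have sub: "(\<Sum>(x,k)\<in>D1. f k) = (\<Sum>k\<in>snd ` D1. f k)" if f0: "\<And>c. f {c} = 0" for f :: "real set \<Rightarrow> real"
      proof -
        define f' where "f' k = (if k = {} then 0 else f k)" for k
        have "(\<Sum>(x,k)\<in>D1. f' k) = (\<Sum>k\<in>snd ` D1. f' k)"
        proof (rule sum.over_tagged_division_lemma[OF tagged_partial_division_of_Union_self[OF D1p]])
          fix u v :: real assume "box u v = {}"
          then have "cbox u v = {} \<or> (\<exists>c. cbox u v = {c})" by (cases "u = v") auto
          then show "f' (cbox u v) = 0" using f0 by (auto simp: f'_def)
        qed
        moreover have "(\<Sum>(x,k)\<in>D1. f' k) = (\<Sum>(x,k)\<in>D1. f k)"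
          using ne by (intro sum.cong) (force simp: f'_def)+
        moreover have "(\<Sum>k\<in>snd ` D1. f' k) = (\<Sum>k\<in>snd ` D1. f k)"
          using ne by (intro sum.cong) (auto simp: f'_def)
        ultimately show ?thesis by simp
      qed
      have dd: "snd ` D1 division_of \<Union>(snd ` D1)" using partial_division_of_tagged_division[OF D1p] .
      have "(\<Sum>K\<in>snd ` D1. Sup K - Inf K) = (\<Sum>K\<in>snd ` D1. measure lebesgue K)"
      proof (rule sum.cong)
        fix K assume "K \<in> snd ` D1"
        then obtain c d where "K = {c..d}" "c \<le> d" using kk by (force simp: D1_def)
        then show "Sup K - Inf K = measure lebesgue K" by auto
      qed simp
      also have "\<dots> = measure lebesgue (\<Union>(snd ` D1))" by (rule content_division[OF dd])
      also have "\<dots> \<le> measure lebesgue O'"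
        using S1 Ol dd by (intro measure_mono_fmeasurable) (auto intro: lmeasurable_division fmeasurableD)
      finally have "(\<Sum>K\<in>snd ` D1. Sup K - Inf K) < \<delta>" using Ol by auto
      from \<delta>(2)[OF dd S1(1) this] have b1: "(\<Sum>(x,K)\<in>D1. \<bar>g (Sup K) - g (Inf K)\<bar>) < e / 2"
        by (subst sub) auto
      have b2: "\<bar>measure lborel K * G x - (g (Sup K) - g (Inf K))\<bar> \<le> e' * measure lborel K" if "(x,K) \<in> D2" for x K
      proof -
        have xK: "(x,K) \<in> \<D>" "x \<notin> N" using that by (auto simp: D2_def)
        obtain c t where K: "K = {c..t}" "c \<le> x" "x \<le> t" "a \<le> c" "t \<le> b" using kk[OF xK(1)] by auto
        have x: "x \<in> {a..b} - N" using K xK by auto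
        have "K \<subseteq> \<gamma> x" using D xK by (auto simp: fine_def)
        then have "K \<subseteq> ball x (d x)" using x by (simp add: \<gamma>_def)
        moreover have "c \<in> K" "t \<in> K" using K by auto
        ultimately have "c \<in> ball x (d x)" "t \<in> ball x (d x)" by blast+
        then have 1: "\<bar>g c - g x - deriv g x * (c - x)\<bar> \<le> e' * \<bar>c - x\<bar>" "\<bar>g t - g x - deriv g x * (t - x)\<bar> \<le> e' * \<bar>t - x\<bar>"
          using d(2)[OF x] by (auto simp: dist_real_def abs_minus_commute)
        \<comment> \<open>The increment over \<open>K\<close> is routed through the tag: both end
          point estimates have the base point \<open>x\<close>.\<close>
        have "\<bar>(t - c) * deriv g x - (g t - g c)\<bar> = \<bar>(g c - g x - deriv g x * (c - x)) - (g t - g x - deriv g x * (t - x))\<bar>"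
          by (simp add: algebra_simps)
        also have "\<dots> \<le> e' * \<bar>c - x\<bar> + e' * \<bar>t - x\<bar>" using 1 by linarith
        also have "\<dots> = e' * (t - c)" using K by (simp add: algebra_simps)
        finally show ?thesis using K xK by (auto simp: G_def)
      qed
      have "(\<Sum>(x, k)\<in>\<D>. measure lborel k *\<^sub>R G x) - (g b - g a) =
          (\<Sum>(x, k)\<in>\<D>. measure lborel k * G x - (g (Sup k) - g (Inf k)))"
        using additive_tagged_division_1[OF ab, of \<D> g] D
        by (simp add: sum_subtractf split_beta)
      also have "\<dots> = (\<Sum>(x, k)\<in>D1. - (g (Sup k) - g (Inf k))) + (\<Sum>(x, k)\<in>D2. measure lborel k * G x - (g (Sup k) - g (Inf k)))"
        unfolding split by (intro arg_cong2[where f="(+)"] sum.cong) (auto simp: D1_def G_def)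
      finally have "\<bar>(\<Sum>(x, k)\<in>\<D>. measure lborel k *\<^sub>R G x) - (g b - g a)\<bar> \<le>
         \<bar>\<Sum>(x, k)\<in>D1. - (g (Sup k) - g (Inf k))\<bar> + \<bar>\<Sum>(x, k)\<in>D2. measure lborel k * G x - (g (Sup k) - g (Inf k))\<bar>"
        by linarith
      also have "\<dots> \<le> (\<Sum>(x, k)\<in>D1. \<bar>g (Sup k) - g (Inf k)\<bar>) + (\<Sum>(x, k)\<in>D2. e' * measure lborel k)"
        by (intro add_mono order.trans[OF sum_abs] sum_mono) (auto dest: b2)
      also have "(\<Sum>(x, k)\<in>D2. e' * measure lborel k) \<le> (\<Sum>(x, k)\<in>\<D>. e' * measure lborel k)"
        using fin e' by (intro sum_mono2) (auto simp: D2_def)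
      also have "\<dots> = e' * (\<Sum>(x, k)\<in>\<D>. measure lborel k)" by (simp add: sum_distrib_left split_beta)
      also have "\<dots> = e' * (b - a)" using additive_content_tagged_division[OF conjunct1[OF D]] ab by simp
      also have "\<dots> < e / 2"
        unfolding e'_def using e ab by (simp add: field_simps)
      finally show "norm ((\<Sum>(x, k)\<in>\<D>. measure lborel k *\<^sub>R G x) - (g b - g a)) < e" using b1 by simp
    qed
  qed
  then show ?thesis
    using has_integral_spike[OF neg, of "{a..b}" "deriv g" G "g b - g a"] by (auto simp: G_def)
qed

lemma AC_on_imp_continuous_on:
  assumes "AC_on a b g" shows "continuous_on {a..b} g"
  unfolding continuous_on_iff
proof (intro ballI allI impI)
  fix x e :: real assume x: "x \<in> {a..b}" and e: "0 < e"
  obtain \<delta> where \<delta>: "\<delta> > 0"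
    "\<And>\<D> S. \<D> division_of S \<Longrightarrow> S \<subseteq> {a..b} \<Longrightarrow> (\<Sum>K\<in>\<D>. Sup K - Inf K) < \<delta> \<Longrightarrow>
          (\<Sum>K\<in>\<D>. \<bar>g (Sup K) - g (Inf K)\<bar>) < e"
    using assms e unfolding AC_on_def by meson
  have "\<bar>g d - g c\<bar> < e" if "c \<le> d" "d - c < \<delta>" "c \<in> {a..b}" "d \<in> {a..b}" for c d
    using \<delta>(2)[of "{{c..d}}" "{c..d}"] that division_of_self[of c d] by auto
  from this[of x] this[of _ x] have "dist (g x') (g x) < e" if "x' \<in> {a..b}" "dist x' x < \<delta>" for x'
    using that x by (cases "x \<le> x'") (simp_all add: dist_real_def abs_minus_commute)
  then show "\<exists>d>0. \<forall>x'\<in>{a..b}. dist x' x < d \<longrightarrow> dist (g x') (g x) < e"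
    using \<delta>(1) by blast
qed

lemma AC_on_subset:
  assumes "AC_on a b g" "{c..d} \<subseteq> {a..b}" shows "AC_on c d g"
  using assms unfolding AC_on_def by (meson order_trans)

lemma Lipschitz_imp_AC_on:
  assumes L: "\<And>x y. x \<in> {a..b} \<Longrightarrow> y \<in> {a..b} \<Longrightarrow> \<bar>g x - g y\<bar> \<le> C * \<bar>x - y\<bar>"
  shows "AC_on a b g"
  unfolding AC_on_def
proof (intro allI impI)
  fix e :: real assume e: "e > 0"
  \<comment> \<open>\<open>C\<close> carries no sign condition, hence a positive majorant to divide
    by.\<close>
  define C' where "C' = \<bar>C\<bar> + 1"
  have C': "C' > 0" "C \<le> C'" by (auto simp: C'_def)
  show "\<exists>\<delta>>0. \<forall>\<D> S. \<D> division_of S \<and> S \<subseteq> {a..b} \<and> (\<Sum>K\<in>\<D>. Sup K - Inf K) < \<delta> \<longrightarrow> (\<Sum>K\<in>\<D>. \<bar>g (Sup K) - g (Inf K)\<bar>) < e"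
  proof (intro exI[of _ "e / C'"] conjI allI impI)
    show "0 < e / C'" using e C' by simp
    fix \<D> S assume D: "\<D> division_of S \<and> S \<subseteq> {a..b} \<and> (\<Sum>K\<in>\<D>. Sup K - Inf K) < e / C'"
    have "(\<Sum>K\<in>\<D>. \<bar>g (Sup K) - g (Inf K)\<bar>) \<le> (\<Sum>K\<in>\<D>. C' * (Sup K - Inf K))"
    proof (rule sum_mono)
      fix K assume K: "K \<in> \<D>"
      then obtain c d where cd: "K = cbox c d" using D by (meson division_ofD(4))
      have ne: "K \<noteq> {}" "K \<subseteq> S" using D K division_ofD(2,3) by blast+
      have K': "K = {c..d}" "c \<le> d" using cd ne by auto
      have "c \<in> K" "d \<in> K" using K' by auto
      then have "c \<in> {a..b}" "d \<in> {a..b}" using ne D by auto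
      then have "\<bar>g d - g c\<bar> \<le> C * \<bar>d - c\<bar>" using L by blast
      also have "\<dots> \<le> C' * \<bar>d - c\<bar>" using C' by (intro mult_right_mono) auto
      finally show "\<bar>g (Sup K) - g (Inf K)\<bar> \<le> C' * (Sup K - Inf K)" using K' by auto
    qed
    also have "\<dots> = C' * (\<Sum>K\<in>\<D>. Sup K - Inf K)" by (simp add: sum_distrib_left)
    also have "\<dots> < C' * (e / C')" using D C' by (intro mult_strict_left_mono) auto
    also have "\<dots> = e" using C' by simp
    finally show "(\<Sum>K\<in>\<D>. \<bar>g (Sup K) - g (Inf K)\<bar>) < e" .
  qed
qed

section \<open>Products of square integrable functions\<close>

lemma integrable_mult_of_squares:
  fixes f g :: "'a \<Rightarrow> real"
  assumes [measurable]: "f \<in> borel_measurable M" "g \<in> borel_measurable M"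
    and "integrable M (\<lambda>x. (f x)\<^sup>2)" "integrable M (\<lambda>x. (g x)\<^sup>2)"
  shows "integrable M (\<lambda>x. f x * g x)"
proof (rule Bochner_Integration.integrable_bound)
  show "integrable M (\<lambda>x. (f x)\<^sup>2 + (g x)\<^sup>2)" using assms by simp
  have "\<bar>a * b\<bar> \<le> a\<^sup>2 + b\<^sup>2" for a b :: real
  proof -
    have "2 * \<bar>a * b\<bar> \<le> a\<^sup>2 + b\<^sup>2" using sum_squares_bound[of "\<bar>a\<bar>" "\<bar>b\<bar>"] by (simp add: abs_mult)
    then show ?thesis by linarith
  qed
  then show "AE x in M. norm (f x * g x) \<le> norm ((f x)\<^sup>2 + (g x)\<^sup>2)" by (auto simp: sum_power2_ge_zero)
qed simp

lemma integrable_square_add: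
  fixes f g :: "'a \<Rightarrow> real"
  assumes [measurable]: "f \<in> borel_measurable M" "g \<in> borel_measurable M"
    and "integrable M (\<lambda>x. (f x)\<^sup>2)" "integrable M (\<lambda>x. (g x)\<^sup>2)"
  shows "integrable M (\<lambda>x. (f x + g x)\<^sup>2)"
  using assms integrable_mult_of_squares[OF assms]
  by (simp add: power2_sum) (simp add: mult.assoc)

lemma integrable_square_diff:
  fixes f g :: "'a \<Rightarrow> real"
  assumes [measurable]: "f \<in> borel_measurable M" "g \<in> borel_measurable M"
    and "integrable M (\<lambda>x. (f x)\<^sup>2)" "integrable M (\<lambda>x. (g x)\<^sup>2)"
  shows "integrable M (\<lambda>x. (f x - g x)\<^sup>2)"
  using integrable_square_add[of f M "\<lambda>x. - g x"] assms by simp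

lemma (in pair_sigma_finite) integrable_product_mult:
  fixes f g :: "_ \<Rightarrow> real"
  assumes f: "integrable M1 f" and g: "integrable M2 g"
  shows "integrable (M1 \<Otimes>\<^sub>M M2) (\<lambda>(x, y). f x * g y)"
proof (rule Fubini_integrable)
  have [measurable]: "f \<in> borel_measurable M1" "g \<in> borel_measurable M2" using f g by auto
  show "(\<lambda>(x, y). f x * g y) \<in> borel_measurable (M1 \<Otimes>\<^sub>M M2)" by measurable
  have "integrable M1 (\<lambda>x. \<bar>f x\<bar> * (\<integral>y. \<bar>g y\<bar> \<partial>M2))" using f by simp
  then show "integrable M1 (\<lambda>x. \<integral>y. norm (case (x, y) of (x, y) \<Rightarrow> f x * g y) \<partial>M2)"
    by (simp add: abs_mult)
  show "AE x in M1. integrable M2 (\<lambda>y. case (x, y) of (x, y) \<Rightarrow> f x * g y)" using g by simp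
qed

subsection \<open>The variational problem\<close>

lemma finite_measure_lebesgue_on_Icc: "finite_measure (lebesgue_on {a..b::real})"
  by (rule finite_measureI) (simp add: emeasure_restrict_space emeasure_lborel_Icc_eq)

lemma energy_alt: "energy T f w = (\<integral>s. (f s - w s)\<^sup>2 + (deriv f s)\<^sup>2 \<partial>lebesgue_on {0..T})"
  unfolding energy_def set_lebesgue_integral_def by (subst integral_restrict_space) auto

lemma borel_measurable_lebesgue_on:
  "g \<in> borel_measurable borel \<Longrightarrow> g \<in> borel_measurable (lebesgue_on A)"
  by (intro measurable_restrict_space1 measurable_completion) simp

lemma square_integrable_iff:
  "square_integrable {a..b} g \<longleftrightarrow> g \<in> borel_measurable (lebesgue_on {a..b}) \<and> integrable (lebesgue_on {a..b}) (\<lambda>s. (g s)\<^sup>2)"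
  unfolding square_integrable_def set_borel_measurable_def set_integrable_def
  by (subst borel_measurable_restrict_space_iff integrable_restrict_space; simp)+

text \<open>On the finite measure \<open>lebesgue_on {0..T}\<close> square integrable functions are
  integrable, which gives the integrals below their meaning. The last claim is the fundamental
  theorem on {0..x} for the restriction of \<open>g\<close>.\<close>

lemma W21_D:
  assumes g: "g \<in> W21 T"
  shows "continuous_on {0..T} g" "g \<in> borel_measurable (lebesgue_on {0..T})"
    "integrable (lebesgue_on {0..T}) (\<lambda>s. (g s)\<^sup>2)"
    "deriv g \<in> borel_measurable (lebesgue_on {0..T})"
    "integrable (lebesgue_on {0..T}) (\<lambda>s. (deriv g s)\<^sup>2)"
    "integrable (lebesgue_on {0..T}) (deriv g)"
    "\<And>x. x \<in> {0..T} \<Longrightarrow> g x = g 0 + (\<integral>s. indicator {0..x} s * deriv g s \<partial>lebesgue_on {0..T})"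
proof -
  interpret finite_measure "lebesgue_on {0..T}" by (rule finite_measure_lebesgue_on_Icc)
  show c: "continuous_on {0..T} g" using g by (auto simp: W21_def intro: AC_on_imp_continuous_on)
  then show gm: "g \<in> borel_measurable (lebesgue_on {0..T})"
    by (intro continuous_imp_measurable_on_sets_lebesgue) auto
  have "continuous_on {0..T} (\<lambda>s. (g s)\<^sup>2)" using c by (intro continuous_intros)
  then have "(\<lambda>s. (g s)\<^sup>2) absolutely_integrable_on {0..T}" by (rule absolutely_integrable_continuous_real)
  then show "integrable (lebesgue_on {0..T}) (\<lambda>s. (g s)\<^sup>2)"
    by (subst integrable_restrict_space) (auto simp: set_integrable_def)
  show d: "deriv g \<in> borel_measurable (lebesgue_on {0..T})" "integrable (lebesgue_on {0..T}) (\<lambda>s. (deriv g s)\<^sup>2)"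
    using g by (auto simp: W21_def square_integrable_iff)
  then show i: "integrable (lebesgue_on {0..T}) (deriv g)" by (rule square_integrable_imp_integrable)
  fix x assume x: "x \<in> {0..T}"
  have "set_integrable lebesgue {0..T} (deriv g)" using i by (subst (asm) integrable_restrict_space) (auto simp: set_integrable_def)
  then have si: "set_integrable lebesgue {0..x} (deriv g)" by (rule set_integrable_subset) (use x in auto)
  have acx: "AC_on 0 x g" 
  proof (rule AC_on_subset)
    show "AC_on 0 T g" using g by (simp add: W21_def)
  qed (use x in auto)
  have "AE s in lebesgue. s \<in> {0..T} \<longrightarrow> g differentiable (at s)"
    using g by (auto simp: W21_def AE_restrict_space_iff)
  then have "AE s in lebesgue_on {0..x}. g differentiable (at s)"
    using x by (auto simp: AE_restrict_space_iff elim!: eventually_mono)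
  from AC_on_has_integral_deriv[OF acx _ this] x have "integral {0..x} (deriv g) = g x - g 0"
    by (auto simp: integral_unique)
  then have "g x - g 0 = (LINT s:{0..x}|lebesgue. deriv g s)" using set_lebesgue_integral_eq_integral(2)[OF si] by simp
  also have "\<dots> = (\<integral>s. indicator {0..T} s *\<^sub>R (indicator {0..x} s * deriv g s) \<partial>lebesgue)"
    unfolding set_lebesgue_integral_def using x by (intro Bochner_Integration.integral_cong) (auto split: split_indicator)
  also have "\<dots> = (\<integral>s. indicator {0..x} s * deriv g s \<partial>lebesgue_on {0..T})"
    by (subst integral_restrict_space) auto
  finally show "g x = g 0 + (\<integral>s. indicator {0..x} s * deriv g s \<partial>lebesgue_on {0..T})" by simp
qed

text \<open>A derivative that is continuous on the whole line is bounded on {0..T}, so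
  \<open>\<phi>\<close> is Lipschitz there.\<close>

lemma W21_C1:
  assumes d: "\<And>x. (\<phi> has_real_derivative \<psi> x) (at x)" and c: "continuous_on UNIV \<psi>"
  shows "\<phi> \<in> W21 T" "deriv \<phi> = \<psi>"
proof -
  show dd: "deriv \<phi> = \<psi>" using d by (auto intro!: DERIV_imp_deriv)
  have "continuous_on {0..T} \<psi>" using c continuous_on_subset by blast
  then have "compact (\<psi> ` {0..T})" by (intro compact_continuous_image) auto
  then obtain C where C: "\<And>x. x \<in> {0..T} \<Longrightarrow> \<bar>\<psi> x\<bar> \<le> C"
    using compact_imp_bounded bounded_iff by (metis image_eqI real_norm_def)
  have "AC_on 0 T \<phi>"
  proof (rule Lipschitz_imp_AC_on[where C=C])
    fix x y assume xy: "x \<in> {0..T}" "y \<in> {0..T}"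
    have "norm (\<phi> x - \<phi> y) \<le> C * norm (x - y)"
    proof (rule field_differentiable_bound[of "{0..T}" \<phi> \<psi>])
      fix z assume "z \<in> {0..T}"
      then show "(\<phi> has_field_derivative \<psi> z) (at z within {0..T})" "norm (\<psi> z) \<le> C"
        using has_field_derivative_at_within[OF d] C by auto
    qed (use xy in auto)
    then show "\<bar>\<phi> x - \<phi> y\<bar> \<le> C * \<bar>x - y\<bar>" by simp
  qed
  moreover have "AE s in lebesgue_on {0..T}. \<phi> differentiable (at s)"
    using d real_differentiable_def by blast
  moreover have "square_integrable {0..T} (deriv \<phi>)"
  proof -
    have "continuous_on {0..T} (\<lambda>s. (\<psi> s)\<^sup>2)" using continuous_on_subset[OF c, of "{0..T}"] by (intro continuous_intros) auto
    then have "(\<lambda>s. (\<psi> s)\<^sup>2) absolutely_integrable_on {0..T}" by (rule absolutely_integrable_continuous_real)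
    then show ?thesis unfolding square_integrable_iff dd
      using c by (auto simp: integrable_restrict_space set_integrable_def
         intro!: borel_measurable_lebesgue_on borel_measurable_continuous_onI)
  qed
  ultimately show "\<phi> \<in> W21 T" by (simp add: W21_def)
qed

lemma W21_energy_integrable:
  assumes g: "g \<in> W21 T" and w[measurable]: "w \<in> borel_measurable borel"
    and w2: "integrable (lebesgue_on {0..T}) (\<lambda>s. (w s)\<^sup>2)"
  shows "integrable (lebesgue_on {0..T}) (\<lambda>s. (g s - w s)\<^sup>2 + (deriv g s)\<^sup>2)"
  using W21_D[OF g] w2 borel_measurable_lebesgue_on[OF w]
  by (intro Bochner_Integration.integrable_add integrable_square_diff) auto

text \<open>The cross term vanishes because \<open>\<psi>\<close> is a primitive of \<open>\<phi> - w\<close> that is zero at both ends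
  (the Euler--Lagrange equation with natural boundary conditions).\<close>
lemma energy_Pythagoras:
  assumes T: "T > 0" and w[measurable]: "w \<in> borel_measurable borel"
    and w2: "integrable (lebesgue_on {0..T}) (\<lambda>s. (w s)\<^sup>2)"
    and d: "\<And>x. (\<phi> has_real_derivative \<psi> x) (at x)" and c: "continuous_on UNIV \<psi>"
    and prim: "\<And>x. x \<in> {0..T} \<Longrightarrow> \<psi> x = (\<integral>s. indicator {0..x} s * (\<phi> s - w s) \<partial>lebesgue_on {0..T})"
    and end0: "\<psi> T = 0" and g: "g \<in> W21 T"
  shows "energy T g w = energy T \<phi> w + (\<integral>s. (g s - \<phi> s)\<^sup>2 + (deriv g s - \<psi> s)\<^sup>2 \<partial>lebesgue_on {0..T})"
proof -
  define L where "L = lebesgue_on {0..T}"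
  interpret finite_measure L unfolding L_def by (rule finite_measure_lebesgue_on_Icc)
  interpret LL: pair_sigma_finite L L ..
  have dphi: "deriv \<phi> = \<psi>" and phi: "\<phi> \<in> W21 T" using W21_C1[OF d c] by auto
  define k where "k s = \<phi> s - w s" for s
  define h where "h s = g s - \<phi> s" for s
  define h' where "h' s = deriv g s - \<psi> s" for s
  note Dg = W21_D[OF g, folded L_def] and Dp = W21_D[OF phi, folded L_def, unfolded dphi]
  have wL[measurable]: "w \<in> borel_measurable L" unfolding L_def by (rule borel_measurable_lebesgue_on) simp
  note [measurable] = Dg(2,4) Dp(2,4)
  have km[measurable]: "k \<in> borel_measurable L" "h \<in> borel_measurable L" "h' \<in> borel_measurable L"
    unfolding k_def h_def h'_def by measurable
  have k2: "integrable L (\<lambda>s. (k s)\<^sup>2)" unfolding k_def using Dp w2 by (intro integrable_square_diff) (auto simp: L_def[symmetric])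
  have h2: "integrable L (\<lambda>s. (h s)\<^sup>2)" unfolding h_def using Dp Dg by (intro integrable_square_diff) auto
  have h'2: "integrable L (\<lambda>s. (h' s)\<^sup>2)" unfolding h'_def using Dp Dg by (intro integrable_square_diff) auto
  have ki: "integrable L k" and hi: "integrable L h'" by (rule square_integrable_imp_integrable; use k2 h'2 in auto)+
  have spL: "space L = {0..T}" by (simp add: L_def)
  have idL: "(\<lambda>x. x) \<in> measurable L borel" unfolding L_def by (rule borel_measurable_lebesgue_on) simp
  have "{0..x} \<inter> {0..T} \<in> sets L" for x by (auto simp: L_def sets_restrict_space)
  have hx: "h x = h 0 + (\<integral>s. indicator {0..x} s * h' s \<partial>L)" if x: "x \<in> {0..T}" for x
  proof -
    have [measurable]: "{0..x} \<in> sets L" using x by (auto simp: L_def sets_restrict_space)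
    have "(\<integral>s. indicator {0..x} s * h' s \<partial>L) = (\<integral>s. indicator {0..x} s * deriv g s \<partial>L) - (\<integral>s. indicator {0..x} s * \<psi> s \<partial>L)"
      unfolding h'_def right_diff_distrib
      by (rule Bochner_Integration.integral_diff) (auto intro!: integrable_real_mult_indicator Dg Dp simp: mult.commute[of "indicator _ _"])
    then show ?thesis using Dg(7)[OF x] Dp(7)[OF x] by (simp add: h_def)
  qed
  \<comment> \<open>The integrals of \<open>k\<close> over {0..x} and {x..T} add up to
    \<open>\<psi> T = 0\<close>; the point x is counted twice, which is harmless as a null
    set.\<close>
  have kint: "(\<integral>s. indicator {x..T} s * k s \<partial>L) = - \<psi> x" if x: "x \<in> {0..T}" for x
  proof -
    have [measurable]: "{0..x} \<in> sets L" "{x..T} \<in> sets L" "{0..T} \<in> sets L" using x by (auto simp: L_def sets_restrict_space)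
    have ne: "AE s in L. s \<noteq> x"
    proof -
      have "AE s in lebesgue. s \<noteq> x" by (intro AE_completion) (auto intro: AE_lborel_singleton)
      then show ?thesis unfolding L_def by (subst AE_restrict_space_iff) auto
    qed
    have "(\<integral>s. indicator {0..T} s * k s \<partial>L) = (\<integral>s. indicator {0..x} s * k s + indicator {x..T} s * k s \<partial>L)"
      using ne x by (intro integral_cong_AE) (auto simp: L_def[symmetric] split: split_indicator elim!: eventually_mono)
    also have "\<dots> = (\<integral>s. indicator {0..x} s * k s \<partial>L) + (\<integral>s. indicator {x..T} s * k s \<partial>L)"
      by (rule Bochner_Integration.integral_add) (auto intro!: integrable_real_mult_indicator ki simp: mult.commute[of "indicator _ _"])
    finally show ?thesis using prim[OF x, folded L_def] prim[of T, folded L_def] T end0 by (simp add: k_def)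
  qed
  have triangle[measurable]: "Measurable.pred (L \<Otimes>\<^sub>M L) (\<lambda>p. snd p \<le> fst p)"
    using idL by measurable
  \<comment> \<open>Integration by parts through Fubini: \<open>h s - h 0\<close> is the integral of
    \<open>h'\<close> up to s, and the order of integration is exchanged on the triangle x \<le> s.
    The constant \<open>h 0\<close> drops out because \<open>k\<close> has integral 0.\<close>
  have cross: "(\<integral>s. k s * h s \<partial>L) = - (\<integral>x. h' x * \<psi> x \<partial>L)"
  proof -
    have int1: "integrable (L \<Otimes>\<^sub>M L) (\<lambda>(s, x). k s * h' x * (if x \<le> s then 1 else 0))"
    proof (rule Bochner_Integration.integrable_bound[OF LL.integrable_product_mult[OF ki hi]])
      show "(\<lambda>(s, x). k s * h' x * (if x \<le> s then 1 else 0)) \<in> borel_measurable (L \<Otimes>\<^sub>M L)"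
        using triangle unfolding split_beta by measurable
    qed (auto simp: split_beta)
    have "(\<integral>s. k s * (\<integral>x. indicator {0..s} x * h' x \<partial>L) \<partial>L) = (\<integral>s. (\<integral>x. k s * h' x * (if x \<le> s then 1 else 0) \<partial>L) \<partial>L)"
    proof (rule Bochner_Integration.integral_cong[OF refl])
      fix s assume "s \<in> space L"
      have "(\<integral>x. k s * h' x * (if x \<le> s then 1 else 0) \<partial>L) = (\<integral>x. k s * (indicator {0..s} x * h' x) \<partial>L)"
        by (intro Bochner_Integration.integral_cong) (auto simp: spL split: split_indicator)
      then show "k s * (\<integral>x. indicator {0..s} x * h' x \<partial>L) = (\<integral>x. k s * h' x * (if x \<le> s then 1 else 0) \<partial>L)" by simp
    qed
    also have "\<dots> = (\<integral>x. (\<integral>s. k s * h' x * (if x \<le> s then 1 else 0) \<partial>L) \<partial>L)"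
      using LL.Fubini_integral[OF int1] by simp
    also have "\<dots> = (\<integral>x. h' x * - \<psi> x \<partial>L)"
    proof (rule Bochner_Integration.integral_cong[OF refl])
      fix x assume x: "x \<in> space L"
      have "(\<integral>s. k s * h' x * (if x \<le> s then 1 else 0) \<partial>L) = (\<integral>s. h' x * (indicator {x..T} s * k s) \<partial>L)"
        by (intro Bochner_Integration.integral_cong) (auto simp: spL split: split_indicator)
      then show "(\<integral>s. k s * h' x * (if x \<le> s then 1 else 0) \<partial>L) = h' x * - \<psi> x" using kint[of x] x by (simp add: spL)
    qed
    finally have 1: "(\<integral>s. k s * (\<integral>x. indicator {0..s} x * h' x \<partial>L) \<partial>L) = - (\<integral>x. h' x * \<psi> x \<partial>L)" by simp
    have k0: "(\<integral>s. k s \<partial>L) = 0"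
    proof -
      have "(\<integral>s. k s \<partial>L) = (\<integral>s. indicator {0..T} s * k s \<partial>L)"
        by (intro Bochner_Integration.integral_cong) (auto simp: spL)
      then show ?thesis using kint[of 0] prim[of T, folded L_def] T end0 by (simp add: k_def)
    qed
    have kh: "integrable L (\<lambda>s. k s * h s)" by (intro integrable_mult_of_squares k2 h2) auto
    have "(\<integral>s. k s * (\<integral>x. indicator {0..s} x * h' x \<partial>L) \<partial>L) = (\<integral>s. k s * h s - h 0 * k s \<partial>L)"
    proof (rule Bochner_Integration.integral_cong[OF refl])
      fix s assume "s \<in> space L"
      then have e: "(\<integral>x. indicator {0..s} x * h' x \<partial>L) = h s - h 0" using hx[of s] by (simp add: spL)
      show "k s * (\<integral>x. indicator {0..s} x * h' x \<partial>L) = k s * h s - h 0 * k s" unfolding e by (simp add: algebra_simps)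
    qed
    also have "\<dots> = (\<integral>s. k s * h s \<partial>L)" using kh ki k0 by simp
    finally show ?thesis using 1 by simp
  qed
  have i1: "integrable L (\<lambda>s. (k s)\<^sup>2 + (\<psi> s)\<^sup>2)" and i2: "integrable L (\<lambda>s. (h s)\<^sup>2 + (h' s)\<^sup>2)"
    and i3: "integrable L (\<lambda>s. k s * h s)" "integrable L (\<lambda>s. h' s * \<psi> s)"
    using k2 h2 h'2 Dp(5) by (auto intro: integrable_mult_of_squares)
  \<comment> \<open>Here g - w = h + k and g' = h' + \<psi>, so the mixed terms are
    \<open>2 * k * h\<close> and \<open>2 * h' * \<psi>\<close>, whose integrals cancel by
    \<open>cross\<close>.\<close>
  have "energy T g w = (\<integral>s. ((k s)\<^sup>2 + (\<psi> s)\<^sup>2) + ((h s)\<^sup>2 + (h' s)\<^sup>2) + 2 * (k s * h s) + 2 * (h' s * \<psi> s) \<partial>L)"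
    unfolding energy_alt L_def[symmetric]
    by (intro Bochner_Integration.integral_cong) (auto simp: k_def h_def h'_def power2_eq_square algebra_simps)
  also have "\<dots> = (\<integral>s. (k s)\<^sup>2 + (\<psi> s)\<^sup>2 \<partial>L) + (\<integral>s. (h s)\<^sup>2 + (h' s)\<^sup>2 \<partial>L) + 2 * (\<integral>s. k s * h s \<partial>L) + 2 * (\<integral>s. h' s * \<psi> s \<partial>L)"
    using i1 i2 i3 by simp
  also have "\<dots> = (\<integral>s. (k s)\<^sup>2 + (\<psi> s)\<^sup>2 \<partial>L) + (\<integral>s. (h s)\<^sup>2 + (h' s)\<^sup>2 \<partial>L)" using cross by simp
  finally show ?thesis by (simp add: energy_alt dphi L_def k_def h_def h'_def)
qed

text \<open>\<open>minimizer\<close> is a Hilbert choice; once some minimizer \<open>\<phi>\<close>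
  exists, the chosen function is one as well and attains the same energy.\<close>

lemma energy_minimizer_eq:
  assumes "\<phi> \<in> W21 T" "\<And>g. g \<in> W21 T \<Longrightarrow> energy T \<phi> w \<le> energy T g w"
  shows "energy T (minimizer T w) w = energy T \<phi> w" "minimizer T w \<in> W21 T"
proof -
  have "is_arg_min (\<lambda>f. energy T f w) (\<lambda>f. f \<in> W21 T) (minimizer T w)"
    unfolding minimizer_def arg_min_def
    by (rule someI[of _ \<phi>]) (use assms in \<open>simp add: is_arg_min_def not_less\<close>)
  then show "energy T (minimizer T w) w = energy T \<phi> w" and m: "minimizer T w \<in> W21 T"
    using assms by (simp_all add: is_arg_min_def not_less antisym)
qed

text \<open>Every competitor has energy 0 by the convention for non-integrable functions. This
  settles the value on exceptional paths, which measurability of the minimal energy in \<omega>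
  requires.\<close>

lemma energy_minimizer_not_L2:
  assumes w[measurable]: "w \<in> borel_measurable borel"
    and w2: "\<not> integrable (lebesgue_on {0..T}) (\<lambda>s. (w s)\<^sup>2)"
  shows "energy T (minimizer T w) w = 0"
proof -
  have E: "energy T g w = 0" if g: "g \<in> W21 T" for g
  proof -
    note D = W21_D[OF g]
    have wL[measurable]: "w \<in> borel_measurable (lebesgue_on {0..T})" by (rule borel_measurable_lebesgue_on) simp
    have "\<not> integrable (lebesgue_on {0..T}) (\<lambda>s. (g s - w s)\<^sup>2 + (deriv g s)\<^sup>2)"
    proof
      assume "integrable (lebesgue_on {0..T}) (\<lambda>s. (g s - w s)\<^sup>2 + (deriv g s)\<^sup>2)"
      then have "integrable (lebesgue_on {0..T}) (\<lambda>s. ((g s - w s)\<^sup>2 + (deriv g s)\<^sup>2) - (deriv g s)\<^sup>2)"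
        using D(5) by (rule Bochner_Integration.integrable_diff)
      then have "integrable (lebesgue_on {0..T}) (\<lambda>s. (g s - w s)\<^sup>2)" by simp
      then have "integrable (lebesgue_on {0..T}) (\<lambda>s. (g s - (g s - w s))\<^sup>2)"
        using D by (rule_tac integrable_square_diff) auto
      then show False using w2 by simp
    qed
    then show ?thesis unfolding energy_alt by (rule not_integrable_integral_eq)
  qed
  have "(\<lambda>_. 0) \<in> W21 T" using W21_C1[of "\<lambda>_. 0" "\<lambda>_. 0"] by auto
  then show ?thesis using energy_minimizer_eq[of "\<lambda>_. 0" T w] E by auto
qed

lemma energy_minimizer_optimal:
  assumes T: "T > 0" and w[measurable]: "w \<in> borel_measurable borel"
    and w2: "integrable (lebesgue_on {0..T}) (\<lambda>s. (w s)\<^sup>2)"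
    and d: "\<And>x. (\<phi> has_real_derivative \<psi> x) (at x)" and c: "continuous_on UNIV \<psi>"
    and prim: "\<And>x. x \<in> {0..T} \<Longrightarrow> \<psi> x = (\<integral>s. indicator {0..x} s * (\<phi> s - w s) \<partial>lebesgue_on {0..T})"
    and end0: "\<psi> T = 0"
  shows "energy T (minimizer T w) w = energy T \<phi> w" "minimizer T w \<in> W21 T"
    "\<And>g. g \<in> W21 T \<Longrightarrow> energy T \<phi> w \<le> energy T g w"
proof -
  show le: "\<And>g. g \<in> W21 T \<Longrightarrow> energy T \<phi> w \<le> energy T g w"
    using energy_Pythagoras[OF assms] by (auto intro!: integral_nonneg_AE)
  show "energy T (minimizer T w) w = energy T \<phi> w" "minimizer T w \<in> W21 T"
    using energy_minimizer_eq[OF _ le] W21_C1[OF d c] by auto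
qed

subsection \<open>The explicit minimizer\<close>

text \<open>\<open>laplace_even\<close> is the Green kernel of \<open>1 - d\<^sup>2/dt\<^sup>2\<close> on the whole line.\<close>

definition laplace_even :: "real \<Rightarrow> real" where
  "laplace_even r = exp (- \<bar>r\<bar>) / 2"

text \<open>The derivative of \<open>laplace_even\<close> with reversed sign, so that
  \<open>laplace_odd (s - t)\<close> is the derivative of \<open>laplace_even (s - t)\<close> in t
  for t \<noteq> s. It jumps by 1 at 0 and takes the left limit there.\<close>

definition laplace_odd :: "real \<Rightarrow> real" where
  "laplace_odd r = (if r > 0 then exp (- r) / 2 else - exp r / 2)"

definition smooth :: "(real \<Rightarrow> real) \<Rightarrow> real \<Rightarrow> real" where
  "smooth w t = (\<integral>s. laplace_even (s - t) * w s \<partial>lborel)"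

definition smooth_deriv :: "(real \<Rightarrow> real) \<Rightarrow> real \<Rightarrow> real" where
  "smooth_deriv w t = (\<integral>s. laplace_odd (s - t) * w s \<partial>lborel)"

lemma laplace_measurable[measurable]:
  "laplace_even \<in> borel_measurable borel" "laplace_odd \<in> borel_measurable borel"
  unfolding laplace_even_def[abs_def] laplace_odd_def[abs_def] by measurable

lemma abs_laplace: "\<bar>laplace_even r\<bar> = exp (- \<bar>r\<bar>) / 2" "\<bar>laplace_odd r\<bar> = exp (- \<bar>r\<bar>) / 2"
  by (auto simp: laplace_even_def laplace_odd_def)

text \<open>Shifting the kernel by t costs only the factor \<open>exp \<bar>t\<bar>\<close>, so a
  single weight handles all shifts, uniformly for bounded t.\<close>

lemma laplace_bound:
  assumes "k \<in> {laplace_even, laplace_odd}"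
  shows "\<bar>k (s - t)\<bar> \<le> exp \<bar>t\<bar> * exp (- \<bar>s\<bar>)"
proof -
  have "\<bar>k (s - t)\<bar> = exp (- \<bar>s - t\<bar>) / 2" using assms abs_laplace by auto
  also have "\<dots> \<le> exp (- \<bar>s - t\<bar>)" by simp
  also have "\<dots> \<le> exp (\<bar>t\<bar> - \<bar>s\<bar>)" by simp
  also have "\<dots> = exp \<bar>t\<bar> * exp (- \<bar>s\<bar>)" by (simp add: exp_add[symmetric])
  finally show ?thesis .
qed

text \<open>The kink at t = s is the one exceptional point of the fundamental theorem;
  \<open>laplace_even\<close> is continuous across it.\<close>

lemma laplace_even_primitive:
  assumes ab: "a \<le> b"
  shows "((\<lambda>t. laplace_odd (s - t)) has_integral (laplace_even (s - b) - laplace_even (s - a))) {a..b}"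
proof (rule fundamental_theorem_of_calculus_interior_strong[of "{s}"])
  show "continuous_on {a..b} (\<lambda>t. laplace_even (s - t))" unfolding laplace_even_def by (auto intro!: continuous_intros)
  fix x assume "x \<in> {a<..<b} - {s}"
  then consider "x < s" | "x > s" by fastforce
  then have "((\<lambda>t. laplace_even (s - t)) has_real_derivative laplace_odd (s - x)) (at x)"
  proof cases
    case 1
    have "((\<lambda>t. exp (t - s) / 2) has_real_derivative laplace_odd (s - x)) (at x)"
      using 1 by (auto simp: laplace_odd_def intro!: derivative_eq_intros)
    moreover have "\<forall>\<^sub>F t in nhds x. laplace_even (s - t) = exp (t - s) / 2"
      using eventually_nhds_in_open[of "{..<s}" x] 1 by (auto elim!: eventually_mono simp: laplace_even_def)
    ultimately show ?thesis by (subst DERIV_cong_ev[OF refl _ refl]) 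
  next
    case 2
    have "((\<lambda>t. exp (s - t) / 2) has_real_derivative laplace_odd (s - x)) (at x)"
      using 2 by (auto simp: laplace_odd_def intro!: derivative_eq_intros)
    moreover have "\<forall>\<^sub>F t in nhds x. laplace_even (s - t) = exp (s - t) / 2"
      using eventually_nhds_in_open[of "{s<..}" x] 2 by (auto elim!: eventually_mono simp: laplace_even_def)
    ultimately show ?thesis by (subst DERIV_cong_ev[OF refl _ refl])
  qed
  then show "((\<lambda>t. laplace_even (s - t)) has_vector_derivative laplace_odd (s - x)) (at x)"
    by (simp add: has_real_derivative_iff_has_vector_derivative)
qed (use ab in auto)

lemma laplace_odd_primitive:
  assumes ab: "a \<le> b"
  shows "((\<lambda>t. laplace_even (s - t)) has_integral (laplace_odd (s - b) - laplace_odd (s - a) + indicator {a<..b} s)) {a..b}"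
proof -
  \<comment> \<open>\<open>D t\<close> is \<open>laplace_odd (s - t)\<close>, plus 1 from t = s on,
    which repairs the jump and makes the primitive continuous. The indicator in the claim is the
    increment of this step; since \<open>laplace_odd 0\<close> is the left limit, the interval is
    open at a and closed at b.\<close>
  define D where "D t = (if t \<le> s then exp (t - s) / 2 else 1 - exp (s - t) / 2)" for t
  have "((\<lambda>t. laplace_even (s - t)) has_integral (D b - D a)) {a..b}"
  proof (rule fundamental_theorem_of_calculus_interior_strong[of "{s}"])
    show "continuous_on {a..b} D"
    proof -
      have "continuous_on ({..s} \<union> {s..}) D"
        unfolding D_def by (rule continuous_on_If) (auto intro!: continuous_intros)
      then show ?thesis by (rule continuous_on_subset) auto
    qed
    fix x assume "x \<in> {a<..<b} - {s}"
    then consider "x < s" | "x > s" by fastforce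
    then have "(D has_real_derivative laplace_even (s - x)) (at x)"
    proof cases
      case 1
      have "((\<lambda>t. exp (t - s) / 2) has_real_derivative laplace_even (s - x)) (at x)"
        using 1 by (auto simp: laplace_even_def intro!: derivative_eq_intros)
      moreover have "\<forall>\<^sub>F t in nhds x. D t = exp (t - s) / 2"
        using eventually_nhds_in_open[of "{..<s}" x] 1 by (auto elim!: eventually_mono simp: D_def)
      ultimately show ?thesis by (subst DERIV_cong_ev[OF refl _ refl])
    next
      case 2
      have "((\<lambda>t. 1 - exp (s - t) / 2) has_real_derivative laplace_even (s - x)) (at x)"
        using 2 by (auto simp: laplace_even_def intro!: derivative_eq_intros)
      moreover have "\<forall>\<^sub>F t in nhds x. D t = 1 - exp (s - t) / 2"
        using eventually_nhds_in_open[of "{s<..}" x] 2 by (auto elim!: eventually_mono simp: D_def)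
      ultimately show ?thesis by (subst DERIV_cong_ev[OF refl _ refl])
    qed
    then show "(D has_vector_derivative laplace_even (s - x)) (at x)"
      by (simp add: has_real_derivative_iff_has_vector_derivative)
  qed (use ab in auto)
  moreover have "D b - D a = laplace_odd (s - b) - laplace_odd (s - a) + indicator {a<..b} s"
    using ab by (auto simp: D_def laplace_odd_def split: split_indicator)
  ultimately show ?thesis by simp
qed

lemma laplace_set_integral:
  assumes k: "k \<in> {laplace_even, laplace_odd}" and i: "((\<lambda>t. k (s - t)) has_integral I) {a..b}"
  shows "(\<integral>t. indicator {a..b} t * k (s - t) \<partial>lborel) = I"
proof -
  have [measurable]: "k \<in> borel_measurable borel" using k by auto
  have "set_integrable lborel {a..b} (\<lambda>t. k (s - t))"
    unfolding set_integrable_def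
  proof (rule Bochner_Integration.integrable_bound)
    show "integrable lborel (\<lambda>t. indicator {a..b} t * (1::real))"
      by (simp add: emeasure_lborel_Icc_eq integrable_real_indicator)
    have "\<bar>k r\<bar> \<le> 1" for r
    proof -
      have "\<bar>k r\<bar> = exp (- \<bar>r\<bar>) / 2" using k abs_laplace[of r] by auto
      also have "exp (- \<bar>r\<bar>) \<le> 1" by simp
      finally show ?thesis by simp
    qed
    then show "AE t in lborel. norm (indicator {a..b} t *\<^sub>R k (s - t)) \<le> norm (indicator {a..b} t * (1::real))"
      by (auto simp: abs_mult split: split_indicator)
  qed simp
  from set_borel_integral_eq_integral(2)[OF this] i show ?thesis
    by (simp add: set_lebesgue_integral_def integral_unique)
qed

text \<open>The weight is the decay of the kernels: this condition makes all shifted kernels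
  integrable against \<open>w\<close>. Almost every path of \<open>B\<close> satisfies it, and so
  does a path in L2[0,T] that is cut off outside {0..T}.\<close>

locale exp_integrable_path =
  fixes w :: "real \<Rightarrow> real"
  assumes w_measurable[measurable]: "w \<in> borel_measurable borel"
    and exp_integrable: "integrable lborel (\<lambda>s. exp (- \<bar>s\<bar>) * w s)"
begin

lemma laplace_integrable:
  assumes k: "k \<in> {laplace_even, laplace_odd}"
  shows "integrable lborel (\<lambda>s. k (s - t) * w s)"
proof (rule Bochner_Integration.integrable_bound)
  have [measurable]: "k \<in> borel_measurable borel" using k by auto
  show "integrable lborel (\<lambda>s. exp \<bar>t\<bar> * (exp (- \<bar>s\<bar>) * w s))" using exp_integrable by simp
  show "(\<lambda>s. k (s - t) * w s) \<in> borel_measurable lborel" by measurable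
  show "AE s in lborel. norm (k (s - t) * w s) \<le> norm (exp \<bar>t\<bar> * (exp (- \<bar>s\<bar>) * w s))"
    using laplace_bound[OF k] by (auto simp: abs_mult mult.assoc[symmetric] intro!: mult_right_mono)
qed

text \<open>For t in {a..b} the factor \<open>exp \<bar>t\<bar>\<close> of
  \<open>laplace_bound\<close> is at most \<open>C\<close>, so the integrand is dominated by a
  product of two integrable functions.\<close>

lemma laplace_integrable_pair:
  assumes k: "k \<in> {laplace_even, laplace_odd}"
  shows "integrable (lborel \<Otimes>\<^sub>M lborel) (\<lambda>(t, s). indicator {a..b} t * (k (s - t) * w s))"
proof (rule Bochner_Integration.integrable_bound)
  have [measurable]: "k \<in> borel_measurable borel" using k by auto
  define C where "C = exp (\<bar>a\<bar> + \<bar>b\<bar>)"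
  have "integrable lborel (\<lambda>t::real. indicator {a..b} t * C)"
    by (simp add: emeasure_lborel_Icc_eq integrable_real_indicator)
  from lborel_pair.integrable_product_mult[OF this exp_integrable]
  show "integrable (lborel \<Otimes>\<^sub>M lborel) (\<lambda>(t, s). (indicator {a..b} t * C) * (exp (- \<bar>s\<bar>) * w s))" .
  show "(\<lambda>(t, s). indicator {a..b} t * (k (s - t) * w s)) \<in> borel_measurable (lborel \<Otimes>\<^sub>M lborel)" by measurable
  have "norm (indicator {a..b} t * (k (s - t) * w s)) \<le> norm ((indicator {a..b} t * C) * (exp (- \<bar>s\<bar>) * w s))" for t s
  proof (cases "t \<in> {a..b}")
    case True
    then have "exp \<bar>t\<bar> \<le> C" unfolding C_def by (subst exp_le_cancel_iff) auto
    then have "\<bar>k (s - t)\<bar> \<le> C * exp (- \<bar>s\<bar>)"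
      using laplace_bound[OF k, of s t] by (meson exp_ge_zero mult_right_mono order_trans)
    then have "\<bar>k (s - t)\<bar> * \<bar>w s\<bar> \<le> C * exp (- \<bar>s\<bar>) * \<bar>w s\<bar>" by (rule mult_right_mono) simp
    then show ?thesis using True by (simp add: abs_mult C_def)
  qed simp
  then show "AE x in lborel \<Otimes>\<^sub>M lborel. norm (case x of (t, s) \<Rightarrow> indicator {a..b} t * (k (s - t) * w s))
      \<le> norm (case x of (t, s) \<Rightarrow> (indicator {a..b} t * C) * (exp (- \<bar>s\<bar>) * w s))"
    by auto
qed

lemma laplace_Fubini:
  assumes k: "k \<in> {laplace_even, laplace_odd}"
  shows "integrable lborel (\<lambda>t. indicator {a..b} t * (\<integral>s. k (s - t) * w s \<partial>lborel))"
    "(\<integral>t. indicator {a..b} t * (\<integral>s. k (s - t) * w s \<partial>lborel) \<partial>lborel) =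
     (\<integral>s. (\<integral>t. indicator {a..b} t * k (s - t) \<partial>lborel) * w s \<partial>lborel)"
proof -
  note * = laplace_integrable_pair[OF k, of a b]
  show "integrable lborel (\<lambda>t. indicator {a..b} t * (\<integral>s. k (s - t) * w s \<partial>lborel))"
    using lborel_pair.integrable_fst[OF *] by simp
  have "(\<integral>t. indicator {a..b} t * (\<integral>s. k (s - t) * w s \<partial>lborel) \<partial>lborel) =
      (\<integral>t. (\<integral>s. indicator {a..b} t * (k (s - t) * w s) \<partial>lborel) \<partial>lborel)"
    by simp
  also have "\<dots> = (\<integral>s. (\<integral>t. indicator {a..b} t * (k (s - t) * w s) \<partial>lborel) \<partial>lborel)"
    by (rule lborel_pair.Fubini_integral[OF *, symmetric])
  also have "\<dots> = (\<integral>s. (\<integral>t. (indicator {a..b} t * k (s - t)) * w s \<partial>lborel) \<partial>lborel)"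
    by (simp add: mult.assoc)
  also have "\<dots> = (\<integral>s. (\<integral>t. indicator {a..b} t * k (s - t) \<partial>lborel) * w s \<partial>lborel)" by simp
  finally show "(\<integral>t. indicator {a..b} t * (\<integral>s. k (s - t) * w s \<partial>lborel) \<partial>lborel) =
     (\<integral>s. (\<integral>t. indicator {a..b} t * k (s - t) \<partial>lborel) * w s \<partial>lborel)" .
qed

lemma set_integrable_w: "integrable lborel (\<lambda>s. indicator {a..b} s * w s)"
proof (rule Bochner_Integration.integrable_bound)
  define C where "C = exp (\<bar>a\<bar> + \<bar>b\<bar>)"
  show "integrable lborel (\<lambda>s. C * (exp (- \<bar>s\<bar>) * w s))" using exp_integrable by simp
  have "norm (indicator {a..b} s * w s) \<le> norm (C * (exp (- \<bar>s\<bar>) * w s))" for s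
  proof (cases "s \<in> {a..b}")
    case True
    then have "1 \<le> C * exp (- \<bar>s\<bar>)" unfolding C_def exp_add[symmetric] by auto
    then have "1 * \<bar>w s\<bar> \<le> C * exp (- \<bar>s\<bar>) * \<bar>w s\<bar>" by (intro mult_right_mono) auto
    then show ?thesis using True by (simp add: abs_mult C_def)
  qed simp
  then show "AE s in lborel. norm (indicator {a..b} s * w s) \<le> norm (C * (exp (- \<bar>s\<bar>) * w s))" by simp
qed simp

lemma smooth_diff:
  assumes ab: "a \<le> b"
  shows "smooth w b - smooth w a = (\<integral>t. indicator {a..b} t * smooth_deriv w t \<partial>lborel)"
proof -
  have "(\<integral>t. indicator {a..b} t * smooth_deriv w t \<partial>lborel) =
     (\<integral>s. (laplace_even (s - b) - laplace_even (s - a)) * w s \<partial>lborel)"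
    unfolding smooth_deriv_def
    by (subst laplace_Fubini) (simp_all add: laplace_set_integral[OF _ laplace_even_primitive[OF ab]])
  also have "\<dots> = smooth w b - smooth w a"
    unfolding smooth_def left_diff_distrib by (intro Bochner_Integration.integral_diff laplace_integrable) auto
  finally show ?thesis by simp
qed

text \<open>The equation smooth'' = smooth - w in integrated form, which suits a path that is merely
  measurable. The term \<open>w\<close> comes from the unit jump of
  \<open>laplace_odd\<close>.\<close>

lemma smooth_deriv_diff:
  assumes ab: "a \<le> b"
  shows "smooth_deriv w b - smooth_deriv w a = (\<integral>t. indicator {a..b} t * (smooth w t - w t) \<partial>lborel)"
    "integrable lborel (\<lambda>t. indicator {a..b} t * (smooth w t - w t))"
proof -
  have i: "integrable lborel (\<lambda>t. indicator {a..b} t * smooth w t)"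
    unfolding smooth_def by (rule laplace_Fubini) auto
  then show "integrable lborel (\<lambda>t. indicator {a..b} t * (smooth w t - w t))"
    using set_integrable_w[of a b] by (simp add: right_diff_distrib)
  have e: "(\<integral>s. indicator {a<..b} s * w s \<partial>lborel) = (\<integral>s. indicator {a..b} s * w s \<partial>lborel)"
    using AE_lborel_singleton[of a]
    by (intro integral_cong_AE) (auto elim!: eventually_mono split: split_indicator)
  have i': "integrable lborel (\<lambda>s. indicator {a<..b} s * w s)"
  proof (rule Bochner_Integration.integrable_bound[OF set_integrable_w[of a b]])
  qed (auto split: split_indicator)
  have "(\<integral>t. indicator {a..b} t * smooth w t \<partial>lborel) =
     (\<integral>s. (laplace_odd (s - b) - laplace_odd (s - a) + indicator {a<..b} s) * w s \<partial>lborel)"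
    unfolding smooth_def
    by (subst laplace_Fubini) (simp_all add: laplace_set_integral[OF _ laplace_odd_primitive[OF ab]])
  also have "\<dots> = (\<integral>s. laplace_odd (s - b) * w s - laplace_odd (s - a) * w s + indicator {a<..b} s * w s \<partial>lborel)"
    by (simp add: algebra_simps)
  also have "\<dots> = smooth_deriv w b - smooth_deriv w a + (\<integral>s. indicator {a<..b} s * w s \<partial>lborel)"
    unfolding smooth_deriv_def using laplace_integrable i' by simp
  finally show "smooth_deriv w b - smooth_deriv w a = (\<integral>t. indicator {a..b} t * (smooth w t - w t) \<partial>lborel)"
    unfolding right_diff_distrib using i set_integrable_w[of a b] e by simp
qed

text \<open>\<open>smooth_deriv w\<close> is an indefinite integral by
  \<open>smooth_deriv_diff\<close>. Its continuity then upgrades \<open>smooth_diff\<close> from an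
  integral identity to a derivative at every point.\<close>

lemma continuous_smooth_deriv: "continuous_on UNIV (smooth_deriv w)"
proof -
  have "isCont (smooth_deriv w) x" for x
  proof -
    define a b where "a = x - 1" and "b = x + 1"
    have si: "set_integrable lborel {a..b} (\<lambda>t. smooth w t - w t)"
      using smooth_deriv_diff(2)[of a b] by (simp add: set_integrable_def a_def b_def)
    have "continuous_on {a..b} (\<lambda>t. smooth_deriv w a + integral {a..t} (\<lambda>t. smooth w t - w t))"
      by (intro continuous_intros indefinite_integral_continuous_1 set_borel_integral_eq_integral(1)[OF si])
    moreover have "smooth_deriv w a + integral {a..t} (\<lambda>t. smooth w t - w t) = smooth_deriv w t" if t: "t \<in> {a..b}" for t
    proof -
      have "set_integrable lborel {a..t} (\<lambda>t. smooth w t - w t)" by (rule set_integrable_subset[OF si]) (use t in auto)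
      from set_borel_integral_eq_integral(2)[OF this] show ?thesis
        using smooth_deriv_diff(1)[of a t] t by (simp add: set_lebesgue_integral_def)
    qed
    ultimately have "continuous_on {a..b} (smooth_deriv w)" by (rule continuous_on_eq)
    then show ?thesis
      by (rule continuous_on_interior) (auto simp: a_def b_def)
  qed
  then show ?thesis by (simp add: continuous_at_imp_continuous_on)
qed

lemma smooth_measurable[measurable]:
  "smooth w \<in> borel_measurable borel" "smooth_deriv w \<in> borel_measurable borel"
  unfolding smooth_def[abs_def] smooth_deriv_def[abs_def] by measurable

lemma DERIV_smooth: "(smooth w has_real_derivative smooth_deriv w x) (at x)"
proof -
  define a b where "a = x - 1" and "b = x + 1"
  have c: "continuous_on {a..b} (smooth_deriv w)" using continuous_smooth_deriv continuous_on_subset by blast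
  have d: "((\<lambda>t. smooth w a + integral {a..t} (smooth_deriv w)) has_real_derivative smooth_deriv w x) (at x within {a..b})"
    by (subst add_0[symmetric], intro DERIV_add DERIV_const integral_has_real_derivative[OF c]) (auto simp: a_def b_def)
  have "smooth w a + integral {a..t} (smooth_deriv w) = smooth w t" if t: "t \<in> {a..b}" for t
  proof -
    have "set_integrable lborel {a..t} (smooth_deriv w)"
      by (intro borel_integrable_atLeastAtMost' continuous_on_subset[OF continuous_smooth_deriv]) auto
    from set_borel_integral_eq_integral(2)[OF this] show ?thesis
      using smooth_diff[of a t] t by (simp add: set_lebesgue_integral_def)
  qed
  note eq = this
  have "(smooth w has_real_derivative smooth_deriv w x) (at x within {a..b})"
    by (rule has_field_derivative_transform_within[OF d, of 1]) (use eq in \<open>auto simp: a_def b_def\<close>)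
  then show ?thesis
    by (subst (asm) at_within_interior) (auto simp: a_def b_def)
qed

lemma energy_minimizer_formula:
  assumes T: "T > 0" and w2: "integrable (lebesgue_on {0..T}) (\<lambda>s. (w s)\<^sup>2)"
  defines "A \<equiv> smooth_deriv w T" and "C \<equiv> smooth_deriv w 0"
  shows "energy T (minimizer T w) w =
      (\<integral>s. indicator {0..T} s * ((smooth w s - w s)\<^sup>2 + (smooth_deriv w s)\<^sup>2) \<partial>lborel)
       - ((A\<^sup>2 + C\<^sup>2) * cosh T - 2 * A * C) / sinh T" (is ?formula)
    and "minimizer T w \<in> W21 T"
    and "\<And>g. g \<in> W21 T \<Longrightarrow> energy T (minimizer T w) w \<le> energy T g w"
proof -
  \<comment> \<open>\<open>h\<close> solves h'' = h with h'(0) = C and h'(T) = A. Subtracting it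
    from \<open>smooth w\<close> keeps the differential equation and enforces the natural boundary
    conditions.\<close>
  define h where "h t = (A * cosh t - C * cosh (T - t)) / sinh T" for t
  define h' where "h' t = (A * sinh t + C * sinh (T - t)) / sinh T" for t
  have sT: "sinh T > 0" using T by simp
  have dh: "(h has_real_derivative h' x) (at x)" for x
  proof -
    have "((\<lambda>t. A * cosh t - C * cosh (T - t)) has_real_derivative A * sinh x + C * sinh (T - x)) (at x)"
      by (auto intro!: derivative_eq_intros)
    from DERIV_cdivide[OF this] show ?thesis unfolding h_def h'_def .
  qed
  have dh': "(h' has_real_derivative h x) (at x)" for x
  proof -
    have "((\<lambda>t. A * sinh t + C * sinh (T - t)) has_real_derivative A * cosh x - C * cosh (T - x)) (at x)"
      by (auto intro!: derivative_eq_intros)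
    from DERIV_cdivide[OF this] show ?thesis unfolding h_def h'_def .
  qed
  have ch: "continuous_on S h" "continuous_on S h'" for S
    using dh dh' by (auto intro: DERIV_continuous_on has_field_derivative_at_within)
  define \<phi> where "\<phi> t = smooth w t - h t" for t
  define \<psi> where "\<psi> t = smooth_deriv w t - h' t" for t
  have ends: "h' 0 = C" "h' T = A" using sT by (auto simp: h'_def)
  have 1: "(\<phi> has_real_derivative \<psi> x) (at x)" for x
    unfolding \<phi>_def \<psi>_def by (intro DERIV_diff DERIV_smooth dh)
  have 2: "continuous_on UNIV \<psi>"
    unfolding \<psi>_def by (intro continuous_intros continuous_smooth_deriv ch)
  have 3: "\<psi> x = (\<integral>s. indicator {0..x} s * (\<phi> s - w s) \<partial>lebesgue_on {0..T})" if x: "x \<in> {0..T}" for x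
  proof -
    have [measurable]: "h \<in> borel_measurable borel" using ch by (intro borel_measurable_continuous_onI)
    have hs: "set_integrable lborel {0..x} h" by (intro borel_integrable_atLeastAtMost' ch)
    have "(\<integral>s. indicator {0..x} s * (\<phi> s - w s) \<partial>lebesgue_on {0..T}) = (\<integral>s. indicator {0..x} s * (\<phi> s - w s) \<partial>lebesgue)"
      using x by (subst integral_restrict_space) (auto intro!: Bochner_Integration.integral_cong split: split_indicator)
    also have "\<dots> = (\<integral>s. indicator {0..x} s * (\<phi> s - w s) \<partial>lborel)"
      unfolding \<phi>_def by (subst integral_completion) auto
    also have "\<dots> = (\<integral>s. indicator {0..x} s * (smooth w s - w s) - indicator {0..x} s * h s \<partial>lborel)"
      unfolding \<phi>_def by (simp add: algebra_simps)
    also have "\<dots> = (smooth_deriv w x - C) - (\<integral>s. indicator {0..x} s * h s \<partial>lborel)"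
      using smooth_deriv_diff[of 0 x] x hs by (simp add: C_def set_integrable_def)
    also have "(\<integral>s. indicator {0..x} s * h s \<partial>lborel) = integral {0..x} h"
      using set_borel_integral_eq_integral(2)[OF hs] by (simp add: set_lebesgue_integral_def)
    also have "(h has_integral (h' x - h' 0)) {0..x}"
      using x dh' by (intro fundamental_theorem_of_calculus) 
         (auto simp: has_real_derivative_iff_has_vector_derivative[symmetric] intro: has_field_derivative_at_within)
    then have "integral {0..x} h = h' x - C" using ends by (simp add: integral_unique)
    finally show ?thesis by (simp add: \<psi>_def)
  qed
  have 4: "\<psi> T = 0" using ends by (simp add: \<psi>_def A_def)
  note opt = energy_minimizer_optimal[OF T w_measurable w2 1 2 3 4]
  show "minimizer T w \<in> W21 T" by (rule opt)
  show "\<And>g. g \<in> W21 T \<Longrightarrow> energy T (minimizer T w) w \<le> energy T g w" using opt by simp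
  note sm = W21_C1[OF DERIV_smooth continuous_smooth_deriv]
  \<comment> \<open>Pythagoras with \<open>smooth w\<close> itself as competitor: its excess over
    the minimal energy is the integral for \<open>h\<close>.\<close>
  have "energy T (smooth w) w = energy T \<phi> w + (\<integral>s. (h s)\<^sup>2 + (h' s)\<^sup>2 \<partial>lebesgue_on {0..T})"
  proof -
    have "smooth w s - \<phi> s = h s" "smooth_deriv w s - \<psi> s = h' s" for s by (simp_all add: \<phi>_def \<psi>_def)
    then show ?thesis using energy_Pythagoras[OF T w_measurable w2 1 2 3 4 sm(1)] sm(2) by simp
  qed
  also have "(\<integral>s. (h s)\<^sup>2 + (h' s)\<^sup>2 \<partial>lebesgue_on {0..T}) = integral {0..T} (\<lambda>s. (h s)\<^sup>2 + (h' s)\<^sup>2)"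
  proof -
    have "(\<lambda>s. (h s)\<^sup>2 + (h' s)\<^sup>2) absolutely_integrable_on {0..T}"
      by (intro absolutely_integrable_continuous_real continuous_intros ch)
    from set_lebesgue_integral_eq_integral(2)[OF this] show ?thesis
      by (subst integral_restrict_space) (auto simp: set_lebesgue_integral_def)
  qed
  \<comment> \<open>The equation h'' = h makes the integrand the derivative of h h', so only end
    point values remain.\<close>
  also have "((\<lambda>s. (h s)\<^sup>2 + (h' s)\<^sup>2) has_integral (h T * h' T - h 0 * h' 0)) {0..T}"
  proof (intro fundamental_theorem_of_calculus)
    fix x assume "x \<in> {0..T}"
    have "((\<lambda>x. h x * h' x) has_real_derivative (h x)\<^sup>2 + (h' x)\<^sup>2) (at x)"
      by (rule derivative_eq_intros dh dh')+ (simp add: power2_eq_square)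
    then show "((\<lambda>x. h x * h' x) has_vector_derivative (h x)\<^sup>2 + (h' x)\<^sup>2) (at x within {0..T})"
      by (simp add: has_real_derivative_iff_has_vector_derivative[symmetric] has_field_derivative_at_within)
  qed (use T in auto)
  then have "integral {0..T} (\<lambda>s. (h s)\<^sup>2 + (h' s)\<^sup>2) = h T * A - h 0 * C" using ends by (simp add: integral_unique)
  also have "h T * A - h 0 * C = ((A\<^sup>2 + C\<^sup>2) * cosh T - 2 * A * C) / sinh T"
  proof -
    have "h T * A - h 0 * C = ((A * cosh T - C) * A - (A - C * cosh T) * C) / sinh T"
      by (simp add: h_def diff_divide_distrib[symmetric])
    also have "(A * cosh T - C) * A - (A - C * cosh T) * C = (A\<^sup>2 + C\<^sup>2) * cosh T - 2 * A * C"
      by (simp add: algebra_simps power2_eq_square)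
    finally show ?thesis .
  qed
  also have "energy T (smooth w) w = (\<integral>s. indicator {0..T} s * ((smooth w s - w s)\<^sup>2 + (smooth_deriv w s)\<^sup>2) \<partial>lebesgue)"
    unfolding energy_alt sm(2) by (subst integral_restrict_space) auto
  also have "\<dots> = (\<integral>s. indicator {0..T} s * ((smooth w s - w s)\<^sup>2 + (smooth_deriv w s)\<^sup>2) \<partial>lborel)"
    by (subst integral_completion) auto
  finally show ?formula using opt(1) by simp
qed

end

section \<open>Truncated paths and monotonicity in the length of the interval\<close>

lemma exp_integrable_path_restrict:
  assumes [measurable]: "w \<in> borel_measurable borel"
    and w2: "integrable (lebesgue_on {0..T}) (\<lambda>s. (w s)\<^sup>2)"
  shows "exp_integrable_path (\<lambda>s. indicator {0..T} s * w s)"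
proof
  have "w \<in> borel_measurable (lebesgue_on {0..T})" by (rule borel_measurable_lebesgue_on) simp
  then have "integrable (lebesgue_on {0..T}) w"
    by (rule finite_measure.square_integrable_imp_integrable[OF finite_measure_lebesgue_on_Icc _ w2])
  then have "integrable lebesgue (\<lambda>s. indicator {0..T} s * w s)" by (subst (asm) integrable_restrict_space) auto
  then have "integrable lborel (\<lambda>s. indicator {0..T} s * w s)" by (subst (asm) integrable_completion) auto
  then show "integrable lborel (\<lambda>s. exp (- \<bar>s\<bar>) * (indicator {0..T} s * w s))"
    by (rule Bochner_Integration.integrable_bound) (auto simp: abs_mult intro!: mult_left_le_one_le)
qed measurable

lemma energy_cong_path:
  assumes "\<And>s. s \<in> {0..T} \<Longrightarrow> w s = w' s"
  shows "energy T f w = energy T f w'" "minimizer T w = minimizer T w'"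
proof -
  show "energy T f w = energy T f w'" for f
    unfolding energy_alt using assms by (intro Bochner_Integration.integral_cong) auto
  then show "minimizer T w = minimizer T w'" unfolding minimizer_def by simp
qed

text \<open>Values of the path outside {0..T} do not affect the energy, so the path may be replaced
  by its truncation, which is exponentially integrable. This covers each single path in L2[0,T],
  whatever its growth.\<close>

lemma energy_minimizer_restrict:
  assumes T: "T > 0" and w[measurable]: "w \<in> borel_measurable borel"
    and w2: "integrable (lebesgue_on {0..T}) (\<lambda>s. (w s)\<^sup>2)"
  defines "v \<equiv> (\<lambda>s. indicator {0..T} s * w s)"
  shows "energy T (minimizer T w) w =
      (\<integral>s. indicator {0..T} s * ((smooth v s - v s)\<^sup>2 + (smooth_deriv v s)\<^sup>2) \<partial>lborel)
       - (((smooth_deriv v T)\<^sup>2 + (smooth_deriv v 0)\<^sup>2) * cosh T - 2 * smooth_deriv v T * smooth_deriv v 0) / sinh T"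
    and "minimizer T w \<in> W21 T"
    and "\<And>g. g \<in> W21 T \<Longrightarrow> energy T (minimizer T w) w \<le> energy T g w"
proof -
  interpret exp_integrable_path v unfolding v_def by (rule exp_integrable_path_restrict[OF w w2])
  have e: "energy T f w = energy T f v" "minimizer T w = minimizer T v" for f
    by (rule energy_cong_path; simp add: v_def)+
  have "integrable (lebesgue_on {0..T}) (\<lambda>s. (v s)\<^sup>2)"
    using w2 by (rule Bochner_Integration.integrable_cong[THEN iffD1, rotated -1]) (auto simp: v_def)
  from energy_minimizer_formula[OF T this]
  show "energy T (minimizer T w) w =
      (\<integral>s. indicator {0..T} s * ((smooth v s - v s)\<^sup>2 + (smooth_deriv v s)\<^sup>2) \<partial>lborel)
       - (((smooth_deriv v T)\<^sup>2 + (smooth_deriv v 0)\<^sup>2) * cosh T - 2 * smooth_deriv v T * smooth_deriv v 0) / sinh T"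
    "minimizer T w \<in> W21 T" "\<And>g. g \<in> W21 T \<Longrightarrow> energy T (minimizer T w) w \<le> energy T g w"
    unfolding e by auto
qed

text \<open>The minimizer for the longer interval, restricted to {0..S}, is a competitor on the
  shorter one, and the integrand is nonnegative.\<close>

lemma energy_minimizer_mono:
  assumes S: "0 < S" "S \<le> T" and w[measurable]: "w \<in> borel_measurable borel"
    and w2: "integrable (lebesgue_on {0..T}) (\<lambda>s. (w s)\<^sup>2)"
  shows "energy S (minimizer S w) w \<le> energy T (minimizer T w) w" "0 \<le> energy S (minimizer S w) w"
proof -
  have si: "set_integrable lebesgue {0..T} (\<lambda>s. (w s)\<^sup>2)" using w2 by (subst (asm) integrable_restrict_space) (auto simp: set_integrable_def)
  then have "set_integrable lebesgue {0..S} (\<lambda>s. (w s)\<^sup>2)" by (rule set_integrable_subset) (use S in auto)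
  then have w2S: "integrable (lebesgue_on {0..S}) (\<lambda>s. (w s)\<^sup>2)" by (subst integrable_restrict_space) (auto simp: set_integrable_def)
  define g where "g = minimizer T w"
  have T: "T > 0" using S by simp
  have g: "g \<in> W21 T" unfolding g_def by (rule energy_minimizer_restrict(2)[OF T w w2])
  have gS: "g \<in> W21 S"
  proof -
    have "AC_on 0 S g" by (rule AC_on_subset[of 0 T]) (use g S in \<open>auto simp: W21_def\<close>)
    moreover have "AE s in lebesgue_on {0..S}. g differentiable (at s)"
      using g S by (auto simp: W21_def AE_restrict_space_iff elim!: eventually_mono)
    moreover have "square_integrable {0..S} (deriv g)"
      using g S unfolding W21_def square_integrable_def
      by (auto intro: set_integrable_subset[of lebesgue "{0..T}"] set_borel_measurable_subset[of lebesgue "{0..T}"])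
    ultimately show ?thesis by (simp add: W21_def)
  qed
  have "energy S (minimizer S w) w \<le> energy S g w" by (rule energy_minimizer_restrict(3)[OF S(1) w w2S gS])
  also have "\<dots> \<le> energy T g w"
    unfolding energy_def set_lebesgue_integral_def
  proof (rule integral_mono)
    have si: "set_integrable lebesgue {0..T} (\<lambda>s. (g s - w s)\<^sup>2 + (deriv g s)\<^sup>2)"
      using W21_energy_integrable[OF g w w2] by (subst (asm) integrable_restrict_space) (auto simp: set_integrable_def)
    then show "integrable lebesgue (\<lambda>s. indicator {0..T} s *\<^sub>R ((g s - w s)\<^sup>2 + (deriv g s)\<^sup>2))" by (simp add: set_integrable_def)
    have "set_integrable lebesgue {0..S} (\<lambda>s. (g s - w s)\<^sup>2 + (deriv g s)\<^sup>2)" by (rule set_integrable_subset[OF si]) (use S in auto)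
    then show "integrable lebesgue (\<lambda>s. indicator {0..S} s *\<^sub>R ((g s - w s)\<^sup>2 + (deriv g s)\<^sup>2))" by (simp add: set_integrable_def)
  qed (use S in \<open>auto split: split_indicator\<close>)
  finally show "energy S (minimizer S w) w \<le> energy T (minimizer T w) w" by (simp add: g_def)
  show "0 \<le> energy S (minimizer S w) w" unfolding energy_alt by (intro integral_nonneg_AE) auto
qed

subsection \<open>Characteristic functions and Gaussian limits\<close>

text \<open>The weighted law of \<open>V\<close> is a signed measure. Since |U| \<le> 1 the density
  2 + U is positive; after division by \<open>c\<close> it defines a probability measure, to which
  Levy's uniqueness theorem applies. Subtracting twice the plain law of \<open>V\<close> isolates
  the weight.\<close>

lemma (in prob_space) law_with_weight_unique:
  fixes U U' V V' :: "'a \<Rightarrow> real"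
  assumes [measurable]: "U \<in> borel_measurable M" "U' \<in> borel_measurable M" "V \<in> borel_measurable M" "V' \<in> borel_measurable M"
    and U: "\<And>\<omega>. \<bar>U \<omega>\<bar> \<le> 1" "\<And>\<omega>. \<bar>U' \<omega>\<bar> \<le> 1"
    and eq: "\<And>\<theta>. (\<integral>\<omega>. U \<omega> *\<^sub>R iexp (\<theta> * V \<omega>) \<partial>M) = (\<integral>\<omega>. U' \<omega> *\<^sub>R iexp (\<theta> * V' \<omega>) \<partial>M)"
    and eq1: "\<And>\<theta>. (\<integral>\<omega>. iexp (\<theta> * V \<omega>) \<partial>M) = (\<integral>\<omega>. iexp (\<theta> * V' \<omega>) \<partial>M)"
    and A[measurable]: "A \<in> sets borel"
  shows "(\<integral>\<omega>. U \<omega> * indicator A (V \<omega>) \<partial>M) = (\<integral>\<omega>. U' \<omega> * indicator A (V' \<omega>) \<partial>M)"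
proof -
  have iU: "integrable M U" "integrable M U'"
    using U by (auto intro!: integrable_const_bound[where B=1])
  have ie: "integrable M (\<lambda>\<omega>. u \<omega> *\<^sub>R iexp (\<theta> * v \<omega>))" if [measurable]: "u \<in> borel_measurable M" "v \<in> borel_measurable M" and "\<And>\<omega>. \<bar>u \<omega>\<bar> \<le> 1" for u v :: "'a \<Rightarrow> real" and \<theta>
    using that(3) by (intro integrable_const_bound[where B=1]) auto
  define c where "c = (\<integral>\<omega>. 2 + U \<omega> \<partial>M)"
  \<comment> \<open>Frequency 0 shows that both weights have the same normalization.\<close>
  have c': "c = (\<integral>\<omega>. 2 + U' \<omega> \<partial>M)"
  proof -
    have "(\<integral>\<omega>. u \<omega> *\<^sub>R iexp (0 * v \<omega>) \<partial>M) = complex_of_real (\<integral>\<omega>. u \<omega> \<partial>M)" for u v :: "'a \<Rightarrow> real"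
      by (simp add: scaleR_conv_of_real)
    then have "(\<integral>\<omega>. U \<omega> \<partial>M) = (\<integral>\<omega>. U' \<omega> \<partial>M)" using eq[of 0] by (metis of_real_eq_iff)
    then show ?thesis using iU by (simp add: c_def)
  qed
  have "(\<integral>\<omega>. 1 \<partial>M) \<le> c" unfolding c_def
    using iU U(1) by (intro integral_mono) (auto, smt (verit))
  then have c: "c \<ge> 1" by (simp add: prob_space)
  define D where "D u v = distr (density M (\<lambda>\<omega>. ennreal ((2 + u \<omega>) / c))) borel v" for u v :: "'a \<Rightarrow> real"
  have D: "real_distribution (D u v)" 
    "measure (D u v) A = (2 * measure M (v -` A \<inter> space M) + (\<integral>\<omega>. u \<omega> * indicator A (v \<omega>) \<partial>M)) / c"
    "char (D u v) \<theta> = (2 * (\<integral>\<omega>. iexp (\<theta> * v \<omega>) \<partial>M) + (\<integral>\<omega>. u \<omega> *\<^sub>R iexp (\<theta> * v \<omega>) \<partial>M)) / c"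
    if [measurable]: "u \<in> borel_measurable M" "v \<in> borel_measurable M" and u: "\<And>\<omega>. \<bar>u \<omega>\<bar> \<le> 1" and cu: "c = (\<integral>\<omega>. 2 + u \<omega> \<partial>M)" for u v \<theta>
  proof -
    have nn: "0 \<le> (2 + u \<omega>) / c" for \<omega> using u[of \<omega>] c by (auto simp: abs_le_iff)
    have iu: "integrable M u" using u by (auto intro!: integrable_const_bound[where B=1])
    have "emeasure (density M (\<lambda>\<omega>. ennreal ((2 + u \<omega>) / c))) (space M) = (\<integral>\<^sup>+\<omega>. ennreal ((2 + u \<omega>) / c) \<partial>M)"
      by (subst emeasure_density) (auto intro!: nn_integral_cong)
    also have "\<dots> = ennreal (\<integral>\<omega>. (2 + u \<omega>) / c \<partial>M)"
      using nn iu by (intro nn_integral_eq_integral) auto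
    also have "(\<integral>\<omega>. (2 + u \<omega>) / c \<partial>M) = 1" using c cu by simp
    finally interpret d: prob_space "density M (\<lambda>\<omega>. ennreal ((2 + u \<omega>) / c))"
      by (intro prob_spaceI) (auto)
    show "real_distribution (D u v)" unfolding D_def by (rule d.real_distribution_distr) simp
    show "measure (D u v) A = (2 * measure M (v -` A \<inter> space M) + (\<integral>\<omega>. u \<omega> * indicator A (v \<omega>) \<partial>M)) / c"
    proof -
      have "measure (D u v) A = (\<integral>x. indicator A x \<partial>D u v)" by (simp add: D_def)
      also have "\<dots> = (\<integral>\<omega>. indicator A (v \<omega>) \<partial>density M (\<lambda>\<omega>. ennreal ((2 + u \<omega>) / c)))"
        unfolding D_def by (subst integral_distr) auto
      also have "\<dots> = (\<integral>\<omega>. ((2 + u \<omega>) / c) *\<^sub>R indicator A (v \<omega>) \<partial>M)"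
        using nn by (subst integral_density) auto
      also have "\<dots> = (\<integral>\<omega>. (2 * indicator (v -` A \<inter> space M) \<omega> + u \<omega> * indicator A (v \<omega>)) / c \<partial>M)"
        by (intro Bochner_Integration.integral_cong) (auto split: split_indicator)
      also have "\<dots> = (\<integral>\<omega>. 2 * indicator (v -` A \<inter> space M) \<omega> + u \<omega> * indicator A (v \<omega>) \<partial>M) / c" by simp
      also have "(\<integral>\<omega>. 2 * indicator (v -` A \<inter> space M) \<omega> + u \<omega> * indicator A (v \<omega>) \<partial>M) =
           2 * measure M (v -` A \<inter> space M) + (\<integral>\<omega>. u \<omega> * indicator A (v \<omega>) \<partial>M)"
      proof (subst Bochner_Integration.integral_add)
        show "integrable M (\<lambda>\<omega>. u \<omega> * indicator A (v \<omega>))"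
          using u by (intro integrable_const_bound[where B=1]) (auto split: split_indicator)
        show "integrable M (\<lambda>\<omega>. 2 * indicator (v -` A \<inter> space M) \<omega> :: real)"
          by (intro integrable_const_bound[where B=2]) (auto split: split_indicator)
      qed auto
      finally show ?thesis .
    qed
    have "char (D u v) \<theta> = (\<integral>\<omega>. iexp (\<theta> * v \<omega>) \<partial>density M (\<lambda>\<omega>. ennreal ((2 + u \<omega>) / c)))"
      unfolding D_def char_def by (subst integral_distr) auto
    also have "\<dots> = (\<integral>\<omega>. ((2 + u \<omega>) / c) *\<^sub>R iexp (\<theta> * v \<omega>) \<partial>M)"
      using nn by (subst integral_density) auto
    also have "\<dots> = (\<integral>\<omega>. (2 * iexp (\<theta> * v \<omega>) + u \<omega> *\<^sub>R iexp (\<theta> * v \<omega>)) / c \<partial>M)"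
      by (intro Bochner_Integration.integral_cong) (auto simp: scaleR_conv_of_real algebra_simps add_divide_distrib)
    also have "\<dots> = (2 * (\<integral>\<omega>. iexp (\<theta> * v \<omega>) \<partial>M) + (\<integral>\<omega>. u \<omega> *\<^sub>R iexp (\<theta> * v \<omega>) \<partial>M)) / c"
      using ie[of u v \<theta>] ie[of "\<lambda>_. 1" v \<theta>] u by simp
    finally show "char (D u v) \<theta> = (2 * (\<integral>\<omega>. iexp (\<theta> * v \<omega>) \<partial>M) + (\<integral>\<omega>. u \<omega> *\<^sub>R iexp (\<theta> * v \<omega>) \<partial>M)) / c" .
  qed
  have dV: "distr M borel V = distr M borel V'"
  proof (rule Levy_uniqueness)
    show "char (distr M borel V) = char (distr M borel V')"
      using eq1 by (auto simp: char_def integral_distr)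
  qed auto
  have "D U V = D U' V'"
    using D U c' c_def eq eq1 by (intro Levy_uniqueness ext) auto
  moreover have "measure M (V -` A \<inter> space M) = measure M (V' -` A \<inter> space M)"
    using arg_cong[OF dV, of "\<lambda>N. measure N A"] by (simp add: measure_distr)
  ultimately show ?thesis
    using D(2)[of U V] D(2)[of U' V'] U c c' c_def by simp
qed

text \<open>Splits the weight into real and imaginary part. The transform of each is a combination
  of the given transform at \<open>\<theta>\<close> and the conjugate of the one at
  \<open>- \<theta>\<close>, and both agree by assumption.\<close>

lemma (in prob_space) law_with_complex_weight_unique:
  fixes G G' :: "'a \<Rightarrow> complex" and V V' :: "'a \<Rightarrow> real"
  assumes m[measurable]: "G \<in> borel_measurable M" "G' \<in> borel_measurable M" "V \<in> borel_measurable M" "V' \<in> borel_measurable M"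
    and G: "\<And>\<omega>. cmod (G \<omega>) \<le> 1" "\<And>\<omega>. cmod (G' \<omega>) \<le> 1"
    and eq: "\<And>\<theta>. (\<integral>\<omega>. G \<omega> * iexp (\<theta> * V \<omega>) \<partial>M) = (\<integral>\<omega>. G' \<omega> * iexp (\<theta> * V' \<omega>) \<partial>M)"
    and eq1: "\<And>\<theta>. (\<integral>\<omega>. iexp (\<theta> * V \<omega>) \<partial>M) = (\<integral>\<omega>. iexp (\<theta> * V' \<omega>) \<partial>M)"
    and A[measurable]: "A \<in> sets borel"
  shows "(\<integral>\<omega>. G \<omega> * indicator A (V \<omega>) \<partial>M) = (\<integral>\<omega>. G' \<omega> * indicator A (V' \<omega>) \<partial>M)"
proof -
  have i: "integrable M (\<lambda>\<omega>. g \<omega> * iexp (\<theta> * v \<omega>))" if [measurable]: "g \<in> borel_measurable M" "v \<in> borel_measurable M" and "\<And>\<omega>. cmod (g \<omega>) \<le> 1" for g v \<theta>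
    using that(3) by (intro integrable_const_bound[where B=1]) (auto simp: norm_mult)
  have re: "(\<integral>\<omega>. Re (g \<omega>) *\<^sub>R iexp (\<theta> * v \<omega>) \<partial>M) = ((\<integral>\<omega>. g \<omega> * iexp (\<theta> * v \<omega>) \<partial>M) + cnj (\<integral>\<omega>. g \<omega> * iexp (- \<theta> * v \<omega>) \<partial>M)) / 2"
    and im: "(\<integral>\<omega>. Im (g \<omega>) *\<^sub>R iexp (\<theta> * v \<omega>) \<partial>M) = ((\<integral>\<omega>. g \<omega> * iexp (\<theta> * v \<omega>) \<partial>M) - cnj (\<integral>\<omega>. g \<omega> * iexp (- \<theta> * v \<omega>) \<partial>M)) / (2 * \<i>)"
    if [measurable]: "g \<in> borel_measurable M" "v \<in> borel_measurable M" and g: "\<And>\<omega>. cmod (g \<omega>) \<le> 1" for g v \<theta>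
  proof -
    have *: "cnj (iexp (- \<theta> * x)) = iexp (\<theta> * x)" for x by (simp add: exp_cnj)
    have ii: "integrable M (\<lambda>\<omega>. g \<omega> * iexp (\<theta> * v \<omega>))" "integrable M (\<lambda>\<omega>. cnj (g \<omega> * iexp (- \<theta> * v \<omega>)))"
      using i[of g v \<theta>] i[of g v "- \<theta>"] g by (simp_all del: complex_cnj_mult mult_minus_left of_real_minus)
    have "(\<integral>\<omega>. Re (g \<omega>) *\<^sub>R iexp (\<theta> * v \<omega>) \<partial>M) = (\<integral>\<omega>. (g \<omega> * iexp (\<theta> * v \<omega>) + cnj (g \<omega> * iexp (- \<theta> * v \<omega>))) / 2 \<partial>M)"
      unfolding complex_cnj_mult *
      by (simp add: scaleR_conv_of_real distrib_right[symmetric] complex_add_cnj)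
    also have "\<dots> = ((\<integral>\<omega>. g \<omega> * iexp (\<theta> * v \<omega>) \<partial>M) + (\<integral>\<omega>. cnj (g \<omega> * iexp (- \<theta> * v \<omega>)) \<partial>M)) / 2"
      using ii by (simp del: complex_cnj_mult)
    finally show "(\<integral>\<omega>. Re (g \<omega>) *\<^sub>R iexp (\<theta> * v \<omega>) \<partial>M) = ((\<integral>\<omega>. g \<omega> * iexp (\<theta> * v \<omega>) \<partial>M) + cnj (\<integral>\<omega>. g \<omega> * iexp (- \<theta> * v \<omega>) \<partial>M)) / 2"
      by (simp only: Bochner_Integration.integral_cnj[of M "\<lambda>\<omega>. g \<omega> * iexp (- \<theta> * v \<omega>)"])
    have "(\<integral>\<omega>. Im (g \<omega>) *\<^sub>R iexp (\<theta> * v \<omega>) \<partial>M) = (\<integral>\<omega>. (g \<omega> * iexp (\<theta> * v \<omega>) - cnj (g \<omega> * iexp (- \<theta> * v \<omega>))) / (2 * \<i>) \<partial>M)"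
    proof -
      have A: "Im z *\<^sub>R e = (z * e - cnj z * e) / (2 * \<i>)" for z e
      proof -
        have "z * e - cnj z * e = complex_of_real (2 * Im z) * \<i> * e"
          by (simp only: left_diff_distrib[symmetric] complex_diff_cnj)
        then show ?thesis unfolding scaleR_conv_of_real by (subst nonzero_eq_divide_eq) (simp_all add: mult_ac)
      qed
      show ?thesis unfolding complex_cnj_mult * by (simp only: A)
    qed
    also have "\<dots> = ((\<integral>\<omega>. g \<omega> * iexp (\<theta> * v \<omega>) \<partial>M) - (\<integral>\<omega>. cnj (g \<omega> * iexp (- \<theta> * v \<omega>)) \<partial>M)) / (2 * \<i>)"
      using ii by (simp del: complex_cnj_mult)
    finally show "(\<integral>\<omega>. Im (g \<omega>) *\<^sub>R iexp (\<theta> * v \<omega>) \<partial>M) = ((\<integral>\<omega>. g \<omega> * iexp (\<theta> * v \<omega>) \<partial>M) - cnj (\<integral>\<omega>. g \<omega> * iexp (- \<theta> * v \<omega>) \<partial>M)) / (2 * \<i>)"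
      by (simp only: Bochner_Integration.integral_cnj[of M "\<lambda>\<omega>. g \<omega> * iexp (- \<theta> * v \<omega>)"])
  qed
  have R: "(\<integral>\<omega>. Re (G \<omega>) * indicator A (V \<omega>) \<partial>M) = (\<integral>\<omega>. Re (G' \<omega>) * indicator A (V' \<omega>) \<partial>M)"
  proof (rule law_with_weight_unique)
    show "(\<integral>\<omega>. Re (G \<omega>) *\<^sub>R iexp (\<theta> * V \<omega>) \<partial>M) = (\<integral>\<omega>. Re (G' \<omega>) *\<^sub>R iexp (\<theta> * V' \<omega>) \<partial>M)" for \<theta>
      by (simp only: re[OF m(1,3) G(1)] re[OF m(2,4) G(2)] eq)
  qed (use G eq1 in \<open>auto intro: order_trans[OF abs_Re_le_cmod]\<close>)
  have I: "(\<integral>\<omega>. Im (G \<omega>) * indicator A (V \<omega>) \<partial>M) = (\<integral>\<omega>. Im (G' \<omega>) * indicator A (V' \<omega>) \<partial>M)"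
  proof (rule law_with_weight_unique)
    show "(\<integral>\<omega>. Im (G \<omega>) *\<^sub>R iexp (\<theta> * V \<omega>) \<partial>M) = (\<integral>\<omega>. Im (G' \<omega>) *\<^sub>R iexp (\<theta> * V' \<omega>) \<partial>M)" for \<theta>
      by (simp only: im[OF m(1,3) G(1)] im[OF m(2,4) G(2)] eq)
  qed (use G eq1 in \<open>auto intro: order_trans[OF abs_Im_le_cmod]\<close>)
  have ig: "integrable M (\<lambda>\<omega>. G \<omega> * indicator A (V \<omega>))" "integrable M (\<lambda>\<omega>. G' \<omega> * indicator A (V' \<omega>))"
    using G by (auto intro!: integrable_const_bound[where B=1] simp: norm_mult split: split_indicator)
  have "Re (x * indicator A y) = Re x * indicator A y" "Im (x * indicator A y) = Im x * indicator A y" for x :: complex and y :: real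
    by (auto split: split_indicator)
  then show ?thesis using R I ig by (intro complex_eqI) (simp_all add: integral_Re[symmetric] integral_Im[symmetric])
qed

text \<open>Coordinates are converted one at a time: in \<open>claim\<close> those in
  \<open>K\<close> are tested by indicators, the remaining ones by exponentials. The induction step
  treats the bounded factor of the other coordinates as a complex weight on the law of coordinate k.
  At K = I only indicators of boxes are left, and these determine the joint law.\<close>

lemma (in prob_space) Cramer_Wold:
  fixes Y Y' :: "'i \<Rightarrow> 'a \<Rightarrow> real"
  assumes I: "finite I" and m[measurable]: "\<And>i. i \<in> I \<Longrightarrow> Y i \<in> borel_measurable M" "\<And>i. i \<in> I \<Longrightarrow> Y' i \<in> borel_measurable M"
    and eq: "\<And>a. (\<integral>\<omega>. iexp (\<Sum>i\<in>I. a i * Y i \<omega>) \<partial>M) = (\<integral>\<omega>. iexp (\<Sum>i\<in>I. a i * Y' i \<omega>) \<partial>M)"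
  shows "distr M (PiM I (\<lambda>_. borel)) (\<lambda>\<omega>. \<lambda>i\<in>I. Y i \<omega>) = distr M (PiM I (\<lambda>_. borel)) (\<lambda>\<omega>. \<lambda>i\<in>I. Y' i \<omega>)"
proof (rule measure_eqI_PiM_finite[OF I])
  show "sets (distr M (PiM I (\<lambda>_. borel)) (\<lambda>\<omega>. \<lambda>i\<in>I. Y i \<omega>)) = sets (PiM I (\<lambda>_. borel))"
    "sets (distr M (PiM I (\<lambda>_. borel)) (\<lambda>\<omega>. \<lambda>i\<in>I. Y' i \<omega>)) = sets (PiM I (\<lambda>_. borel))" by auto
  have mm: "(\<lambda>\<omega>. \<lambda>i\<in>I. Y i \<omega>) \<in> measurable M (PiM I (\<lambda>_. borel))" "(\<lambda>\<omega>. \<lambda>i\<in>I. Y' i \<omega>) \<in> measurable M (PiM I (\<lambda>_. borel))"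
    by (auto intro!: measurable_restrict m)
  show "range (\<lambda>_. PiE I (\<lambda>_. UNIV)) \<subseteq> prod_algebra I (\<lambda>_. borel)"
    by (auto intro!: prod_algebraI_finite I)
  show "(\<Union>i::nat. PiE I (\<lambda>_. UNIV)) = space (PiM I (\<lambda>_. borel))" by (simp add: space_PiM)
  show "emeasure (distr M (PiM I (\<lambda>_. borel)) (\<lambda>\<omega>. \<lambda>i\<in>I. Y i \<omega>)) (PiE I (\<lambda>_. UNIV)) \<noteq> \<infinity>" for i :: nat
    using mm by (subst emeasure_distr) (auto intro!: sets_PiM_I_finite I)
  fix A :: "'i \<Rightarrow> real set" assume A: "\<And>i. i \<in> I \<Longrightarrow> A i \<in> sets borel"
  note [measurable] = A
  have claim: "K \<subseteq> I \<Longrightarrow> \<forall>a. (\<integral>\<omega>. (\<Prod>i\<in>K. indicator (A i) (Y i \<omega>)) * iexp (\<Sum>i\<in>I - K. a i * Y i \<omega>) \<partial>M)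
      = (\<integral>\<omega>. (\<Prod>i\<in>K. indicator (A i) (Y' i \<omega>)) * iexp (\<Sum>i\<in>I - K. a i * Y' i \<omega>) \<partial>M)" if "finite K" for K
    using that
  proof (induction K)
    case empty
    then show ?case using eq by simp
  next
    case (insert k K)
    then have k: "k \<in> I" "K \<subseteq> I" "k \<in> I - K" "finite (I - K)" "(I - K) - {k} = I - insert k K" using I by auto
    \<comment> \<open>The free frequency \<open>\<theta>\<close> of coordinate k becomes its
      coefficient, so the induction hypothesis for the updated \<open>a\<close> applies.\<close>
    have ms: "(\<Prod>i\<in>K. indicator (A i) (z i \<omega>) :: complex) * iexp (\<Sum>i\<in>I - insert k K. a i * z i \<omega>) * iexp (\<theta> * z k \<omega>) =
        (\<Prod>i\<in>K. indicator (A i) (z i \<omega>)) * iexp (\<Sum>i\<in>I - K. (a(k := \<theta>)) i * z i \<omega>)" for z :: "'i \<Rightarrow> 'a \<Rightarrow> real" and \<omega> \<theta> a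
    proof -
      have "(\<Sum>i\<in>I - K. (a(k := \<theta>)) i * z i \<omega>) = \<theta> * z k \<omega> + (\<Sum>i\<in>I - insert k K. (a(k := \<theta>)) i * z i \<omega>)"
        using sum.remove[OF k(4,3), of "\<lambda>i. (a(k := \<theta>)) i * z i \<omega>"] k(5) by simp
      also have "(\<Sum>i\<in>I - insert k K. (a(k := \<theta>)) i * z i \<omega>) = (\<Sum>i\<in>I - insert k K. a i * z i \<omega>)"
        by (intro sum.cong) auto
      finally show ?thesis by (simp add: exp_add distrib_left mult.assoc mult.commute)
    qed
    show ?case
    proof
      fix a :: "'i \<Rightarrow> real"
      have sK: "\<And>i. i \<in> K \<Longrightarrow> i \<in> I" using k by auto
      have n1: "cmod (\<Prod>i\<in>K. indicator (A i) (z i)) \<le> 1" for z :: "'i \<Rightarrow> real"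
        unfolding prod_norm[symmetric] by (intro prod_le_1) (auto split: split_indicator)
      have "(\<integral>\<omega>. ((\<Prod>i\<in>K. indicator (A i) (Y i \<omega>)) * iexp (\<Sum>i\<in>I - insert k K. a i * Y i \<omega>)) * indicator (A k) (Y k \<omega>) \<partial>M)
          = (\<integral>\<omega>. ((\<Prod>i\<in>K. indicator (A i) (Y' i \<omega>)) * iexp (\<Sum>i\<in>I - insert k K. a i * Y' i \<omega>)) * indicator (A k) (Y' k \<omega>) \<partial>M)"
      proof (rule law_with_complex_weight_unique)
        show "(\<lambda>\<omega>. (\<Prod>i\<in>K. indicator (A i) (Y i \<omega>)) * iexp (\<Sum>i\<in>I - insert k K. a i * Y i \<omega>)) \<in> borel_measurable M"
          "(\<lambda>\<omega>. (\<Prod>i\<in>K. indicator (A i) (Y' i \<omega>)) * iexp (\<Sum>i\<in>I - insert k K. a i * Y' i \<omega>)) \<in> borel_measurable M"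
          using sK by (auto intro!: borel_measurable_times borel_measurable_prod borel_measurable_sum measurable_compose[OF _ borel_measurable_indicator]
              measurable_compose[OF _ borel_measurable_exp] borel_measurable_of_real m A)
        show "(\<integral>\<omega>. iexp (\<theta> * Y k \<omega>) \<partial>M) = (\<integral>\<omega>. iexp (\<theta> * Y' k \<omega>) \<partial>M)" for \<theta>
        proof -
          have "(\<Sum>i\<in>I. (if i = k then \<theta> else 0) * z i) = \<theta> * z k" for z :: "'i \<Rightarrow> real"
          proof -
            have "(\<Sum>i\<in>I. (if i = k then \<theta> else 0) * z i) = (\<Sum>i\<in>I. if k = i then \<theta> * z i else 0)" by (intro sum.cong) auto
            then show ?thesis using I k by simp
          qed
          then show ?thesis using eq[of "\<lambda>i. if i = k then \<theta> else 0"] by simp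
        qed
        show "(\<integral>\<omega>. (\<Prod>i\<in>K. indicator (A i) (Y i \<omega>)) * iexp (\<Sum>i\<in>I - insert k K. a i * Y i \<omega>) * iexp (\<theta> * Y k \<omega>) \<partial>M)
          = (\<integral>\<omega>. (\<Prod>i\<in>K. indicator (A i) (Y' i \<omega>)) * iexp (\<Sum>i\<in>I - insert k K. a i * Y' i \<omega>) * iexp (\<theta> * Y' k \<omega>) \<partial>M)" for \<theta>
          unfolding ms using insert.IH k by blast
      qed (use k n1 in \<open>auto simp: norm_mult\<close>)
      then show "(\<integral>\<omega>. (\<Prod>i\<in>insert k K. indicator (A i) (Y i \<omega>)) * iexp (\<Sum>i\<in>I - insert k K. a i * Y i \<omega>) \<partial>M)
        = (\<integral>\<omega>. (\<Prod>i\<in>insert k K. indicator (A i) (Y' i \<omega>)) * iexp (\<Sum>i\<in>I - insert k K. a i * Y' i \<omega>) \<partial>M)"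
        using insert.hyps by (simp add: mult_ac)
    qed
  qed
  have E: "emeasure (distr M (PiM I (\<lambda>_. borel)) (\<lambda>\<omega>. \<lambda>i\<in>I. z i \<omega>)) (PiE I A) = ennreal (Re (\<integral>\<omega>. (\<Prod>i\<in>I. indicator (A i) (z i \<omega>)) \<partial>M))"
    if z[measurable]: "\<And>i. i \<in> I \<Longrightarrow> z i \<in> borel_measurable M" for z
  proof -
    have zm: "(\<lambda>\<omega>. \<lambda>i\<in>I. z i \<omega>) \<in> measurable M (PiM I (\<lambda>_. borel))" by (auto intro!: measurable_restrict z)
    have S: "PiE I A \<in> sets (PiM I (\<lambda>_. borel))" by (auto intro!: sets_PiM_I_finite I A)
    define S' where "S' = (\<lambda>\<omega>. \<lambda>i\<in>I. z i \<omega>) -` PiE I A \<inter> space M"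
    have S': "S' \<in> sets M" unfolding S'_def using zm S by (rule measurable_sets)
    have "(\<Prod>i\<in>I. indicator (A i) (z i \<omega>) :: complex) = complex_of_real (indicator S' \<omega>)" if "\<omega> \<in> space M" for \<omega>
      using that I by (auto simp: S'_def PiE_iff indicator_def)
    then have "(\<integral>\<omega>. (\<Prod>i\<in>I. indicator (A i) (z i \<omega>)) \<partial>M) = (\<integral>\<omega>. complex_of_real (indicator S' \<omega>) \<partial>M)"
      by (intro Bochner_Integration.integral_cong) auto
    also have "\<dots> = complex_of_real (measure M S')" 
      using S' by (subst integral_of_real) (auto intro!: integrable_const_bound[where B=1] split: split_indicator)
    finally show ?thesis using zm S by (simp add: emeasure_distr S'_def emeasure_eq_measure)
  qed
  show "emeasure (distr M (PiM I (\<lambda>_. borel)) (\<lambda>\<omega>. \<lambda>i\<in>I. Y i \<omega>)) (PiE I A) = emeasure (distr M (PiM I (\<lambda>_. borel)) (\<lambda>\<omega>. \<lambda>i\<in>I. Y' i \<omega>)) (PiE I A)"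
    using claim[OF I] by (simp add: E[OF m(1)] E[OF m(2)])
qed

section \<open>Cauchy-Schwarz and mean-square limits\<close>

lemma Cauchy_Schwarz_integral:
  fixes f g :: "'a \<Rightarrow> real"
  assumes [measurable]: "f \<in> borel_measurable M" "g \<in> borel_measurable M"
    and f2: "integrable M (\<lambda>x. (f x)\<^sup>2)" and g2: "integrable M (\<lambda>x. (g x)\<^sup>2)"
  shows "(\<integral>x. \<bar>f x * g x\<bar> \<partial>M) \<le> sqrt (\<integral>x. (f x)\<^sup>2 \<partial>M) * sqrt (\<integral>x. (g x)\<^sup>2 \<partial>M)"
    "\<bar>\<integral>x. f x * g x \<partial>M\<bar> \<le> sqrt (\<integral>x. (f x)\<^sup>2 \<partial>M) * sqrt (\<integral>x. (g x)\<^sup>2 \<partial>M)"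
proof -
  have fg: "integrable M (\<lambda>x. f x * g x)" by (intro integrable_mult_of_squares f2 g2) auto
  have "ennreal ((\<integral>x. \<bar>f x * g x\<bar> \<partial>M)\<^sup>2) = (\<integral>\<^sup>+x. ennreal \<bar>f x\<bar> * ennreal \<bar>g x\<bar> \<partial>M)\<^sup>2"
  proof -
    have "(\<integral>\<^sup>+x. ennreal \<bar>f x * g x\<bar> \<partial>M) = ennreal (\<integral>x. \<bar>f x * g x\<bar> \<partial>M)"
      using fg by (intro nn_integral_eq_integral) auto
    then show ?thesis by (simp add: ennreal_power[symmetric] abs_mult ennreal_mult[symmetric])
  qed
  also have "\<dots> \<le> (\<integral>\<^sup>+x. (ennreal \<bar>f x\<bar>)\<^sup>2 \<partial>M) * (\<integral>\<^sup>+x. (ennreal \<bar>g x\<bar>)\<^sup>2 \<partial>M)"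
    by (rule Cauchy_Schwarz_nn_integral) auto
  also have "\<dots> = ennreal ((\<integral>x. (f x)\<^sup>2 \<partial>M) * (\<integral>x. (g x)\<^sup>2 \<partial>M))"
    using f2 g2 by (simp add: ennreal_power nn_integral_eq_integral ennreal_mult)
  finally have "(\<integral>x. \<bar>f x * g x\<bar> \<partial>M)\<^sup>2 \<le> (\<integral>x. (f x)\<^sup>2 \<partial>M) * (\<integral>x. (g x)\<^sup>2 \<partial>M)"
    by (subst (asm) ennreal_le_iff) auto
  then show *: "(\<integral>x. \<bar>f x * g x\<bar> \<partial>M) \<le> sqrt (\<integral>x. (f x)\<^sup>2 \<partial>M) * sqrt (\<integral>x. (g x)\<^sup>2 \<partial>M)"
    unfolding real_sqrt_mult[symmetric] by (rule real_le_rsqrt)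
  have "\<bar>\<integral>x. f x * g x \<partial>M\<bar> \<le> (\<integral>x. \<bar>f x * g x\<bar> \<partial>M)" by (rule integral_abs_bound)
  then show "\<bar>\<integral>x. f x * g x \<partial>M\<bar> \<le> sqrt (\<integral>x. (f x)\<^sup>2 \<partial>M) * sqrt (\<integral>x. (g x)\<^sup>2 \<partial>M)" using * by linarith
qed

lemma (in prob_space) abs_expectation_le_L2:
  fixes f :: "'a \<Rightarrow> real"
  assumes "f \<in> borel_measurable M" "integrable M (\<lambda>x. (f x)\<^sup>2)"
  shows "(\<integral>x. \<bar>f x\<bar> \<partial>M) \<le> sqrt (\<integral>x. (f x)\<^sup>2 \<partial>M)"
  using Cauchy_Schwarz_integral(1)[of f M "\<lambda>_. 1"] assms by (simp add: prob_space)

lemma square_integrable_of_nn_integral: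
  fixes Y Z :: "'a \<Rightarrow> real"
  assumes [measurable]: "Y \<in> borel_measurable M" "Z \<in> borel_measurable M"
    and Z: "integrable M (\<lambda>\<omega>. (Z \<omega>)\<^sup>2)" and fin: "(\<integral>\<^sup>+\<omega>. ennreal ((Z \<omega> - Y \<omega>)\<^sup>2) \<partial>M) < \<infinity>"
  shows "integrable M (\<lambda>\<omega>. (Z \<omega> - Y \<omega>)\<^sup>2)" "integrable M (\<lambda>\<omega>. (Y \<omega>)\<^sup>2)"
proof -
  show i: "integrable M (\<lambda>\<omega>. (Z \<omega> - Y \<omega>)\<^sup>2)"
    using fin by (intro integrableI_nonneg) auto
  show "integrable M (\<lambda>\<omega>. (Y \<omega>)\<^sup>2)"
    using integrable_square_diff[of Z M "\<lambda>\<omega>. Z \<omega> - Y \<omega>"] Z i by simp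
qed

text \<open>Convergence is stated with nonnegative integrals because this form does not presuppose a
  square integrable limit; that is the first consequence.\<close>

lemma L2_tendsto:
  fixes Y :: "'a \<Rightarrow> real" and Yn :: "nat \<Rightarrow> 'a \<Rightarrow> real"
  assumes [measurable]: "\<And>n. Yn n \<in> borel_measurable M" "Y \<in> borel_measurable M"
    and Yn: "\<And>n. integrable M (\<lambda>\<omega>. (Yn n \<omega>)\<^sup>2)"
    and lim: "(\<lambda>n. \<integral>\<^sup>+\<omega>. ennreal ((Yn n \<omega> - Y \<omega>)\<^sup>2) \<partial>M) \<longlonglongrightarrow> 0"
  shows "integrable M (\<lambda>\<omega>. (Y \<omega>)\<^sup>2)"
    "\<forall>\<^sub>F n in sequentially. integrable M (\<lambda>\<omega>. (Yn n \<omega> - Y \<omega>)\<^sup>2)"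
    "(\<lambda>n. \<integral>\<omega>. (Yn n \<omega> - Y \<omega>)\<^sup>2 \<partial>M) \<longlonglongrightarrow> 0"
    "(\<lambda>n. \<integral>\<omega>. (Yn n \<omega>)\<^sup>2 \<partial>M) \<longlonglongrightarrow> (\<integral>\<omega>. (Y \<omega>)\<^sup>2 \<partial>M)"
proof -
  have ev: "\<forall>\<^sub>F n in sequentially. (\<integral>\<^sup>+\<omega>. ennreal ((Yn n \<omega> - Y \<omega>)\<^sup>2) \<partial>M) < 1"
    using order_tendstoD(2)[OF lim] by simp
  then obtain n0 where "(\<integral>\<^sup>+\<omega>. ennreal ((Yn n0 \<omega> - Y \<omega>)\<^sup>2) \<partial>M) < 1" by (auto simp: eventually_sequentially)
  then have fin: "(\<integral>\<^sup>+\<omega>. ennreal ((Yn n0 \<omega> - Y \<omega>)\<^sup>2) \<partial>M) < \<infinity>" by (rule order.strict_trans) simp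
  show Y2: "integrable M (\<lambda>\<omega>. (Y \<omega>)\<^sup>2)"
    by (rule square_integrable_of_nn_integral(2)[OF _ _ Yn fin]) auto
  have d: "integrable M (\<lambda>\<omega>. (Yn n \<omega> - Y \<omega>)\<^sup>2)" for n using Yn Y2 by (intro integrable_square_diff) auto
  then show "\<forall>\<^sub>F n in sequentially. integrable M (\<lambda>\<omega>. (Yn n \<omega> - Y \<omega>)\<^sup>2)" by simp
  have "(\<integral>\<^sup>+\<omega>. ennreal ((Yn n \<omega> - Y \<omega>)\<^sup>2) \<partial>M) = ennreal (\<integral>\<omega>. (Yn n \<omega> - Y \<omega>)\<^sup>2 \<partial>M)" for n
    by (intro nn_integral_eq_integral d) auto
  then show l0: "(\<lambda>n. \<integral>\<omega>. (Yn n \<omega> - Y \<omega>)\<^sup>2 \<partial>M) \<longlonglongrightarrow> 0"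
    using lim by (subst tendsto_ennreal_iff[symmetric]) auto
  define D where "D n = (\<integral>\<omega>. (Yn n \<omega> - Y \<omega>)\<^sup>2 \<partial>M)" for n
  define K where "K = sqrt (\<integral>\<omega>. (Y \<omega>)\<^sup>2 \<partial>M)"
  \<comment> \<open>Expansion around \<open>Y\<close>, with Cauchy-Schwarz for the mixed
    term.\<close>
  have b: "\<bar>(\<integral>\<omega>. (Yn n \<omega>)\<^sup>2 \<partial>M) - (\<integral>\<omega>. (Y \<omega>)\<^sup>2 \<partial>M)\<bar> \<le> D n + 2 * (sqrt (D n) * K)" for n
  proof -
    have c: "integrable M (\<lambda>\<omega>. (Yn n \<omega> - Y \<omega>) * Y \<omega>)" using d Y2 by (intro integrable_mult_of_squares) auto
    have "(\<integral>\<omega>. (Yn n \<omega>)\<^sup>2 \<partial>M) = (\<integral>\<omega>. (Yn n \<omega> - Y \<omega>)\<^sup>2 + 2 * ((Yn n \<omega> - Y \<omega>) * Y \<omega>) + (Y \<omega>)\<^sup>2 \<partial>M)"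
      by (intro Bochner_Integration.integral_cong) (auto simp: power2_eq_square algebra_simps)
    also have "\<dots> = D n + 2 * (\<integral>\<omega>. (Yn n \<omega> - Y \<omega>) * Y \<omega> \<partial>M) + (\<integral>\<omega>. (Y \<omega>)\<^sup>2 \<partial>M)"
      using d c Y2 by (simp add: D_def)
    finally have e: "(\<integral>\<omega>. (Yn n \<omega>)\<^sup>2 \<partial>M) - (\<integral>\<omega>. (Y \<omega>)\<^sup>2 \<partial>M) = D n + 2 * (\<integral>\<omega>. (Yn n \<omega> - Y \<omega>) * Y \<omega> \<partial>M)" by simp
    have "\<bar>\<integral>\<omega>. (Yn n \<omega> - Y \<omega>) * Y \<omega> \<partial>M\<bar> \<le> sqrt (D n) * K"
      unfolding D_def K_def by (rule Cauchy_Schwarz_integral(2)) (use d Y2 in auto)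
    moreover have "D n \<ge> 0" by (simp add: D_def)
    ultimately show ?thesis unfolding e by linarith
  qed
  have "(\<lambda>n. D n + 2 * (sqrt (D n) * K)) \<longlonglongrightarrow> 0 + 2 * (sqrt 0 * K)"
    using l0 unfolding D_def[symmetric] by (intro tendsto_intros)
  then have "(\<lambda>n. D n + 2 * (sqrt (D n) * K)) \<longlonglongrightarrow> 0" by simp
  then have "(\<lambda>n. (\<integral>\<omega>. (Yn n \<omega>)\<^sup>2 \<partial>M) - (\<integral>\<omega>. (Y \<omega>)\<^sup>2 \<partial>M)) \<longlonglongrightarrow> 0"
    by (rule Lim_null_comparison[rotated]) (use b in auto)
  then show "(\<lambda>n. \<integral>\<omega>. (Yn n \<omega>)\<^sup>2 \<partial>M) \<longlonglongrightarrow> (\<integral>\<omega>. (Y \<omega>)\<^sup>2 \<partial>M)" by (simp add: LIM_zero_iff)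
qed

lemma (in prob_space) L2_tendsto_L1:
  fixes Y :: "'a \<Rightarrow> real" and Yn :: "nat \<Rightarrow> 'a \<Rightarrow> real"
  assumes [measurable]: "\<And>n. Yn n \<in> borel_measurable M" "Y \<in> borel_measurable M"
    and Yn: "\<And>n. integrable M (\<lambda>\<omega>. (Yn n \<omega>)\<^sup>2)"
    and lim: "(\<lambda>n. \<integral>\<^sup>+\<omega>. ennreal ((Yn n \<omega> - Y \<omega>)\<^sup>2) \<partial>M) \<longlonglongrightarrow> 0"
  shows "(\<lambda>n. \<integral>\<omega>. \<bar>Yn n \<omega> - Y \<omega>\<bar> \<partial>M) \<longlonglongrightarrow> 0" "(\<lambda>n. \<integral>\<omega>. Yn n \<omega> \<partial>M) \<longlonglongrightarrow> (\<integral>\<omega>. Y \<omega> \<partial>M)"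
proof -
  note L = L2_tendsto[OF assms]
  have i: "integrable M (Yn n)" "integrable M Y" for n
    using Yn L(1) by (auto intro: square_integrable_imp_integrable)
  have d: "integrable M (\<lambda>\<omega>. (Yn n \<omega> - Y \<omega>)\<^sup>2)" for n using Yn L(1) by (intro integrable_square_diff) auto
  have "(\<lambda>n. sqrt (\<integral>\<omega>. (Yn n \<omega> - Y \<omega>)\<^sup>2 \<partial>M)) \<longlonglongrightarrow> sqrt 0" by (intro tendsto_intros L(3))
  then have "(\<lambda>n. sqrt (\<integral>\<omega>. (Yn n \<omega> - Y \<omega>)\<^sup>2 \<partial>M)) \<longlonglongrightarrow> 0" by simp
  then show l1: "(\<lambda>n. \<integral>\<omega>. \<bar>Yn n \<omega> - Y \<omega>\<bar> \<partial>M) \<longlonglongrightarrow> 0"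
    by (rule Lim_null_comparison[rotated]) (use abs_expectation_le_L2[OF _ d] in auto)
  have "(\<lambda>n. (\<integral>\<omega>. Yn n \<omega> \<partial>M) - (\<integral>\<omega>. Y \<omega> \<partial>M)) \<longlonglongrightarrow> 0"
  proof (rule Lim_null_comparison[OF _ l1])
    have "\<bar>(\<integral>\<omega>. Yn n \<omega> \<partial>M) - (\<integral>\<omega>. Y \<omega> \<partial>M)\<bar> \<le> (\<integral>\<omega>. \<bar>Yn n \<omega> - Y \<omega>\<bar> \<partial>M)" for n
      unfolding Bochner_Integration.integral_diff[OF i, symmetric] by (rule integral_abs_bound)
    then show "\<forall>\<^sub>F n in sequentially. norm ((\<integral>\<omega>. Yn n \<omega> \<partial>M) - (\<integral>\<omega>. Y \<omega> \<partial>M)) \<le> (\<integral>\<omega>. \<bar>Yn n \<omega> - Y \<omega>\<bar> \<partial>M)" by simp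
  qed
  then show "(\<lambda>n. \<integral>\<omega>. Yn n \<omega> \<partial>M) \<longlonglongrightarrow> (\<integral>\<omega>. Y \<omega> \<partial>M)" by (simp add: LIM_zero_iff)
qed

text \<open>Unlike \<^const>\<open>gaussian_rv\<close>, this formulation is visibly closed under mean-square limits.\<close>
definition gaussian_char :: "'a measure \<Rightarrow> ('a \<Rightarrow> real) \<Rightarrow> bool" where
  "gaussian_char M Y \<longleftrightarrow> Y \<in> borel_measurable M \<and> integrable M (\<lambda>\<omega>. (Y \<omega>)\<^sup>2) \<and>
     (\<forall>\<theta>. (\<integral>\<omega>. iexp (\<theta> * Y \<omega>) \<partial>M) = iexp (\<theta> * (\<integral>\<omega>. Y \<omega> \<partial>M)) *
        complex_of_real (exp (- (\<theta>\<^sup>2 * ((\<integral>\<omega>. (Y \<omega>)\<^sup>2 \<partial>M) - (\<integral>\<omega>. Y \<omega> \<partial>M)\<^sup>2)) / 2)))"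

text \<open>A constant is the case of variance 0, so one formula for the characteristic function
  covers both alternatives.\<close>

lemma (in prob_space) gaussian_rv_imp_gaussian_char:
  assumes "gaussian_rv M Y" shows "gaussian_char M Y"
proof -
  have m[measurable]: "Y \<in> borel_measurable M" using assms by (simp add: gaussian_rv_def)
  from assms consider (normal) m \<sigma> where "\<sigma> > 0" "distributed M lborel Y (\<lambda>x. ennreal (normal_density m \<sigma> x))"
    | (const) c where "AE \<omega> in M. Y \<omega> = c"
    by (auto simp: gaussian_rv_def)
  then show ?thesis
  proof cases
    case normal
    define Z where "Z \<omega> = (Y \<omega> - m) / \<sigma>" for \<omega>
    have [measurable]: "Z \<in> borel_measurable M" unfolding Z_def by measurable
    have "distributed M lborel Z std_normal_density"
      using normal normal_standard_normal_convert[of \<sigma> Y m] unfolding Z_def[abs_def] by simp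
    then have d: "distr M lborel Z = std_normal_distribution" by (rule distributed_distr_eq_density)
    have t: "(\<integral>\<omega>. g (Z \<omega>) \<partial>M) = (\<integral>x. g x \<partial>std_normal_distribution)" if "g \<in> borel_measurable borel" for g :: "real \<Rightarrow> complex"
      unfolding d[symmetric] by (rule integral_distr[symmetric]) (use that in auto)
    have t': "(\<integral>\<omega>. g (Z \<omega>) \<partial>M) = (\<integral>x. g x \<partial>std_normal_distribution)" 
      "integrable M (\<lambda>\<omega>. g (Z \<omega>)) = integrable std_normal_distribution g" if "g \<in> borel_measurable borel" for g :: "real \<Rightarrow> real"
      unfolding d[symmetric] by (rule integral_distr[symmetric] integrable_distr_eq[symmetric]; use that in simp)+
    have Z1: "(\<integral>\<omega>. Z \<omega> \<partial>M) = 0" "integrable M Z"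
      using t'[of "\<lambda>x. x"] integral_std_normal_distribution_moment_odd[of 1] integrable_std_normal_distribution_moment[of 1] by auto
    have Z2: "(\<integral>\<omega>. (Z \<omega>)\<^sup>2 \<partial>M) = 1" "integrable M (\<lambda>\<omega>. (Z \<omega>)\<^sup>2)"
      using t'[of "\<lambda>x. x\<^sup>2"] std_normal_distribution_even_moments[of 1] by auto
    have Y: "Y = (\<lambda>\<omega>. m + \<sigma> * Z \<omega>)" using normal(1) by (auto simp: Z_def)
    have Y1: "(\<integral>\<omega>. Y \<omega> \<partial>M) = m" unfolding Y using Z1 by (simp add: prob_space)
    have sq: "(m + \<sigma> * z)\<^sup>2 = m\<^sup>2 + (2 * m * \<sigma>) * z + \<sigma>\<^sup>2 * z\<^sup>2" for z :: real by (simp add: power2_eq_square algebra_simps)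
    have Y2: "integrable M (\<lambda>\<omega>. (Y \<omega>)\<^sup>2)" "(\<integral>\<omega>. (Y \<omega>)\<^sup>2 \<partial>M) = m\<^sup>2 + \<sigma>\<^sup>2"
      unfolding Y sq using Z1 Z2 by (simp_all add: prob_space)
    have "(\<integral>\<omega>. iexp (\<theta> * Y \<omega>) \<partial>M) = iexp (\<theta> * m) * complex_of_real (exp (- (\<theta>\<^sup>2 * \<sigma>\<^sup>2) / 2))" for \<theta>
    proof -
      have "(\<integral>\<omega>. iexp (\<theta> * Y \<omega>) \<partial>M) = (\<integral>\<omega>. iexp (\<theta> * m) * iexp ((\<theta> * \<sigma>) * Z \<omega>) \<partial>M)"
        unfolding Y by (simp add: exp_add[symmetric] algebra_simps)
      also have "\<dots> = iexp (\<theta> * m) * (\<integral>\<omega>. iexp ((\<theta> * \<sigma>) * Z \<omega>) \<partial>M)" by simp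
      also have "(\<integral>\<omega>. iexp ((\<theta> * \<sigma>) * Z \<omega>) \<partial>M) = char std_normal_distribution (\<theta> * \<sigma>)"
        unfolding char_def by (rule t) simp
      finally show ?thesis by (simp add: char_std_normal_distribution power_mult_distrib)
    qed
    then show ?thesis unfolding gaussian_char_def using Y1 Y2 by simp
  next
    case const
    have 1: "(\<integral>\<omega>. g (Y \<omega>) \<partial>M) = g c" if [measurable]: "g \<in> borel_measurable borel" for g :: "real \<Rightarrow> real"
    proof -
      have "AE \<omega> in M. g (Y \<omega>) = g c" using const by (rule eventually_mono) simp
      then have "(\<integral>\<omega>. g (Y \<omega>) \<partial>M) = (\<integral>\<omega>. g c \<partial>M)" by (intro integral_cong_AE) auto
      then show ?thesis by (simp add: prob_space)
    qed
    have 2: "(\<integral>\<omega>. g (Y \<omega>) \<partial>M) = g c" if [measurable]: "g \<in> borel_measurable borel" for g :: "real \<Rightarrow> complex"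
    proof -
      have "AE \<omega> in M. g (Y \<omega>) = g c" using const by (rule eventually_mono) simp
      then have "(\<integral>\<omega>. g (Y \<omega>) \<partial>M) = (\<integral>\<omega>. g c \<partial>M)" by (intro integral_cong_AE) auto
      then show ?thesis by (simp add: prob_space)
    qed
    have "AE \<omega> in M. (Y \<omega>)\<^sup>2 = c\<^sup>2" using const by (rule eventually_mono) simp
    then have "integrable M (\<lambda>\<omega>. (Y \<omega>)\<^sup>2)" by (subst integrable_cong_AE[where g="\<lambda>_. c\<^sup>2"]) auto
    then show ?thesis unfolding gaussian_char_def
      using 1[of "\<lambda>x. x"] 1[of "\<lambda>x. x\<^sup>2"] 2[of "\<lambda>x. iexp (_ * x)"] by simp
  qed
qed

lemma cmod_iexp_diff_le: "cmod (iexp x - iexp y) \<le> \<bar>x - y\<bar>"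
proof -
  have "cmod (iexp x - iexp y) = cmod (iexp y * (iexp (x - y) - 1))" by (simp add: exp_diff right_diff_distrib)
  also have "\<dots> = cmod (iexp (x - y) - 1)" by (simp add: norm_mult)
  also have "\<dots> \<le> \<bar>x - y\<bar>" using iexp_approx1[of "x - y" 0] by simp
  finally show ?thesis .
qed

text \<open>Mean, second moment and characteristic function all converge; for the last one
  \<open>iexp\<close> is 1-Lipschitz, so convergence in L1 suffices.\<close>

lemma (in prob_space) gaussian_char_limit:
  fixes Y :: "'a \<Rightarrow> real" and Yn :: "nat \<Rightarrow> 'a \<Rightarrow> real"
  assumes g: "\<And>n. gaussian_char M (Yn n)" and Y[measurable]: "Y \<in> borel_measurable M"
    and lim: "(\<lambda>n. \<integral>\<^sup>+\<omega>. ennreal ((Yn n \<omega> - Y \<omega>)\<^sup>2) \<partial>M) \<longlonglongrightarrow> 0"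
  shows "gaussian_char M Y"
proof -
  have m[measurable]: "\<And>n. Yn n \<in> borel_measurable M" and i2: "\<And>n. integrable M (\<lambda>\<omega>. (Yn n \<omega>)\<^sup>2)"
    using g by (auto simp: gaussian_char_def)
  note L = L2_tendsto[OF m Y i2 lim] L2_tendsto_L1[OF m Y i2 lim]
  have i: "integrable M (Yn n)" "integrable M Y" for n
    using i2 L(1) by (auto intro: square_integrable_imp_integrable)
  have "(\<integral>\<omega>. iexp (\<theta> * Y \<omega>) \<partial>M) = iexp (\<theta> * (\<integral>\<omega>. Y \<omega> \<partial>M)) *
        complex_of_real (exp (- (\<theta>\<^sup>2 * ((\<integral>\<omega>. (Y \<omega>)\<^sup>2 \<partial>M) - (\<integral>\<omega>. Y \<omega> \<partial>M)\<^sup>2)) / 2))" (is "?l = ?r") for \<theta>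
  proof (rule LIMSEQ_unique)
    have "(\<lambda>n. (\<integral>\<omega>. iexp (\<theta> * Yn n \<omega>) \<partial>M) - (\<integral>\<omega>. iexp (\<theta> * Y \<omega>) \<partial>M)) \<longlonglongrightarrow> 0"
    proof (rule Lim_null_comparison)
      have "norm ((\<integral>\<omega>. iexp (\<theta> * Yn n \<omega>) \<partial>M) - (\<integral>\<omega>. iexp (\<theta> * Y \<omega>) \<partial>M)) \<le> \<bar>\<theta>\<bar> * (\<integral>\<omega>. \<bar>Yn n \<omega> - Y \<omega>\<bar> \<partial>M)" for n
      proof -
        have ie: "integrable M (\<lambda>\<omega>. iexp (\<theta> * y \<omega>))" if "y \<in> borel_measurable M" for y
          using that by (intro integrable_const_bound[where B=1]) auto
        have "norm ((\<integral>\<omega>. iexp (\<theta> * Yn n \<omega>) \<partial>M) - (\<integral>\<omega>. iexp (\<theta> * Y \<omega>) \<partial>M)) = norm (\<integral>\<omega>. iexp (\<theta> * Yn n \<omega>) - iexp (\<theta> * Y \<omega>) \<partial>M)"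
          using ie[OF m] ie[OF Y] by (simp add: Bochner_Integration.integral_diff)
        also have "\<dots> \<le> (\<integral>\<omega>. norm (iexp (\<theta> * Yn n \<omega>) - iexp (\<theta> * Y \<omega>)) \<partial>M)" by (rule integral_norm_bound)
        also have "\<dots> \<le> (\<integral>\<omega>. \<bar>\<theta>\<bar> * \<bar>Yn n \<omega> - Y \<omega>\<bar> \<partial>M)"
        proof (rule integral_mono)
          show "integrable M (\<lambda>\<omega>. norm (iexp (\<theta> * Yn n \<omega>) - iexp (\<theta> * Y \<omega>)))"
            using ie[OF m] ie[OF Y] by (intro integrable_norm Bochner_Integration.integrable_diff)
          show "norm (iexp (\<theta> * Yn n \<omega>) - iexp (\<theta> * Y \<omega>)) \<le> \<bar>\<theta>\<bar> * \<bar>Yn n \<omega> - Y \<omega>\<bar>" for \<omega>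
            using cmod_iexp_diff_le[of "\<theta> * Yn n \<omega>" "\<theta> * Y \<omega>"] by (simp add: right_diff_distrib[symmetric] abs_mult)
        qed (use i in auto)
        finally show ?thesis by simp
      qed
      then show "\<forall>\<^sub>F n in sequentially. norm ((\<integral>\<omega>. iexp (\<theta> * Yn n \<omega>) \<partial>M) - (\<integral>\<omega>. iexp (\<theta> * Y \<omega>) \<partial>M)) \<le> \<bar>\<theta>\<bar> * (\<integral>\<omega>. \<bar>Yn n \<omega> - Y \<omega>\<bar> \<partial>M)"
        by simp
      show "(\<lambda>n. \<bar>\<theta>\<bar> * (\<integral>\<omega>. \<bar>Yn n \<omega> - Y \<omega>\<bar> \<partial>M)) \<longlonglongrightarrow> 0" using L(5) by (rule tendsto_mult_right_zero)
    qed
    then show "(\<lambda>n. \<integral>\<omega>. iexp (\<theta> * Yn n \<omega>) \<partial>M) \<longlonglongrightarrow> ?l" by (simp only: LIM_zero_iff)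
    have e: "(\<integral>\<omega>. iexp (\<theta> * Yn n \<omega>) \<partial>M) = iexp (\<theta> * (\<integral>\<omega>. Yn n \<omega> \<partial>M)) *
        complex_of_real (exp (- (\<theta>\<^sup>2 * ((\<integral>\<omega>. (Yn n \<omega>)\<^sup>2 \<partial>M) - (\<integral>\<omega>. Yn n \<omega> \<partial>M)\<^sup>2)) / 2))" for n
      using g by (simp add: gaussian_char_def)
    show "(\<lambda>n. \<integral>\<omega>. iexp (\<theta> * Yn n \<omega>) \<partial>M) \<longlonglongrightarrow> ?r"
      unfolding e by (intro tendsto_intros L) simp
  qed
  then show ?thesis unfolding gaussian_char_def using L(1) Y by blast
qed

text \<open>By Levy's uniqueness theorem \<open>Y\<close> has the law of \<open>\<sigma>\<close>
  times a standard normal variable, whose fourth moment is 3. The value \<open>\<sigma> = 0\<close>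
  is included.\<close>

lemma (in prob_space) gaussian_char_fourth_moment:
  assumes g: "gaussian_char M Y" and mean: "(\<integral>\<omega>. Y \<omega> \<partial>M) = 0"
  shows "integrable M (\<lambda>\<omega>. (Y \<omega>) ^ 4)" "(\<integral>\<omega>. (Y \<omega>) ^ 4 \<partial>M) = 3 * (\<integral>\<omega>. (Y \<omega>)\<^sup>2 \<partial>M)\<^sup>2"
proof -
  have [measurable]: "Y \<in> borel_measurable M" using g by (simp add: gaussian_char_def)
  define \<sigma> where "\<sigma> = sqrt (\<integral>\<omega>. (Y \<omega>)\<^sup>2 \<partial>M)"
  have \<sigma>: "\<sigma>\<^sup>2 = (\<integral>\<omega>. (Y \<omega>)\<^sup>2 \<partial>M)" by (simp add: \<sigma>_def)
  interpret N: real_distribution std_normal_distribution by (rule real_dist_normal_dist)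
  have eq: "distr M borel Y = distr std_normal_distribution borel (\<lambda>x. \<sigma> * x)"
  proof (rule Levy_uniqueness)
    show "real_distribution (distr M borel Y)" by (rule real_distribution_distr) simp
    show "real_distribution (distr std_normal_distribution borel (\<lambda>x. \<sigma> * x))" by (rule N.real_distribution_distr) simp
    show "char (distr M borel Y) = char (distr std_normal_distribution borel (\<lambda>x. \<sigma> * x))"
    proof
      fix \<theta>
      have "char (distr std_normal_distribution borel (\<lambda>x. \<sigma> * x)) \<theta> = char std_normal_distribution (\<theta> * \<sigma>)"
        by (simp add: char_def integral_distr mult.assoc)
      also have "\<dots> = complex_of_real (exp (- (\<theta>\<^sup>2 * (\<integral>\<omega>. (Y \<omega>)\<^sup>2 \<partial>M)) / 2))"
        by (simp add: char_std_normal_distribution power_mult_distrib \<sigma>)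
      also have "\<dots> = char (distr M borel Y) \<theta>"
        using g mean by (simp add: char_def integral_distr gaussian_char_def)
      finally show "char (distr M borel Y) \<theta> = char (distr std_normal_distribution borel (\<lambda>x. \<sigma> * x)) \<theta>" by simp
    qed
  qed
  have 4: "(\<integral>x. x ^ 4 \<partial>std_normal_distribution) = 3" "integrable std_normal_distribution (\<lambda>x. x ^ 4)"
    using std_normal_distribution_even_moments[of 2] by (auto simp: fact_numeral)
  have "integrable (distr std_normal_distribution borel (\<lambda>x. \<sigma> * x)) (\<lambda>x. x ^ 4)"
    using 4 by (simp add: integrable_distr_eq power_mult_distrib)
  then show "integrable M (\<lambda>\<omega>. (Y \<omega>) ^ 4)" unfolding eq[symmetric] by (simp add: integrable_distr_eq)
  have "(\<integral>\<omega>. (Y \<omega>) ^ 4 \<partial>M) = (\<integral>x. x ^ 4 \<partial>distr M borel Y)" by (simp add: integral_distr)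
  also have "\<dots> = (\<integral>x. (\<sigma> * x) ^ 4 \<partial>std_normal_distribution)" unfolding eq by (simp add: integral_distr)
  also have "\<dots> = 3 * (\<sigma>\<^sup>2)\<^sup>2" using 4 by (simp add: power_mult_distrib)
  finally show "(\<integral>\<omega>. (Y \<omega>) ^ 4 \<partial>M) = 3 * (\<integral>\<omega>. (Y \<omega>)\<^sup>2 \<partial>M)\<^sup>2" by (simp add: \<sigma>)
qed

subsection \<open>Ergodic averages of stationary sequences\<close>

text \<open>Stationarity is tested on Lipschitz functions of finitely many coordinates only: this is
  closed under \<open>L\<^sub>1\<close> limits and suffices for the maximal ergodic inequality.\<close>
definition stationary_seq :: "'a measure \<Rightarrow> (nat \<Rightarrow> 'a \<Rightarrow> real) \<Rightarrow> bool" where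
  "stationary_seq M \<xi> \<longleftrightarrow> (\<forall>k. integrable M (\<xi> k)) \<and>
     (\<forall>n L \<Phi>. \<Phi> \<in> borel_measurable (PiM UNIV (\<lambda>_. borel)) \<longrightarrow>
        (\<forall>x y. \<bar>\<Phi> x - \<Phi> y\<bar> \<le> L * (\<Sum>j<n. \<bar>x j - y j\<bar>)) \<longrightarrow>
        (\<integral>\<omega>. \<Phi> (\<lambda>k. \<xi> k \<omega>) \<partial>M) = (\<integral>\<omega>. \<Phi> (\<lambda>k. \<xi> (Suc k) \<omega>) \<partial>M))"

lemma measurable_sequence:
  fixes \<xi> :: "nat \<Rightarrow> 'a \<Rightarrow> real"
  assumes "\<And>k. \<xi> k \<in> borel_measurable M"
  shows "(\<lambda>\<omega> k. \<xi> k \<omega>) \<in> measurable M (PiM UNIV (\<lambda>_. borel))"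
  by (rule measurable_PiM_single') (use assms in \<open>auto simp: space_PiM\<close>)

lemma (in prob_space) integrable_Lipschitz:
  fixes \<xi> :: "nat \<Rightarrow> 'a \<Rightarrow> real"
  assumes \<Phi>: "\<Phi> \<in> borel_measurable (PiM UNIV (\<lambda>_. borel))" "\<And>x y. \<bar>\<Phi> x - \<Phi> y\<bar> \<le> L * (\<Sum>j<n. \<bar>x j - y j\<bar>)"
    and \<xi>: "\<And>k. integrable M (\<xi> k)"
  shows "integrable M (\<lambda>\<omega>. \<Phi> (\<lambda>k. \<xi> k \<omega>))"
proof (rule Bochner_Integration.integrable_bound)
  show "integrable M (\<lambda>\<omega>. \<bar>\<Phi> (\<lambda>_. 0)\<bar> + L * (\<Sum>j<n. \<bar>\<xi> j \<omega>\<bar>))" using \<xi> by simp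
  show "(\<lambda>\<omega>. \<Phi> (\<lambda>k. \<xi> k \<omega>)) \<in> borel_measurable M"
    by (rule measurable_compose[OF measurable_sequence \<Phi>(1)]) (use \<xi> in auto)
  have "norm (\<Phi> x) \<le> norm (\<bar>\<Phi> (\<lambda>_. 0)\<bar> + L * (\<Sum>j<n. \<bar>x j\<bar>))" for x
    using \<Phi>(2)[of x "\<lambda>_. 0"] by simp
  then show "AE \<omega> in M. norm (\<Phi> (\<lambda>k. \<xi> k \<omega>)) \<le> norm (\<bar>\<Phi> (\<lambda>_. 0)\<bar> + L * (\<Sum>j<n. \<bar>\<xi> j \<omega>\<bar>))" by simp
qed

text \<open>The Lipschitz constant bounds the error on either side of the stationarity identity by
  L1 distances of finitely many coordinates; in \<open>conv\<close> the map \<open>s\<close> stands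
  for the identity or for \<open>Suc\<close>.\<close>

lemma (in prob_space) stationary_seq_limit:
  fixes \<xi> :: "nat \<Rightarrow> 'a \<Rightarrow> real" and \<xi>N :: "nat \<Rightarrow> nat \<Rightarrow> 'a \<Rightarrow> real"
  assumes st: "\<And>N. stationary_seq M (\<xi>N N)" and \<xi>: "\<And>k. integrable M (\<xi> k)"
    and lim: "\<And>k. (\<lambda>N. \<integral>\<omega>. \<bar>\<xi>N N k \<omega> - \<xi> k \<omega>\<bar> \<partial>M) \<longlonglongrightarrow> 0"
  shows "stationary_seq M \<xi>"
  unfolding stationary_seq_def
proof (intro conjI allI impI \<xi>)
  fix n L and \<Phi> :: "(nat \<Rightarrow> real) \<Rightarrow> real"
  assume \<Phi>: "\<Phi> \<in> borel_measurable (PiM UNIV (\<lambda>_. borel))" "\<forall>x y. \<bar>\<Phi> x - \<Phi> y\<bar> \<le> L * (\<Sum>j<n. \<bar>x j - y j\<bar>)"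
  have iN: "integrable M (\<xi>N N k)" for N k using st by (simp add: stationary_seq_def)
  have conv: "(\<lambda>N. \<integral>\<omega>. \<Phi> (\<lambda>k. \<xi>N N (s k) \<omega>) \<partial>M) \<longlonglongrightarrow> (\<integral>\<omega>. \<Phi> (\<lambda>k. \<xi> (s k) \<omega>) \<partial>M)" for s :: "nat \<Rightarrow> nat"
  proof -
    have i: "integrable M (\<lambda>\<omega>. \<Phi> (\<lambda>k. \<xi>N N (s k) \<omega>))" "integrable M (\<lambda>\<omega>. \<Phi> (\<lambda>k. \<xi> (s k) \<omega>))" for N
      by (rule integrable_Lipschitz[OF \<Phi>(1) \<Phi>(2)[rule_format]], rule iN)
         (rule integrable_Lipschitz[OF \<Phi>(1) \<Phi>(2)[rule_format]], rule \<xi>)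
    have "(\<lambda>N. (\<integral>\<omega>. \<Phi> (\<lambda>k. \<xi>N N (s k) \<omega>) \<partial>M) - (\<integral>\<omega>. \<Phi> (\<lambda>k. \<xi> (s k) \<omega>) \<partial>M)) \<longlonglongrightarrow> 0"
    proof (rule Lim_null_comparison)
      have "\<bar>(\<integral>\<omega>. \<Phi> (\<lambda>k. \<xi>N N (s k) \<omega>) \<partial>M) - (\<integral>\<omega>. \<Phi> (\<lambda>k. \<xi> (s k) \<omega>) \<partial>M)\<bar> \<le>
         L * (\<Sum>j<n. \<integral>\<omega>. \<bar>\<xi>N N (s j) \<omega> - \<xi> (s j) \<omega>\<bar> \<partial>M)" for N
      proof -
        have "\<bar>(\<integral>\<omega>. \<Phi> (\<lambda>k. \<xi>N N (s k) \<omega>) \<partial>M) - (\<integral>\<omega>. \<Phi> (\<lambda>k. \<xi> (s k) \<omega>) \<partial>M)\<bar> \<le>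
            (\<integral>\<omega>. \<bar>\<Phi> (\<lambda>k. \<xi>N N (s k) \<omega>) - \<Phi> (\<lambda>k. \<xi> (s k) \<omega>)\<bar> \<partial>M)"
          unfolding Bochner_Integration.integral_diff[OF i, symmetric] by (rule integral_abs_bound)
        also have "\<dots> \<le> (\<integral>\<omega>. L * (\<Sum>j<n. \<bar>\<xi>N N (s j) \<omega> - \<xi> (s j) \<omega>\<bar>) \<partial>M)"
          using \<Phi>(2) i iN \<xi> by (intro integral_mono) auto
        also have "\<dots> = L * (\<Sum>j<n. \<integral>\<omega>. \<bar>\<xi>N N (s j) \<omega> - \<xi> (s j) \<omega>\<bar> \<partial>M)" using iN \<xi> by simp
        finally show ?thesis .
      qed
      then show "\<forall>\<^sub>F N in sequentially. norm ((\<integral>\<omega>. \<Phi> (\<lambda>k. \<xi>N N (s k) \<omega>) \<partial>M) - (\<integral>\<omega>. \<Phi> (\<lambda>k. \<xi> (s k) \<omega>) \<partial>M)) \<le>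
         L * (\<Sum>j<n. \<integral>\<omega>. \<bar>\<xi>N N (s j) \<omega> - \<xi> (s j) \<omega>\<bar> \<partial>M)" by simp
      show "(\<lambda>N. L * (\<Sum>j<n. \<integral>\<omega>. \<bar>\<xi>N N (s j) \<omega> - \<xi> (s j) \<omega>\<bar> \<partial>M)) \<longlonglongrightarrow> 0"
        using lim by (intro tendsto_mult_right_zero tendsto_null_sum) auto
    qed
    then show ?thesis by (simp add: LIM_zero_iff)
  qed
  have "(\<integral>\<omega>. \<Phi> (\<lambda>k. \<xi>N N k \<omega>) \<partial>M) = (\<integral>\<omega>. \<Phi> (\<lambda>k. \<xi>N N (Suc k) \<omega>) \<partial>M)" for N
    using st \<Phi> unfolding stationary_seq_def by blast
  then show "(\<integral>\<omega>. \<Phi> (\<lambda>k. \<xi> k \<omega>) \<partial>M) = (\<integral>\<omega>. \<Phi> (\<lambda>k. \<xi> (Suc k) \<omega>) \<partial>M)"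
    using conv[of "\<lambda>k. k"] conv[of Suc] LIMSEQ_unique by auto
qed

text \<open>Serves for block means, for subtracting a threshold and for negation. The guard on
  \<open>d\<close> keeps the statement valid over every measure: a nonzero constant is integrable
  only when the measure is finite.\<close>

lemma stationary_seq_moving_sum:
  assumes st: "stationary_seq M \<xi>"
  shows "stationary_seq (M :: 'a measure) (\<lambda>k \<omega>. c * (\<Sum>i<m. \<xi> (k + i) \<omega>) + (if finite_measure M then d else 0))"
proof -
  have i: "integrable M (\<xi> k)" for k using st by (simp add: stationary_seq_def)
  define d' where "d' = (if finite_measure M then d else 0)"
  have d': "integrable M (\<lambda>_. d')" by (auto simp: d'_def intro: finite_measure.integrable_const)
  show ?thesis unfolding stationary_seq_def d'_def[symmetric]
  proof (intro conjI allI impI)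
    show "integrable M (\<lambda>\<omega>. c * (\<Sum>i<m. \<xi> (k + i) \<omega>) + d')" for k
      using i d' by (intro Bochner_Integration.integrable_add) auto
    fix n L and \<Phi> :: "(nat \<Rightarrow> real) \<Rightarrow> real"
    assume \<Phi>: "\<Phi> \<in> borel_measurable (PiM UNIV (\<lambda>_. borel))" "\<forall>x y. \<bar>\<Phi> x - \<Phi> y\<bar> \<le> L * (\<Sum>j<n. \<bar>x j - y j\<bar>)"
    define A where "A x k = c * (\<Sum>i<m. x (k + i)) + d'" for x :: "nat \<Rightarrow> real" and k
    have "A \<in> measurable (PiM UNIV (\<lambda>_. borel)) (PiM UNIV (\<lambda>_. borel))"
      unfolding A_def[abs_def] by (rule measurable_PiM_single') (auto simp: space_PiM)
    then have 1: "(\<lambda>x. \<Phi> (A x)) \<in> borel_measurable (PiM UNIV (\<lambda>_. borel))" using \<Phi>(1) by (rule measurable_compose)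
    \<comment> \<open>The first n block sums read at most the first n + m entries, and each of them
      changes by at most |c| m S; the Lipschitz constant is crude but finite.\<close>
    have 2: "\<bar>\<Phi> (A x) - \<Phi> (A y)\<bar> \<le> (\<bar>L\<bar> * (n * (\<bar>c\<bar> * m))) * (\<Sum>j<n + m. \<bar>x j - y j\<bar>)" for x y
    proof -
      define S where "S = (\<Sum>j<n + m. \<bar>x j - y j\<bar>)"
      have "\<bar>A x j - A y j\<bar> \<le> \<bar>c\<bar> * (m * S)" if "j < n" for j
      proof -
        have "\<bar>A x j - A y j\<bar> = \<bar>c\<bar> * \<bar>\<Sum>i<m. x (j + i) - y (j + i)\<bar>"
          by (simp add: A_def sum_subtractf abs_mult[symmetric] right_diff_distrib)
        also have "\<dots> \<le> \<bar>c\<bar> * (\<Sum>i<m. \<bar>x (j + i) - y (j + i)\<bar>)" by (intro mult_left_mono sum_abs) auto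
        also have "\<dots> \<le> \<bar>c\<bar> * (\<Sum>i<m. S)"
          unfolding S_def using that by (intro mult_left_mono sum_mono member_le_sum) auto
        finally show ?thesis by simp
      qed
      then have "(\<Sum>j<n. \<bar>A x j - A y j\<bar>) \<le> (\<Sum>j<n. \<bar>c\<bar> * (m * S))" by (intro sum_mono) auto
      then have "\<bar>L\<bar> * (\<Sum>j<n. \<bar>A x j - A y j\<bar>) \<le> \<bar>L\<bar> * (n * (\<bar>c\<bar> * (m * S)))" by (intro mult_left_mono) auto
      moreover have "\<bar>\<Phi> (A x) - \<Phi> (A y)\<bar> \<le> \<bar>L\<bar> * (\<Sum>j<n. \<bar>A x j - A y j\<bar>)"
        by (rule order_trans[OF \<Phi>(2)[rule_format]]) (auto intro!: mult_right_mono sum_nonneg)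
      ultimately show ?thesis by (simp add: S_def mult_ac)
    qed
    have "(\<integral>\<omega>. \<Phi> (A (\<lambda>k. \<xi> k \<omega>)) \<partial>M) = (\<integral>\<omega>. \<Phi> (A (\<lambda>k. \<xi> (Suc k) \<omega>)) \<partial>M)"
      using st 1 2 unfolding stationary_seq_def by blast
    then show "(\<integral>\<omega>. \<Phi> (\<lambda>k. c * (\<Sum>i<m. \<xi> (k + i) \<omega>) + d') \<partial>M) = (\<integral>\<omega>. \<Phi> (\<lambda>k. c * (\<Sum>i<m. \<xi> (Suc k + i) \<omega>) + d') \<partial>M)"
      by (simp add: A_def[abs_def])
  qed
qed

section \<open>The maximal ergodic inequality\<close>

text \<open>The largest of the partial sums of length 0, ..., n, built by splitting off the first
  term; Garsia's argument compares exactly this recursion with the shifted sequence.\<close>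

primrec max_partial_sum :: "nat \<Rightarrow> (nat \<Rightarrow> real) \<Rightarrow> real" where
  "max_partial_sum 0 x = 0"
| "max_partial_sum (Suc n) x = max 0 (x 0 + max_partial_sum n (\<lambda>k. x (Suc k)))"

lemma max_partial_sum_measurable[measurable]:
  "max_partial_sum n \<in> borel_measurable (PiM UNIV (\<lambda>_. borel))"
proof (induction n)
  case (Suc n)
  have "(\<lambda>x k. x (Suc k)) \<in> measurable (PiM UNIV (\<lambda>_. borel)) (PiM UNIV (\<lambda>_. borel :: real measure))"
    by (rule measurable_PiM_single') (auto simp: space_PiM)
  from measurable_compose[OF this Suc] show ?case by (simp, measurable)
qed simp

lemma max_partial_sum_Lipschitz: "\<bar>max_partial_sum n x - max_partial_sum n y\<bar> \<le> 1 * (\<Sum>j<n. \<bar>x j - y j\<bar>)"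
proof (induction n arbitrary: x y)
  case (Suc n)
  show ?case using Suc[of "\<lambda>k. x (Suc k)" "\<lambda>k. y (Suc k)"] by (simp add: sum.lessThan_Suc_shift del: sum.lessThan_Suc)
qed simp

lemma max_partial_sum_mono: "max_partial_sum n x \<le> max_partial_sum (Suc n) x"
proof (induction n arbitrary: x)
  case (Suc n)
  show ?case using Suc[of "\<lambda>k. x (Suc k)"] by simp
qed simp

lemma max_partial_sum_ge: "k \<le> n \<Longrightarrow> (\<Sum>j<k. x j) \<le> max_partial_sum n x"
proof (induction n arbitrary: k x)
  case (Suc n)
  show ?case
  proof (cases k)
    case (Suc k')
    then show ?thesis using Suc.prems Suc.IH[of k' "\<lambda>j. x (Suc j)"] by (simp add: sum.lessThan_Suc_shift del: sum.lessThan_Suc)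
  qed simp
qed simp

text \<open>Garsia's proof of the maximal ergodic inequality.\<close>
lemma (in prob_space) maximal_ergodic:
  assumes st: "stationary_seq M \<xi>"
  shows "0 \<le> (\<integral>\<omega>. \<xi> 0 \<omega> * (if max_partial_sum (Suc n) (\<lambda>k. \<xi> k \<omega>) > 0 then 1 else 0) \<partial>M)"
proof -
  have i: "integrable M (\<xi> k)" for k using st by (simp add: stationary_seq_def)
  then have [measurable]: "\<xi> k \<in> borel_measurable M" for k by auto
  have [measurable]: "(\<lambda>\<omega> k. \<xi> k \<omega>) \<in> measurable M (PiM UNIV (\<lambda>_. borel))" by (rule measurable_sequence) simp
  have [measurable]: "(\<lambda>\<omega>. max_partial_sum n (\<lambda>k. \<xi> k \<omega>)) \<in> borel_measurable M" for n
    by (rule measurable_compose[OF _ max_partial_sum_measurable]) simp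
  have iG: "integrable M (\<lambda>\<omega>. max_partial_sum n (\<lambda>k. \<xi> (s k) \<omega>))" for n s
    by (rule integrable_Lipschitz[OF max_partial_sum_measurable max_partial_sum_Lipschitz]) (rule i)
  have nonneg: "0 \<le> max_partial_sum n x" for n x by (cases n) auto
  have "0 \<le> (\<integral>\<omega>. max_partial_sum (Suc n) (\<lambda>k. \<xi> k \<omega>) - max_partial_sum n (\<lambda>k. \<xi> k \<omega>) \<partial>M)"
    using max_partial_sum_mono by (intro integral_nonneg_AE) (auto simp del: max_partial_sum.simps)
  also have "\<dots> = (\<integral>\<omega>. max_partial_sum (Suc n) (\<lambda>k. \<xi> k \<omega>) \<partial>M) - (\<integral>\<omega>. max_partial_sum n (\<lambda>k. \<xi> k \<omega>) \<partial>M)"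
    using iG[of _ "\<lambda>k. k"] by (intro Bochner_Integration.integral_diff) (auto simp del: max_partial_sum.simps)
  \<comment> \<open>Stationarity enters here, for the Lipschitz function
    \<open>max_partial_sum n\<close>.\<close>
  also have "(\<integral>\<omega>. max_partial_sum n (\<lambda>k. \<xi> k \<omega>) \<partial>M) = (\<integral>\<omega>. max_partial_sum n (\<lambda>k. \<xi> (Suc k) \<omega>) \<partial>M)"
    using st max_partial_sum_measurable max_partial_sum_Lipschitz unfolding stationary_seq_def by blast
  also have "(\<integral>\<omega>. max_partial_sum (Suc n) (\<lambda>k. \<xi> k \<omega>) \<partial>M) - \<dots> =
     (\<integral>\<omega>. max_partial_sum (Suc n) (\<lambda>k. \<xi> k \<omega>) - max_partial_sum n (\<lambda>k. \<xi> (Suc k) \<omega>) \<partial>M)"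
    using iG[of _ "\<lambda>k. k"] iG[of n Suc] by (intro Bochner_Integration.integral_diff[symmetric]) (auto simp del: max_partial_sum.simps)
  also have "\<dots> \<le> (\<integral>\<omega>. \<xi> 0 \<omega> * (if max_partial_sum (Suc n) (\<lambda>k. \<xi> k \<omega>) > 0 then 1 else 0) \<partial>M)"
  proof (rule integral_mono)
    show "integrable M (\<lambda>\<omega>. max_partial_sum (Suc n) (\<lambda>k. \<xi> k \<omega>) - max_partial_sum n (\<lambda>k. \<xi> (Suc k) \<omega>))"
      using iG[of _ "\<lambda>k. k"] iG[of n Suc] by (intro Bochner_Integration.integrable_diff) (auto simp del: max_partial_sum.simps)
    show "integrable M (\<lambda>\<omega>. \<xi> 0 \<omega> * (if max_partial_sum (Suc n) (\<lambda>k. \<xi> k \<omega>) > 0 then 1 else 0))"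
      by (rule Bochner_Integration.integrable_bound[OF i[of 0]]) (auto simp del: max_partial_sum.simps)
    fix \<omega>
    \<comment> \<open>Where the maximum is positive it equals \<open>\<xi> 0\<close> plus the
      shifted maximum; elsewhere the difference is at most 0, because the shifted maximum is
      nonnegative.\<close>
    show "max_partial_sum (Suc n) (\<lambda>k. \<xi> k \<omega>) - max_partial_sum n (\<lambda>k. \<xi> (Suc k) \<omega>)
      \<le> \<xi> 0 \<omega> * (if max_partial_sum (Suc n) (\<lambda>k. \<xi> k \<omega>) > 0 then 1 else 0)"
      using nonneg[of n "\<lambda>k. \<xi> (Suc k) \<omega>"] by (auto simp: max_def)
  qed
  finally show ?thesis .
qed

text \<open>A partial sum above l k is a positive partial sum of \<open>\<xi> - l\<close>. On the
  event that one occurs, \<open>maximal_ergodic\<close> bounds l times the probability by the mean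
  of |\<xi> 0|.\<close>

lemma (in prob_space) maximal_inequality_one_sided:
  fixes l :: real
  assumes st: "stationary_seq M \<xi>" and l: "l > 0"
  shows "l * prob {\<omega>\<in>space M. \<exists>k\<in>{1..n}. (\<Sum>j<k. \<xi> j \<omega>) > l * k} \<le> (\<integral>\<omega>. \<bar>\<xi> 0 \<omega>\<bar> \<partial>M)"
proof -
  have i: "integrable M (\<xi> k)" for k using st by (simp add: stationary_seq_def)
  then have [measurable]: "\<xi> k \<in> borel_measurable M" for k by auto
  define \<eta> where "\<eta> k \<omega> = \<xi> k \<omega> - l" for k \<omega>
  have st': "stationary_seq M \<eta>"
    using stationary_seq_moving_sum[OF st, of 1 1 "- l"] finite_measure_axioms by (simp add: \<eta>_def[abs_def])
  have [measurable]: "(\<lambda>\<omega>. max_partial_sum n (\<lambda>k. \<eta> k \<omega>)) \<in> borel_measurable M" for n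
    unfolding \<eta>_def by (rule measurable_compose[OF measurable_sequence max_partial_sum_measurable]) simp
  define E where "E = {\<omega>\<in>space M. max_partial_sum (Suc n) (\<lambda>k. \<eta> k \<omega>) > 0}"
  have [measurable]: "E \<in> sets M" unfolding E_def by measurable
  have sub: "{\<omega>\<in>space M. \<exists>k\<in>{1..n}. (\<Sum>j<k. \<xi> j \<omega>) > l * k} \<subseteq> E"
  proof clarify
    fix \<omega> k assume *: "\<omega> \<in> space M" "k \<in> {1..n}" "l * real k < (\<Sum>j<k. \<xi> j \<omega>)"
    have "0 < (\<Sum>j<k. \<eta> j \<omega>)" using * by (simp add: \<eta>_def sum_subtractf mult.commute)
    also have "\<dots> \<le> max_partial_sum (Suc n) (\<lambda>k. \<eta> k \<omega>)" using * by (intro max_partial_sum_ge) auto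
    finally show "\<omega> \<in> E" using * by (simp add: E_def)
  qed
  have "0 \<le> (\<integral>\<omega>. \<eta> 0 \<omega> * (if max_partial_sum (Suc n) (\<lambda>k. \<eta> k \<omega>) > 0 then 1 else 0) \<partial>M)"
    by (rule maximal_ergodic[OF st'])
  also have "\<dots> = (\<integral>\<omega>. \<xi> 0 \<omega> * indicator E \<omega> - l * indicator E \<omega> \<partial>M)"
    by (intro Bochner_Integration.integral_cong) (auto simp: E_def \<eta>_def simp del: max_partial_sum.simps)
  also have "\<dots> = (\<integral>\<omega>. \<xi> 0 \<omega> * indicator E \<omega> \<partial>M) - l * prob E"
    using i by (subst Bochner_Integration.integral_diff) (auto intro: integrable_real_mult_indicator simp: less_top[symmetric])
  also have "(\<integral>\<omega>. \<xi> 0 \<omega> * indicator E \<omega> \<partial>M) \<le> (\<integral>\<omega>. \<bar>\<xi> 0 \<omega>\<bar> \<partial>M)"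
    using i by (intro integral_mono integrable_real_mult_indicator) (auto split: split_indicator)
  finally have "l * prob E \<le> (\<integral>\<omega>. \<bar>\<xi> 0 \<omega>\<bar> \<partial>M)" by simp
  moreover have "l * prob {\<omega>\<in>space M. \<exists>k\<in>{1..n}. (\<Sum>j<k. \<xi> j \<omega>) > l * k} \<le> l * prob E"
    using sub l by (intro mult_left_mono finite_measure_mono) auto
  ultimately show ?thesis by simp
qed

text \<open>Both signs of the sequence are used, hence the factor 2; continuity from below lets the
  range of k grow.\<close>

lemma (in prob_space) maximal_inequality:
  fixes l :: real
  assumes st: "stationary_seq M \<xi>" and l: "l > 0"
  shows "prob {\<omega>\<in>space M. \<exists>k\<ge>1. \<bar>\<Sum>j<k. \<xi> j \<omega>\<bar> > l * k} \<le> 2 * (\<integral>\<omega>. \<bar>\<xi> 0 \<omega>\<bar> \<partial>M) / l"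
proof -
  have i: "integrable M (\<xi> k)" for k using st by (simp add: stationary_seq_def)
  then have [measurable]: "\<xi> k \<in> borel_measurable M" for k by auto
  have st': "stationary_seq M (\<lambda>k \<omega>. - \<xi> k \<omega>)"
    using stationary_seq_moving_sum[OF st, of "-1" 1 0] by simp
  define E where "E n = {\<omega>\<in>space M. \<exists>k\<in>{1..n}. (\<Sum>j<k. \<xi> j \<omega>) > l * k}" for n :: nat
  define F where "F n = {\<omega>\<in>space M. \<exists>k\<in>{1..n}. (\<Sum>j<k. - \<xi> j \<omega>) > l * k}" for n :: nat
  have [measurable]: "E n \<in> sets M" "F n \<in> sets M" for n unfolding E_def F_def by measurable
  have "incseq (\<lambda>n. E n \<union> F n)" by (rule incseq_SucI) (auto simp: E_def F_def; force)
  then have "(\<lambda>n. prob (E n \<union> F n)) \<longlonglongrightarrow> prob (\<Union>n. E n \<union> F n)"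
    by (intro finite_Lim_measure_incseq) auto
  moreover have "prob (E n \<union> F n) \<le> 2 * (\<integral>\<omega>. \<bar>\<xi> 0 \<omega>\<bar> \<partial>M) / l" for n
  proof -
    have "prob (E n \<union> F n) \<le> prob (E n) + prob (F n)" by (intro measure_Un_le) auto
    moreover have "l * prob (E n) \<le> (\<integral>\<omega>. \<bar>\<xi> 0 \<omega>\<bar> \<partial>M)" unfolding E_def by (rule maximal_inequality_one_sided[OF st l])
    moreover have "l * prob (F n) \<le> (\<integral>\<omega>. \<bar>\<xi> 0 \<omega>\<bar> \<partial>M)" unfolding F_def using maximal_inequality_one_sided[OF st' l, of n] by simp
    ultimately have "l * prob (E n \<union> F n) \<le> 2 * (\<integral>\<omega>. \<bar>\<xi> 0 \<omega>\<bar> \<partial>M)"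
      using l mult_left_mono[of "prob (E n \<union> F n)" "prob (E n) + prob (F n)" l] by (simp add: distrib_left)
    then show ?thesis using l by (simp add: pos_le_divide_eq mult.commute)
  qed
  ultimately have "prob (\<Union>n. E n \<union> F n) \<le> 2 * (\<integral>\<omega>. \<bar>\<xi> 0 \<omega>\<bar> \<partial>M) / l"
    by (intro LIMSEQ_le_const2) auto
  moreover have "{\<omega>\<in>space M. \<exists>k\<ge>1. \<bar>\<Sum>j<k. \<xi> j \<omega>\<bar> > l * k} = (\<Union>n. E n \<union> F n)"
  proof (intro set_eqI iffI)
    fix \<omega> assume "\<omega> \<in> {\<omega>\<in>space M. \<exists>k\<ge>1. \<bar>\<Sum>j<k. \<xi> j \<omega>\<bar> > l * k}"
    then obtain k where "\<omega> \<in> space M" "k \<ge> 1" "\<bar>\<Sum>j<k. \<xi> j \<omega>\<bar> > l * k" by auto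
    then have "\<omega> \<in> E k \<union> F k" unfolding E_def F_def by (auto simp: sum_negf abs_if split: if_splits)
    then show "\<omega> \<in> (\<Union>n. E n \<union> F n)" by blast
  qed (auto simp: E_def F_def sum_negf abs_if)
  ultimately show ?thesis by simp
qed

section \<open>Almost sure convergence of averages\<close>

text \<open>The series of the \<open>Z k\<close> has finite expectation, so it converges almost
  surely and its terms tend to 0.\<close>

lemma AE_tendsto_zero_of_summable:
  fixes Z :: "nat \<Rightarrow> 'a \<Rightarrow> real"
  assumes Z: "\<And>k. integrable M (Z k)" "\<And>k \<omega>. 0 \<le> Z k \<omega>"
    and C: "\<And>k. (\<integral>\<omega>. Z k \<omega> \<partial>M) \<le> C k" "summable C"
  shows "AE \<omega> in M. (\<lambda>k. Z k \<omega>) \<longlonglongrightarrow> 0"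
proof -
  have [measurable]: "\<And>k. Z k \<in> borel_measurable M" using Z by auto
  have C0: "0 \<le> C k" for k using C(1)[of k] Z(2) by (meson Bochner_Integration.integral_nonneg order_trans)
  have "(\<integral>\<^sup>+\<omega>. (\<Sum>k. ennreal (Z k \<omega>)) \<partial>M) = (\<Sum>k. \<integral>\<^sup>+\<omega>. ennreal (Z k \<omega>) \<partial>M)" by (rule nn_integral_suminf) simp
  also have "\<dots> = (\<Sum>k. ennreal (\<integral>\<omega>. Z k \<omega> \<partial>M))" using Z by (intro suminf_cong nn_integral_eq_integral) auto
  also have "\<dots> \<le> (\<Sum>k. ennreal (C k))" using C by (intro suminf_le) (auto intro: ennreal_leI)
  also have "\<dots> < \<infinity>" using C C0 by (simp add: suminf_ennreal2 less_top)
  finally have "AE \<omega> in M. (\<Sum>k. ennreal (Z k \<omega>)) \<noteq> \<infinity>" by (intro nn_integral_PInf_AE) auto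
  then show ?thesis
  proof eventually_elim
    case (elim \<omega>)
    have "summable (\<lambda>k. Z k \<omega>)" by (rule summable_suminf_not_top) (use Z elim in auto)
    then show ?case by (rule summable_LIMSEQ_zero)
  qed
qed

text \<open>One more shift changes the sum by \<open>x (k + i) - x i\<close> only, which is
  negligible after division by k.\<close>

lemma shifted_averages_tendsto:
  fixes x :: "nat \<Rightarrow> real"
  assumes x: "(\<lambda>k. x k / real (Suc k)) \<longlonglongrightarrow> 0"
  shows "(\<lambda>k. ((\<Sum>j<k. x (j + i)) - (\<Sum>j<k. x j)) / real k) \<longlonglongrightarrow> 0"
proof (induction i)
  case (Suc i)
  have tel: "(\<Sum>j<k. x (j + Suc i)) = (\<Sum>j<k. x (j + i)) + (x (k + i) - x i)" for k
    by (induction k) auto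
  have "(\<lambda>k. x (k + i) / real (Suc (k + i))) \<longlonglongrightarrow> 0" using LIMSEQ_ignore_initial_segment[OF x, of i] by simp
  moreover have "(\<lambda>k. real (Suc (k + i)) / real k) \<longlonglongrightarrow> 1"
  proof (rule Lim_transform_eventually)
    show "(\<lambda>k. 1 + real (Suc i) / real k) \<longlonglongrightarrow> 1"
      using tendsto_add[OF tendsto_const lim_const_over_n, of 1 "real (Suc i)"] by simp
    show "\<forall>\<^sub>F k in sequentially. 1 + real (Suc i) / real k = real (Suc (k + i)) / real k"
      using eventually_gt_at_top[of 0] by eventually_elim (simp add: field_simps)
  qed
  ultimately have "(\<lambda>k. x (k + i) / real (Suc (k + i)) * (real (Suc (k + i)) / real k)) \<longlonglongrightarrow> 0 * 1" by (rule tendsto_mult)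
  then have 1: "(\<lambda>k. x (k + i) / real k) \<longlonglongrightarrow> 0" by simp
  have 2: "(\<lambda>k. x i / real k) \<longlonglongrightarrow> 0" by (rule lim_const_over_n)
  have eq: "((\<Sum>j<k. x (j + Suc i)) - (\<Sum>j<k. x j)) / real k =
      ((\<Sum>j<k. x (j + i)) - (\<Sum>j<k. x j)) / real k + (x (k + i) / real k - x i / real k)" for k
    by (subst tel) (simp add: add_divide_distrib diff_divide_distrib)
  have "(\<lambda>k. ((\<Sum>j<k. x (j + i)) - (\<Sum>j<k. x j)) / real k + (x (k + i) / real k - x i / real k)) \<longlonglongrightarrow> 0 + (0 - 0)"
    by (intro tendsto_add tendsto_diff Suc 1 2)
  then show ?case unfolding eq by simp
qed simp

text \<open>The averages of \<open>\<xi>\<close> and of its block means \<open>\<eta>\<close> of length \<open>m\<close> have the same limit points, and by the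
  maximal inequality the averages of \<open>\<eta>\<close> are uniformly small with high probability because
  \<open>\<eta>\<close> is small in \<open>L\<^sub>1\<close> for large \<open>m\<close>.\<close>
lemma (in prob_space) ergodic_AE:
  assumes st: "stationary_seq M \<xi>"
    and sq: "\<And>k. integrable M (\<lambda>\<omega>. (\<xi> k \<omega>)\<^sup>2)" "\<And>k. (\<integral>\<omega>. (\<xi> k \<omega>)\<^sup>2 \<partial>M) \<le> K"
    and L1: "(\<lambda>n. \<integral>\<omega>. \<bar>(\<Sum>j<n. \<xi> j \<omega>) / n\<bar> \<partial>M) \<longlonglongrightarrow> 0"
  shows "AE \<omega> in M. (\<lambda>n. (\<Sum>j<n. \<xi> j \<omega>) / n) \<longlonglongrightarrow> 0"
proof -
  have i: "integrable M (\<xi> k)" for k using st by (simp add: stationary_seq_def)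
  then have [measurable]: "\<xi> k \<in> borel_measurable M" for k by auto
  \<comment> \<open>Bounded second moments divided by k^2 are summable; this makes single terms
    negligible, as \<open>shifted_averages_tendsto\<close> demands.\<close>
  have "AE \<omega> in M. (\<lambda>k. (\<xi> k \<omega>)\<^sup>2 / (real (Suc k))\<^sup>2) \<longlonglongrightarrow> 0"
  proof (rule AE_tendsto_zero_of_summable[where C="\<lambda>k. K * (1 / (real (Suc k))\<^sup>2)"])
    show "summable (\<lambda>k. K * (1 / (real (Suc k))\<^sup>2))"
      using inverse_power_summable[of 2, where 'a=real] summable_Suc_iff[of "\<lambda>k. 1 / (real k)\<^sup>2"]
      by (intro summable_mult) (simp add: inverse_eq_divide del: of_nat_Suc)
    show "(\<integral>\<omega>. (\<xi> k \<omega>)\<^sup>2 / (real (Suc k))\<^sup>2 \<partial>M) \<le> K * (1 / (real (Suc k))\<^sup>2)" for k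
      using sq(2)[of k] by (simp add: divide_right_mono)
  qed (use sq in auto)
  then have small: "AE \<omega> in M. (\<lambda>k. \<xi> k \<omega> / real (Suc k)) \<longlonglongrightarrow> 0"
  proof eventually_elim
    case (elim \<omega>)
    have "(\<lambda>k. sqrt ((\<xi> k \<omega>)\<^sup>2 / (real (Suc k))\<^sup>2)) \<longlonglongrightarrow> sqrt 0" by (intro tendsto_real_sqrt elim)
    then have "(\<lambda>k. \<bar>\<xi> k \<omega> / real (Suc k)\<bar>) \<longlonglongrightarrow> 0" by (simp add: real_sqrt_divide)
    then show ?case by (rule tendsto_rabs_zero_cancel)
  qed
  have key: "AE \<omega> in M. \<forall>\<^sub>F k in sequentially. \<bar>(\<Sum>j<k. \<xi> j \<omega>) / k\<bar> \<le> 2 * l" if l: "l > 0" for l :: real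
  proof -
    define B where "B = {\<omega>\<in>space M. \<not> (\<forall>\<^sub>F k in sequentially. \<bar>(\<Sum>j<k. \<xi> j \<omega>) / k\<bar> \<le> 2 * l)}"
    have Bm[measurable]: "B \<in> sets M" unfolding B_def eventually_sequentially by measurable
    \<comment> \<open>The left side does not depend on m, while the right side tends to 0 by
      \<open>L1\<close>; hence \<open>B\<close> is null.\<close>
    have "prob B \<le> 2 * (\<integral>\<omega>. \<bar>(\<Sum>j<m. \<xi> j \<omega>) / m\<bar> \<partial>M) / l" if m: "m \<ge> 1" for m :: nat
    proof -
      define \<eta> where "\<eta> k \<omega> = (1 / m) * (\<Sum>i<m. \<xi> (k + i) \<omega>)" for k \<omega>
      have st': "stationary_seq M \<eta>" using stationary_seq_moving_sum[OF st, of "1/m" m 0] by (simp add: \<eta>_def[abs_def])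
      have [measurable]: "\<eta> k \<in> borel_measurable M" for k unfolding \<eta>_def by measurable
      have "AE \<omega> in M. \<omega> \<in> B \<longrightarrow> \<omega> \<in> {\<omega>\<in>space M. \<exists>k\<ge>1. \<bar>\<Sum>j<k. \<eta> j \<omega>\<bar> > l * k}"
        using small AE_space
      proof eventually_elim
        case (elim \<omega>)
        show ?case
        proof
          assume B: "\<omega> \<in> B"
          have "(\<lambda>k. (1 / m) * (\<Sum>i<m. ((\<Sum>j<k. \<xi> (j + i) \<omega>) - (\<Sum>j<k. \<xi> j \<omega>)) / real k)) \<longlonglongrightarrow> (1 / m) * (\<Sum>i<m. 0)"
            by (intro tendsto_mult tendsto_const tendsto_sum shifted_averages_tendsto elim)
          moreover have "(1 / m) * (\<Sum>i<m. ((\<Sum>j<k. \<xi> (j + i) \<omega>) - (\<Sum>j<k. \<xi> j \<omega>)) / real k) = ((\<Sum>j<k. \<eta> j \<omega>) - (\<Sum>j<k. \<xi> j \<omega>)) / real k" for k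
          proof -
            have "(\<Sum>j<k. \<eta> j \<omega>) = (1 / m) * (\<Sum>i<m. \<Sum>j<k. \<xi> (j + i) \<omega>)"
              unfolding \<eta>_def sum_distrib_left[symmetric] by (subst sum.swap) simp
            moreover have "(1 / m) * (\<Sum>i<m. \<Sum>j<k. \<xi> j \<omega>) = (\<Sum>j<k. \<xi> j \<omega>)" using m by simp
            ultimately show ?thesis using m by (simp add: sum_divide_distrib[symmetric] sum_subtractf diff_divide_distrib)
          qed
          ultimately have "(\<lambda>k. ((\<Sum>j<k. \<eta> j \<omega>) - (\<Sum>j<k. \<xi> j \<omega>)) / real k) \<longlonglongrightarrow> 0" by simp
          then have "\<forall>\<^sub>F k in sequentially. \<bar>((\<Sum>j<k. \<eta> j \<omega>) - (\<Sum>j<k. \<xi> j \<omega>)) / real k\<bar> < l"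
            using l by (auto simp: tendsto_iff dist_real_def)
          moreover have "\<exists>\<^sub>F k in sequentially. \<not> (\<bar>(\<Sum>j<k. \<xi> j \<omega>) / k\<bar> \<le> 2 * l)" using B by (simp add: B_def frequently_def)
          moreover have "\<forall>\<^sub>F k in sequentially. k \<ge> (1::nat)" by (rule eventually_ge_at_top)
          ultimately have "\<exists>\<^sub>F k in sequentially. \<not> (\<bar>(\<Sum>j<k. \<xi> j \<omega>) / k\<bar> \<le> 2 * l) \<and> (\<bar>((\<Sum>j<k. \<eta> j \<omega>) - (\<Sum>j<k. \<xi> j \<omega>)) / real k\<bar> < l \<and> k \<ge> 1)"
            by (intro frequently_eventually_frequently eventually_conj)
          then obtain k where k: "\<not> (\<bar>(\<Sum>j<k. \<xi> j \<omega>) / k\<bar> \<le> 2 * l)" "\<bar>((\<Sum>j<k. \<eta> j \<omega>) - (\<Sum>j<k. \<xi> j \<omega>)) / real k\<bar> < l" "k \<ge> 1"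
            by (auto dest: frequently_ex)
          \<comment> \<open>An average of \<open>\<xi>\<close> above 2 l and a gap below l leave an
            average of \<open>\<eta>\<close> above l.\<close>
          then have "\<bar>(\<Sum>j<k. \<eta> j \<omega>) / real k\<bar> > l" unfolding diff_divide_distrib by linarith
          then have "\<bar>\<Sum>j<k. \<eta> j \<omega>\<bar> > l * k" using k by (simp add: pos_less_divide_eq)
          then show "\<omega> \<in> {\<omega>\<in>space M. \<exists>k\<ge>1. \<bar>\<Sum>j<k. \<eta> j \<omega>\<bar> > l * k}" using k elim by auto
        qed
      qed
      then have "prob B \<le> prob {\<omega>\<in>space M. \<exists>k\<ge>1. \<bar>\<Sum>j<k. \<eta> j \<omega>\<bar> > l * k}"
        by (intro finite_measure_mono_AE) auto
      also have "\<dots> \<le> 2 * (\<integral>\<omega>. \<bar>\<eta> 0 \<omega>\<bar> \<partial>M) / l" by (rule maximal_inequality[OF st' l])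
      finally show ?thesis by (simp add: \<eta>_def)
    qed
    moreover have "(\<lambda>m. 2 * (\<integral>\<omega>. \<bar>(\<Sum>j<m. \<xi> j \<omega>) / m\<bar> \<partial>M) / l) \<longlonglongrightarrow> 2 * 0 / l"
      using l by (intro tendsto_intros L1) auto
    ultimately have "prob B \<le> 2 * 0 / l" by (intro LIMSEQ_le_const) auto
    then have "prob B = 0" by (simp add: measure_le_0_iff)
    then have "AE \<omega> in M. \<omega> \<notin> B" by (simp add: prob_eq_0)
    then show ?thesis using AE_space by eventually_elim (auto simp: B_def)
  qed
  have "AE \<omega> in M. \<forall>n. \<forall>\<^sub>F k in sequentially. \<bar>(\<Sum>j<k. \<xi> j \<omega>) / k\<bar> \<le> 2 * (1 / real (Suc n))"
    unfolding AE_all_countable by (intro allI key) simp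
  then show ?thesis
  proof eventually_elim
    case (elim \<omega>)
    show ?case unfolding tendsto_iff
    proof (intro allI impI)
      fix e :: real assume "e > 0"
      then obtain n where n: "1 / real (Suc n) < e / 2" using nat_approx_posE[of "e/2"] by auto
      show "\<forall>\<^sub>F k in sequentially. dist ((\<Sum>j<k. \<xi> j \<omega>) / k) 0 < e"
        using elim[rule_format, of n] by eventually_elim (use n in \<open>auto simp: dist_real_def\<close>)
    qed
  qed
qed

subsection \<open>Stationary Gaussian processes with atomless spectrum\<close>

text \<open>Bounded second moments over a finite index measure make the square integrable on the
  product space, from which everything follows. The double integral of covariances is the variance
  computation for time averages; the last bound is Cauchy-Schwarz in the index.\<close>

lemma square_integral_Fubini:
  fixes Z :: "'b \<Rightarrow> 'a \<Rightarrow> real"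
  assumes N: "finite_measure N" and M: "finite_measure M"
    and Z[measurable]: "(\<lambda>(s, \<omega>). Z s \<omega>) \<in> borel_measurable (N \<Otimes>\<^sub>M M)"
    and Z2: "\<And>s. s \<in> space N \<Longrightarrow> integrable M (\<lambda>\<omega>. (Z s \<omega>)\<^sup>2)"
    and K: "\<And>s. s \<in> space N \<Longrightarrow> (\<integral>\<omega>. (Z s \<omega>)\<^sup>2 \<partial>M) \<le> K"
  shows "AE \<omega> in M. integrable N (\<lambda>s. (Z s \<omega>)\<^sup>2)"
    "AE \<omega> in M. integrable N (\<lambda>s. Z s \<omega>)"
    "integrable M (\<lambda>\<omega>. (\<integral>s. Z s \<omega> \<partial>N)\<^sup>2)"
    "(\<integral>\<omega>. (\<integral>s. Z s \<omega> \<partial>N)\<^sup>2 \<partial>M) = (\<integral>s. (\<integral>t. (\<integral>\<omega>. Z s \<omega> * Z t \<omega> \<partial>M) \<partial>N) \<partial>N)"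
    "integrable (N \<Otimes>\<^sub>M M) (\<lambda>(s, \<omega>). Z s \<omega>)"
    "(\<integral>\<omega>. (\<integral>s. Z s \<omega> \<partial>N)\<^sup>2 \<partial>M) \<le> measure N (space N) * (\<integral>s. (\<integral>\<omega>. (Z s \<omega>)\<^sup>2 \<partial>M) \<partial>N)"
proof -
  interpret N: finite_measure N by fact
  interpret M: finite_measure M by fact
  interpret NM: pair_sigma_finite N M ..
  have Zs[measurable]: "Z s \<in> borel_measurable M" if "s \<in> space N" for s
    using measurable_compose[OF measurable_Pair1'[OF that] Z] by simp
  have Z\<omega>[measurable]: "(\<lambda>s. Z s \<omega>) \<in> borel_measurable N" if "\<omega> \<in> space M" for \<omega>
    using measurable_compose[OF measurable_Pair2'[OF that] Z] by simp
  have int2: "integrable (N \<Otimes>\<^sub>M M) (\<lambda>(s, \<omega>). (Z s \<omega>)\<^sup>2)"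
  proof (rule NM.Fubini_integrable)
    show "(\<lambda>(s, \<omega>). (Z s \<omega>)\<^sup>2) \<in> borel_measurable (N \<Otimes>\<^sub>M M)" by measurable
    show "integrable N (\<lambda>s. \<integral>\<omega>. norm (case (s, \<omega>) of (s, \<omega>) \<Rightarrow> (Z s \<omega>)\<^sup>2) \<partial>M)"
    proof (rule N.integrable_const_bound)
      show "AE s in N. norm (\<integral>\<omega>. norm (case (s, \<omega>) of (s, \<omega>) \<Rightarrow> (Z s \<omega>)\<^sup>2) \<partial>M) \<le> K" using K by (auto intro!: AE_I2)
      show "(\<lambda>s. \<integral>\<omega>. norm (case (s, \<omega>) of (s, \<omega>) \<Rightarrow> (Z s \<omega>)\<^sup>2) \<partial>M) \<in> borel_measurable N" by measurable
    qed
  qed (use Z2 in auto)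
  interpret f: finite_measure "N \<Otimes>\<^sub>M M" by (rule finite_measure_pair_measure; fact)
  show "integrable (N \<Otimes>\<^sub>M M) (\<lambda>(s, \<omega>). Z s \<omega>)"
    by (rule f.square_integrable_imp_integrable) (use int2 in \<open>simp_all add: case_prod_unfold\<close>)
  show AE2: "AE \<omega> in M. integrable N (\<lambda>s. (Z s \<omega>)\<^sup>2)" using NM.AE_integrable_snd[OF int2] by simp
  show AE1: "AE \<omega> in M. integrable N (\<lambda>s. Z s \<omega>)"
    using AE2 AE_space by eventually_elim (auto intro: N.square_integrable_imp_integrable)
  define G where "G \<omega> = (\<integral>s. Z s \<omega> \<partial>N)" for \<omega>
  have [measurable]: "G \<in> borel_measurable M" unfolding G_def by measurable
  define c where "c = measure N (space N)"
  have Gm: "(\<lambda>\<omega>. (\<integral>s. Z s \<omega> \<partial>N)\<^sup>2) \<in> borel_measurable M" by measurable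
  have ic: "integrable M (\<lambda>\<omega>. c * (\<integral>s. (Z s \<omega>)\<^sup>2 \<partial>N))" using NM.integrable_snd[OF int2] by simp
  have le: "AE \<omega> in M. (\<integral>s. Z s \<omega> \<partial>N)\<^sup>2 \<le> c * (\<integral>s. (Z s \<omega>)\<^sup>2 \<partial>N)"
    using AE2 AE_space
  proof eventually_elim
    case (elim \<omega>)
    have "\<bar>\<integral>s. Z s \<omega> * 1 \<partial>N\<bar> \<le> sqrt (\<integral>s. (Z s \<omega>)\<^sup>2 \<partial>N) * sqrt (\<integral>s. 1\<^sup>2 \<partial>N)"
      by (rule Cauchy_Schwarz_integral(2)) (use elim in auto)
    then have "(\<integral>s. Z s \<omega> \<partial>N)\<^sup>2 \<le> (sqrt (\<integral>s. (Z s \<omega>)\<^sup>2 \<partial>N) * sqrt c)\<^sup>2" by (intro abs_le_square_iff[THEN iffD1]) (simp add: c_def)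
    also have "\<dots> = c * (\<integral>s. (Z s \<omega>)\<^sup>2 \<partial>N)" by (simp add: power_mult_distrib c_def)
    finally show ?case .
  qed
  show G2: "integrable M (\<lambda>\<omega>. (\<integral>s. Z s \<omega> \<partial>N)\<^sup>2)"
    by (rule Bochner_Integration.integrable_bound[OF ic Gm]) (use le in \<open>auto elim!: eventually_mono simp: c_def\<close>)
  have "(\<integral>\<omega>. (\<integral>s. Z s \<omega> \<partial>N)\<^sup>2 \<partial>M) \<le> (\<integral>\<omega>. c * (\<integral>s. (Z s \<omega>)\<^sup>2 \<partial>N) \<partial>M)" by (rule integral_mono_AE[OF G2 ic le])
  also have "\<dots> = c * (\<integral>s. (\<integral>\<omega>. (Z s \<omega>)\<^sup>2 \<partial>M) \<partial>N)" using NM.Fubini_integral[OF int2] by simp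
  finally show "(\<integral>\<omega>. (\<integral>s. Z s \<omega> \<partial>N)\<^sup>2 \<partial>M) \<le> measure N (space N) * (\<integral>s. (\<integral>\<omega>. (Z s \<omega>)\<^sup>2 \<partial>M) \<partial>N)" by (simp only: c_def)
  have ZZ: "integrable (N \<Otimes>\<^sub>M M) (\<lambda>(t, \<omega>). U \<omega> * Z t \<omega>)" if [measurable]: "U \<in> borel_measurable M" and U: "integrable M (\<lambda>\<omega>. (U \<omega>)\<^sup>2)" for U
  proof -
    have "integrable (N \<Otimes>\<^sub>M M) (\<lambda>(t, \<omega>). (U \<omega>)\<^sup>2)"
      using NM.integrable_product_mult[of "\<lambda>_. 1" "\<lambda>\<omega>. (U \<omega>)\<^sup>2"] U by simp
    then have "integrable (N \<Otimes>\<^sub>M M) (\<lambda>p. U (snd p) * Z (fst p) (snd p))"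
      using int2 by (intro integrable_mult_of_squares) (auto simp: case_prod_unfold)
    then show ?thesis by (simp add: case_prod_unfold)
  qed
  have G2': "integrable M (\<lambda>\<omega>. (G \<omega>)\<^sup>2)" using G2 by (simp add: G_def)
  \<comment> \<open>One factor of the square is kept as a fixed random variable \<open>G\<close>:
    Fubini is applied twice on \<open>N\<close> times \<open>M\<close> instead of once on a triple
    product.\<close>
  have "(\<integral>\<omega>. (\<integral>s. Z s \<omega> \<partial>N)\<^sup>2 \<partial>M) = (\<integral>\<omega>. (\<integral>s. G \<omega> * Z s \<omega> \<partial>N) \<partial>M)"
    by (simp add: G_def power2_eq_square)
  also have "\<dots> = (\<integral>s. (\<integral>\<omega>. G \<omega> * Z s \<omega> \<partial>M) \<partial>N)" by (rule NM.Fubini_integral[OF ZZ]) (use G2' in auto)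
  also have "\<dots> = (\<integral>s. (\<integral>t. (\<integral>\<omega>. Z s \<omega> * Z t \<omega> \<partial>M) \<partial>N) \<partial>N)"
  proof (rule Bochner_Integration.integral_cong[OF refl])
    fix s assume s: "s \<in> space N"
    have "(\<integral>\<omega>. G \<omega> * Z s \<omega> \<partial>M) = (\<integral>\<omega>. (\<integral>t. Z s \<omega> * Z t \<omega> \<partial>N) \<partial>M)"
      by (simp add: G_def mult.commute)
    also have "\<dots> = (\<integral>t. (\<integral>\<omega>. Z s \<omega> * Z t \<omega> \<partial>M) \<partial>N)"
      by (rule NM.Fubini_integral[OF ZZ]) (use Z2 s in auto)
    finally show "(\<integral>\<omega>. G \<omega> * Z s \<omega> \<partial>M) = (\<integral>t. (\<integral>\<omega>. Z s \<omega> * Z t \<omega> \<partial>M) \<partial>N)" .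
  qed
  finally show "(\<integral>\<omega>. (\<integral>s. Z s \<omega> \<partial>N)\<^sup>2 \<partial>M) = (\<integral>s. (\<integral>t. (\<integral>\<omega>. Z s \<omega> * Z t \<omega> \<partial>M) \<partial>N) \<partial>N)" .
qed

text \<open>Rounds times to finitely many values. Integrals over time then become finite linear
  combinations, for which Gaussianity and stationarity are available; the bound 2 |s| supplies
  domination in the limit.\<close>

lemma simple_approximation_of_identity:
  obtains d :: "nat \<Rightarrow> real \<Rightarrow> real" where "\<And>N. d N \<in> borel_measurable borel" "\<And>N. finite (range (d N))"
    "\<And>s. (\<lambda>N. d N s) \<longlonglongrightarrow> s" "\<And>N s. \<bar>d N s\<bar> \<le> 2 * \<bar>s\<bar>"
proof -
  have "(\<lambda>s::real. s) \<in> borel_measurable borel" by simp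
  from borel_measurable_implies_sequence_metric[OF this, of 0]
  obtain d :: "nat \<Rightarrow> real \<Rightarrow> real" where d: "\<And>N. simple_function borel (d N)" "\<And>s. (\<lambda>N. d N s) \<longlonglongrightarrow> s" "\<And>N s. dist (d N s) 0 \<le> 2 * dist s 0"
    by auto
  show ?thesis
  proof (rule that[of d])
    show "d N \<in> borel_measurable borel" for N using d(1) by (rule borel_measurable_simple_function)
    show "finite (range (d N))" for N using d(1)[of N] by (simp add: simple_function_def)
  qed (use d in \<open>auto simp: dist_real_def\<close>)
qed

text \<open>The weights of the finite sum are the integrals of \<open>h\<close> over the level sets
  of \<open>d\<close>; they depend on \<open>h\<close> and \<open>d\<close> but not on
  \<open>\<phi>\<close>, so they serve for random variables and for exponentials alike.\<close>

lemma integral_simple_composition: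
  fixes h :: "'b \<Rightarrow> real" and d :: "'b \<Rightarrow> real" and \<phi> :: "real \<Rightarrow> 'c :: {banach, second_countable_topology}"
  assumes h: "integrable N h" and d[measurable]: "d \<in> borel_measurable N" and D: "finite D" "\<And>s. d s \<in> D"
  shows "integrable N (\<lambda>s. h s *\<^sub>R \<phi> (d s))"
    "(\<integral>s. h s *\<^sub>R \<phi> (d s) \<partial>N) = (\<Sum>x\<in>D. (\<integral>s. h s * indicator {x} (d s) \<partial>N) *\<^sub>R \<phi> x)"
proof -
  have e: "h s *\<^sub>R \<phi> (d s) = (\<Sum>x\<in>D. (h s * indicator {x} (d s)) *\<^sub>R \<phi> x)" for s
  proof -
    have "(\<Sum>x\<in>D. (h s * indicator {x} (d s)) *\<^sub>R \<phi> x) = (\<Sum>x\<in>D. if d s = x then h s *\<^sub>R \<phi> x else 0)"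
      by (intro sum.cong) (auto split: split_indicator)
    then show ?thesis using D by simp
  qed
  have i: "integrable N (\<lambda>s. h s * indicator {x} (d s))" for x
    using h by (rule Bochner_Integration.integrable_bound) (use h in \<open>auto split: split_indicator\<close>)
  show "integrable N (\<lambda>s. h s *\<^sub>R \<phi> (d s))" unfolding e using i by simp
  show "(\<integral>s. h s *\<^sub>R \<phi> (d s) \<partial>N) = (\<Sum>x\<in>D. (\<integral>s. h s * indicator {x} (d s) \<partial>N) *\<^sub>R \<phi> x)"
    unfolding e using i by simp
qed

section \<open>Wiener's lemma for an atomless measure\<close>

lemma integral_cos_symmetric:
  fixes z T :: real
  shows "z \<noteq> 0 \<Longrightarrow> T \<ge> 0 \<Longrightarrow> ((\<lambda>x. cos (x * z)) has_integral (2 * sin (T * z) / z)) {-T..T}"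
proof -
  assume z: "z \<noteq> 0" and T: "T \<ge> 0"
  have "((\<lambda>x. cos (x * z)) has_integral (sin (T * z) / z - sin (- T * z) / z)) {-T..T}"
  proof (rule fundamental_theorem_of_calculus)
    fix x
    have "((\<lambda>x. sin (x * z) / z) has_real_derivative cos (x * z)) (at x)"
      using z by (auto intro!: derivative_eq_intros)
    then show "((\<lambda>x. sin (x * z) / z) has_vector_derivative cos (x * z)) (at x within {- T..T})"
      by (simp add: has_real_derivative_iff_has_vector_derivative[symmetric] has_field_derivative_at_within)
  qed (use T in auto)
  then show ?thesis by simp
qed

lemma finite_measure_lborel_restrict: "finite_measure (restrict_space lborel {a..b::real})" "finite_measure (restrict_space lborel {a..<b::real})"
  by (rule finite_measureI, cases "a \<le> b", simp_all add: emeasure_restrict_space emeasure_lborel_Icc_eq)+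

lemma integrable_bounded_restrict:
  fixes f :: "real \<Rightarrow> real"
  assumes "f \<in> borel_measurable borel" "\<And>x. \<bar>f x\<bar> \<le> K"
  shows "integrable (restrict_space lborel {a..b}) f"
  by (rule finite_measure.integrable_const_bound[OF finite_measure_lborel_restrict(1), of _ K])
     (use assms in \<open>auto intro!: measurable_restrict_space1\<close>)

locale atomless_measure = m: finite_measure m for m :: "real measure" +
  assumes sets_m[measurable_cong]: "sets m = sets borel"
    and atoms: "\<And>u. emeasure m {u} = 0"
begin

text \<open>The product of cosines is half the sum of two cosines with frequencies u - v and u + v,
  whose integrals over {-n..n} stay bounded unless the frequency is 0. The bound 2 is the length 2 n
  divided by n; at n = 0 the quotient is 0 by convention.\<close>

lemma Wiener_kernel:
  "\<bar>(\<integral>x. cos (x * u) * cos (x * v) \<partial>restrict_space lborel {- real n..n}) / n\<bar> \<le> 2"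
  "u \<noteq> v \<Longrightarrow> u \<noteq> - v \<Longrightarrow> (\<lambda>n. (\<integral>x. cos (x * u) * cos (x * v) \<partial>restrict_space lborel {- real n..n}) / n) \<longlonglongrightarrow> 0"
proof -
  interpret L: finite_measure "restrict_space lborel {- real n..real n}" for n by (rule finite_measure_lborel_restrict)
  have c1: "\<bar>cos (x * u) * cos (x * v)\<bar> \<le> 1" for x :: real
    unfolding abs_mult by (intro mult_le_one) auto
  have "\<bar>\<integral>x. cos (x * u) * cos (x * v) \<partial>restrict_space lborel {- real n..n}\<bar> \<le> (\<integral>x. \<bar>cos (x * u) * cos (x * v)\<bar> \<partial>restrict_space lborel {- real n..n})"
    by (rule integral_abs_bound)
  also have "\<dots> \<le> (\<integral>x. 1 \<partial>restrict_space lborel {- real n..n})"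
    using c1 by (intro integral_mono integrable_abs integrable_bounded_restrict[where K=1]) auto
  also have "\<dots> = 2 * real n" by (simp add: measure_restrict_space)
  finally show "\<bar>(\<integral>x. cos (x * u) * cos (x * v) \<partial>restrict_space lborel {- real n..n}) / n\<bar> \<le> 2"
    by (cases "n = 0") (auto simp: divide_le_eq)
  have S: "(\<integral>x. cos (x * z) \<partial>restrict_space lborel {- real n..n}) = 2 * sin (n * z) / z" if "z \<noteq> 0" for z :: real and n :: nat
  proof -
    have i: "integrable (restrict_space lborel {- real n..real n}) (\<lambda>x. cos (x * z))" by (rule integrable_bounded_restrict[where K=1]) auto
    then have si: "set_integrable lborel {- real n..n} (\<lambda>x. cos (x * z))"
      by (subst (asm) integrable_restrict_space) (auto simp: set_integrable_def)
    show ?thesis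
      using set_borel_integral_eq_integral(2)[OF si] integral_cos_symmetric[OF that, of "real n"]
      by (subst integral_restrict_space) (auto simp: set_lebesgue_integral_def integral_unique)
  qed
  assume uv: "u \<noteq> v" "u \<noteq> - v"
  have e: "(\<integral>x. cos (x * u) * cos (x * v) \<partial>restrict_space lborel {- real n..n}) / n = (sin (n * (u - v)) / (u - v) + sin (n * (u + v)) / (u + v)) / n" for n :: nat
  proof -
    have i: "integrable (restrict_space lborel {- real n..real n}) (\<lambda>x. cos (x * z))" for z by (rule integrable_bounded_restrict[where K=1]) auto
    have "(\<integral>x. cos (x * u) * cos (x * v) \<partial>restrict_space lborel {- real n..n}) =
       (\<integral>x. (cos (x * (u - v)) + cos (x * (u + v))) / 2 \<partial>restrict_space lborel {- real n..n})"
      by (simp add: cos_times_cos algebra_simps)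
    also have "\<dots> = (2 * sin (n * (u - v)) / (u - v) + 2 * sin (n * (u + v)) / (u + v)) / 2"
      using S[of "u - v" n] S[of "u + v" n] uv i by (simp add: add_eq_0_iff)
    also have "\<dots> = sin (n * (u - v)) / (u - v) + sin (n * (u + v)) / (u + v)"
    proof -
      have "(2 * a / c + 2 * b / d) / 2 = a / c + b / d" for a b c d :: real by (simp add: add_divide_distrib)
      then show ?thesis .
    qed
    finally show ?thesis by simp
  qed
  show "(\<lambda>n. (\<integral>x. cos (x * u) * cos (x * v) \<partial>restrict_space lborel {- real n..n}) / n) \<longlonglongrightarrow> 0"
    unfolding e
  proof (rule Lim_null_comparison)
    show "(\<lambda>n. (1 / \<bar>u - v\<bar> + 1 / \<bar>u + v\<bar>) / real n) \<longlonglongrightarrow> 0" by (rule lim_const_over_n)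
    have "\<bar>sin (n * (u - v)) / (u - v) + sin (n * (u + v)) / (u + v)\<bar> \<le> 1 / \<bar>u - v\<bar> + 1 / \<bar>u + v\<bar>" for n :: nat
      by (rule order_trans[OF abs_triangle_ineq]) (auto intro!: add_mono divide_right_mono simp: abs_divide)
    then show "\<forall>\<^sub>F n in sequentially. norm ((sin (n * (u - v)) / (u - v) + sin (n * (u + v)) / (u + v)) / real n) \<le> (1 / \<bar>u - v\<bar> + 1 / \<bar>u + v\<bar>) / real n"
      by (auto simp: abs_divide intro!: always_eventually divide_right_mono)
  qed
qed

text \<open>Covariance function of a real stationary process with spectral measure \<open>m\<close>,
  as \<open>covariance_Y\<close> shows below.\<close>

definition fourier_cos :: "real \<Rightarrow> real" where "fourier_cos x = (\<integral>u. cos (x * u) \<partial>m)"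

lemma fourier_cos_bound: "\<bar>fourier_cos x\<bar> \<le> measure m (space m)"
proof -
  have "\<bar>fourier_cos x\<bar> \<le> (\<integral>u. \<bar>cos (x * u)\<bar> \<partial>m)" unfolding fourier_cos_def by (rule integral_abs_bound)
  also have "\<dots> \<le> (\<integral>u. 1 \<partial>m)" by (intro integral_mono m.integrable_const_bound[where B=1]) auto
  finally show ?thesis by simp
qed

lemma fourier_cos_measurable[measurable]: "fourier_cos \<in> borel_measurable borel"
  unfolding fourier_cos_def[abs_def] by measurable

lemma fourier_cos_tendsto: "x \<longlonglongrightarrow> 0 \<Longrightarrow> (\<lambda>n. fourier_cos (x n)) \<longlonglongrightarrow> measure m (space m)"
proof -
  assume x: "x \<longlonglongrightarrow> 0"
  have "(\<lambda>n. \<integral>u. cos (x n * u) \<partial>m) \<longlonglongrightarrow> (\<integral>u. 1 \<partial>m)"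
  proof (rule integral_dominated_convergence[where w="\<lambda>_. 1"])
    show "AE u in m. (\<lambda>n. cos (x n * u)) \<longlonglongrightarrow> 1"
    proof (rule AE_I2)
      fix u have "(\<lambda>n. cos (x n * u)) \<longlonglongrightarrow> cos (0 * u)" by (intro tendsto_intros x)
      then show "(\<lambda>n. cos (x n * u)) \<longlonglongrightarrow> 1" by simp
    qed
  qed auto
  then show ?thesis by (simp add: fourier_cos_def)
qed

text \<open>Writing the square as a double integral over \<open>m\<close> turns its average into an
  integral of the kernel \<open>k n u v\<close>, bounded by 2. For fixed u the kernel tends to 0
  except at v = u and v = -u, two points without mass.\<close>

lemma Wiener: "(\<lambda>n. (\<integral>x. (fourier_cos x)\<^sup>2 \<partial>restrict_space lborel {- real n..n}) / n) \<longlonglongrightarrow> 0"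
proof -
  define L where "L n = restrict_space lborel {- real n..real n}" for n :: nat
  interpret L: finite_measure "L n" for n unfolding L_def by (rule finite_measure_lborel_restrict)
  interpret Lm: pair_sigma_finite "L n" m for n ..
  interpret Lmf: finite_measure "L n \<Otimes>\<^sub>M m" for n by (rule finite_measure_pair_measure) unfold_locales
  have [measurable_cong]: "sets (L n) = sets (restrict_space borel {- real n..real n})" for n by (simp add: L_def sets_restrict_space)
  have Lb[measurable (raw)]: "f \<in> borel_measurable borel \<Longrightarrow> f \<in> borel_measurable (L n)" for f :: "real \<Rightarrow> real" and n
    unfolding L_def by (intro measurable_restrict_space1) simp
  have fstm: "(\<lambda>p. fst p) \<in> borel_measurable (L n \<Otimes>\<^sub>M m)" for n
    by (rule measurable_compose[OF measurable_fst Lb]) simp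
  have sndm: "(\<lambda>p. snd p) \<in> borel_measurable (L n \<Otimes>\<^sub>M m)" for n by measurable
  define k where "k n u v = (\<integral>x. cos (x * u) * cos (x * v) \<partial>L n) / n" for n u v
  have int: "integrable (L n \<Otimes>\<^sub>M m) (\<lambda>(x, u). f x * cos (x * u))" if [measurable]: "f \<in> borel_measurable borel" and f: "\<And>x. \<bar>f x\<bar> \<le> K" for f K n
  proof (rule Lmf.integrable_const_bound[where B=K])
    have "(\<lambda>p. f (fst p) * cos (fst p * snd p)) \<in> borel_measurable (L n \<Otimes>\<^sub>M m)"
      using fstm sndm by measurable
    then show "(\<lambda>(x, u). f x * cos (x * u)) \<in> borel_measurable (L n \<Otimes>\<^sub>M m)" by (simp add: split_beta)
    have "\<bar>f x * cos (x * u)\<bar> \<le> K" for x u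
      using mult_mono[OF f[of x], of "\<bar>cos (x * u)\<bar>" 1] f[of x] by (simp add: abs_mult order_trans[OF abs_ge_zero f])
    then show "AE p in L n \<Otimes>\<^sub>M m. norm (case p of (x, u) \<Rightarrow> f x * cos (x * u)) \<le> K" by auto
  qed
  have inner: "(\<integral>x. fourier_cos x * cos (x * u) \<partial>L n) / n = (\<integral>v. k n u v \<partial>m)" for n u
  proof -
    have "(\<integral>x. fourier_cos x * cos (x * u) \<partial>L n) = (\<integral>x. (\<integral>v. cos (x * u) * cos (x * v) \<partial>m) \<partial>L n)"
      by (simp add: fourier_cos_def mult.commute)
    also have "\<dots> = (\<integral>v. (\<integral>x. cos (x * u) * cos (x * v) \<partial>L n) \<partial>m)"
      using Lm.Fubini_integral[OF int[of "\<lambda>x. cos (x * u)" 1 n]] by simp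
    finally show ?thesis by (simp add: k_def)
  qed
  have outer: "(\<integral>x. (fourier_cos x)\<^sup>2 \<partial>L n) / n = (\<integral>u. (\<integral>x. fourier_cos x * cos (x * u) \<partial>L n) / n \<partial>m)" for n
  proof -
    have "(\<integral>x. (fourier_cos x)\<^sup>2 \<partial>L n) = (\<integral>x. (\<integral>u. fourier_cos x * cos (x * u) \<partial>m) \<partial>L n)"
      by (simp add: power2_eq_square fourier_cos_def[symmetric])
    also have "\<dots> = (\<integral>u. (\<integral>x. fourier_cos x * cos (x * u) \<partial>L n) \<partial>m)"
      using Lm.Fubini_integral[OF int[of "fourier_cos" "measure m (space m)" n]] fourier_cos_bound by simp
    finally show ?thesis by simp
  qed
  have km: "(\<lambda>v. k n u v) \<in> borel_measurable m" for n u
    using borel_measurable_integrable[OF Lm.integrable_snd[OF int[of "\<lambda>x. cos (x * u)" 1 n]]]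
    unfolding k_def by simp
  have km2: "(\<lambda>u. \<integral>v. k n u v \<partial>m) \<in> borel_measurable m" for n
    using borel_measurable_integrable[OF Lm.integrable_snd[OF int[of fourier_cos "measure m (space m)" n]]] fourier_cos_bound
    unfolding inner[symmetric] by simp
  have kb: "\<bar>k n u v\<bar> \<le> 2" for n u v unfolding k_def L_def by (rule Wiener_kernel)
  have AEne: "AE v in m. v \<noteq> u \<and> v \<noteq> - u" for u
  proof -
    have "AE v in m. v \<noteq> w" for w
      using atoms[of w] by (intro AE_I'[of "{w}"]) (auto simp: null_sets_def sets_m)
    then show ?thesis using eventually_conj by blast
  qed
  have g0: "(\<lambda>n. \<integral>v. k n u v \<partial>m) \<longlonglongrightarrow> 0" for u
  proof -
    have "(\<lambda>n. \<integral>v. k n u v \<partial>m) \<longlonglongrightarrow> (\<integral>v. 0 \<partial>m)"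
    proof (rule integral_dominated_convergence[where w="\<lambda>_. 2"])
      show "AE v in m. (\<lambda>n. k n u v) \<longlonglongrightarrow> 0"
        using AEne[of u]
      proof eventually_elim
        case (elim v)
        then show ?case unfolding k_def L_def by (intro Wiener_kernel) auto
      qed
    qed (use km kb in auto)
    then show ?thesis by simp
  qed
  have "(\<lambda>n. \<integral>u. (\<integral>v. k n u v \<partial>m) \<partial>m) \<longlonglongrightarrow> (\<integral>u. 0 \<partial>m)"
  proof (rule integral_dominated_convergence[where w="\<lambda>_. 2 * measure m (space m)"])
    have "\<bar>\<integral>v. k n u v \<partial>m\<bar> \<le> 2 * measure m (space m)" for n u
    proof -
      have "\<bar>\<integral>v. k n u v \<partial>m\<bar> \<le> (\<integral>v. \<bar>k n u v\<bar> \<partial>m)" by (rule integral_abs_bound)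
      also have "\<dots> \<le> (\<integral>v. 2 \<partial>m)" using kb km by (intro integral_mono m.integrable_const_bound[where B=2]) auto
      finally show ?thesis by simp
    qed
    then show "AE u in m. norm (\<integral>v. k n u v \<partial>m) \<le> 2 * measure m (space m)" for n by simp
  qed (use g0 km2 in auto)
  then show ?thesis unfolding L_def[symmetric] outer inner by simp
qed

text \<open>Cauchy-Schwarz passes from squares to absolute values, the form that the covariance of
  the process itself calls for.\<close>

lemma Wiener_abs: "(\<lambda>n. (\<integral>x. \<bar>fourier_cos x\<bar> \<partial>restrict_space lborel {- real n..n}) / n) \<longlonglongrightarrow> 0"
proof (rule Lim_null_comparison)
  define L where "L n = restrict_space lborel {- real n..real n}" for n :: nat
  have "(\<integral>x. \<bar>fourier_cos x\<bar> \<partial>L n) / n \<le> sqrt (2 * ((\<integral>x. (fourier_cos x)\<^sup>2 \<partial>L n) / n))" if n: "n > 0" for n :: nat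
  proof -
    interpret L: finite_measure "L n" unfolding L_def by (rule finite_measure_lborel_restrict)
    have [measurable]: "fourier_cos \<in> borel_measurable (L n)" unfolding L_def by (rule measurable_restrict_space1) simp
    have "integrable (L n) (\<lambda>x. (fourier_cos x)\<^sup>2)"
    proof -
      have "\<bar>(fourier_cos x)\<^sup>2\<bar> \<le> (measure m (space m))\<^sup>2" for x
        using power_mono[OF fourier_cos_bound[of x], of 2] by simp
      then show ?thesis unfolding L_def by (intro integrable_bounded_restrict) auto
    qed
    then have "(\<integral>x. \<bar>fourier_cos x * 1\<bar> \<partial>L n) \<le> sqrt (\<integral>x. (fourier_cos x)\<^sup>2 \<partial>L n) * sqrt (\<integral>x. 1\<^sup>2 \<partial>L n)"
      by (intro Cauchy_Schwarz_integral(1)) auto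
    also have "(\<integral>x. 1\<^sup>2 \<partial>L n) = 2 * real n" by (simp add: L_def measure_restrict_space)
    finally have "(\<integral>x. \<bar>fourier_cos x\<bar> \<partial>L n) / n \<le> sqrt (\<integral>x. (fourier_cos x)\<^sup>2 \<partial>L n) * sqrt (2 * real n) / n"
      by (simp add: divide_right_mono)
    also have "\<dots> = sqrt (2 * ((\<integral>x. (fourier_cos x)\<^sup>2 \<partial>L n) / n))"
    proof -
      have "real n = sqrt n * sqrt n" by simp
      then show ?thesis using n by (simp add: real_sqrt_mult real_sqrt_divide field_simps)
    qed
    finally show ?thesis .
  qed
  then show "\<forall>\<^sub>F n in sequentially. norm ((\<integral>x. \<bar>fourier_cos x\<bar> \<partial>restrict_space lborel {- real n..n}) / n)
    \<le> sqrt (2 * ((\<integral>x. (fourier_cos x)\<^sup>2 \<partial>restrict_space lborel {- real n..n}) / n))"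
    unfolding L_def by (intro eventually_mono[OF eventually_gt_at_top[of 0]]) (auto simp: abs_divide)
  have "(\<lambda>n. sqrt (2 * ((\<integral>x. (fourier_cos x)\<^sup>2 \<partial>restrict_space lborel {- real n..n}) / n))) \<longlonglongrightarrow> sqrt (2 * 0)"
    by (intro tendsto_intros Wiener)
  then show "(\<lambda>n. sqrt (2 * ((\<integral>x. (fourier_cos x)\<^sup>2 \<partial>restrict_space lborel {- real n..n}) / n))) \<longlonglongrightarrow> 0" by simp
qed

end

section \<open>Gaussian stationary processes and their time averages\<close>

text \<open>The covariance is encoded by the isometry between linear combinations of
  \<open>Y\<close> and trigonometric sums in L2(m). Stationarity is derived from it: a time shift
  multiplies the sums by a factor of modulus 1.\<close>

locale gaussian_stationary = prob_space M + atomless_measure m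
  for M :: "'a measure" and m :: "real measure" +
  fixes Y :: "real \<Rightarrow> 'a \<Rightarrow> real"
  assumes Y_joint: "(\<lambda>(t, \<omega>). Y t \<omega>) \<in> borel_measurable (borel \<Otimes>\<^sub>M M)"
    and gauss: "\<And>I a. finite I \<Longrightarrow> gaussian_char M (\<lambda>\<omega>. \<Sum>t\<in>I. a t * Y t \<omega>)"
    and mean_zero: "\<And>t. (\<integral>\<omega>. Y t \<omega> \<partial>M) = 0"
    and second_moment: "\<And>I a. finite I \<Longrightarrow> (\<integral>\<omega>. (\<Sum>t\<in>I. a t * Y t \<omega>)\<^sup>2 \<partial>M) =
        (\<integral>u. (cmod (\<Sum>t\<in>I. complex_of_real (a t) * iexp (t * u)))\<^sup>2 \<partial>m)"
begin

definition total where "total = measure m (space m)"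

lemma Y_measurable[measurable (raw)]:
  "f \<in> borel_measurable N \<Longrightarrow> g \<in> measurable N M \<Longrightarrow> (\<lambda>x. Y (f x) (g x)) \<in> borel_measurable N"
  using measurable_compose[OF measurable_Pair Y_joint, of f N g] by simp

lemma two_point:
  "gaussian_char M (\<lambda>\<omega>. a * Y s \<omega> + b * Y t \<omega>)"
  "(\<integral>\<omega>. (a * Y s \<omega> + b * Y t \<omega>)\<^sup>2 \<partial>M) = (a\<^sup>2 + b\<^sup>2) * total + 2 * a * b * fourier_cos (s - t)"
proof -
  have ic: "integrable m (\<lambda>u. cos (x * u))" for x by (intro m.integrable_const_bound[where B=1]) auto
  have k: "(cmod (complex_of_real a * iexp (s * u) + complex_of_real b * iexp (t * u)))\<^sup>2 = (a\<^sup>2 + b\<^sup>2) + 2 * a * b * cos ((s - t) * u)" for u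
  proof -
    have "(cmod (complex_of_real a * iexp (s * u) + complex_of_real b * iexp (t * u)))\<^sup>2 =
       (a * cos (s * u) + b * cos (t * u))\<^sup>2 + (a * sin (s * u) + b * sin (t * u))\<^sup>2"
      by (simp add: cmod_power2 Re_exp Im_exp)
    also have "\<dots> = a\<^sup>2 * ((cos (s * u))\<^sup>2 + (sin (s * u))\<^sup>2) + b\<^sup>2 * ((cos (t * u))\<^sup>2 + (sin (t * u))\<^sup>2)
        + 2 * a * b * (cos (s * u) * cos (t * u) + sin (s * u) * sin (t * u))"
    proof -
      have "(a * c + b * c')\<^sup>2 + (a * d + b * d')\<^sup>2 = a\<^sup>2 * (c\<^sup>2 + d\<^sup>2) + b\<^sup>2 * (c'\<^sup>2 + d'\<^sup>2) + 2 * a * b * (c * c' + d * d')"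
        for c c' d d' :: real by (simp add: power2_eq_square algebra_simps)
      then show ?thesis .
    qed
    also have "\<dots> = (a\<^sup>2 + b\<^sup>2) + 2 * a * b * cos ((s - t) * u)"
      by (simp add: left_diff_distrib cos_diff)
    finally show ?thesis .
  qed
  \<comment> \<open>An index set cannot list the same time twice, so s = t is treated with the
    single coefficient a + b.\<close>
  have "gaussian_char M (\<lambda>\<omega>. a * Y s \<omega> + b * Y t \<omega>) \<and> (\<integral>\<omega>. (a * Y s \<omega> + b * Y t \<omega>)\<^sup>2 \<partial>M) =
      (\<integral>u. (cmod (complex_of_real a * iexp (s * u) + complex_of_real b * iexp (t * u)))\<^sup>2 \<partial>m)"
  proof (cases "s = t")
    case True
    have "(\<lambda>\<omega>. a * Y s \<omega> + b * Y t \<omega>) = (\<lambda>\<omega>. \<Sum>x\<in>{t}. (a + b) * Y x \<omega>)" using True by (simp add: algebra_simps)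
    then show ?thesis using gauss[of "{t}" "\<lambda>_. a + b"] second_moment[of "{t}" "\<lambda>_. a + b"] True by (simp add: algebra_simps)
  next
    case False
    then show ?thesis using gauss[of "{s, t}" "\<lambda>x. if x = s then a else b"] second_moment[of "{s, t}" "\<lambda>x. if x = s then a else b"]
      by simp
  qed
  then show "gaussian_char M (\<lambda>\<omega>. a * Y s \<omega> + b * Y t \<omega>)"
    "(\<integral>\<omega>. (a * Y s \<omega> + b * Y t \<omega>)\<^sup>2 \<partial>M) = (a\<^sup>2 + b\<^sup>2) * total + 2 * a * b * fourier_cos (s - t)"
  proof -
    have "(\<integral>u. (a\<^sup>2 + b\<^sup>2) + 2 * a * b * cos ((s - t) * u) \<partial>m) = (a\<^sup>2 + b\<^sup>2) * total + 2 * a * b * fourier_cos (s - t)"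
      using ic[of "s - t"] by (subst Bochner_Integration.integral_add) (auto simp: total_def fourier_cos_def)
    moreover assume "gaussian_char M (\<lambda>\<omega>. a * Y s \<omega> + b * Y t \<omega>) \<and> (\<integral>\<omega>. (a * Y s \<omega> + b * Y t \<omega>)\<^sup>2 \<partial>M) =
      (\<integral>u. (cmod (complex_of_real a * iexp (s * u) + complex_of_real b * iexp (t * u)))\<^sup>2 \<partial>m)"
    ultimately show "gaussian_char M (\<lambda>\<omega>. a * Y s \<omega> + b * Y t \<omega>)"
      "(\<integral>\<omega>. (a * Y s \<omega> + b * Y t \<omega>)\<^sup>2 \<partial>M) = (a\<^sup>2 + b\<^sup>2) * total + 2 * a * b * fourier_cos (s - t)"
      unfolding k by auto
  qed
qed

lemma square_integrable_Y: "integrable M (\<lambda>\<omega>. (Y t \<omega>)\<^sup>2)" "(\<integral>\<omega>. (Y t \<omega>)\<^sup>2 \<partial>M) = total"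
  using two_point[of 1 t 0 t] by (auto simp: gaussian_char_def)

lemma fourth_moment: "integrable M (\<lambda>\<omega>. (a * Y s \<omega> + b * Y t \<omega>) ^ 4)"
  "(\<integral>\<omega>. (a * Y s \<omega> + b * Y t \<omega>) ^ 4 \<partial>M) = 3 * ((a\<^sup>2 + b\<^sup>2) * total + 2 * a * b * fourier_cos (s - t))\<^sup>2"
proof -
  have "integrable M (Y t)" for t by (rule square_integrable_imp_integrable) (use square_integrable_Y[of t] in auto)
  then have "(\<integral>\<omega>. a * Y s \<omega> + b * Y t \<omega> \<partial>M) = 0" using mean_zero by simp
  from gaussian_char_fourth_moment[OF two_point(1) this]
  show "integrable M (\<lambda>\<omega>. (a * Y s \<omega> + b * Y t \<omega>) ^ 4)"
    "(\<integral>\<omega>. (a * Y s \<omega> + b * Y t \<omega>) ^ 4 \<partial>M) = 3 * ((a\<^sup>2 + b\<^sup>2) * total + 2 * a * b * fourier_cos (s - t))\<^sup>2"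
    by (simp_all add: two_point(2))
qed

lemma covariance_Y: "(\<integral>\<omega>. Y s \<omega> * Y t \<omega> \<partial>M) = fourier_cos (s - t)"
proof -
  have "(\<integral>\<omega>. (1 * Y s \<omega> + 1 * Y t \<omega>)\<^sup>2 \<partial>M) = (\<integral>\<omega>. (Y s \<omega>)\<^sup>2 + (Y t \<omega>)\<^sup>2 + 2 * (Y s \<omega> * Y t \<omega>) \<partial>M)"
    by (simp add: power2_sum mult.assoc)
  also have "\<dots> = total + total + 2 * (\<integral>\<omega>. Y s \<omega> * Y t \<omega> \<partial>M)"
    using square_integrable_Y integrable_mult_of_squares[of "Y s" M "Y t"] by simp
  finally show ?thesis unfolding two_point by simp
qed

text \<open>Polarization of the fourth moments (a case of Isserlis' theorem).\<close>
lemma covariance_square: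
  "integrable M (\<lambda>\<omega>. ((Y t \<omega>)\<^sup>2 - total)\<^sup>2)"
  "(\<integral>\<omega>. ((Y s \<omega>)\<^sup>2 - total) * ((Y t \<omega>)\<^sup>2 - total) \<partial>M) = 2 * (fourier_cos (s - t))\<^sup>2"
proof -
  have i4: "integrable M (\<lambda>\<omega>. ((Y t \<omega>)\<^sup>2)\<^sup>2)" for t using fourth_moment(1)[of 1 t 0 t] by simp
  show "integrable M (\<lambda>\<omega>. ((Y t \<omega>)\<^sup>2 - total)\<^sup>2)" using i4 by (rule_tac integrable_square_diff) auto
  have i22: "integrable M (\<lambda>\<omega>. (Y s \<omega>)\<^sup>2 * (Y t \<omega>)\<^sup>2)" using i4 by (intro integrable_mult_of_squares) auto
  \<comment> \<open>The coefficients 1, 0 and -1 are written out to match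
    \<open>fourth_moment\<close> term by term.\<close>
  have pol: "a\<^sup>2 * b\<^sup>2 = ((1 * a + 1 * b) ^ 4 + (1 * a + (-1) * b) ^ 4 - 2 * (1 * a + 0 * b) ^ 4 - 2 * (0 * a + 1 * b) ^ 4) / 12" for a b :: real
    by (simp add: power2_eq_square power4_eq_xxxx algebra_simps)
  have "(\<integral>\<omega>. (Y s \<omega>)\<^sup>2 * (Y t \<omega>)\<^sup>2 \<partial>M) = total\<^sup>2 + 2 * (fourier_cos (s - t))\<^sup>2"
    unfolding pol using fourth_moment[of 1 s 1 t] fourth_moment[of 1 s "-1" t] fourth_moment[of 1 s 0 t] fourth_moment[of 0 s 1 t]
    by (simp add: power2_eq_square algebra_simps)
  moreover have "(\<integral>\<omega>. ((Y s \<omega>)\<^sup>2 - total) * ((Y t \<omega>)\<^sup>2 - total) \<partial>M) =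
      (\<integral>\<omega>. (Y s \<omega>)\<^sup>2 * (Y t \<omega>)\<^sup>2 - total * (Y s \<omega>)\<^sup>2 - total * (Y t \<omega>)\<^sup>2 + total\<^sup>2 \<partial>M)"
    by (simp add: power2_eq_square algebra_simps)
  moreover have "\<dots> = (\<integral>\<omega>. (Y s \<omega>)\<^sup>2 * (Y t \<omega>)\<^sup>2 \<partial>M) - total\<^sup>2"
    using i22 square_integrable_Y by (simp add: prob_space power2_eq_square)
  ultimately show "(\<integral>\<omega>. ((Y s \<omega>)\<^sup>2 - total) * ((Y t \<omega>)\<^sup>2 - total) \<partial>M) = 2 * (fourier_cos (s - t))\<^sup>2" by simp
qed

lemma increment_square: "(\<integral>\<omega>. (Y s \<omega> - Y t \<omega>)\<^sup>2 \<partial>M) = 2 * total - 2 * fourier_cos (s - t)"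
  using two_point(2)[of 1 s "-1" t] by simp

text \<open>The characteristic function of a linear combination depends only on the spectral
  integral of a squared modulus, and the shift by 1 contributes the factor \<open>iexp u\<close> of
  modulus 1. Cramer-Wold lifts this to the joint law.\<close>

lemma law_shift:
  assumes I: "finite I"
  shows "distr M (PiM I (\<lambda>_. borel)) (\<lambda>\<omega>. \<lambda>t\<in>I. Y t \<omega>) = distr M (PiM I (\<lambda>_. borel)) (\<lambda>\<omega>. \<lambda>t\<in>I. Y (t + 1) \<omega>)"
proof (rule Cramer_Wold[OF I])
  fix a :: "real \<Rightarrow> real"
  have iY: "integrable M (Y t)" for t by (rule square_integrable_imp_integrable) (use square_integrable_Y[of t] in auto)
  have ch: "(\<integral>\<omega>. iexp (\<Sum>t\<in>J. b t * Y t \<omega>) \<partial>M) =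
      complex_of_real (exp (- (\<integral>u. (cmod (\<Sum>t\<in>J. complex_of_real (b t) * iexp (t * u)))\<^sup>2 \<partial>m) / 2))" if J: "finite J" for J b
  proof -
    have zero: "(\<integral>\<omega>. (\<Sum>t\<in>J. b t * Y t \<omega>) \<partial>M) = 0" using iY mean_zero by simp
    define Z where "Z \<omega> = (\<Sum>t\<in>J. b t * Y t \<omega>)" for \<omega>
    have "gaussian_char M Z" unfolding Z_def by (rule gauss[OF J])
    then have "(\<integral>\<omega>. iexp (1 * Z \<omega>) \<partial>M) = iexp (1 * (\<integral>\<omega>. Z \<omega> \<partial>M)) *
        complex_of_real (exp (- (1\<^sup>2 * ((\<integral>\<omega>. (Z \<omega>)\<^sup>2 \<partial>M) - (\<integral>\<omega>. Z \<omega> \<partial>M)\<^sup>2)) / 2))"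
      unfolding gaussian_char_def by blast
    moreover have "(\<integral>\<omega>. Z \<omega> \<partial>M) = 0" using zero by (simp only: Z_def)
    ultimately have "(\<integral>\<omega>. iexp (Z \<omega>) \<partial>M) = complex_of_real (exp (- (\<integral>\<omega>. (Z \<omega>)\<^sup>2 \<partial>M) / 2))" by simp
    then show ?thesis unfolding Z_def second_moment[OF J, of b] .
  qed
  define J where "J = (\<lambda>t. t + 1) ` I"
  have reix: "(\<Sum>t\<in>J. f t) = (\<Sum>t\<in>I. f (t + 1))" for f :: "real \<Rightarrow> 'z :: comm_monoid_add"
    unfolding J_def by (subst sum.reindex) (auto simp: inj_on_def)
  have "(\<integral>\<omega>. iexp (\<Sum>t\<in>I. a t * Y (t + 1) \<omega>) \<partial>M) = (\<integral>\<omega>. iexp (\<Sum>t\<in>J. a (t - 1) * Y t \<omega>) \<partial>M)"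
    unfolding reix by simp
  also have "\<dots> = complex_of_real (exp (- (\<integral>u. (cmod (\<Sum>t\<in>J. complex_of_real (a (t - 1)) * iexp (t * u)))\<^sup>2 \<partial>m) / 2))"
    using I by (intro ch) (simp add: J_def)
  also have "(\<lambda>u. (cmod (\<Sum>t\<in>J. complex_of_real (a (t - 1)) * iexp (t * u)))\<^sup>2) = (\<lambda>u. (cmod (\<Sum>t\<in>I. complex_of_real (a t) * iexp (t * u)))\<^sup>2)"
  proof
    fix u
    have "(\<Sum>t\<in>J. complex_of_real (a (t - 1)) * iexp (t * u)) = iexp u * (\<Sum>t\<in>I. complex_of_real (a t) * iexp (t * u))"
      unfolding reix by (simp add: sum_distrib_left exp_add distrib_left distrib_right mult_ac)
    then show "(cmod (\<Sum>t\<in>J. complex_of_real (a (t - 1)) * iexp (t * u)))\<^sup>2 = (cmod (\<Sum>t\<in>I. complex_of_real (a t) * iexp (t * u)))\<^sup>2"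
      by (simp add: norm_mult)
  qed
  finally show "(\<integral>\<omega>. iexp (\<Sum>t\<in>I. a t * Y t \<omega>) \<partial>M) = (\<integral>\<omega>. iexp (\<Sum>t\<in>I. a t * Y (t + 1) \<omega>) \<partial>M)"
    using ch[OF I, of a] by simp
qed measurable

text \<open>A test function that is Lipschitz in the first n entries sees \<open>Y\<close> only at
  the finitely many times in \<open>I\<close>, so equality of the finite-dimensional laws
  applies.\<close>

lemma stationary_finite_sum:
  assumes D: "finite D" and F[measurable]: "F \<in> borel_measurable borel" and Fi: "\<And>t. integrable M (\<lambda>\<omega>. F (Y t \<omega>))"
  shows "stationary_seq M (\<lambda>k \<omega>. \<Sum>x\<in>D. c x * F (Y (real k + x) \<omega>))"
  unfolding stationary_seq_def
proof (intro conjI allI impI)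
  show "integrable M (\<lambda>\<omega>. \<Sum>x\<in>D. c x * F (Y (real k + x) \<omega>))" for k using Fi by simp
  fix n L and \<Phi> :: "(nat \<Rightarrow> real) \<Rightarrow> real"
  assume \<Phi>: "\<Phi> \<in> borel_measurable (PiM UNIV (\<lambda>_. borel))" "\<forall>x y. \<bar>\<Phi> x - \<Phi> y\<bar> \<le> L * (\<Sum>j<n. \<bar>x j - y j\<bar>)"
  define I where "I = (\<lambda>(k, x). real k + x) ` ({..<n} \<times> D)"
  have I: "finite I" unfolding I_def using D by simp
  have Imem: "real k + x \<in> I" if "k < n" "x \<in> D" for k x
    unfolding I_def using that by (auto intro!: image_eqI[where x="(k, x)"])
  define \<Psi> where "\<Psi> y = \<Phi> (\<lambda>k. if k < n then \<Sum>x\<in>D. c x * F (y (real k + x)) else 0)" for y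
  have "(\<lambda>y k. if k < n then \<Sum>x\<in>D. c x * F (y (real k + x)) else 0) \<in> measurable (PiM I (\<lambda>_. borel)) (PiM UNIV (\<lambda>_. borel))"
  proof (rule measurable_PiM_single')
    fix k
    show "(\<lambda>y. if k < n then \<Sum>x\<in>D. c x * F (y (real k + x)) else 0) \<in> borel_measurable (PiM I (\<lambda>_. borel))"
    proof (cases "k < n")
      case True
      have [measurable]: "(\<lambda>y. y (real k + x)) \<in> borel_measurable (PiM I (\<lambda>_. borel))" if "x \<in> D" for x
        using Imem[OF True that] by (rule measurable_component_singleton)
      show ?thesis using True by simp
    qed simp
  qed (auto simp: space_PiM)
  from measurable_compose[OF this \<Phi>(1)] have \<Psi>m: "\<Psi> \<in> borel_measurable (PiM I (\<lambda>_. borel))" unfolding \<Psi>_def .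
  \<comment> \<open>The Lipschitz bound sums over j < n, hence \<open>\<Phi>\<close> ignores all
    later entries.\<close>
  have dep: "\<Phi> (\<lambda>k. if k < n then x k else 0) = \<Phi> x" for x
  proof -
    have "\<bar>\<Phi> (\<lambda>k. if k < n then x k else 0) - \<Phi> x\<bar> \<le> L * (\<Sum>j<n. \<bar>(if j < n then x j else 0) - x j\<bar>)" using \<Phi>(2) by blast
    also have "\<dots> = 0" by simp
    finally show ?thesis by simp
  qed
  have ev: "(\<integral>\<omega>. \<Phi> (\<lambda>k. \<Sum>x\<in>D. c x * F (Y (real k + x + h) \<omega>)) \<partial>M) = (\<integral>y. \<Psi> y \<partial>distr M (PiM I (\<lambda>_. borel)) (\<lambda>\<omega>. \<lambda>t\<in>I. Y (t + h) \<omega>))" for h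
  proof -
    have "(\<integral>y. \<Psi> y \<partial>distr M (PiM I (\<lambda>_. borel)) (\<lambda>\<omega>. \<lambda>t\<in>I. Y (t + h) \<omega>)) = (\<integral>\<omega>. \<Psi> (\<lambda>t\<in>I. Y (t + h) \<omega>) \<partial>M)"
      by (rule integral_distr[OF _ \<Psi>m]) (rule measurable_restrict, measurable)
    also have "\<dots> = (\<integral>\<omega>. \<Phi> (\<lambda>k. \<Sum>x\<in>D. c x * F (Y (real k + x + h) \<omega>)) \<partial>M)"
    proof (rule Bochner_Integration.integral_cong[OF refl])
      fix \<omega>
      have "\<Psi> (\<lambda>t\<in>I. Y (t + h) \<omega>) = \<Phi> (\<lambda>k. if k < n then \<Sum>x\<in>D. c x * F (Y (real k + x + h) \<omega>) else 0)"
        unfolding \<Psi>_def using Imem by (intro arg_cong[where f=\<Phi>] ext) (auto intro!: sum.cong)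
      then show "\<Psi> (\<lambda>t\<in>I. Y (t + h) \<omega>) = \<Phi> (\<lambda>k. \<Sum>x\<in>D. c x * F (Y (real k + x + h) \<omega>))" using dep by simp
    qed
    finally show ?thesis by simp
  qed
  have sh: "real k + x + 1 = real (Suc k) + x" for k x by simp
  have "(\<integral>\<omega>. \<Phi> (\<lambda>k. \<Sum>x\<in>D. c x * F (Y (real k + x) \<omega>)) \<partial>M) = (\<integral>\<omega>. \<Phi> (\<lambda>k. \<Sum>x\<in>D. c x * F (Y (real k + x + 1) \<omega>)) \<partial>M)"
    using ev[of 0] ev[of 1] law_shift[OF I] by simp
  then show "(\<integral>\<omega>. \<Phi> (\<lambda>k. \<Sum>x\<in>D. c x * F (Y (real k + x) \<omega>)) \<partial>M) = (\<integral>\<omega>. \<Phi> (\<lambda>k. \<Sum>x\<in>D. c x * F (Y (real (Suc k) + x) \<omega>)) \<partial>M)"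
    unfolding sh .
qed

text \<open>Common core for the averages of \<open>Y\<close> and of its centred square.
  \<open>cov\<close> and \<open>W\<close> give the variance of the average a vanishing bound;
  \<open>Lip\<close> gives the continuity in mean that lets stationarity pass from finite sums to
  integrals over unit blocks.\<close>

lemma functional_average:
  fixes F \<rho> :: "real \<Rightarrow> real" and C K :: real
  assumes F[measurable]: "F \<in> borel_measurable borel"
    and F2: "\<And>t. integrable M (\<lambda>\<omega>. (F (Y t \<omega>))\<^sup>2)"
    and Lip: "\<And>s t. (\<integral>\<omega>. \<bar>F (Y s \<omega>) - F (Y t \<omega>)\<bar> \<partial>M) \<le> C * sqrt (\<integral>\<omega>. (Y s \<omega> - Y t \<omega>)\<^sup>2 \<partial>M)"
    and cov: "\<And>s t. (\<integral>\<omega>. F (Y s \<omega>) * F (Y t \<omega>) \<partial>M) = \<rho> (s - t)"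
    and \<rho>[measurable]: "\<rho> \<in> borel_measurable borel" and K: "\<And>x. \<bar>\<rho> x\<bar> \<le> K"
    and W: "(\<lambda>n. (\<integral>x. \<bar>\<rho> x\<bar> \<partial>restrict_space lborel {- real n..n}) / n) \<longlonglongrightarrow> 0"
  shows "AE \<omega> in M. (\<lambda>n. (\<integral>s. F (Y s \<omega>) \<partial>restrict_space lborel {0..<real n}) / n) \<longlonglongrightarrow> 0"
    "(\<lambda>n. \<integral>\<omega>. ((\<integral>s. F (Y s \<omega>) \<partial>restrict_space lborel {0..<real n}) / n)\<^sup>2 \<partial>M) \<longlonglongrightarrow> 0"
    "\<And>n. integrable M (\<lambda>\<omega>. ((\<integral>s. F (Y s \<omega>) \<partial>restrict_space lborel {0..<real n}) / n)\<^sup>2)"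
    "AE \<omega> in M. \<forall>n. integrable (restrict_space lborel {0..<real n}) (\<lambda>s. F (Y s \<omega>))"
proof -
  define L where "L n = restrict_space lborel {0..<real n}" for n :: nat
  have Lfin: "finite_measure (L n)" for n unfolding L_def by (rule finite_measure_lborel_restrict)
  interpret L: finite_measure "L n" for n by (rule Lfin)
  have Lm[measurable (raw)]: "f \<in> borel_measurable borel \<Longrightarrow> f \<in> borel_measurable (L n)" for f :: "real \<Rightarrow> real" and n
    unfolding L_def by (intro measurable_restrict_space1) simp
  have rho0: "(\<integral>\<omega>. (F (Y t \<omega>))\<^sup>2 \<partial>M) = \<rho> 0" for t using cov[of t t] by (simp add: power2_eq_square)
  have joint: "(\<lambda>(s, \<omega>). F (Y (g s) \<omega>)) \<in> borel_measurable (L n \<Otimes>\<^sub>M M)" if g: "g \<in> borel_measurable borel" for g n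
  proof -
    have [measurable]: "(\<lambda>p. g (fst p)) \<in> borel_measurable (L n \<Otimes>\<^sub>M M)"
      by (rule measurable_compose[OF measurable_fst Lm[OF g]])
    show ?thesis unfolding case_prod_unfold by measurable
  qed
  note Fub = square_integral_Fubini[OF Lfin finite_measure_axioms joint F2, where K="\<rho> 0"]
  define S where "S n \<omega> = (\<integral>s. F (Y s \<omega>) \<partial>L n)" for n \<omega>
  have idm: "(\<lambda>s::real. s) \<in> borel_measurable borel" by simp
  have S2: "integrable M (\<lambda>\<omega>. (S n \<omega>)\<^sup>2)" "(\<integral>\<omega>. (S n \<omega>)\<^sup>2 \<partial>M) = (\<integral>s. (\<integral>t. \<rho> (s - t) \<partial>L n) \<partial>L n)"
     "AE \<omega> in M. integrable (L n) (\<lambda>s. F (Y s \<omega>))" for n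
    using Fub[OF idm] rho0 unfolding S_def cov by auto
  have [measurable]: "S n \<in> borel_measurable M" for n
    unfolding S_def using joint[OF idm, of n] by measurable
  show "AE \<omega> in M. \<forall>n. integrable (restrict_space lborel {0..<real n}) (\<lambda>s. F (Y s \<omega>))"
    using S2(3) unfolding L_def[symmetric] AE_all_countable by blast
  show "integrable M (\<lambda>\<omega>. ((\<integral>s. F (Y s \<omega>) \<partial>restrict_space lborel {0..<real n}) / n)\<^sup>2)" for n
    using S2(1)[of n] unfolding L_def[symmetric] S_def[symmetric] by (simp add: power_divide)
  \<comment> \<open>For s in {0..<n} the difference s - t stays in {-n..n}, so the inner integral is
    at most \<open>R\<close>; the outer one contributes the factor n, and division by n^2 leaves R /
    n.\<close>
  have ES: "(\<integral>\<omega>. (S n \<omega> / n)\<^sup>2 \<partial>M) \<le> (\<integral>x. \<bar>\<rho> x\<bar> \<partial>restrict_space lborel {- real n..n}) / n" for n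
  proof -
    define R where "R = (\<integral>x. \<bar>\<rho> x\<bar> \<partial>restrict_space lborel {- real n..n})"
    have inner: "\<bar>\<integral>t. \<rho> (s - t) \<partial>L n\<bar> \<le> R" if s: "s \<in> {0..<real n}" for s
    proof -
      have "\<bar>\<integral>t. \<rho> (s - t) \<partial>L n\<bar> \<le> (\<integral>t. \<bar>\<rho> (s - t)\<bar> \<partial>L n)" by (rule integral_abs_bound)
      also have "\<dots> = (\<integral>t. indicator {0..<real n} t * \<bar>\<rho> (s - t)\<bar> \<partial>lborel)"
        unfolding L_def by (subst integral_restrict_space) auto
      also have "\<dots> = (\<integral>x. indicator {0..<real n} (s + (-1) * x) * \<bar>\<rho> (s - (s + (-1) * x))\<bar> \<partial>lborel)"
        by (subst lborel_integral_real_affine[where c="-1" and t=s]) auto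
      also have "\<dots> \<le> (\<integral>x. indicator {- real n..n} x * \<bar>\<rho> x\<bar> \<partial>lborel)"
      proof (rule integral_mono)
        have b: "integrable lborel (\<lambda>x. indicator {- real n..n} x * \<bar>\<rho> x\<bar>)"
        proof -
          have "integrable (restrict_space lborel {- real n..n}) (\<lambda>x. \<bar>\<rho> x\<bar>)"
            by (rule integrable_bounded_restrict[where K=K]) (use K in auto)
          then show ?thesis by (subst (asm) integrable_restrict_space) auto
        qed
        then show "integrable lborel (\<lambda>x. indicator {- real n..n} x * \<bar>\<rho> x\<bar>)" .
        show "integrable lborel (\<lambda>x. indicator {0..<real n} (s + (-1) * x) * \<bar>\<rho> (s - (s + (-1) * x))\<bar>)"
          by (rule Bochner_Integration.integrable_bound[OF b]) (use s in \<open>auto split: split_indicator\<close>)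
      qed (use s in \<open>auto split: split_indicator\<close>)
      also have "\<dots> = R" unfolding R_def by (subst integral_restrict_space) auto
      finally show ?thesis .
    qed
    have "(\<integral>\<omega>. (S n \<omega>)\<^sup>2 \<partial>M) \<le> (\<integral>s. R \<partial>L n)"
      unfolding S2
    proof (rule integral_mono)
      have meas: "(\<lambda>s. \<integral>t. \<rho> (s - t) \<partial>L n) \<in> borel_measurable borel"
      proof -
        have [measurable]: "(\<lambda>p. snd p) \<in> borel_measurable (borel \<Otimes>\<^sub>M L n)"
          by (rule measurable_compose[OF measurable_snd Lm]) simp
        show ?thesis by measurable
      qed
      show "integrable (L n) (\<lambda>s. \<integral>t. \<rho> (s - t) \<partial>L n)"
      proof (rule L.integrable_const_bound[where B=R])
        show "AE s in L n. norm (\<integral>t. \<rho> (s - t) \<partial>L n) \<le> R"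
          by (rule AE_I2) (use inner in \<open>auto simp: L_def\<close>)
      qed (rule Lm[OF meas])
      show "(\<integral>t. \<rho> (s - t) \<partial>L n) \<le> R" if "s \<in> space (L n)" for s
        using inner[of s] that by (auto simp: L_def)
    qed simp
    also have "\<dots> = n * R" by (simp add: L_def measure_restrict_space)
    finally have "(\<integral>\<omega>. (S n \<omega>)\<^sup>2 \<partial>M) / (real n)\<^sup>2 \<le> n * R / (real n)\<^sup>2" by (rule divide_right_mono) simp
    also have "\<dots> = R / n" by (simp add: power2_eq_square)
    finally show ?thesis by (simp add: R_def power_divide)
  qed
  have lim2: "(\<lambda>n. \<integral>\<omega>. (S n \<omega> / n)\<^sup>2 \<partial>M) \<longlonglongrightarrow> 0"
    by (rule Lim_null_comparison[OF _ W]) (use ES in auto)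
  then show "(\<lambda>n. \<integral>\<omega>. ((\<integral>s. F (Y s \<omega>) \<partial>restrict_space lborel {0..<real n}) / n)\<^sup>2 \<partial>M) \<longlonglongrightarrow> 0"
    unfolding L_def[symmetric] S_def[symmetric] .
  \<comment> \<open>Integrals over unit blocks: they add up to \<open>S n\<close> and form the
    stationary sequence to which \<open>ergodic_AE\<close> is applied.\<close>
  define \<xi> where "\<xi> k \<omega> = (\<integral>s. F (Y (real k + s) \<omega>) \<partial>L 1)" for k :: nat and \<omega>
  have km: "(\<lambda>s. real k + s) \<in> borel_measurable borel" for k by simp
  have [measurable]: "\<xi> k \<in> borel_measurable M" for k
    unfolding \<xi>_def using joint[OF km, of k 1] by measurable
  have \<xi>2: "integrable M (\<lambda>\<omega>. (\<xi> k \<omega>)\<^sup>2)" "(\<integral>\<omega>. (\<xi> k \<omega>)\<^sup>2 \<partial>M) = (\<integral>s. (\<integral>t. \<rho> (s - t) \<partial>L 1) \<partial>L 1)" for k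
    using Fub[OF km] rho0 unfolding \<xi>_def cov by auto
  have Fi: "integrable M (\<lambda>\<omega>. F (Y t \<omega>))" for t by (rule square_integrable_imp_integrable) (use F2 in auto)
  have st: "stationary_seq M \<xi>"
  proof -
    \<comment> \<open>The time inside a block is rounded to finitely many values; the resulting
      finite sums are stationary and converge in L1.\<close>
    obtain d :: "nat \<Rightarrow> real \<Rightarrow> real" where d[measurable]: "\<And>N. d N \<in> borel_measurable borel" and dfin: "\<And>N. finite (range (d N))"
      and dlim: "\<And>s. (\<lambda>N. d N s) \<longlonglongrightarrow> s"
      by (rule simple_approximation_of_identity) blast
    define \<xi>N where "\<xi>N N k \<omega> = (\<integral>s. F (Y (real k + d N s) \<omega>) \<partial>L 1)" for N k \<omega>
    have dm: "(\<lambda>s. real k + d N s) \<in> borel_measurable borel" for k N by simp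
    have sum: "\<xi>N N k \<omega> = (\<Sum>x\<in>range (d N). (\<integral>s. 1 * indicator {x} (d N s) \<partial>L 1) * F (Y (real k + x) \<omega>))" for N k \<omega>
      unfolding \<xi>N_def
      using integral_simple_composition(2)[of "L 1" "\<lambda>_. 1" "d N" "range (d N)" "\<lambda>x. F (Y (real k + x) \<omega>)"] dfin by simp
    have stN: "stationary_seq M (\<xi>N N)" for N
      unfolding sum[abs_def] by (rule stationary_finite_sum[OF dfin F Fi])
    show ?thesis
    proof (rule stationary_seq_limit[OF stN])
      show "integrable M (\<xi> k)" for k by (rule square_integrable_imp_integrable) (use \<xi>2 in auto)
      fix k
      have bound: "(\<integral>\<omega>. \<bar>\<xi>N N k \<omega> - \<xi> k \<omega>\<bar> \<partial>M) \<le> (\<integral>s. \<bar>C\<bar> * sqrt (2 * total - 2 * fourier_cos (d N s - s)) \<partial>L 1)" for N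
      proof -
        interpret LM: pair_sigma_finite "L 1" M ..
        note FN = Fub[OF dm[of k N], of 1] and F1 = Fub[OF km[of k], of 1]
        have pint: "integrable (L 1 \<Otimes>\<^sub>M M) (\<lambda>(s, \<omega>). \<bar>F (Y (real k + d N s) \<omega>) - F (Y (real k + s) \<omega>)\<bar>)"
        proof -
          have "integrable (L 1 \<Otimes>\<^sub>M M) (\<lambda>p. \<bar>(case p of (s, \<omega>) \<Rightarrow> F (Y (real k + d N s) \<omega>)) - (case p of (s, \<omega>) \<Rightarrow> F (Y (real k + s) \<omega>))\<bar>)"
            using FN(5) F1(5) rho0 by (intro integrable_abs Bochner_Integration.integrable_diff) auto
          then show ?thesis by (simp add: case_prod_unfold)
        qed
        have "(\<integral>\<omega>. \<bar>\<xi>N N k \<omega> - \<xi> k \<omega>\<bar> \<partial>M) \<le> (\<integral>\<omega>. (\<integral>s. \<bar>F (Y (real k + d N s) \<omega>) - F (Y (real k + s) \<omega>)\<bar> \<partial>L 1) \<partial>M)"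
        proof (rule integral_mono_AE)
          show "integrable M (\<lambda>\<omega>. \<bar>\<xi>N N k \<omega> - \<xi> k \<omega>\<bar>)"
          proof -
            have "integrable M (\<xi> k)" by (rule square_integrable_imp_integrable) (use \<xi>2 in auto)
            moreover have "integrable M (\<xi>N N k)" using stN[of N] by (simp add: stationary_seq_def)
            ultimately show ?thesis by simp
          qed
          show "integrable M (\<lambda>\<omega>. \<integral>s. \<bar>F (Y (real k + d N s) \<omega>) - F (Y (real k + s) \<omega>)\<bar> \<partial>L 1)"
            using LM.integrable_snd[OF pint] by simp
          have "AE \<omega> in M. integrable (L 1) (\<lambda>s. F (Y (real k + d N s) \<omega>))" "AE \<omega> in M. integrable (L 1) (\<lambda>s. F (Y (real k + s) \<omega>))"
            using FN(2) F1(2) rho0 by auto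
          then show "AE \<omega> in M. \<bar>\<xi>N N k \<omega> - \<xi> k \<omega>\<bar> \<le> (\<integral>s. \<bar>F (Y (real k + d N s) \<omega>) - F (Y (real k + s) \<omega>)\<bar> \<partial>L 1)"
          proof eventually_elim
            case (elim \<omega>)
            then show ?case unfolding \<xi>N_def \<xi>_def Bochner_Integration.integral_diff[OF elim, symmetric]
              by (intro integral_abs_bound)
          qed
        qed
        also have "\<dots> = (\<integral>s. (\<integral>\<omega>. \<bar>F (Y (real k + d N s) \<omega>) - F (Y (real k + s) \<omega>)\<bar> \<partial>M) \<partial>L 1)"
          by (rule LM.Fubini_integral[OF pint])
        also have "\<dots> \<le> (\<integral>s. \<bar>C\<bar> * sqrt (2 * total - 2 * fourier_cos (d N s - s)) \<partial>L 1)"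
        proof (rule integral_mono)
          show "integrable (L 1) (\<lambda>s. \<integral>\<omega>. \<bar>F (Y (real k + d N s) \<omega>) - F (Y (real k + s) \<omega>)\<bar> \<partial>M)"
            using LM.integrable_fst[OF pint] by simp
          have nn: "0 \<le> 2 * total - 2 * fourier_cos x" "2 * total - 2 * fourier_cos x \<le> 4 * total" for x
            using fourier_cos_bound[of x] by (auto simp: total_def abs_le_iff)
          have "norm (\<bar>C\<bar> * sqrt (2 * total - 2 * fourier_cos x)) \<le> \<bar>C\<bar> * sqrt (4 * total)" for x
            using nn[of x] by (auto simp: abs_mult intro!: mult_left_mono real_sqrt_le_mono)
          then show "integrable (L 1) (\<lambda>s. \<bar>C\<bar> * sqrt (2 * total - 2 * fourier_cos (d N s - s)))"
            by (intro L.integrable_const_bound[where B="\<bar>C\<bar> * sqrt (4 * total)"]) auto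
          fix s
          have "(\<integral>\<omega>. \<bar>F (Y (real k + d N s) \<omega>) - F (Y (real k + s) \<omega>)\<bar> \<partial>M) \<le> C * sqrt (2 * total - 2 * fourier_cos (d N s - s))"
            using Lip[of "real k + d N s" "real k + s"] unfolding increment_square by simp
          also have "\<dots> \<le> \<bar>C\<bar> * sqrt (2 * total - 2 * fourier_cos (d N s - s))"
            using nn by (intro mult_right_mono) auto
          finally show "(\<integral>\<omega>. \<bar>F (Y (real k + d N s) \<omega>) - F (Y (real k + s) \<omega>)\<bar> \<partial>M) \<le> \<bar>C\<bar> * sqrt (2 * total - 2 * fourier_cos (d N s - s))" .
        qed
        finally show ?thesis .
      qed
      \<comment> \<open>The rounding error d N s - s tends to 0 and \<open>fourier_cos\<close> tends
        to \<open>total\<close> there, so the increments of \<open>Y\<close> vanish in mean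
        square.\<close>
      have "(\<lambda>N. \<integral>s. \<bar>C\<bar> * sqrt (2 * total - 2 * fourier_cos (d N s - s)) \<partial>L 1) \<longlonglongrightarrow> (\<integral>s. 0 \<partial>L 1)"
      proof (rule integral_dominated_convergence[where w="\<lambda>_. \<bar>C\<bar> * sqrt (4 * total)"])
        have nn: "0 \<le> 2 * total - 2 * fourier_cos x" "2 * total - 2 * fourier_cos x \<le> 4 * total" for x
          using fourier_cos_bound[of x] by (auto simp: total_def abs_le_iff)
        have "norm (\<bar>C\<bar> * sqrt (2 * total - 2 * fourier_cos x)) \<le> \<bar>C\<bar> * sqrt (4 * total)" for x
          using nn[of x] by (auto simp: abs_mult intro!: mult_left_mono real_sqrt_le_mono)
        then show "AE s in L 1. norm (\<bar>C\<bar> * sqrt (2 * total - 2 * fourier_cos (d N s - s))) \<le> \<bar>C\<bar> * sqrt (4 * total)" for N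
          by blast
        show "AE s in L 1. (\<lambda>N. \<bar>C\<bar> * sqrt (2 * total - 2 * fourier_cos (d N s - s))) \<longlonglongrightarrow> 0"
        proof (rule AE_I2)
          fix s
          have "(\<lambda>N. d N s - s) \<longlonglongrightarrow> 0" using dlim[of s] by (simp add: LIM_zero_iff)
          then have "(\<lambda>N. fourier_cos (d N s - s)) \<longlonglongrightarrow> total" unfolding total_def by (rule fourier_cos_tendsto)
          then have "(\<lambda>N. \<bar>C\<bar> * sqrt (2 * total - 2 * fourier_cos (d N s - s))) \<longlonglongrightarrow> \<bar>C\<bar> * sqrt (2 * total - 2 * total)"
            by (intro tendsto_intros)
          then show "(\<lambda>N. \<bar>C\<bar> * sqrt (2 * total - 2 * fourier_cos (d N s - s))) \<longlonglongrightarrow> 0" by simp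
        qed
      qed auto
      then have "(\<lambda>N. \<integral>s. \<bar>C\<bar> * sqrt (2 * total - 2 * fourier_cos (d N s - s)) \<partial>L 1) \<longlonglongrightarrow> 0" by simp
      then show "(\<lambda>N. \<integral>\<omega>. \<bar>\<xi>N N k \<omega> - \<xi> k \<omega>\<bar> \<partial>M) \<longlonglongrightarrow> 0"
        by (rule Lim_null_comparison[rotated]) (use bound in auto)
    qed
  qed
  \<comment> \<open>Half-open intervals tile {0..<n} exactly, so the block integrals add up on every
    path for which the integrals exist.\<close>
  have sumS: "AE \<omega> in M. \<forall>n. (\<Sum>k<n. \<xi> k \<omega>) = S n \<omega>"
  proof -
    have "AE \<omega> in M. \<forall>n. integrable (L n) (\<lambda>s. F (Y s \<omega>))" using S2(3) unfolding AE_all_countable by blast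
    then show ?thesis using AE_space
    proof eventually_elim
      case (elim \<omega>)
      have [measurable]: "(\<lambda>s. F (Y s \<omega>)) \<in> borel_measurable borel" using elim(2) by measurable
      have il: "integrable lborel (\<lambda>s. indicator {0..<real n} s * F (Y s \<omega>))" for n
        using elim(1)[rule_format, of n] unfolding L_def by (subst (asm) integrable_restrict_space) auto
      have Sl: "S n \<omega> = (\<integral>s. indicator {0..<real n} s * F (Y s \<omega>) \<partial>lborel)" for n
        unfolding S_def L_def by (subst integral_restrict_space) auto
      show ?case
      proof
        fix n show "(\<Sum>k<n. \<xi> k \<omega>) = S n \<omega>"
        proof (induction n)
          case 0 then show ?case by (simp add: Sl)
        next
          case (Suc n)
          have i2: "integrable lborel (\<lambda>s. indicator {real n..<real (Suc n)} s * F (Y s \<omega>))"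
            by (rule Bochner_Integration.integrable_bound[OF il[of "Suc n"]]) (auto split: split_indicator)
          have "\<xi> n \<omega> = (\<integral>s. indicator {0..<1} s * F (Y (real n + s) \<omega>) \<partial>lborel)"
            unfolding \<xi>_def L_def by (subst integral_restrict_space) auto
          also have "\<dots> = (\<integral>s. indicator {real n..<real (Suc n)} (real n + 1 * s) * F (Y (real n + 1 * s) \<omega>) \<partial>lborel)"
            by (intro Bochner_Integration.integral_cong) (auto split: split_indicator)
          also have "\<dots> = (\<integral>s. indicator {real n..<real (Suc n)} s * F (Y s \<omega>) \<partial>lborel)"
            by (subst lborel_integral_real_affine[where c=1 and t="real n"]) auto
          finally have "(\<Sum>k<Suc n. \<xi> k \<omega>) = (\<integral>s. indicator {0..<real n} s * F (Y s \<omega>) + indicator {real n..<real (Suc n)} s * F (Y s \<omega>) \<partial>lborel)"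
            using Suc il[of n] i2 by (simp add: Sl)
          also have "\<dots> = S (Suc n) \<omega>" unfolding Sl by (intro Bochner_Integration.integral_cong) (auto split: split_indicator)
          finally show ?case .
        qed
      qed
    qed
  qed
  have "AE \<omega> in M. (\<lambda>n. (\<Sum>j<n. \<xi> j \<omega>) / n) \<longlonglongrightarrow> 0"
  proof (rule ergodic_AE[OF st \<xi>2(1)])
    show "(\<integral>\<omega>. (\<xi> k \<omega>)\<^sup>2 \<partial>M) \<le> (\<integral>s. (\<integral>t. \<rho> (s - t) \<partial>L 1) \<partial>L 1)" for k by (simp add: \<xi>2)
    have "(\<integral>\<omega>. \<bar>(\<Sum>j<n. \<xi> j \<omega>) / n\<bar> \<partial>M) \<le> sqrt (\<integral>\<omega>. (S n \<omega> / n)\<^sup>2 \<partial>M)" for n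
    proof -
      have "(\<integral>\<omega>. \<bar>(\<Sum>j<n. \<xi> j \<omega>) / n\<bar> \<partial>M) = (\<integral>\<omega>. \<bar>S n \<omega> / n\<bar> \<partial>M)"
      proof (rule integral_cong_AE)
        show "AE \<omega> in M. \<bar>(\<Sum>j<n. \<xi> j \<omega>) / n\<bar> = \<bar>S n \<omega> / n\<bar>" using sumS by (rule eventually_mono) simp
      qed measurable
      also have "\<dots> \<le> sqrt (\<integral>\<omega>. (S n \<omega> / n)\<^sup>2 \<partial>M)"
        using S2(1) by (intro abs_expectation_le_L2) (auto simp: power_divide)
      finally show ?thesis .
    qed
    note b = this
    have lim: "(\<lambda>n. sqrt (\<integral>\<omega>. (S n \<omega> / n)\<^sup>2 \<partial>M)) \<longlonglongrightarrow> 0" using tendsto_real_sqrt[OF lim2] by simp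
    show "(\<lambda>n. \<integral>\<omega>. \<bar>(\<Sum>j<n. \<xi> j \<omega>) / n\<bar> \<partial>M) \<longlonglongrightarrow> 0"
      by (rule Lim_null_comparison[OF _ lim]) (use b in auto)
  qed
  then show "AE \<omega> in M. (\<lambda>n. (\<integral>s. F (Y s \<omega>) \<partial>restrict_space lborel {0..<real n}) / n) \<longlonglongrightarrow> 0"
    using sumS by eventually_elim (simp add: L_def[symmetric] S_def[symmetric])
qed

lemma average_zero:
  "AE \<omega> in M. (\<lambda>n. (\<integral>s. Y s \<omega> \<partial>restrict_space lborel {0..<real n}) / n) \<longlonglongrightarrow> 0"
  "(\<lambda>n. \<integral>\<omega>. ((\<integral>s. Y s \<omega> \<partial>restrict_space lborel {0..<real n}) / n)\<^sup>2 \<partial>M) \<longlonglongrightarrow> 0"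
  "\<And>n. integrable M (\<lambda>\<omega>. ((\<integral>s. Y s \<omega> \<partial>restrict_space lborel {0..<real n}) / n)\<^sup>2)"
  "AE \<omega> in M. \<forall>n. integrable (restrict_space lborel {0..<real n}) (\<lambda>s. Y s \<omega>)"
proof -
  have Lip: "(\<integral>\<omega>. \<bar>Y s \<omega> - Y t \<omega>\<bar> \<partial>M) \<le> 1 * sqrt (\<integral>\<omega>. (Y s \<omega> - Y t \<omega>)\<^sup>2 \<partial>M)" for s t
    using abs_expectation_le_L2[of "\<lambda>\<omega>. Y s \<omega> - Y t \<omega>"] integrable_square_diff[of "Y s" M "Y t"] square_integrable_Y by simp
  note * = functional_average[of "\<lambda>x. x" 1 fourier_cos, OF _ square_integrable_Y(1) Lip covariance_Y fourier_cos_measurable fourier_cos_bound Wiener_abs]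
  show "AE \<omega> in M. (\<lambda>n. (\<integral>s. Y s \<omega> \<partial>restrict_space lborel {0..<real n}) / n) \<longlonglongrightarrow> 0"
    "(\<lambda>n. \<integral>\<omega>. ((\<integral>s. Y s \<omega> \<partial>restrict_space lborel {0..<real n}) / n)\<^sup>2 \<partial>M) \<longlonglongrightarrow> 0"
    "\<And>n. integrable M (\<lambda>\<omega>. ((\<integral>s. Y s \<omega> \<partial>restrict_space lborel {0..<real n}) / n)\<^sup>2)"
    "AE \<omega> in M. \<forall>n. integrable (restrict_space lborel {0..<real n}) (\<lambda>s. Y s \<omega>)"
    using * by simp_all
qed

text \<open>By \<open>covariance_square\<close> the covariance of the centred square is twice the
  square of \<open>fourier_cos\<close>, to which \<open>Wiener\<close> applies directly.\<close>

lemma average_square: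
  "AE \<omega> in M. (\<lambda>n. (\<integral>s. (Y s \<omega>)\<^sup>2 - total \<partial>restrict_space lborel {0..<real n}) / n) \<longlonglongrightarrow> 0"
  "(\<lambda>n. \<integral>\<omega>. ((\<integral>s. (Y s \<omega>)\<^sup>2 - total \<partial>restrict_space lborel {0..<real n}) / n)\<^sup>2 \<partial>M) \<longlonglongrightarrow> 0"
  "\<And>n. integrable M (\<lambda>\<omega>. ((\<integral>s. (Y s \<omega>)\<^sup>2 - total \<partial>restrict_space lborel {0..<real n}) / n)\<^sup>2)"
  "AE \<omega> in M. \<forall>n. integrable (restrict_space lborel {0..<real n}) (\<lambda>s. (Y s \<omega>)\<^sup>2 - total)"
proof -
  \<comment> \<open>The difference of squares is factored and Cauchy-Schwarz is used;
    \<open>Y s + Y t\<close> has second moment at most 4 total.\<close>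
  have Lip: "(\<integral>\<omega>. \<bar>((Y s \<omega>)\<^sup>2 - total) - ((Y t \<omega>)\<^sup>2 - total)\<bar> \<partial>M) \<le> sqrt (4 * total) * sqrt (\<integral>\<omega>. (Y s \<omega> - Y t \<omega>)\<^sup>2 \<partial>M)" for s t
  proof -
    have i: "integrable M (\<lambda>\<omega>. (Y s \<omega> + Y t \<omega>)\<^sup>2)" "integrable M (\<lambda>\<omega>. (Y s \<omega> - Y t \<omega>)\<^sup>2)"
      using square_integrable_Y by (intro integrable_square_add integrable_square_diff; simp)+
    have "(\<integral>\<omega>. (Y s \<omega> + Y t \<omega>)\<^sup>2 \<partial>M) = 2 * total + 2 * fourier_cos (s - t)" using two_point(2)[of 1 s 1 t] by simp
    also have "\<dots> \<le> 4 * total" using fourier_cos_bound[of "s - t"] by (simp add: total_def abs_le_iff)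
    finally have 4: "(\<integral>\<omega>. (Y s \<omega> + Y t \<omega>)\<^sup>2 \<partial>M) \<le> 4 * total" .
    have "(\<integral>\<omega>. \<bar>((Y s \<omega>)\<^sup>2 - total) - ((Y t \<omega>)\<^sup>2 - total)\<bar> \<partial>M) = (\<integral>\<omega>. \<bar>(Y s \<omega> + Y t \<omega>) * (Y s \<omega> - Y t \<omega>)\<bar> \<partial>M)"
      by (simp add: power2_eq_square algebra_simps)
    also have "\<dots> \<le> sqrt (\<integral>\<omega>. (Y s \<omega> + Y t \<omega>)\<^sup>2 \<partial>M) * sqrt (\<integral>\<omega>. (Y s \<omega> - Y t \<omega>)\<^sup>2 \<partial>M)"
      by (rule Cauchy_Schwarz_integral(1)) (use i in auto)
    also have "\<dots> \<le> sqrt (4 * total) * sqrt (\<integral>\<omega>. (Y s \<omega> - Y t \<omega>)\<^sup>2 \<partial>M)"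
      using 4 by (intro mult_right_mono real_sqrt_le_mono) auto
    finally show ?thesis .
  qed
  have K: "\<bar>2 * (fourier_cos x)\<^sup>2\<bar> \<le> 2 * total\<^sup>2" for x
    using power_mono[OF fourier_cos_bound[of x], of 2] by (simp add: total_def)
  have W: "(\<lambda>n. (\<integral>x. \<bar>2 * (fourier_cos x)\<^sup>2\<bar> \<partial>restrict_space lborel {- real n..n}) / n) \<longlonglongrightarrow> 0"
    using tendsto_mult_right_zero[OF Wiener, of 2] by simp
  note * = functional_average[of "\<lambda>x. x\<^sup>2 - total" _ "\<lambda>x. 2 * (fourier_cos x)\<^sup>2", OF _ covariance_square(1) Lip covariance_square(2) _ K W]
  show "AE \<omega> in M. (\<lambda>n. (\<integral>s. (Y s \<omega>)\<^sup>2 - total \<partial>restrict_space lborel {0..<real n}) / n) \<longlonglongrightarrow> 0"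
    "(\<lambda>n. \<integral>\<omega>. ((\<integral>s. (Y s \<omega>)\<^sup>2 - total \<partial>restrict_space lborel {0..<real n}) / n)\<^sup>2 \<partial>M) \<longlonglongrightarrow> 0"
    "\<And>n. integrable M (\<lambda>\<omega>. ((\<integral>s. (Y s \<omega>)\<^sup>2 - total \<partial>restrict_space lborel {0..<real n}) / n)\<^sup>2)"
    "AE \<omega> in M. \<forall>n. integrable (restrict_space lborel {0..<real n}) (\<lambda>s. (Y s \<omega>)\<^sup>2 - total)"
    using * by simp_all
qed

text \<open>Fourth moments give terms of order 1 / n^2, which are summable; second moments would
  leave the divergent series of 1 / n.\<close>

lemma boundary_small: "AE \<omega> in M. (\<lambda>n. (Y (real n) \<omega>)\<^sup>2 / n) \<longlonglongrightarrow> 0"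
proof -
  have "AE \<omega> in M. (\<lambda>n. (Y (real n) \<omega>) ^ 4 / (real n)\<^sup>2) \<longlonglongrightarrow> 0"
  proof (rule AE_tendsto_zero_of_summable[where C="\<lambda>n. 3 * total\<^sup>2 * (1 / (real n)\<^sup>2)"])
    show "summable (\<lambda>n. 3 * total\<^sup>2 * (1 / (real n)\<^sup>2))"
      using inverse_power_summable[of 2, where 'a=real] by (intro summable_mult) (simp add: inverse_eq_divide)
    show "(\<integral>\<omega>. (Y (real n) \<omega>) ^ 4 / (real n)\<^sup>2 \<partial>M) \<le> 3 * total\<^sup>2 * (1 / (real n)\<^sup>2)" for n
      using fourth_moment(2)[of 1 "real n" 0 0] by simp
    show "integrable M (\<lambda>\<omega>. (Y (real n) \<omega>) ^ 4 / (real n)\<^sup>2)" for n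
      using fourth_moment(1)[of 1 "real n" 0 0] by simp
  qed auto
  then show ?thesis
  proof eventually_elim
    case (elim \<omega>)
    have "(\<lambda>n. sqrt ((Y (real n) \<omega>) ^ 4 / (real n)\<^sup>2)) \<longlonglongrightarrow> sqrt 0" by (intro tendsto_real_sqrt elim)
    moreover have "sqrt ((Y (real n) \<omega>) ^ 4 / (real n)\<^sup>2) = (Y (real n) \<omega>)\<^sup>2 / n" for n
    proof -
      have "(Y (real n) \<omega>) ^ 4 = ((Y (real n) \<omega>)\<^sup>2)\<^sup>2" by simp
      then show ?thesis by (simp only: real_sqrt_divide real_sqrt_abs abs_power2 abs_of_nat)
    qed
    ultimately show ?case by simp
  qed
qed

end

subsection \<open>Stochastic integrals\<close>

lemma norm_add_square_le:
  fixes x y :: "'b :: real_normed_vector"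
  shows "(norm (a *\<^sub>R x + b *\<^sub>R y))\<^sup>2 \<le> 2 * a\<^sup>2 * (norm x)\<^sup>2 + 2 * b\<^sup>2 * (norm y)\<^sup>2"
proof -
  have "(norm (a *\<^sub>R x + b *\<^sub>R y))\<^sup>2 \<le> (norm (a *\<^sub>R x) + norm (b *\<^sub>R y))\<^sup>2" by (intro power_mono norm_triangle_ineq) auto
  also have "\<dots> \<le> 2 * (norm (a *\<^sub>R x))\<^sup>2 + 2 * (norm (b *\<^sub>R y))\<^sup>2"
    using sum_squares_bound[of "norm (a *\<^sub>R x)" "norm (b *\<^sub>R y)"] by (simp add: power2_sum)
  finally show ?thesis by (simp add: power_mult_distrib)
qed

lemma cnj_borel_measurable[measurable]: "cnj \<in> borel_measurable borel"
  by (intro borel_measurable_continuous_onI continuous_intros)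

lemma integrable_mult_cnj:
  fixes f g :: "'a \<Rightarrow> complex"
  assumes [measurable]: "f \<in> borel_measurable M" "g \<in> borel_measurable M"
    and "integrable M (\<lambda>x. (cmod (f x))\<^sup>2)" "integrable M (\<lambda>x. (cmod (g x))\<^sup>2)"
  shows "integrable M (\<lambda>x. f x * cnj (g x))"
proof -
  have "integrable M (\<lambda>x. cmod (f x) * cmod (g x))" using assms by (intro integrable_mult_of_squares) auto
  then show ?thesis by (rule Bochner_Integration.integrable_bound) (auto simp: norm_mult)
qed

lemma integral_double_sum:
  fixes f :: "'i \<Rightarrow> 'i \<Rightarrow> 'a \<Rightarrow> complex"
  assumes "\<And>i j. i \<in> I \<Longrightarrow> j \<in> I \<Longrightarrow> integrable M (f i j)"
  shows "integrable M (\<lambda>x. \<Sum>i\<in>I. \<Sum>j\<in>I. f i j x)" "(\<integral>x. (\<Sum>i\<in>I. \<Sum>j\<in>I. f i j x) \<partial>M) = (\<Sum>i\<in>I. \<Sum>j\<in>I. \<integral>x. f i j x \<partial>M)"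
proof -
  have i: "integrable M (\<lambda>x. \<Sum>j\<in>I. f i j x)" if "i \<in> I" for i
    using assms that by (intro Bochner_Integration.integrable_sum)
  then show "integrable M (\<lambda>x. \<Sum>i\<in>I. \<Sum>j\<in>I. f i j x)" by (rule Bochner_Integration.integrable_sum)
  have "(\<integral>x. (\<Sum>i\<in>I. \<Sum>j\<in>I. f i j x) \<partial>M) = (\<Sum>i\<in>I. \<integral>x. (\<Sum>j\<in>I. f i j x) \<partial>M)"
    by (rule Bochner_Integration.integral_sum[OF i])
  also have "\<dots> = (\<Sum>i\<in>I. \<Sum>j\<in>I. \<integral>x. f i j x \<partial>M)"
    using assms by (intro sum.cong refl Bochner_Integration.integral_sum)
  finally show "(\<integral>x. (\<Sum>i\<in>I. \<Sum>j\<in>I. f i j x) \<partial>M) = (\<Sum>i\<in>I. \<Sum>j\<in>I. \<integral>x. f i j x \<partial>M)" .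
qed

text \<open>A sequence converging in \<open>L\<^sub>2\<close> has converging moduli; this transfers \<open>L2_tendsto\<close> to complex functions.\<close>
lemma L2_tendsto_cmod:
  fixes Y :: "'a \<Rightarrow> complex" and Yn :: "nat \<Rightarrow> 'a \<Rightarrow> complex"
  assumes [measurable]: "\<And>n. Yn n \<in> borel_measurable M" "Y \<in> borel_measurable M"
    and Yn: "\<And>n. integrable M (\<lambda>\<omega>. (cmod (Yn n \<omega>))\<^sup>2)"
    and lim: "(\<lambda>n. \<integral>\<^sup>+\<omega>. ennreal ((cmod (Yn n \<omega> - Y \<omega>))\<^sup>2) \<partial>M) \<longlonglongrightarrow> 0"
  shows "integrable M (\<lambda>\<omega>. (cmod (Y \<omega>))\<^sup>2)" "(\<lambda>n. \<integral>\<omega>. (cmod (Yn n \<omega>))\<^sup>2 \<partial>M) \<longlonglongrightarrow> (\<integral>\<omega>. (cmod (Y \<omega>))\<^sup>2 \<partial>M)"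
proof -
  have "(\<lambda>n. \<integral>\<^sup>+\<omega>. ennreal ((cmod (Yn n \<omega>) - cmod (Y \<omega>))\<^sup>2) \<partial>M) \<longlonglongrightarrow> 0"
  proof (rule tendsto_sandwich[OF _ _ tendsto_const lim])
    have "(cmod x - cmod y)\<^sup>2 \<le> (cmod (x - y))\<^sup>2" for x y
      using norm_triangle_ineq3[of x y] by (intro abs_le_square_iff[THEN iffD1]) simp
    then show "\<forall>\<^sub>F n in sequentially. (\<integral>\<^sup>+\<omega>. ennreal ((cmod (Yn n \<omega>) - cmod (Y \<omega>))\<^sup>2) \<partial>M) \<le> (\<integral>\<^sup>+\<omega>. ennreal ((cmod (Yn n \<omega> - Y \<omega>))\<^sup>2) \<partial>M)"
      by (intro always_eventually allI nn_integral_mono ennreal_leI)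
  qed auto
  from L2_tendsto[OF _ _ Yn this]
  show "integrable M (\<lambda>\<omega>. (cmod (Y \<omega>))\<^sup>2)" "(\<lambda>n. \<integral>\<omega>. (cmod (Yn n \<omega>))\<^sup>2 \<partial>M) \<longlonglongrightarrow> (\<integral>\<omega>. (cmod (Y \<omega>))\<^sup>2 \<partial>M)"
    by simp_all
qed

section \<open>Isometry of the stochastic integral\<close>

locale random_measure = prob_space M for M :: "'a measure" +
  fixes \<mu> :: "real measure" and X :: "real set \<Rightarrow> 'a \<Rightarrow> complex"
  assumes urm: "uncorrelated_random_measure M \<mu> X"
begin

lemma X_facts:
  assumes "A \<in> fmeasurable \<mu>"
  shows "X A \<in> borel_measurable M" "integrable M (\<lambda>\<omega>. (cmod (X A \<omega>))\<^sup>2)" "(\<integral>\<omega>. X A \<omega> \<partial>M) = 0"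
    "(\<integral>\<omega>. (cmod (X A \<omega>))\<^sup>2 \<partial>M) = measure \<mu> A"
  using urm assms unfolding uncorrelated_random_measure_def by blast+

lemma X_integrable: "A \<in> fmeasurable \<mu> \<Longrightarrow> integrable M (X A)"
proof -
  assume A: "A \<in> fmeasurable \<mu>"
  have "integrable M (\<lambda>\<omega>. X A \<omega> * cnj 1)" using X_facts[OF A] by (intro integrable_mult_cnj) auto
  then show ?thesis by simp
qed

lemma X_disjoint: "A \<in> fmeasurable \<mu> \<Longrightarrow> A' \<in> fmeasurable \<mu> \<Longrightarrow> A \<inter> A' = {} \<Longrightarrow> (\<integral>\<omega>. X A \<omega> * cnj (X A' \<omega>) \<partial>M) = 0"
  using urm unfolding uncorrelated_random_measure_def by blast

text \<open>Countable additivity in mean square for the sequence A, A', {}, {}, ..., together with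
  \<open>X {} = 0\<close> almost surely, which holds because \<mu> {} = 0. From index 2 on the
  approximation error is constant, so it equals its limit 0.\<close>

lemma X_additive:
  assumes A: "A \<in> fmeasurable \<mu>" "A' \<in> fmeasurable \<mu>" "A \<inter> A' = {}"
  shows "AE \<omega> in M. X (A \<union> A') \<omega> = X A \<omega> + X A' \<omega>"
proof -
  define S where "S i = (if i = 0 then A else if i = 1 then A' else {})" for i :: nat
  have U: "(\<Union>i. S i) = A \<union> A'" by (auto simp: S_def split: if_splits)
  have "range S \<subseteq> sets \<mu>" using A by (auto simp: S_def fmeasurable_def)
  moreover have "disjoint_family S" using A by (auto simp: disjoint_family_on_def S_def)
  moreover have "(\<Union>i. S i) \<in> fmeasurable \<mu>" unfolding U using A by auto
  ultimately have lim: "(\<lambda>n. \<integral>\<^sup>+\<omega>. ennreal ((cmod (X (\<Union>i. S i) \<omega> - (\<Sum>i<n. X (S i) \<omega>)))\<^sup>2) \<partial>M) \<longlonglongrightarrow> 0"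
    using urm unfolding uncorrelated_random_measure_def by blast
  have E: "{} \<in> fmeasurable \<mu>" by auto
  have "AE \<omega> in M. (cmod (X {} \<omega>))\<^sup>2 = 0"
    using X_facts[OF E] by (subst integral_nonneg_eq_0_iff_AE[symmetric]) auto
  then have X0: "AE \<omega> in M. X {} \<omega> = 0" by simp
  define c where "c = (\<integral>\<^sup>+\<omega>. ennreal ((cmod (X (A \<union> A') \<omega> - (X A \<omega> + X A' \<omega>)))\<^sup>2) \<partial>M)"
  have m[measurable]: "X A \<in> borel_measurable M" "X A' \<in> borel_measurable M" "X (A \<union> A') \<in> borel_measurable M"
    using A by (auto intro!: X_facts)
  have "(\<integral>\<^sup>+\<omega>. ennreal ((cmod (X (\<Union>i. S i) \<omega> - (\<Sum>i<n + 2. X (S i) \<omega>)))\<^sup>2) \<partial>M) = c" for n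
    unfolding c_def U
  proof (rule nn_integral_cong_AE)
    show "AE \<omega> in M. ennreal ((cmod (X (A \<union> A') \<omega> - (\<Sum>i<n + 2. X (S i) \<omega>)))\<^sup>2) = ennreal ((cmod (X (A \<union> A') \<omega> - (X A \<omega> + X A' \<omega>)))\<^sup>2)"
      using X0
    proof eventually_elim
      case (elim \<omega>)
      have "(\<Sum>i<n + 2. X (S i) \<omega>) = X A \<omega> + X A' \<omega>"
        by (induction n) (auto simp: S_def elim numeral_2_eq_2)
      then show ?case by simp
    qed
  qed
  then have "(\<lambda>n::nat. c) \<longlonglongrightarrow> 0" using LIMSEQ_ignore_initial_segment[OF lim, of 2] by simp
  then have "c = 0" by (simp add: LIMSEQ_const_iff)
  then have "AE \<omega> in M. ennreal ((cmod (X (A \<union> A') \<omega> - (X A \<omega> + X A' \<omega>)))\<^sup>2) = 0"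
    unfolding c_def by (subst (asm) nn_integral_0_iff_AE) auto
  then show ?thesis by eventually_elim simp
qed

text \<open>Both sets are cut into the common part \<open>P\<close> and the remainders
  \<open>Q\<close> and \<open>R\<close>; by orthogonality on disjoint sets only \<open>P\<close>
  against itself survives.\<close>

lemma X_covariance:
  assumes A: "A \<in> fmeasurable \<mu>" "A' \<in> fmeasurable \<mu>"
  shows "(\<integral>\<omega>. X A \<omega> * cnj (X A' \<omega>) \<partial>M) = complex_of_real (measure \<mu> (A \<inter> A'))"
proof -
  define P Q R where "P = A \<inter> A'" and "Q = A - A'" and "R = A' - A"
  have f: "P \<in> fmeasurable \<mu>" "Q \<in> fmeasurable \<mu>" "R \<in> fmeasurable \<mu>"
    unfolding P_def Q_def R_def using A by (auto intro: fmeasurable_Diff)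
  have dj: "P \<inter> Q = {}" "P \<inter> R = {}" "Q \<inter> P = {}" "Q \<inter> R = {}" by (auto simp: P_def Q_def R_def)
  have AU: "A = P \<union> Q" "A' = P \<union> R" by (auto simp: P_def Q_def R_def)
  have [measurable]: "X A \<in> borel_measurable M" "X A' \<in> borel_measurable M" "X P \<in> borel_measurable M" "X Q \<in> borel_measurable M" "X R \<in> borel_measurable M"
    using A f by (auto intro: X_facts)
  have i: "integrable M (\<lambda>\<omega>. X S \<omega> * cnj (X S' \<omega>))" if "S \<in> fmeasurable \<mu>" "S' \<in> fmeasurable \<mu>" for S S'
    using that by (intro integrable_mult_cnj X_facts)
  have "(\<integral>\<omega>. X A \<omega> * cnj (X A' \<omega>) \<partial>M) = (\<integral>\<omega>. (X P \<omega> + X Q \<omega>) * cnj (X P \<omega> + X R \<omega>) \<partial>M)"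
  proof (rule integral_cong_AE)
    show "AE \<omega> in M. X A \<omega> * cnj (X A' \<omega>) = (X P \<omega> + X Q \<omega>) * cnj (X P \<omega> + X R \<omega>)"
      using X_additive[OF f(1,2) dj(1)] X_additive[OF f(1,3) dj(2)] by eventually_elim (simp add: AU[symmetric])
  qed measurable
  also have "\<dots> = (\<integral>\<omega>. X P \<omega> * cnj (X P \<omega>) + X P \<omega> * cnj (X R \<omega>) + X Q \<omega> * cnj (X P \<omega>) + X Q \<omega> * cnj (X R \<omega>) \<partial>M)"
    by (simp add: algebra_simps)
  also have "\<dots> = (\<integral>\<omega>. X P \<omega> * cnj (X P \<omega>) \<partial>M)"
    using i f dj by (simp add: X_disjoint)
  also have "\<dots> = (\<integral>\<omega>. complex_of_real ((cmod (X P \<omega>))\<^sup>2) \<partial>M)" by (simp only: complex_norm_square)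
  also have "\<dots> = complex_of_real (measure \<mu> P)" using X_facts[OF f(1)] by (subst integral_of_real) auto
  finally show ?thesis by (simp add: P_def)
qed

text \<open>The sets in the list may overlap, so the double sum runs over the covariances of all
  pairs; \<open>X_covariance\<close> matches them with integrals of indicators of
  intersections.\<close>

lemma simple_isometry:
  assumes L: "\<forall>(c, A)\<in>set L. A \<in> fmeasurable \<mu>"
  defines "Z \<equiv> (\<lambda>\<omega>. \<Sum>(c, A)\<leftarrow>L. c * X A \<omega>)" and "g \<equiv> (\<lambda>u. \<Sum>(c, A)\<leftarrow>L. c * indicator A u)"
  shows "Z \<in> borel_measurable M" "g \<in> borel_measurable \<mu>" "integrable M (\<lambda>\<omega>. (cmod (Z \<omega>))\<^sup>2)" "integrable \<mu> (\<lambda>u. (cmod (g u))\<^sup>2)"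
    "(\<integral>\<omega>. (cmod (Z \<omega>))\<^sup>2 \<partial>M) = (\<integral>u. (cmod (g u))\<^sup>2 \<partial>\<mu>)" "(\<integral>\<omega>. Z \<omega> \<partial>M) = 0"
proof -
  define n where "n = length L"
  define c A where "c i = fst (L ! i)" and "A i = snd (L ! i)" for i
  have A: "A i \<in> fmeasurable \<mu>" if "i < n" for i
    using L that nth_mem[of i L] by (auto simp: A_def n_def split_beta)
  have Z: "Z = (\<lambda>\<omega>. \<Sum>i<n. c i * X (A i) \<omega>)" and g: "g = (\<lambda>u. \<Sum>i<n. c i * indicator (A i) u)"
    unfolding Z_def g_def n_def c_def A_def by (auto simp: sum_list_sum_nth atLeast0LessThan split_beta)
  have [measurable]: "X (A i) \<in> borel_measurable M" "A i \<in> sets \<mu>" if "i < n" for i using A[OF that] by (auto intro: X_facts)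
  show mZ: "Z \<in> borel_measurable M" unfolding Z by measurable
  show mg: "g \<in> borel_measurable \<mu>" unfolding g by measurable
  have iX: "integrable M (\<lambda>\<omega>. X (A i) \<omega> * cnj (X (A j) \<omega>))" if "i < n" "j < n" for i j
    using that A by (intro integrable_mult_cnj X_facts) auto
  have fA: "emeasure \<mu> (A i \<inter> A j) < \<infinity>" if "i < n" "j < n" for i j
    using fmeasurable.Int[OF A[OF that(1)] A[OF that(2)]] by (auto simp: fmeasurable_def)
  have iI: "integrable \<mu> (\<lambda>u. complex_of_real (indicator (A i \<inter> A j) u))" if "i < n" "j < n" for i j
    using fA that A by (intro integrable_of_real integrable_real_indicator) auto
  have ZZ: "complex_of_real ((cmod (Z \<omega>))\<^sup>2) = (\<Sum>i<n. \<Sum>j<n. c i * cnj (c j) * (X (A i) \<omega> * cnj (X (A j) \<omega>)))" for \<omega>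
    unfolding complex_norm_square Z cnj_sum sum_product by (simp add: mult_ac)
  have gg: "complex_of_real ((cmod (g u))\<^sup>2) = (\<Sum>i<n. \<Sum>j<n. c i * cnj (c j) * complex_of_real (indicator (A i \<inter> A j) u))" for u
    unfolding complex_norm_square g cnj_sum sum_product by (intro sum.cong) (auto split: split_indicator)
  have i1: "integrable M (\<lambda>\<omega>. complex_of_real ((cmod (Z \<omega>))\<^sup>2))" 
    unfolding ZZ by (rule integral_double_sum(1)) (use iX in auto)
  have i2: "integrable \<mu> (\<lambda>u. complex_of_real ((cmod (g u))\<^sup>2))" 
    unfolding gg by (rule integral_double_sum(1)) (use iI in \<open>auto simp del: of_real_indicator\<close>)
  show i1': "integrable M (\<lambda>\<omega>. (cmod (Z \<omega>))\<^sup>2)" using integrable_Re[OF i1] by simp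
  show i2': "integrable \<mu> (\<lambda>u. (cmod (g u))\<^sup>2)" using integrable_Re[OF i2] by simp
  have "complex_of_real (\<integral>\<omega>. (cmod (Z \<omega>))\<^sup>2 \<partial>M) = (\<integral>\<omega>. complex_of_real ((cmod (Z \<omega>))\<^sup>2) \<partial>M)" using i1' by (subst integral_of_real) auto
  also have "\<dots> = (\<Sum>i<n. \<Sum>j<n. c i * cnj (c j) * complex_of_real (measure \<mu> (A i \<inter> A j)))"
    unfolding ZZ by (subst integral_double_sum(2)) (use iX A in \<open>auto simp: X_covariance\<close>)
  also have "\<dots> = (\<Sum>i<n. \<Sum>j<n. c i * cnj (c j) * (\<integral>u. complex_of_real (indicator (A i \<inter> A j) u) \<partial>\<mu>))"
  proof (intro sum.cong refl arg_cong2[where f="(*)"])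
    fix i j assume "i \<in> {..<n}" "j \<in> {..<n}"
    then show "complex_of_real (measure \<mu> (A i \<inter> A j)) = (\<integral>u. complex_of_real (indicator (A i \<inter> A j) u) \<partial>\<mu>)"
      using iI[of i j] fA[of i j] A[of i] A[of j] by (subst integral_of_real) (auto intro!: integrable_real_indicator)
  qed
  also have "\<dots> = (\<integral>u. complex_of_real ((cmod (g u))\<^sup>2) \<partial>\<mu>)"
    unfolding gg by (subst integral_double_sum(2)) (use iI in \<open>auto simp del: of_real_indicator\<close>)
  also have "\<dots> = complex_of_real (\<integral>u. (cmod (g u))\<^sup>2 \<partial>\<mu>)" using i2' by (subst integral_of_real) auto
  finally show "(\<integral>\<omega>. (cmod (Z \<omega>))\<^sup>2 \<partial>M) = (\<integral>u. (cmod (g u))\<^sup>2 \<partial>\<mu>)" by (simp only: of_real_eq_iff)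
  show "(\<integral>\<omega>. Z \<omega> \<partial>M) = 0" unfolding Z using A by (simp add: X_integrable X_facts(3))
qed

text \<open>Squared norms pass to the limit along the approximating simple functions.
  \<open>Y\<close> is real while the simple integrals are complex, so the mean is computed along
  their real parts.\<close>

lemma stochastic_integral_isometry:
  assumes "has_stochastic_integral M \<mu> X g (\<lambda>\<omega>. complex_of_real (Y \<omega>))"
  shows "g \<in> borel_measurable \<mu>" "Y \<in> borel_measurable M" "integrable M (\<lambda>\<omega>. (Y \<omega>)\<^sup>2)" "integrable \<mu> (\<lambda>u. (cmod (g u))\<^sup>2)"
    "(\<integral>\<omega>. (Y \<omega>)\<^sup>2 \<partial>M) = (\<integral>u. (cmod (g u))\<^sup>2 \<partial>\<mu>)" "(\<integral>\<omega>. Y \<omega> \<partial>M) = 0"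
proof -
  from assms obtain S :: "nat \<Rightarrow> (complex \<times> real set) list" where
    S: "\<And>n. \<forall>(c, A)\<in>set (S n). A \<in> fmeasurable \<mu>"
    and lg: "(\<lambda>n. \<integral>\<^sup>+u. ennreal ((cmod ((\<Sum>(c, A)\<leftarrow>S n. c * indicator A u) - g u))\<^sup>2) \<partial>\<mu>) \<longlonglongrightarrow> 0"
    and lY: "(\<lambda>n. \<integral>\<^sup>+\<omega>. ennreal ((cmod ((\<Sum>(c, A)\<leftarrow>S n. c * X A \<omega>) - complex_of_real (Y \<omega>)))\<^sup>2) \<partial>M) \<longlonglongrightarrow> 0"
    and gm: "g \<in> borel_measurable \<mu>" and Ym: "(\<lambda>\<omega>. complex_of_real (Y \<omega>)) \<in> borel_measurable M"
    unfolding has_stochastic_integral_def by blast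
  note iso = simple_isometry[OF S]
  show "g \<in> borel_measurable \<mu>" by fact
  show Y[measurable]: "Y \<in> borel_measurable M" using measurable_compose[OF Ym borel_measurable_Re] by simp
  note LY = L2_tendsto_cmod[OF iso(1) Ym iso(3) lY] and Lg = L2_tendsto_cmod[OF iso(2) gm iso(4) lg]
  show "integrable M (\<lambda>\<omega>. (Y \<omega>)\<^sup>2)" using LY(1) by simp
  show "integrable \<mu> (\<lambda>u. (cmod (g u))\<^sup>2)" by (rule Lg)
  show "(\<integral>\<omega>. (Y \<omega>)\<^sup>2 \<partial>M) = (\<integral>u. (cmod (g u))\<^sup>2 \<partial>\<mu>)"
    using LIMSEQ_unique[OF LY(2)[unfolded iso(5)] Lg(2)] by simp
  define Z where "Z n \<omega> = (\<Sum>(c, A)\<leftarrow>S n. c * X A \<omega>)" for n \<omega>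
  have [measurable]: "Z n \<in> borel_measurable M" for n unfolding Z_def by (rule iso)
  have Z2: "integrable M (\<lambda>\<omega>. (cmod (Z n \<omega>))\<^sup>2)" for n unfolding Z_def by (rule iso)
  have re: "(Re z)\<^sup>2 \<le> (cmod z)\<^sup>2" for z using abs_Re_le_cmod[of z] by (intro abs_le_square_iff[THEN iffD1]) simp
  have "(\<lambda>n. \<integral>\<omega>. Re (Z n \<omega>) \<partial>M) \<longlonglongrightarrow> (\<integral>\<omega>. Y \<omega> \<partial>M)"
  proof (rule L2_tendsto_L1(2))
    show "integrable M (\<lambda>\<omega>. (Re (Z n \<omega>))\<^sup>2)" for n
      by (rule Bochner_Integration.integrable_bound[OF Z2[of n]]) (use re in auto)
    show "(\<lambda>n. \<integral>\<^sup>+\<omega>. ennreal ((Re (Z n \<omega>) - Y \<omega>)\<^sup>2) \<partial>M) \<longlonglongrightarrow> 0"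
    proof (rule tendsto_sandwich[OF _ _ tendsto_const lY[folded Z_def]])
      have "(Re z - y)\<^sup>2 \<le> (cmod (z - complex_of_real y))\<^sup>2" for z y using re[of "z - complex_of_real y"] by simp
      then show "\<forall>\<^sub>F n in sequentially. (\<integral>\<^sup>+\<omega>. ennreal ((Re (Z n \<omega>) - Y \<omega>)\<^sup>2) \<partial>M) \<le> (\<integral>\<^sup>+\<omega>. ennreal ((cmod (Z n \<omega> - complex_of_real (Y \<omega>)))\<^sup>2) \<partial>M)"
        by (intro always_eventually allI nn_integral_mono ennreal_leI)
    qed auto
  qed measurable
  moreover have "(\<integral>\<omega>. Re (Z n \<omega>) \<partial>M) = 0" for n
  proof -
    have "integrable M (\<lambda>\<omega>. Z n \<omega> * cnj 1)" using Z2 by (intro integrable_mult_cnj) auto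
    then have "(\<integral>\<omega>. Re (Z n \<omega>) \<partial>M) = Re (\<integral>\<omega>. Z n \<omega> \<partial>M)" by (intro integral_Re) simp
    then show ?thesis using iso(6)[of n] by (simp add: Z_def)
  qed
  ultimately show "(\<integral>\<omega>. Y \<omega> \<partial>M) = 0" by (simp add: LIMSEQ_const_iff)
qed

lemma has_stochastic_integral_zero: "has_stochastic_integral M \<mu> X (\<lambda>u. 0) (\<lambda>\<omega>. 0)"
  unfolding has_stochastic_integral_def by (auto intro!: exI[of _ "\<lambda>n. []"])

lemma has_stochastic_integral_add_scaled:
  assumes 1: "has_stochastic_integral M \<mu> X g Y" and 2: "has_stochastic_integral M \<mu> X g' Y'"
  shows "has_stochastic_integral M \<mu> X (\<lambda>u. g u + a * g' u) (\<lambda>\<omega>. Y \<omega> + a * Y' \<omega>)"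
proof -
  from 1 obtain S :: "nat \<Rightarrow> (complex \<times> real set) list" where
    S: "\<And>n. \<forall>(c, A)\<in>set (S n). A \<in> fmeasurable \<mu>"
    and lg: "(\<lambda>n. \<integral>\<^sup>+u. ennreal ((cmod ((\<Sum>(c, A)\<leftarrow>S n. c * indicator A u) - g u))\<^sup>2) \<partial>\<mu>) \<longlonglongrightarrow> 0"
    and lY: "(\<lambda>n. \<integral>\<^sup>+\<omega>. ennreal ((cmod ((\<Sum>(c, A)\<leftarrow>S n. c * X A \<omega>) - Y \<omega>))\<^sup>2) \<partial>M) \<longlonglongrightarrow> 0"
    and m[measurable]: "g \<in> borel_measurable \<mu>" "Y \<in> borel_measurable M"
    unfolding has_stochastic_integral_def by blast
  from 2 obtain S' :: "nat \<Rightarrow> (complex \<times> real set) list" where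
    S': "\<And>n. \<forall>(c, A)\<in>set (S' n). A \<in> fmeasurable \<mu>"
    and lg': "(\<lambda>n. \<integral>\<^sup>+u. ennreal ((cmod ((\<Sum>(c, A)\<leftarrow>S' n. c * indicator A u) - g' u))\<^sup>2) \<partial>\<mu>) \<longlonglongrightarrow> 0"
    and lY': "(\<lambda>n. \<integral>\<^sup>+\<omega>. ennreal ((cmod ((\<Sum>(c, A)\<leftarrow>S' n. c * X A \<omega>) - Y' \<omega>))\<^sup>2) \<partial>M) \<longlonglongrightarrow> 0"
    and m'[measurable]: "g' \<in> borel_measurable \<mu>" "Y' \<in> borel_measurable M"
    unfolding has_stochastic_integral_def by blast
  \<comment> \<open>Concatenated lists represent sums of simple functions, since the sets of a list
    may overlap.\<close>
  define R where "R n = S n @ map (\<lambda>(c, A). (a * c, A)) (S' n)" for n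
  have R: "(\<Sum>(c, A)\<leftarrow>R n. c * f A) = (\<Sum>(c, A)\<leftarrow>S n. c * f A) + a * (\<Sum>(c, A)\<leftarrow>S' n. c * f A)" for n f
    unfolding R_def by (simp add: sum_list_const_mult[symmetric] comp_def split_beta mult.assoc)
  have gen: "(\<lambda>n. \<integral>\<^sup>+x. ennreal ((cmod ((U n x + a * U' n x) - (V x + a * V' x)))\<^sup>2) \<partial>N) \<longlonglongrightarrow> 0"
    if [measurable]: "\<And>n. U n \<in> borel_measurable N" "\<And>n. U' n \<in> borel_measurable N" "V \<in> borel_measurable N" "V' \<in> borel_measurable N"
      and l: "(\<lambda>n. \<integral>\<^sup>+x. ennreal ((cmod (U n x - V x))\<^sup>2) \<partial>N) \<longlonglongrightarrow> 0" "(\<lambda>n. \<integral>\<^sup>+x. ennreal ((cmod (U' n x - V' x))\<^sup>2) \<partial>N) \<longlonglongrightarrow> 0"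
    for U U' :: "nat \<Rightarrow> 'z \<Rightarrow> complex" and V V' N
  proof (rule tendsto_sandwich[OF _ _ tendsto_const])
    have b: "(cmod ((U n x + a * U' n x) - (V x + a * V' x)))\<^sup>2 \<le> 2 * (cmod (U n x - V x))\<^sup>2 + 2 * (cmod a)\<^sup>2 * (cmod (U' n x - V' x))\<^sup>2" for n x
    proof -
      have e: "(U n x + a * U' n x) - (V x + a * V' x) = (U n x - V x) + a * (U' n x - V' x)" by (simp add: algebra_simps)
      show ?thesis using norm_add_square_le[of 1 "U n x - V x" 1 "a * (U' n x - V' x)"]
        unfolding e norm_mult power_mult_distrib by simp
    qed
    have "(\<integral>\<^sup>+x. ennreal ((cmod ((U n x + a * U' n x) - (V x + a * V' x)))\<^sup>2) \<partial>N) \<le>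
       (\<integral>\<^sup>+x. ennreal 2 * ennreal ((cmod (U n x - V x))\<^sup>2) + ennreal (2 * (cmod a)\<^sup>2) * ennreal ((cmod (U' n x - V' x))\<^sup>2) \<partial>N)" for n
      using b by (intro nn_integral_mono) (simp add: ennreal_mult[symmetric] ennreal_plus[symmetric] del: ennreal_plus ennreal_numeral)
    also have "\<dots> n = ennreal 2 * (\<integral>\<^sup>+x. ennreal ((cmod (U n x - V x))\<^sup>2) \<partial>N) + ennreal (2 * (cmod a)\<^sup>2) * (\<integral>\<^sup>+x. ennreal ((cmod (U' n x - V' x))\<^sup>2) \<partial>N)" for n
      by (simp add: nn_integral_add nn_integral_cmult)
    finally show "\<forall>\<^sub>F n in sequentially. (\<integral>\<^sup>+x. ennreal ((cmod ((U n x + a * U' n x) - (V x + a * V' x)))\<^sup>2) \<partial>N) \<le>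
       ennreal 2 * (\<integral>\<^sup>+x. ennreal ((cmod (U n x - V x))\<^sup>2) \<partial>N) + ennreal (2 * (cmod a)\<^sup>2) * (\<integral>\<^sup>+x. ennreal ((cmod (U' n x - V' x))\<^sup>2) \<partial>N)"
      by (intro always_eventually) blast
    have "(\<lambda>n. ennreal 2 * (\<integral>\<^sup>+x. ennreal ((cmod (U n x - V x))\<^sup>2) \<partial>N) + ennreal (2 * (cmod a)\<^sup>2) * (\<integral>\<^sup>+x. ennreal ((cmod (U' n x - V' x))\<^sup>2) \<partial>N)) \<longlonglongrightarrow> ennreal 2 * 0 + ennreal (2 * (cmod a)\<^sup>2) * 0"
      by (intro tendsto_add ennreal_tendsto_cmult l) auto
    then show "(\<lambda>n. ennreal 2 * (\<integral>\<^sup>+x. ennreal ((cmod (U n x - V x))\<^sup>2) \<partial>N) + ennreal (2 * (cmod a)\<^sup>2) * (\<integral>\<^sup>+x. ennreal ((cmod (U' n x - V' x))\<^sup>2) \<partial>N)) \<longlonglongrightarrow> 0" by simp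
  qed simp
  note iso = simple_isometry[OF S] and iso' = simple_isometry[OF S']
  show ?thesis unfolding has_stochastic_integral_def
  proof (intro conjI exI[of _ R])
    show "\<forall>n. \<forall>(c, A)\<in>set (R n). A \<in> fmeasurable \<mu>" using S S' unfolding R_def by fastforce
    show "(\<lambda>n. \<integral>\<^sup>+u. ennreal ((cmod ((\<Sum>(c, A)\<leftarrow>R n. c * indicator A u) - (g u + a * g' u)))\<^sup>2) \<partial>\<mu>) \<longlonglongrightarrow> 0"
      unfolding R by (rule gen[OF iso(2) iso'(2) m(1) m'(1) lg lg'])
    show "(\<lambda>n. \<integral>\<^sup>+\<omega>. ennreal ((cmod ((\<Sum>(c, A)\<leftarrow>R n. c * X A \<omega>) - (Y \<omega> + a * Y' \<omega>)))\<^sup>2) \<partial>M) \<longlonglongrightarrow> 0"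
      unfolding R[of "\<lambda>A. X A _"] by (rule gen[OF iso(1) iso'(1) m(2) m'(2) lY lY'])
  qed measurable
qed

lemma has_stochastic_integral_sum:
  assumes "finite I" "\<And>t. t \<in> I \<Longrightarrow> has_stochastic_integral M \<mu> X (g t) (Y t)"
  shows "has_stochastic_integral M \<mu> X (\<lambda>u. \<Sum>t\<in>I. a t * g t u) (\<lambda>\<omega>. \<Sum>t\<in>I. a t * Y t \<omega>)"
  using assms
proof (induction I)
  case empty then show ?case by (simp add: has_stochastic_integral_zero)
next
  case (insert x I)
  then show ?case using has_stochastic_integral_add_scaled[of "\<lambda>u. \<Sum>t\<in>I. a t * g t u" "\<lambda>\<omega>. \<Sum>t\<in>I. a t * Y t \<omega>" "g x" "Y x" "a x"]
    by (simp add: add.commute)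
qed

end

lemma integrable_exp_abs:
  fixes c :: real
  assumes c: "c > 0"
  shows "integrable lborel (\<lambda>r. exp (- c * \<bar>r\<bar>))"
proof -
  have "integrable lborel (\<lambda>x::real. exp (- x) * indicator {0..} x)"
  proof (rule integrableI_nonneg)
    have "(\<integral>\<^sup>+x. ennreal (exp (- x) * indicator {0..} x) \<partial>lborel) = (\<integral>\<^sup>+x. ennreal (x ^ 0 * exp (- x)) * indicator {0..} x \<partial>lborel)"
      by (intro nn_integral_cong) (auto split: split_indicator)
    also have "\<dots> < \<infinity>" by (subst nn_intergal_power_times_exp_Ici) simp
    finally show "(\<integral>\<^sup>+x. ennreal (exp (- x) * indicator {0..} x) \<partial>lborel) < \<infinity>" .
  qed auto
  from lborel_integrable_real_affine[OF this, of c 0] lborel_integrable_real_affine[OF this, of "- c" 0] c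
  have "integrable lborel (\<lambda>x. exp (- (c * x)) * indicator {0..} (c * x) + exp (c * x) * indicator {0..} (- (c * x)))" by simp
  then show ?thesis
  proof (rule Bochner_Integration.integrable_bound)
    show "AE x in lborel. norm (exp (- c * \<bar>x\<bar>)) \<le> norm (exp (- (c * x)) * indicator {0..} (c * x) + exp (c * x) * indicator {0..} (- (c * x)))"
      using c by (intro AE_I2) (auto simp: abs_if mult_le_0_iff zero_le_mult_iff split: split_indicator)
  qed auto
qed

lemma L2_tendsto_linear:
  fixes U U' :: "nat \<Rightarrow> 'z \<Rightarrow> 'b :: {real_normed_vector, second_countable_topology}"
  assumes [measurable]: "\<And>n. U n \<in> borel_measurable N" "\<And>n. U' n \<in> borel_measurable N" "V \<in> borel_measurable N" "V' \<in> borel_measurable N"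
    and l: "(\<lambda>n. \<integral>\<^sup>+x. ennreal ((norm (U n x - V x))\<^sup>2) \<partial>N) \<longlonglongrightarrow> 0" "(\<lambda>n. \<integral>\<^sup>+x. ennreal ((norm (U' n x - V' x))\<^sup>2) \<partial>N) \<longlonglongrightarrow> 0"
  shows "(\<lambda>n. \<integral>\<^sup>+x. ennreal ((norm ((a *\<^sub>R U n x + b *\<^sub>R U' n x) - (a *\<^sub>R V x + b *\<^sub>R V' x)))\<^sup>2) \<partial>N) \<longlonglongrightarrow> 0"
proof (rule tendsto_sandwich[OF _ _ tendsto_const])
  have bnd: "(norm ((a *\<^sub>R U n x + b *\<^sub>R U' n x) - (a *\<^sub>R V x + b *\<^sub>R V' x)))\<^sup>2 \<le> 2 * a\<^sup>2 * (norm (U n x - V x))\<^sup>2 + 2 * b\<^sup>2 * (norm (U' n x - V' x))\<^sup>2" for n x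
  proof -
    have e: "(a *\<^sub>R U n x + b *\<^sub>R U' n x) - (a *\<^sub>R V x + b *\<^sub>R V' x) = a *\<^sub>R (U n x - V x) + b *\<^sub>R (U' n x - V' x)" by (simp add: algebra_simps)
    show ?thesis unfolding e by (rule norm_add_square_le)
  qed
  define A where "A n = (\<integral>\<^sup>+x. ennreal ((norm (U n x - V x))\<^sup>2) \<partial>N)" for n
  define A' where "A' n = (\<integral>\<^sup>+x. ennreal ((norm (U' n x - V' x))\<^sup>2) \<partial>N)" for n
  have "(\<integral>\<^sup>+x. ennreal ((norm ((a *\<^sub>R U n x + b *\<^sub>R U' n x) - (a *\<^sub>R V x + b *\<^sub>R V' x)))\<^sup>2) \<partial>N) \<le> ennreal (2 * a\<^sup>2) * A n + ennreal (2 * b\<^sup>2) * A' n" for n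
  proof -
    have "(\<integral>\<^sup>+x. ennreal ((norm ((a *\<^sub>R U n x + b *\<^sub>R U' n x) - (a *\<^sub>R V x + b *\<^sub>R V' x)))\<^sup>2) \<partial>N) \<le>
       (\<integral>\<^sup>+x. ennreal (2 * a\<^sup>2) * ennreal ((norm (U n x - V x))\<^sup>2) + ennreal (2 * b\<^sup>2) * ennreal ((norm (U' n x - V' x))\<^sup>2) \<partial>N)"
      using bnd by (intro nn_integral_mono) (simp add: ennreal_mult[symmetric] ennreal_plus[symmetric] del: ennreal_plus)
    also have "\<dots> = ennreal (2 * a\<^sup>2) * A n + ennreal (2 * b\<^sup>2) * A' n"
      by (simp add: nn_integral_add nn_integral_cmult A_def A'_def)
    finally show ?thesis .
  qed
  then show "\<forall>\<^sub>F n in sequentially. (\<integral>\<^sup>+x. ennreal ((norm ((a *\<^sub>R U n x + b *\<^sub>R U' n x) - (a *\<^sub>R V x + b *\<^sub>R V' x)))\<^sup>2) \<partial>N) \<le> ennreal (2 * a\<^sup>2) * A n + ennreal (2 * b\<^sup>2) * A' n"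
    by simp
  have "(\<lambda>n. ennreal (2 * a\<^sup>2) * A n + ennreal (2 * b\<^sup>2) * A' n) \<longlonglongrightarrow> ennreal (2 * a\<^sup>2) * 0 + ennreal (2 * b\<^sup>2) * 0"
    unfolding A_def A'_def by (intro tendsto_add ennreal_tendsto_cmult l) auto
  then show "(\<lambda>n. ennreal (2 * a\<^sup>2) * A n + ennreal (2 * b\<^sup>2) * A' n) \<longlonglongrightarrow> 0" by simp
qed simp

section \<open>The process without its linear drift\<close>

text \<open>Combines the bound |x u| for small u with the bound 2 for large u, to match the weight
  \<open>min (u\<^sup>2) 1\<close> whose \<mu>-integral is finite.\<close>

lemma iexp_minus_one_bound: "(cmod (iexp (x * u) - 1))\<^sup>2 \<le> (2 + \<bar>x\<bar>)\<^sup>2 * min (u\<^sup>2) 1"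
proof -
  have 1: "cmod (iexp (x * u) - 1) \<le> \<bar>x\<bar> * \<bar>u\<bar>" using cmod_iexp_diff_le[of "x * u" 0] by (simp add: abs_mult)
  have 2: "cmod (iexp (x * u) - 1) \<le> 2" using norm_triangle_ineq4[of "iexp (x * u)" 1] by simp
  have "cmod (iexp (x * u) - 1) \<le> (2 + \<bar>x\<bar>) * min \<bar>u\<bar> 1"
  proof (cases "\<bar>u\<bar> \<le> 1")
    case True
    have "\<bar>x\<bar> * \<bar>u\<bar> \<le> (2 + \<bar>x\<bar>) * \<bar>u\<bar>" by (intro mult_right_mono) auto
    then show ?thesis using 1 True by simp
  qed (use 2 in auto)
  then have "(cmod (iexp (x * u) - 1))\<^sup>2 \<le> ((2 + \<bar>x\<bar>) * min \<bar>u\<bar> 1)\<^sup>2" by (intro power_mono) auto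
  also have "\<dots> = (2 + \<bar>x\<bar>)\<^sup>2 * min (u\<^sup>2) 1"
    by (auto simp: power_mult_distrib min_def abs_square_le_1 power2_eq_1_iff abs_if split: if_splits)
  finally show ?thesis .
qed

locale spectral_process = prob_space M for M :: "'a measure" +
  fixes B :: "real \<Rightarrow> 'a \<Rightarrow> real" and D\<^sub>0 :: "'a \<Rightarrow> real" and X :: "real set \<Rightarrow> 'a \<Rightarrow> complex" and \<mu> :: "real measure"
  assumes measurable_B: "measurable_process M B"
    and gaussian_B: "gaussian_process M B"
    and spectral: "spectral_representation M B D\<^sub>0 X \<mu>"
begin

sublocale random_measure M \<mu> X
  using spectral by unfold_locales (simp add: spectral_representation_def)

lemma B_measurable[measurable (raw)]:
  "f \<in> borel_measurable N \<Longrightarrow> g \<in> measurable N M \<Longrightarrow> (\<lambda>x. B (f x) (g x)) \<in> borel_measurable N"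
  using measurable_compose[OF measurable_Pair measurable_B[unfolded measurable_process_def], of f N g] by simp

lemma D0: "D\<^sub>0 \<in> borel_measurable M" "integrable M (\<lambda>\<omega>. (D\<^sub>0 \<omega>)\<^sup>2)"
  using spectral by (auto simp: spectral_representation_def)

lemmas [measurable] = D0(1)

text \<open>The part of \<open>B\<close> that is a stochastic integral: centred, with stationary
  second moments of its increments, but in general not itself stationary.\<close>

definition W :: "real \<Rightarrow> 'a \<Rightarrow> real" where "W t \<omega> = B t \<omega> - D\<^sub>0 \<omega> * t"

lemma W_measurable[measurable (raw)]:
  "f \<in> borel_measurable N \<Longrightarrow> g \<in> measurable N M \<Longrightarrow> (\<lambda>x. W (f x) (g x)) \<in> borel_measurable N"
proof -
  assume [measurable]: "f \<in> borel_measurable N" "g \<in> measurable N M"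
  have [measurable]: "(\<lambda>x. D\<^sub>0 (g x)) \<in> borel_measurable N" by (rule measurable_compose[OF _ D0(1)]) simp
  show ?thesis unfolding W_def by measurable
qed

lemma sets_\<mu>: "sets \<mu> = sets (restrict_space borel (- {0}))"
  using urm by (simp add: uncorrelated_random_measure_def)

lemma space_\<mu>: "space \<mu> = - {0}"
  using sets_eq_imp_space_eq[OF sets_\<mu>] by (simp add: space_restrict_space)

lemma borel_measurable_\<mu>[measurable (raw)]: "f \<in> measurable borel N \<Longrightarrow> f \<in> measurable \<mu> N"
  unfolding measurable_cong_sets[OF sets_\<mu> refl] by (rule measurable_restrict_space1)

lemma min_integrable: "integrable \<mu> (\<lambda>u. min (u\<^sup>2) 1)"
proof (rule integrableI_nonneg)
  show "(\<integral>\<^sup>+u. ennreal (min (u\<^sup>2) 1) \<partial>\<mu>) < \<infinity>" using spectral by (simp add: spectral_representation_def)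
  show "(\<lambda>u. min (u\<^sup>2) 1) \<in> borel_measurable \<mu>" by (rule borel_measurable_\<mu>) measurable
qed auto

definition bound :: real where "bound = (\<integral>u. min (u\<^sup>2) 1 \<partial>\<mu>)"

lemma W_combination_integral:
  "finite I \<Longrightarrow> has_stochastic_integral M \<mu> X (\<lambda>u. \<Sum>t\<in>I. complex_of_real (a t) * (iexp (t * u) - 1))
     (\<lambda>\<omega>. complex_of_real (\<Sum>t\<in>I. a t * W t \<omega>))"
proof -
  assume I: "finite I"
  have "has_stochastic_integral M \<mu> X (\<lambda>u. iexp (t * u) - 1) (\<lambda>\<omega>. complex_of_real (W t \<omega>))" for t
    using spectral unfolding spectral_representation_def W_def by blast
  then show ?thesis using has_stochastic_integral_sum[OF I, of "\<lambda>t u. iexp (t * u) - 1" "\<lambda>t \<omega>. complex_of_real (W t \<omega>)" "\<lambda>t. complex_of_real (a t)"]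
    by (simp only: of_real_sum of_real_mult)
qed

lemmas W_combination = stochastic_integral_isometry[OF W_combination_integral]

text \<open>A factor \<open>iexp (t * u)\<close> of modulus 1 reduces the difference of two
  exponentials to the time difference.\<close>

lemma W_increment:
  "integrable M (\<lambda>\<omega>. (W s \<omega> - W t \<omega>)\<^sup>2)" "(\<integral>\<omega>. (W s \<omega> - W t \<omega>)\<^sup>2 \<partial>M) = (\<integral>u. (cmod (iexp ((s - t) * u) - 1))\<^sup>2 \<partial>\<mu>)"
  "integrable \<mu> (\<lambda>u. (cmod (iexp ((s - t) * u) - 1))\<^sup>2)"
proof -
  have c: "cmod (iexp (s * u) - iexp (t * u)) = cmod (iexp ((s - t) * u) - 1)" for u
  proof -
    have "iexp (s * u) - iexp (t * u) = iexp (t * u) * (iexp ((s - t) * u) - 1)"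
      by (simp add: left_diff_distrib right_diff_distrib exp_add[symmetric])
    then show ?thesis by (simp add: norm_mult)
  qed
  have "integrable M (\<lambda>\<omega>. (W s \<omega> - W t \<omega>)\<^sup>2) \<and> (\<integral>\<omega>. (W s \<omega> - W t \<omega>)\<^sup>2 \<partial>M) = (\<integral>u. (cmod (iexp (s * u) - iexp (t * u)))\<^sup>2 \<partial>\<mu>) \<and>
     integrable \<mu> (\<lambda>u. (cmod (iexp (s * u) - iexp (t * u)))\<^sup>2)"
  proof (cases "s = t")
    case False
    define a where "a x = (if x = s then 1 else - 1 :: real)" for x
    have "(\<Sum>x\<in>{s, t}. a x * W x \<omega>) = W s \<omega> - W t \<omega>" "(\<Sum>x\<in>{s, t}. complex_of_real (a x) * (iexp (x * u) - 1)) = iexp (s * u) - iexp (t * u)" for \<omega> u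
      using False by (auto simp: a_def)
    then show ?thesis using W_combination(3,4,5)[of "{s, t}" a] by simp
  qed simp
  then show "integrable M (\<lambda>\<omega>. (W s \<omega> - W t \<omega>)\<^sup>2)" "(\<integral>\<omega>. (W s \<omega> - W t \<omega>)\<^sup>2 \<partial>M) = (\<integral>u. (cmod (iexp ((s - t) * u) - 1))\<^sup>2 \<partial>\<mu>)"
    "integrable \<mu> (\<lambda>u. (cmod (iexp ((s - t) * u) - 1))\<^sup>2)"
    unfolding c by auto
qed

lemma W_square: "integrable M (\<lambda>\<omega>. (W t \<omega>)\<^sup>2)" "(\<integral>\<omega>. (W t \<omega>)\<^sup>2 \<partial>M) = (\<integral>u. (cmod (iexp (t * u) - 1))\<^sup>2 \<partial>\<mu>)"
  using W_combination(3,5)[of "{t}" "\<lambda>_. 1"] by simp_all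

lemma increment_bound: "(\<integral>u. (cmod (iexp (x * u) - 1))\<^sup>2 \<partial>\<mu>) \<le> (2 + \<bar>x\<bar>)\<^sup>2 * bound"
proof -
  have "(\<integral>u. (cmod (iexp (x * u) - 1))\<^sup>2 \<partial>\<mu>) \<le> (\<integral>u. (2 + \<bar>x\<bar>)\<^sup>2 * min (u\<^sup>2) 1 \<partial>\<mu>)"
    using W_increment(3)[of x 0] min_integrable iexp_minus_one_bound by (intro integral_mono) auto
  then show ?thesis by (simp add: bound_def)
qed

text \<open>The isometry exchanges the parametrized integral over \<mu> for one over the probability
  space, where joint measurability of the process gives measurability in x.\<close>

lemma increment_measurable: "(\<lambda>x. \<integral>u. (cmod (iexp (x * u) - 1))\<^sup>2 \<partial>\<mu>) \<in> borel_measurable borel"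
proof -
  have "(\<lambda>x. \<integral>u. (cmod (iexp (x * u) - 1))\<^sup>2 \<partial>\<mu>) = (\<lambda>x. \<integral>\<omega>. (W x \<omega>)\<^sup>2 \<partial>M)" by (simp add: W_square)
  also have "\<dots> \<in> borel_measurable borel" by measurable
  finally show ?thesis .
qed

lemma increment_tendsto:
  assumes x: "x \<longlonglongrightarrow> 0"
  shows "(\<lambda>n. \<integral>u. (cmod (iexp (x n * u) - 1))\<^sup>2 \<partial>\<mu>) \<longlonglongrightarrow> 0"
proof -
  obtain C where C: "\<And>n. \<bar>x n\<bar> \<le> C" using x by (metis Bseq_def convergentI convergent_imp_Bseq real_norm_def)
  have "(\<lambda>n. \<integral>u. (cmod (iexp (x n * u) - 1))\<^sup>2 \<partial>\<mu>) \<longlonglongrightarrow> (\<integral>u. 0 \<partial>\<mu>)"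
  proof (rule integral_dominated_convergence[where w="\<lambda>u. (2 + C)\<^sup>2 * min (u\<^sup>2) 1"])
    show "AE u in \<mu>. (\<lambda>n. (cmod (iexp (x n * u) - 1))\<^sup>2) \<longlonglongrightarrow> 0"
    proof (rule AE_I2)
      fix u
      have "(\<lambda>n. (cmod (iexp (x n * u) - 1))\<^sup>2) \<longlonglongrightarrow> (cmod (iexp (0 * u) - 1))\<^sup>2"
        by (intro tendsto_intros x)
      then show "(\<lambda>n. (cmod (iexp (x n * u) - 1))\<^sup>2) \<longlonglongrightarrow> 0" by simp
    qed
    show "AE u in \<mu>. norm ((cmod (iexp (x n * u) - 1))\<^sup>2) \<le> (2 + C)\<^sup>2 * min (u\<^sup>2) 1" for n
    proof (rule AE_I2)
      fix u
      have "(cmod (iexp (x n * u) - 1))\<^sup>2 \<le> (2 + \<bar>x n\<bar>)\<^sup>2 * min (u\<^sup>2) 1" by (rule iexp_minus_one_bound)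
      also have "\<dots> \<le> (2 + C)\<^sup>2 * min (u\<^sup>2) 1" using C[of n] by (intro mult_right_mono power_mono) auto
      finally show "norm ((cmod (iexp (x n * u) - 1))\<^sup>2) \<le> (2 + C)\<^sup>2 * min (u\<^sup>2) 1" by simp
    qed
  qed (use min_integrable in auto)
  then show ?thesis by simp
qed

text \<open>\<open>D\<^sub>0\<close> is the mean-square limit of \<open>B n / n\<close>, so combinations of \<open>W\<close> are limits of combinations of \<open>B\<close>.\<close>
lemma W_combination_gaussian:
  assumes I: "finite I"
  shows "gaussian_char M (\<lambda>\<omega>. \<Sum>t\<in>I. a t * W t \<omega>)"
proof -
  \<comment> \<open>The combination of \<open>W\<close> is that of \<open>B\<close> minus
    \<open>s * D\<^sub>0\<close>. Replacing \<open>D\<^sub>0\<close> by B(n + 1) / (n + 1) keeps a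
    finite combination of values of \<open>B\<close> and leaves the error - s W(n + 1) / (n + 1);
    \<open>Suc\<close> avoids division by 0.\<close>
  define s where "s = (\<Sum>t\<in>I. a t * t)"
  define Yn where "Yn n \<omega> = (\<Sum>t\<in>I. a t * B t \<omega>) - s * B (real (Suc n)) \<omega> / real (Suc n)" for n \<omega>
  show ?thesis
  proof (rule gaussian_char_limit)
    show "gaussian_char M (Yn n)" for n
    proof (rule gaussian_rv_imp_gaussian_char)
      define J where "J = insert (real (Suc n)) I"
      define b where "b t = (if t \<in> I then a t else 0) - (if t = real (Suc n) then s / real (Suc n) else 0)" for t
      have J: "finite J" using I by (simp add: J_def)
      have "(\<Sum>t\<in>J. b t * B t \<omega>) = Yn n \<omega>" for \<omega>
      proof -
        have "(\<Sum>t\<in>J. b t * B t \<omega>) = (\<Sum>t\<in>J. if t \<in> I then a t * B t \<omega> else 0) - (\<Sum>t\<in>J. if t = real (Suc n) then s / real (Suc n) * B t \<omega> else 0)"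
          unfolding sum_subtractf[symmetric] by (intro sum.cong) (auto simp: b_def algebra_simps)
        also have "(\<Sum>t\<in>J. if t \<in> I then a t * B t \<omega> else 0) = (\<Sum>t\<in>I. a t * B t \<omega>)"
          using J by (subst sum.inter_restrict[symmetric]) (auto simp: J_def intro!: sum.cong)
        also have "(\<Sum>t\<in>J. if t = real (Suc n) then s / real (Suc n) * B t \<omega> else 0) = s / real (Suc n) * B (real (Suc n)) \<omega>"
          using J by (subst sum.delta) (auto simp: J_def)
        finally show ?thesis by (simp add: Yn_def)
      qed
      then have "Yn n = (\<lambda>\<omega>. \<Sum>t\<in>J. b t * B t \<omega>)" by auto
      then show "gaussian_rv M (Yn n)" using gaussian_B J unfolding gaussian_process_def by simp
    qed
    show "(\<lambda>\<omega>. \<Sum>t\<in>I. a t * W t \<omega>) \<in> borel_measurable M" by measurable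
    have e: "(Yn n \<omega> - (\<Sum>t\<in>I. a t * W t \<omega>))\<^sup>2 = s\<^sup>2 * ((W (real (Suc n)) \<omega>)\<^sup>2 / (real (Suc n))\<^sup>2)" for n \<omega>
    proof -
      have "(\<Sum>t\<in>I. a t * W t \<omega>) = (\<Sum>t\<in>I. a t * B t \<omega>) - D\<^sub>0 \<omega> * s"
        unfolding W_def s_def right_diff_distrib sum_subtractf sum_distrib_left by (simp add: mult_ac)
      then have "Yn n \<omega> - (\<Sum>t\<in>I. a t * W t \<omega>) = - s * (W (real (Suc n)) \<omega> / real (Suc n))"
        by (simp add: Yn_def W_def diff_divide_distrib algebra_simps del: of_nat_Suc)
      then show ?thesis by (simp add: power_mult_distrib power_divide)
    qed
    have E: "(\<integral>\<^sup>+\<omega>. ennreal ((Yn n \<omega> - (\<Sum>t\<in>I. a t * W t \<omega>))\<^sup>2) \<partial>M) = ennreal (s\<^sup>2 * (\<integral>u. (cmod (iexp (real (Suc n) * u) - 1))\<^sup>2 / (real (Suc n))\<^sup>2 \<partial>\<mu>))" for n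
      unfolding e using W_square[of "real (Suc n)"]
      by (subst nn_integral_eq_integral) (auto simp del: of_nat_Suc)
    have "(\<lambda>n. s\<^sup>2 * (\<integral>u. (cmod (iexp (real (Suc n) * u) - 1))\<^sup>2 / (real (Suc n))\<^sup>2 \<partial>\<mu>)) \<longlonglongrightarrow> s\<^sup>2 * (\<integral>u. 0 \<partial>\<mu>)"
    proof (intro tendsto_mult tendsto_const integral_dominated_convergence[where w="\<lambda>u. 9 * min (u\<^sup>2) 1"])
      show "AE u in \<mu>. (\<lambda>n. (cmod (iexp (real (Suc n) * u) - 1))\<^sup>2 / (real (Suc n))\<^sup>2) \<longlonglongrightarrow> 0"
      proof (rule AE_I2)
        fix u
        have "(\<lambda>n. inverse (real (Suc n))) \<longlonglongrightarrow> 0" by (rule LIMSEQ_inverse_real_of_nat)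
        then have "(\<lambda>n. 4 * (inverse (real (Suc n)))\<^sup>2) \<longlonglongrightarrow> 4 * 0\<^sup>2" by (intro tendsto_intros)
        then have l: "(\<lambda>n. 4 * (inverse (real (Suc n)))\<^sup>2) \<longlonglongrightarrow> 0" by simp
        have "(cmod (iexp y - 1))\<^sup>2 \<le> 2\<^sup>2" for y using norm_triangle_ineq4[of "iexp y" 1] by (intro power_mono) auto
        then have "(cmod (iexp y - 1))\<^sup>2 / k\<^sup>2 \<le> 4 * (inverse k)\<^sup>2" for y k :: real
          using divide_right_mono[of "(cmod (iexp y - 1))\<^sup>2" "2\<^sup>2" "k\<^sup>2"] by (simp add: divide_inverse power_inverse)
        then show "(\<lambda>n. (cmod (iexp (real (Suc n) * u) - 1))\<^sup>2 / (real (Suc n))\<^sup>2) \<longlonglongrightarrow> 0"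
          by (intro Lim_null_comparison[OF _ l] always_eventually allI) (simp only: real_norm_def abs_divide abs_power2)
      qed
      show "AE u in \<mu>. norm ((cmod (iexp (real (Suc n) * u) - 1))\<^sup>2 / (real (Suc n))\<^sup>2) \<le> 9 * min (u\<^sup>2) 1" for n
      proof (rule AE_I2)
        fix u
        \<comment> \<open>For k \<ge> 1 the factor (2 + k)^2 is at most (3 k)^2, so division by k^2
          leaves 9.\<close>
        define k where "k = real (Suc n)"
        have k: "k \<ge> 1" by (simp add: k_def)
        have "(cmod (iexp (k * u) - 1))\<^sup>2 \<le> (2 + k)\<^sup>2 * min (u\<^sup>2) 1" using iexp_minus_one_bound[of k u] k by simp
        also have "\<dots> \<le> (3 * k)\<^sup>2 * min (u\<^sup>2) 1" using k by (intro mult_right_mono power_mono) auto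
        finally have "(cmod (iexp (k * u) - 1))\<^sup>2 / k\<^sup>2 \<le> 9 * min (u\<^sup>2) 1" using k by (simp add: divide_le_eq power_mult_distrib mult_ac)
        then show "norm ((cmod (iexp (real (Suc n) * u) - 1))\<^sup>2 / (real (Suc n))\<^sup>2) \<le> 9 * min (u\<^sup>2) 1" unfolding k_def by simp
      qed
    qed (use min_integrable in auto)
    then have "(\<lambda>n. ennreal (s\<^sup>2 * (\<integral>u. (cmod (iexp (real (Suc n) * u) - 1))\<^sup>2 / (real (Suc n))\<^sup>2 \<partial>\<mu>))) \<longlonglongrightarrow> ennreal 0"
      by (intro tendsto_ennrealI) simp
    then show "(\<lambda>n. \<integral>\<^sup>+\<omega>. ennreal ((Yn n \<omega> - (\<Sum>t\<in>I. a t * W t \<omega>))\<^sup>2) \<partial>M) \<longlonglongrightarrow> 0" unfolding E by simp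
  qed
qed

section \<open>The closed linear span of the process and its spectral image\<close>

text \<open>Pairs a finite combination of \<open>W\<close> with its image under the isometry; real
  coefficients keep the random variable real.\<close>

definition base :: "('a \<Rightarrow> real) \<Rightarrow> (real \<Rightarrow> complex) \<Rightarrow> bool" where
  "base Y \<phi> \<longleftrightarrow> (\<exists>I a. finite I \<and> Y = (\<lambda>\<omega>. \<Sum>t\<in>I. a t * W t \<omega>) \<and> \<phi> = (\<lambda>u. \<Sum>t\<in>I. complex_of_real (a t) * (iexp (t * u) - 1)))"

text \<open>\<open>Y\<close> belongs to the closed linear span of \<open>W\<close> in \<open>L\<^sub>2(M)\<close>, and \<open>\<phi>\<close> is its image under the isometry into \<open>L\<^sub>2(\<mu>)\<close>.\<close>
definition represents :: "('a \<Rightarrow> real) \<Rightarrow> (real \<Rightarrow> complex) \<Rightarrow> bool" where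
  "represents Y \<phi> \<longleftrightarrow> Y \<in> borel_measurable M \<and> \<phi> \<in> borel_measurable \<mu> \<and>
     (\<exists>Yn \<phi>n. (\<forall>n. base (Yn n) (\<phi>n n)) \<and>
        (\<lambda>n. \<integral>\<^sup>+\<omega>. ennreal ((norm (Yn n \<omega> - Y \<omega>))\<^sup>2) \<partial>M) \<longlonglongrightarrow> 0 \<and>
        (\<lambda>n. \<integral>\<^sup>+u. ennreal ((norm (\<phi>n n u - \<phi> u))\<^sup>2) \<partial>\<mu>) \<longlonglongrightarrow> 0)"

lemma base_measurable: "base Y \<phi> \<Longrightarrow> Y \<in> borel_measurable M" "base Y \<phi> \<Longrightarrow> \<phi> \<in> borel_measurable \<mu>"
  unfolding base_def using W_combination(1,2) by blast+

lemma base_linear: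
  assumes "base Y \<phi>" "base Y' \<phi>'"
  shows "base (\<lambda>\<omega>. a *\<^sub>R Y \<omega> + b *\<^sub>R Y' \<omega>) (\<lambda>u. a *\<^sub>R \<phi> u + b *\<^sub>R \<phi>' u)"
proof -
  from assms obtain I c J d where I: "finite I" "Y = (\<lambda>\<omega>. \<Sum>t\<in>I. c t * W t \<omega>)" "\<phi> = (\<lambda>u. \<Sum>t\<in>I. complex_of_real (c t) * (iexp (t * u) - 1))"
    and J: "finite J" "Y' = (\<lambda>\<omega>. \<Sum>t\<in>J. d t * W t \<omega>)" "\<phi>' = (\<lambda>u. \<Sum>t\<in>J. complex_of_real (d t) * (iexp (t * u) - 1))"
    unfolding base_def by blast
  \<comment> \<open>Coefficients are merged on the union, so a time common to both sums receives
    both weights. In \<open>gen\<close> the function \<open>f\<close> is generic because the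
    identity is used for the variables and for the exponentials.\<close>
  define e where "e t = a * (if t \<in> I then c t else 0) + b * (if t \<in> J then d t else 0)" for t
  have gen: "(\<Sum>t\<in>I \<union> J. e t *\<^sub>R f t) = a *\<^sub>R (\<Sum>t\<in>I. c t *\<^sub>R f t) + b *\<^sub>R (\<Sum>t\<in>J. d t *\<^sub>R f t)" for f :: "real \<Rightarrow> 'z :: real_vector"
  proof -
    have "(\<Sum>t\<in>I \<union> J. e t *\<^sub>R f t) = a *\<^sub>R (\<Sum>t\<in>I \<union> J. if t \<in> I then c t *\<^sub>R f t else 0) + b *\<^sub>R (\<Sum>t\<in>I \<union> J. if t \<in> J then d t *\<^sub>R f t else 0)"
      unfolding scaleR_sum_right sum.distrib[symmetric] by (intro sum.cong) (auto simp: e_def scaleR_left_distrib)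
    also have "(\<Sum>t\<in>I \<union> J. if t \<in> I then c t *\<^sub>R f t else 0) = (\<Sum>t\<in>I. c t *\<^sub>R f t)"
      using I J by (subst sum.inter_restrict[symmetric]) (auto intro!: sum.cong)
    also have "(\<Sum>t\<in>I \<union> J. if t \<in> J then d t *\<^sub>R f t else 0) = (\<Sum>t\<in>J. d t *\<^sub>R f t)"
      using I J by (subst sum.inter_restrict[symmetric]) (auto intro!: sum.cong)
    finally show ?thesis .
  qed
  show ?thesis unfolding base_def
  proof (intro exI[of _ "I \<union> J"] exI[of _ e] conjI)
    show "(\<lambda>\<omega>. a *\<^sub>R Y \<omega> + b *\<^sub>R Y' \<omega>) = (\<lambda>\<omega>. \<Sum>t\<in>I \<union> J. e t * W t \<omega>)"
      using gen[of "\<lambda>t. W t _"] by (simp add: I J)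
    show "(\<lambda>u. a *\<^sub>R \<phi> u + b *\<^sub>R \<phi>' u) = (\<lambda>u. \<Sum>t\<in>I \<union> J. complex_of_real (e t) * (iexp (t * u) - 1))"
      using gen[of "\<lambda>t. iexp (t * _) - 1"] by (simp add: I J scaleR_conv_of_real)
  qed (use I J in auto)
qed

lemma represents_linear:
  assumes "represents Y \<phi>" "represents Y' \<phi>'"
  shows "represents (\<lambda>\<omega>. a *\<^sub>R Y \<omega> + b *\<^sub>R Y' \<omega>) (\<lambda>u. a *\<^sub>R \<phi> u + b *\<^sub>R \<phi>' u)"
proof -
  from assms(1) obtain Yn \<phi>n where 1: "\<And>n. base (Yn n) (\<phi>n n)" "Y \<in> borel_measurable M" "\<phi> \<in> borel_measurable \<mu>"
     "(\<lambda>n. \<integral>\<^sup>+\<omega>. ennreal ((norm (Yn n \<omega> - Y \<omega>))\<^sup>2) \<partial>M) \<longlonglongrightarrow> 0" "(\<lambda>n. \<integral>\<^sup>+u. ennreal ((norm (\<phi>n n u - \<phi> u))\<^sup>2) \<partial>\<mu>) \<longlonglongrightarrow> 0"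
    unfolding represents_def by blast
  from assms(2) obtain Yn' \<phi>n' where 2: "\<And>n. base (Yn' n) (\<phi>n' n)" "Y' \<in> borel_measurable M" "\<phi>' \<in> borel_measurable \<mu>"
     "(\<lambda>n. \<integral>\<^sup>+\<omega>. ennreal ((norm (Yn' n \<omega> - Y' \<omega>))\<^sup>2) \<partial>M) \<longlonglongrightarrow> 0" "(\<lambda>n. \<integral>\<^sup>+u. ennreal ((norm (\<phi>n' n u - \<phi>' u))\<^sup>2) \<partial>\<mu>) \<longlonglongrightarrow> 0"
    unfolding represents_def by blast
  note [measurable] = 1(2,3) 2(2,3)
  note bm = base_measurable[OF 1(1)] base_measurable[OF 2(1)]
  show ?thesis unfolding represents_def
  proof (intro conjI exI[of _ "\<lambda>n \<omega>. a *\<^sub>R Yn n \<omega> + b *\<^sub>R Yn' n \<omega>"] exI[of _ "\<lambda>n u. a *\<^sub>R \<phi>n n u + b *\<^sub>R \<phi>n' n u"] allI)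
    show "base (\<lambda>\<omega>. a *\<^sub>R Yn n \<omega> + b *\<^sub>R Yn' n \<omega>) (\<lambda>u. a *\<^sub>R \<phi>n n u + b *\<^sub>R \<phi>n' n u)" for n by (rule base_linear[OF 1(1) 2(1)])
    show "(\<lambda>n. \<integral>\<^sup>+\<omega>. ennreal ((norm (a *\<^sub>R Yn n \<omega> + b *\<^sub>R Yn' n \<omega> - (a *\<^sub>R Y \<omega> + b *\<^sub>R Y' \<omega>)))\<^sup>2) \<partial>M) \<longlonglongrightarrow> 0"
      by (rule L2_tendsto_linear[OF bm(1,3) 1(2) 2(2) 1(4) 2(4)])
    show "(\<lambda>n. \<integral>\<^sup>+u. ennreal ((norm (a *\<^sub>R \<phi>n n u + b *\<^sub>R \<phi>n' n u - (a *\<^sub>R \<phi> u + b *\<^sub>R \<phi>' u)))\<^sup>2) \<partial>\<mu>) \<longlonglongrightarrow> 0"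
      by (rule L2_tendsto_linear[OF bm(2,4) 1(3) 2(3) 1(5) 2(5)])
  qed measurable
qed

lemma represents_W: "represents (W t) (\<lambda>u. iexp (t * u) - 1)"
proof -
  have "base (W t) (\<lambda>u. iexp (t * u) - 1)"
    unfolding base_def by (intro exI[of _ "{t}"] exI[of _ "\<lambda>_. 1"]) simp
  then show ?thesis unfolding represents_def
    by (intro conjI exI[of _ "\<lambda>n. W t"] exI[of _ "\<lambda>n u. iexp (t * u) - 1"]) (auto dest: base_measurable)
qed

lemma represents_sum:
  assumes "finite D" "\<And>x. x \<in> D \<Longrightarrow> represents (Y x) (\<phi> x)"
  shows "represents (\<lambda>\<omega>. \<Sum>x\<in>D. c x * Y x \<omega>) (\<lambda>u. \<Sum>x\<in>D. complex_of_real (c x) * \<phi> x u)"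
  using assms
proof (induction D)
  case empty
  show ?case using represents_linear[OF represents_W[of 0] represents_W[of 0], of 0 0] by simp
next
  case (insert x D)
  then show ?case
    using represents_linear[of "Y x" "\<phi> x" "\<lambda>\<omega>. \<Sum>x\<in>D. c x * Y x \<omega>" "\<lambda>u. \<Sum>x\<in>D. complex_of_real (c x) * \<phi> x u" "c x" 1]
    by (simp add: scaleR_conv_of_real)
qed

text \<open>Each property holds for finite combinations and survives the two parallel limits, in
  L2(M) and in L2(\<mu>), along which the norms agree.\<close>

lemma represents_properties:
  assumes "represents Y \<phi>"
  shows "gaussian_char M Y" "(\<integral>\<omega>. Y \<omega> \<partial>M) = 0" "(\<integral>\<omega>. (Y \<omega>)\<^sup>2 \<partial>M) = (\<integral>u. (cmod (\<phi> u))\<^sup>2 \<partial>\<mu>)" "integrable \<mu> (\<lambda>u. (cmod (\<phi> u))\<^sup>2)"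
proof -
  from assms obtain Yn \<phi>n where b: "\<And>n. base (Yn n) (\<phi>n n)" and Y: "Y \<in> borel_measurable M" and \<phi>: "\<phi> \<in> borel_measurable \<mu>"
     and lY: "(\<lambda>n. \<integral>\<^sup>+\<omega>. ennreal ((norm (Yn n \<omega> - Y \<omega>))\<^sup>2) \<partial>M) \<longlonglongrightarrow> 0" and l\<phi>: "(\<lambda>n. \<integral>\<^sup>+u. ennreal ((norm (\<phi>n n u - \<phi> u))\<^sup>2) \<partial>\<mu>) \<longlonglongrightarrow> 0"
    unfolding represents_def by blast
  have lY': "(\<lambda>n. \<integral>\<^sup>+\<omega>. ennreal ((Yn n \<omega> - Y \<omega>)\<^sup>2) \<partial>M) \<longlonglongrightarrow> 0" using lY by simp
  have p: "gaussian_char M (Yn n)" "integrable M (\<lambda>\<omega>. (Yn n \<omega>)\<^sup>2)" "integrable \<mu> (\<lambda>u. (cmod (\<phi>n n u))\<^sup>2)"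
    "(\<integral>\<omega>. (Yn n \<omega>)\<^sup>2 \<partial>M) = (\<integral>u. (cmod (\<phi>n n u))\<^sup>2 \<partial>\<mu>)" "(\<integral>\<omega>. Yn n \<omega> \<partial>M) = 0" for n
  proof -
    from b[of n] obtain I a where I: "finite I" and e: "Yn n = (\<lambda>\<omega>. \<Sum>t\<in>I. a t * W t \<omega>)"
      "\<phi>n n = (\<lambda>u. \<Sum>t\<in>I. complex_of_real (a t) * (iexp (t * u) - 1))"
      unfolding base_def by blast
    show "gaussian_char M (Yn n)" "integrable M (\<lambda>\<omega>. (Yn n \<omega>)\<^sup>2)" "integrable \<mu> (\<lambda>u. (cmod (\<phi>n n u))\<^sup>2)"
      "(\<integral>\<omega>. (Yn n \<omega>)\<^sup>2 \<partial>M) = (\<integral>u. (cmod (\<phi>n n u))\<^sup>2 \<partial>\<mu>)" "(\<integral>\<omega>. Yn n \<omega> \<partial>M) = 0"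
      unfolding e by (rule W_combination_gaussian[OF I] W_combination(3,4,5,6)[OF I])+
  qed
  note bm = base_measurable[OF b]
  show "gaussian_char M Y" by (rule gaussian_char_limit[OF p(1) Y lY'])
  note 1 = L2_tendsto[OF bm(1) Y p(2) lY'] and 2 = L2_tendsto_cmod[OF bm(2) \<phi> p(3) l\<phi>] and 3 = L2_tendsto_L1[OF bm(1) Y p(2) lY']
  show "integrable \<mu> (\<lambda>u. (cmod (\<phi> u))\<^sup>2)" by (rule 2)
  show "(\<integral>\<omega>. (Y \<omega>)\<^sup>2 \<partial>M) = (\<integral>u. (cmod (\<phi> u))\<^sup>2 \<partial>\<mu>)" using LIMSEQ_unique[OF 1(4)[unfolded p(4)] 2(2)] .
  show "(\<integral>\<omega>. Y \<omega> \<partial>M) = 0" using 3(2) by (simp add: p(5) LIMSEQ_const_iff)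
qed

text \<open>Diagonal argument: the approximating base elements are chosen at distance \<open>1 / Suc k\<close> from the \<open>k\<close>-th term.\<close>
lemma represents_limit:
  assumes r: "\<And>k. represents (Yk k) (\<phi>k k)" and Y[measurable]: "Y \<in> borel_measurable M" and \<phi>[measurable]: "\<phi> \<in> borel_measurable \<mu>"
    and lY: "(\<lambda>k. \<integral>\<^sup>+\<omega>. ennreal ((norm (Yk k \<omega> - Y \<omega>))\<^sup>2) \<partial>M) \<longlonglongrightarrow> 0"
    and l\<phi>: "(\<lambda>k. \<integral>\<^sup>+u. ennreal ((norm (\<phi>k k u - \<phi> u))\<^sup>2) \<partial>\<mu>) \<longlonglongrightarrow> 0"
  shows "represents Y \<phi>"
proof -
  define close where "close k b \<beta> \<longleftrightarrow> base b \<beta> \<and> (\<integral>\<^sup>+\<omega>. ennreal ((norm (b \<omega> - Yk k \<omega>))\<^sup>2) \<partial>M) \<le> ennreal (inverse (real (Suc k))) \<and>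
      (\<integral>\<^sup>+u. ennreal ((norm (\<beta> u - \<phi>k k u))\<^sup>2) \<partial>\<mu>) \<le> ennreal (inverse (real (Suc k)))" for k b \<beta>
  have ex: "\<exists>b \<beta>. close k b \<beta>" for k
  proof -
    from r[of k] obtain Yn \<phi>n where b: "\<And>n. base (Yn n) (\<phi>n n)"
     and l: "(\<lambda>n. \<integral>\<^sup>+\<omega>. ennreal ((norm (Yn n \<omega> - Yk k \<omega>))\<^sup>2) \<partial>M) \<longlonglongrightarrow> 0" "(\<lambda>n. \<integral>\<^sup>+u. ennreal ((norm (\<phi>n n u - \<phi>k k u))\<^sup>2) \<partial>\<mu>) \<longlonglongrightarrow> 0"
      unfolding represents_def by blast
    have e: "0 < ennreal (inverse (real (Suc k)))" by simp
    have "\<forall>\<^sub>F n in sequentially. (\<integral>\<^sup>+\<omega>. ennreal ((norm (Yn n \<omega> - Yk k \<omega>))\<^sup>2) \<partial>M) < ennreal (inverse (real (Suc k))) \<and>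
       (\<integral>\<^sup>+u. ennreal ((norm (\<phi>n n u - \<phi>k k u))\<^sup>2) \<partial>\<mu>) < ennreal (inverse (real (Suc k)))"
      by (intro eventually_conj order_tendstoD(2)[OF l(1) e] order_tendstoD(2)[OF l(2) e])
    then obtain n where "(\<integral>\<^sup>+\<omega>. ennreal ((norm (Yn n \<omega> - Yk k \<omega>))\<^sup>2) \<partial>M) < ennreal (inverse (real (Suc k)))"
       "(\<integral>\<^sup>+u. ennreal ((norm (\<phi>n n u - \<phi>k k u))\<^sup>2) \<partial>\<mu>) < ennreal (inverse (real (Suc k)))"
      using eventually_happens' sequentially_bot by blast
    then show ?thesis using b[of n] unfolding close_def by (intro exI[of _ "Yn n"] exI[of _ "\<phi>n n"]) (auto intro: less_imp_le)
  qed
  obtain b \<beta> where "\<And>k. close k (b k) (\<beta> k)" using ex by metis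
  then have b: "\<And>k. base (b k) (\<beta> k)"
    and bY: "\<And>k. (\<integral>\<^sup>+\<omega>. ennreal ((norm (b k \<omega> - Yk k \<omega>))\<^sup>2) \<partial>M) \<le> ennreal (inverse (real (Suc k)))"
    and b\<phi>: "\<And>k. (\<integral>\<^sup>+u. ennreal ((norm (\<beta> k u - \<phi>k k u))\<^sup>2) \<partial>\<mu>) \<le> ennreal (inverse (real (Suc k)))"
    unfolding close_def by blast+
  have inv: "(\<lambda>k. ennreal (inverse (real (Suc k)))) \<longlonglongrightarrow> 0"
    using tendsto_ennrealI[OF LIMSEQ_inverse_real_of_nat] by simp
  have m: "Yk k \<in> borel_measurable M" "\<phi>k k \<in> borel_measurable \<mu>" for k using r[of k] by (auto simp: represents_def)
  note bm = base_measurable[OF b]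
  note [measurable] = m bm
  have 1: "(\<lambda>k. \<integral>\<^sup>+\<omega>. ennreal ((norm ((b k \<omega> - Yk k \<omega>) - 0))\<^sup>2) \<partial>M) \<longlonglongrightarrow> 0"
    by (rule tendsto_sandwich[OF _ _ tendsto_const inv]) (use bY in auto)
  have 2: "(\<lambda>k. \<integral>\<^sup>+u. ennreal ((norm ((\<beta> k u - \<phi>k k u) - 0))\<^sup>2) \<partial>\<mu>) \<longlonglongrightarrow> 0"
    by (rule tendsto_sandwich[OF _ _ tendsto_const inv]) (use b\<phi> in auto)
  show ?thesis unfolding represents_def
  proof (intro conjI Y \<phi> exI[of _ b] exI[of _ \<beta>] allI b)
    show "(\<lambda>k. \<integral>\<^sup>+\<omega>. ennreal ((norm (b k \<omega> - Y \<omega>))\<^sup>2) \<partial>M) \<longlonglongrightarrow> 0"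
      using L2_tendsto_linear[of "\<lambda>k \<omega>. b k \<omega> - Yk k \<omega>" M Yk "\<lambda>_. 0" Y 1 1, OF _ _ _ _ 1 lY] by simp
    show "(\<lambda>k. \<integral>\<^sup>+u. ennreal ((norm (\<beta> k u - \<phi> u))\<^sup>2) \<partial>\<mu>) \<longlonglongrightarrow> 0"
      using L2_tendsto_linear[of "\<lambda>k u. \<beta> k u - \<phi>k k u" \<mu> \<phi>k "\<lambda>_. 0" \<phi> 1 1, OF _ _ _ _ 2 l\<phi>] by simp
  qed
qed

end

subsection \<open>Filters of the increments\<close>

text \<open>Growth of order exp(|r| / 2) against the decay exp(- |r|) of the kernels leaves exp(-
  |r| / 2).\<close>

lemma laplace_scaleR_integrable:
  fixes g :: "real \<Rightarrow> 'b :: {banach, second_countable_topology}"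
  assumes k: "k \<in> {laplace_even, laplace_odd}" and g[measurable]: "g \<in> borel_measurable borel"
    and b: "\<And>r. norm (g r) \<le> C * exp (\<bar>r\<bar> / 2)"
  shows "integrable lborel (\<lambda>r. k r *\<^sub>R g r)"
proof (rule Bochner_Integration.integrable_bound)
  have [measurable]: "k \<in> borel_measurable borel" using k by auto
  show "integrable lborel (\<lambda>r. C / 2 * exp (- (1 / 2) * \<bar>r\<bar>))" by (intro integrable_mult_right integrable_exp_abs) auto
  show "(\<lambda>r. k r *\<^sub>R g r) \<in> borel_measurable lborel" by measurable
  have "norm (k r *\<^sub>R g r) \<le> norm (C / 2 * exp (- (1 / 2) * \<bar>r\<bar>))" for r
  proof -
    have "0 \<le> C * exp (\<bar>r\<bar> / 2)" using b[of r] norm_ge_zero[of "g r"] by linarith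
    then have C: "0 \<le> C" by (simp add: zero_le_mult_iff)
    have "norm (k r *\<^sub>R g r) = exp (- \<bar>r\<bar>) / 2 * norm (g r)" using k abs_laplace[of r] by auto
    also have "\<dots> \<le> exp (- \<bar>r\<bar>) / 2 * (C * exp (\<bar>r\<bar> / 2))" using b by (intro mult_left_mono) auto
    also have "\<dots> = C / 2 * (exp (- \<bar>r\<bar>) * exp (\<bar>r\<bar> / 2))" by simp
    also have "exp (- \<bar>r\<bar>) * exp (\<bar>r\<bar> / 2) = exp (- (1 / 2) * \<bar>r\<bar>)" by (simp add: exp_add[symmetric])
    finally show ?thesis using C by simp
  qed
  then show "AE r in lborel. norm (k r *\<^sub>R g r) \<le> norm (C / 2 * exp (- (1 / 2) * \<bar>r\<bar>))" by simp
qed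

text \<open>Reflection folds the negative half-line onto the positive one, where the two kernels
  differ only by a sign on the reflected part.\<close>

lemma laplace_integral_split:
  fixes g :: "real \<Rightarrow> 'b :: {banach, second_countable_topology}"
  assumes g[measurable]: "g \<in> borel_measurable borel" and b: "\<And>r. norm (g r) \<le> C * exp (\<bar>r\<bar> / 2)"
  defines "P \<equiv> (\<lambda>g. \<integral>r. indicator {0<..} r *\<^sub>R (exp (- r) / 2) *\<^sub>R g r \<partial>lborel)"
  shows "(\<integral>r. laplace_even r *\<^sub>R g r \<partial>lborel) = P g + P (\<lambda>r. g (- r))"
    "(\<integral>r. laplace_odd r *\<^sub>R g r \<partial>lborel) = P g - P (\<lambda>r. g (- r))"
proof -
  have i: "integrable lborel (\<lambda>r. indicator {0<..} r *\<^sub>R (exp (- r) / 2) *\<^sub>R f r)" if [measurable]: "f \<in> borel_measurable borel" and "\<And>r. norm (f r) \<le> C * exp (\<bar>r\<bar> / 2)" for f :: "real \<Rightarrow> 'b"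
  proof (rule Bochner_Integration.integrable_bound)
    show "integrable lborel (\<lambda>r. laplace_even r *\<^sub>R f r)" by (rule laplace_scaleR_integrable[OF _ that]) simp
  qed (auto simp: laplace_even_def split: split_indicator)
  have ig: "integrable lborel (\<lambda>r. indicator {0<..} r *\<^sub>R (exp (- r) / 2) *\<^sub>R g r)" by (rule i[OF g b])
  have ig': "integrable lborel (\<lambda>r. indicator {0<..} r *\<^sub>R (exp (- r) / 2) *\<^sub>R g (- r))" by (rule i) (use b[of "- _"] in auto)
  have neg: "integrable lborel (\<lambda>r. indicator {0<..} (0 + (-1) * r) *\<^sub>R (exp (- (0 + (-1) * r)) / 2) *\<^sub>R g (- (0 + (-1) * r)))"
    by (rule lborel_integrable_real_affine[OF ig']) simp
  have P': "P (\<lambda>r. g (- r)) = (\<integral>r. indicator {0<..} (0 + (-1) * r) *\<^sub>R (exp (- (0 + (-1) * r)) / 2) *\<^sub>R g (- (0 + (-1) * r)) \<partial>lborel)"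
    unfolding P_def by (subst lborel_integral_real_affine[where c="-1" and t=0]) auto
  have ne: "AE r in lborel. r \<noteq> (0::real)" by (rule AE_lborel_singleton)
  show "(\<integral>r. laplace_even r *\<^sub>R g r \<partial>lborel) = P g + P (\<lambda>r. g (- r))"
    unfolding P' unfolding P_def
    by (subst Bochner_Integration.integral_add[OF ig neg, symmetric], rule integral_cong_AE)
       (use ne in \<open>auto elim!: eventually_mono simp: laplace_even_def split: split_indicator\<close>)
  show "(\<integral>r. laplace_odd r *\<^sub>R g r \<partial>lborel) = P g - P (\<lambda>r. g (- r))"
    unfolding P' unfolding P_def
    by (subst Bochner_Integration.integral_diff[OF ig neg, symmetric], rule integral_cong_AE)
       (use ne in \<open>auto elim!: eventually_mono simp: laplace_odd_def split: split_indicator\<close>)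
qed

lemma one_sided_exponential_transform:
  "(\<integral>r. indicator {0<..} r *\<^sub>R (exp (- r) / 2) *\<^sub>R iexp (r * u) \<partial>lborel) = 1 / (2 * (1 - \<i> * u))"
proof -
  \<comment> \<open>The integrand is exp(r z) / 2 with Re z = -1, so its primitive exp(r z) / (2 z)
    vanishes at infinity.\<close>
  define z where "z = - 1 + \<i> * complex_of_real u"
  have z0: "z \<noteq> 0" by (auto simp: z_def complex_eq_iff)
  define F where "F r = exp (complex_of_real r * z) / (2 * z)" for r :: real
  define f where "f r = exp (complex_of_real r * z) / 2" for r :: real
  have fe: "f r = (exp (- r) / 2) *\<^sub>R iexp (r * u)" for r
    by (simp add: f_def z_def scaleR_conv_of_real exp_of_real[symmetric] exp_add[symmetric] algebra_simps)
  have ei: "einterval 0 \<infinity> = {0<..}" by (auto simp: einterval_def)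
  have "(LBINT r=0..\<infinity>. f r) = 0 - F 0"
  proof (rule interval_integral_FTC_integrable)
    show "(F has_vector_derivative f x) (at x)" for x
    proof -
      have "((\<lambda>w. exp (w * z) / (2 * z)) has_field_derivative f x) (at (complex_of_real x))"
        unfolding f_def using z0 by (auto intro!: derivative_eq_intros)
      from has_vector_derivative_real_field[OF this] show ?thesis unfolding F_def .
    qed
    show "isCont f x" for x unfolding f_def by (intro continuous_intros) simp
    have "integrable lborel (\<lambda>r. laplace_even r *\<^sub>R iexp (r * u))"
      by (rule laplace_scaleR_integrable[where C=1]) auto
    then show "set_integrable lborel (einterval 0 \<infinity>) f"
      unfolding set_integrable_def ei fe
      by (rule Bochner_Integration.integrable_bound) (auto simp: laplace_even_def split: split_indicator)
    have "(F \<longlongrightarrow> F 0) (at_right 0)" unfolding F_def by (intro tendsto_intros) (use z0 in auto)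
    then show "((F \<circ> real_of_ereal) \<longlongrightarrow> F 0) (at_right 0)"
      unfolding zero_ereal_def ereal_tendsto_simps .
    have "(F \<longlongrightarrow> 0) at_top"
    proof (rule Lim_null_comparison)
      show "\<forall>\<^sub>F r in at_top. norm (F r) \<le> exp (- r) / (2 * cmod z)"
      proof -
        have "Re z = - 1" by (simp add: z_def)
        then show ?thesis by (simp add: F_def norm_divide norm_mult)
      qed
      have "((\<lambda>r::real. exp (- r) / (2 * cmod z)) \<longlongrightarrow> 0 / (2 * cmod z)) at_top"
        by (intro tendsto_divide tendsto_const filterlim_compose[OF exp_at_bot filterlim_uminus_at_bot_at_top]) (use z0 in auto)
      then show "((\<lambda>r::real. exp (- r) / (2 * cmod z)) \<longlongrightarrow> 0) at_top" by simp
    qed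
    then show "((F \<circ> real_of_ereal) \<longlongrightarrow> 0) (at_left \<infinity>)"
      unfolding ereal_tendsto_simps .
  qed simp
  also have "(LBINT r=0..\<infinity>. f r) = (\<integral>r. indicator {0<..} r *\<^sub>R f r \<partial>lborel)"
    unfolding interval_lebesgue_integral_def set_lebesgue_integral_def ei by simp
  finally have "(\<integral>r. indicator {0<..} r *\<^sub>R f r \<partial>lborel) = - 1 / (2 * z)" by (simp add: F_def)
  also have "- 1 / (2 * z) = 1 / (2 * (1 - \<i> * u))"
  proof -
    have "2 * z = - (2 * (1 - \<i> * u))" by (simp add: z_def algebra_simps)
    then show ?thesis by (metis minus_divide_divide)
  qed
  finally show ?thesis by (simp only: fe)
qed

text \<open>Sum and difference of the one-sided transforms at u and -u, whose denominators multiply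
  to a multiple of 1 + u^2.\<close>

lemma laplace_fourier:
  "(\<integral>r. laplace_even r *\<^sub>R iexp (r * u) \<partial>lborel) = 1 / (1 + (complex_of_real u)\<^sup>2)"
  "(\<integral>r. laplace_odd r *\<^sub>R iexp (r * u) \<partial>lborel) = \<i> * u / (1 + (complex_of_real u)\<^sup>2)"
proof -
  have b: "norm (iexp (r * u)) \<le> 1 * exp (\<bar>r\<bar> / 2)" for r by simp
  have m: "(\<lambda>r. iexp (r * u)) \<in> borel_measurable borel" by measurable
  have e: "iexp (- r * u) = iexp (r * - u)" for r by simp
  have nz: "1 - \<i> * u \<noteq> 0" "1 + \<i> * u \<noteq> 0" "1 + (complex_of_real u)\<^sup>2 \<noteq> 0"
  proof -
    show 1: "1 - \<i> * u \<noteq> 0" "1 + \<i> * u \<noteq> 0" by (auto simp: complex_eq_iff)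
    have "1 + (complex_of_real u)\<^sup>2 = (1 - \<i> * u) * (1 + \<i> * u)" by (simp add: power2_eq_square algebra_simps)
    then show "1 + (complex_of_real u)\<^sup>2 \<noteq> 0" using 1 by simp
  qed
  have p: "(1 - \<i> * u) * (1 + \<i> * u) = 1 + (complex_of_real u)\<^sup>2" by (simp add: power2_eq_square algebra_simps)
  have a: "1 / (2 * (1 - \<i> * u)) = (1 + \<i> * u) / (2 * (1 + (complex_of_real u)\<^sup>2))" "1 / (2 * (1 + \<i> * u)) = (1 - \<i> * u) / (2 * (1 + (complex_of_real u)\<^sup>2))"
    unfolding p[symmetric] using nz by simp_all
  have q: "(\<integral>r. indicator {0<..} r *\<^sub>R (exp (- r) / 2) *\<^sub>R iexp (- r * u) \<partial>lborel) = 1 / (2 * (1 + \<i> * u))"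
    unfolding e using one_sided_exponential_transform[of "- u"] by simp
  have half: "(1 + x) / (2 * y) + (1 - x) / (2 * y) = 1 / y" "(1 + x) / (2 * y) - (1 - x) / (2 * y) = x / y" for x y :: complex
    by (simp_all add: add_divide_distrib[symmetric] diff_divide_distrib[symmetric])
  show "(\<integral>r. laplace_even r *\<^sub>R iexp (r * u) \<partial>lborel) = 1 / (1 + (complex_of_real u)\<^sup>2)"
    unfolding laplace_integral_split(1)[OF m b] one_sided_exponential_transform q a half ..
  show "(\<integral>r. laplace_odd r *\<^sub>R iexp (r * u) \<partial>lborel) = \<i> * u / (1 + (complex_of_real u)\<^sup>2)"
    unfolding laplace_integral_split(2)[OF m b] one_sided_exponential_transform q a half ..
qed

text \<open>These four numbers explain the filters: integrated against r \<mapsto> b + d r, the even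
  kernel returns b and the odd kernel returns d. Smoothing thus reproduces the current value, and
  its derivative isolates the drift.\<close>

lemma laplace_moments:
  "(\<integral>r. laplace_even r \<partial>lborel) = 1" "(\<integral>r. laplace_odd r \<partial>lborel) = 0"
  "(\<integral>r. laplace_even r * r \<partial>lborel) = 0" "(\<integral>r. laplace_odd r * r \<partial>lborel) = 1"
proof -
  have P: "(\<integral>r. indicator {0<..} r *\<^sub>R (exp (- r) / 2) *\<^sub>R (r ^ j) \<partial>lborel) = fact j / 2" for j
  proof -
    have "(\<integral>r. indicator {0<..} r *\<^sub>R (exp (- r) / 2) *\<^sub>R (r ^ j) \<partial>lborel) = (\<integral>r. indicator {0..} r * (r ^ j * exp (- r)) / 2 \<partial>lborel)"
      using AE_lborel_singleton[of "0::real"] by (intro integral_cong_AE) (auto elim!: eventually_mono split: split_indicator)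
    also have "\<dots> = (\<integral>r. indicator {0..} r * (r ^ j * exp (- r)) \<partial>lborel) / 2" by simp
    also have "(\<integral>r. indicator {0..} r * (r ^ j * exp (- r)) \<partial>lborel) = enn2real (\<integral>\<^sup>+r. ennreal (r ^ j * exp (- r)) * indicator {0..} r \<partial>lborel)"
      by (subst integral_eq_nn_integral) (auto intro!: arg_cong[where f=enn2real] nn_integral_cong split: split_indicator)
    also have "\<dots> = fact j" by (subst nn_intergal_power_times_exp_Ici) simp
    finally show ?thesis .
  qed
  have b1: "norm (1::real) \<le> 1 * exp (\<bar>r\<bar> / 2)" for r :: real by simp
  have b2: "norm r \<le> 2 * exp (\<bar>r\<bar> / 2)" for r :: real
    unfolding real_norm_def using exp_ge_add_one_self[of "\<bar>r\<bar> / 2"] by linarith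
  show "(\<integral>r. laplace_even r \<partial>lborel) = 1" "(\<integral>r. laplace_odd r \<partial>lborel) = 0"
    using laplace_integral_split[of "\<lambda>_. 1::real", OF _ b1] P[of 0] by simp_all
  show "(\<integral>r. laplace_even r * r \<partial>lborel) = 0" "(\<integral>r. laplace_odd r * r \<partial>lborel) = 1"
    using laplace_integral_split[of "\<lambda>r. r", OF _ b2] P[of 1] by simp_all
qed

locale atomless_spectral_process = spectral_process M B D\<^sub>0 X \<mu>
  for M :: "'a measure" and B :: "real \<Rightarrow> 'a \<Rightarrow> real" and D\<^sub>0 :: "'a \<Rightarrow> real"
    and X :: "real set \<Rightarrow> 'a \<Rightarrow> complex" and \<mu> :: "real measure" +
  assumes atomless: "no_atoms \<mu>"

text \<open>Frequency response of the filter with kernel \<open>k\<close> acting on increments;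
  subtracting 1 makes it small near u = 0, where \<mu> may have infinite mass.\<close>

definition transfer :: "(real \<Rightarrow> real) \<Rightarrow> real \<Rightarrow> complex" where
  "transfer k u = (\<integral>r. k r *\<^sub>R (iexp (r * u) - 1) \<partial>lborel)"

lemma transfer_laplace:
  "transfer laplace_even u = - complex_of_real (u\<^sup>2 / (1 + u\<^sup>2))"
  "transfer laplace_odd u = \<i> * complex_of_real (u / (1 + u\<^sup>2))"
proof -
  have i: "integrable lborel (\<lambda>r. k r *\<^sub>R iexp (r * u))" "integrable lborel (\<lambda>r. k r *\<^sub>R (1 :: complex))" if "k \<in> {laplace_even, laplace_odd}" for k
    by (rule laplace_scaleR_integrable[OF that, where C=1]; simp)+
  have t: "transfer k u = (\<integral>r. k r *\<^sub>R iexp (r * u) \<partial>lborel) - complex_of_real (\<integral>r. k r \<partial>lborel)" if k: "k \<in> {laplace_even, laplace_odd}" for k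
  proof -
    have "transfer k u = (\<integral>r. k r *\<^sub>R iexp (r * u) - k r *\<^sub>R 1 \<partial>lborel)" unfolding transfer_def by (simp add: scaleR_diff_right)
    also have "\<dots> = (\<integral>r. k r *\<^sub>R iexp (r * u) \<partial>lborel) - (\<integral>r. k r *\<^sub>R 1 \<partial>lborel)" by (rule Bochner_Integration.integral_diff[OF i[OF k]])
    also have "(\<integral>r. k r *\<^sub>R (1::complex) \<partial>lborel) = complex_of_real (\<integral>r. k r \<partial>lborel)" by (simp add: scaleR_conv_of_real)
    finally show ?thesis .
  qed
  have nz: "1 + u\<^sup>2 \<noteq> 0" by (metis add_nonneg_eq_0_iff zero_le_one zero_le_power2 zero_neq_one)
  have "transfer laplace_even u = 1 / (1 + (complex_of_real u)\<^sup>2) - complex_of_real 1"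
    using t[of laplace_even] by (simp only: laplace_fourier laplace_moments insertI1)
  also have "\<dots> = complex_of_real (1 / (1 + u\<^sup>2) - 1)" by simp
  also have "1 / (1 + u\<^sup>2) - 1 = - (u\<^sup>2 / (1 + u\<^sup>2))" using nz by (simp add: field_simps)
  finally show "transfer laplace_even u = - complex_of_real (u\<^sup>2 / (1 + u\<^sup>2))" by simp
  have "transfer laplace_odd u = \<i> * u / (1 + (complex_of_real u)\<^sup>2) - complex_of_real 0"
    using t[of laplace_odd] by (simp only: laplace_fourier laplace_moments insertI1 insertI2)
  then show "transfer laplace_odd u = \<i> * complex_of_real (u / (1 + u\<^sup>2))" by simp
qed

section \<open>Filtered increments as stationary Gaussian processes\<close>

context atomless_spectral_process
begin

text \<open>A path by path integral with default value 0 where it does not exist; by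
  \<open>kernel_increment\<close> it exists for almost every \<omega> at each time t.\<close>

definition filtered :: "(real \<Rightarrow> real) \<Rightarrow> real \<Rightarrow> 'a \<Rightarrow> real" where
  "filtered k t \<omega> = (\<integral>r. k r * (W (t + r) \<omega> - W t \<omega>) \<partial>lborel)"

lemma filtered_measurable[measurable (raw)]:
  assumes [measurable]: "k \<in> borel_measurable borel" "f \<in> borel_measurable N" "g \<in> measurable N M"
  shows "(\<lambda>x. filtered k (f x) (g x)) \<in> borel_measurable N"
  unfolding filtered_def by measurable

text \<open>The exponential weight turns the kernel integral into one over a finite measure with uniformly
  square integrable integrand.\<close>
lemma kernel_increment:
  fixes g g' :: "real \<Rightarrow> real"
  assumes k: "k \<in> {laplace_even, laplace_odd}" and g[measurable]: "g \<in> borel_measurable borel" "g' \<in> borel_measurable borel"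
    and d: "\<And>r. \<bar>g r - g' r\<bar> \<le> 3 * \<bar>r\<bar>"
  defines "N \<equiv> density lborel (\<lambda>r. ennreal (exp (- (1 / 2) * \<bar>r\<bar>)))"
  shows "AE \<omega> in M. integrable lborel (\<lambda>r. k r * (W (g r) \<omega> - W (g' r) \<omega>))"
    "integrable M (\<lambda>\<omega>. (\<integral>r. k r * (W (g r) \<omega> - W (g' r) \<omega>) \<partial>lborel)\<^sup>2)"
    "(\<integral>\<omega>. (\<integral>r. k r * (W (g r) \<omega> - W (g' r) \<omega>) \<partial>lborel)\<^sup>2 \<partial>M) \<le>
      measure N (space N) * (\<integral>r. exp (- \<bar>r\<bar>) / 4 * (\<integral>u. (cmod (iexp ((g r - g' r) * u) - 1))\<^sup>2 \<partial>\<mu>) \<partial>N)"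
    "finite_measure N" "\<And>r. exp (- \<bar>r\<bar>) / 4 * (\<integral>u. (cmod (iexp ((g r - g' r) * u) - 1))\<^sup>2 \<partial>\<mu>) \<le> 9 * bound"
proof -
  have [measurable]: "k \<in> borel_measurable borel" using k by auto
  have "(\<integral>\<^sup>+r. ennreal (exp (- (1 / 2) * \<bar>r\<bar>)) \<partial>lborel) < \<infinity>"
    using integrable_exp_abs[of "1/2"] by (simp add: integrable_iff_bounded)
  then show Nf: "finite_measure N" unfolding N_def by (intro finite_measureI) (simp add: emeasure_density)
  have sN[measurable_cong]: "sets N = sets borel" by (simp add: N_def)
  define Z where "Z r \<omega> = (k r * exp (\<bar>r\<bar> / 2)) * (W (g r) \<omega> - W (g' r) \<omega>)" for r \<omega>
  have w: "exp (- (1 / 2) * \<bar>r\<bar>) * (k r * exp (\<bar>r\<bar> / 2) * y) = k r * y" for r y :: real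
  proof -
    have "exp (- (1 / 2) * \<bar>r\<bar>) * exp (\<bar>r\<bar> / 2) = 1" by (simp add: exp_add[symmetric])
    moreover have "exp (- (1 / 2) * \<bar>r\<bar>) * (k r * exp (\<bar>r\<bar> / 2) * y) = (exp (- (1 / 2) * \<bar>r\<bar>) * exp (\<bar>r\<bar> / 2)) * (k r * y)"
      by (simp only: mult_ac)
    ultimately show ?thesis by (simp only: mult_1)
  qed
  \<comment> \<open>The squared kernel is exp(- 2 |r|) / 4, and the square of the factor that
    compensates the weight is exp |r|.\<close>
  have k2: "(k r * exp (\<bar>r\<bar> / 2))\<^sup>2 = exp (- \<bar>r\<bar>) / 4" for r
  proof -
    have "(k r)\<^sup>2 = (exp (- \<bar>r\<bar>) / 2)\<^sup>2" using k abs_laplace[of r] by (metis insertE power2_abs singletonD)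
    then have "(k r * exp (\<bar>r\<bar> / 2))\<^sup>2 = exp (- \<bar>r\<bar>) * exp (- \<bar>r\<bar>) * (exp (\<bar>r\<bar> / 2) * exp (\<bar>r\<bar> / 2)) / 4"
      by (simp add: power_mult_distrib power2_eq_square)
    also have "exp (- \<bar>r\<bar>) * exp (- \<bar>r\<bar>) * (exp (\<bar>r\<bar> / 2) * exp (\<bar>r\<bar> / 2)) = exp (- \<bar>r\<bar>)" by (simp add: exp_add[symmetric])
    finally show ?thesis .
  qed
  have Z2: "integrable M (\<lambda>\<omega>. (Z r \<omega>)\<^sup>2)" "(\<integral>\<omega>. (Z r \<omega>)\<^sup>2 \<partial>M) = exp (- \<bar>r\<bar>) / 4 * (\<integral>u. (cmod (iexp ((g r - g' r) * u) - 1))\<^sup>2 \<partial>\<mu>)" for r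
    unfolding Z_def power_mult_distrib[of "k r * exp (\<bar>r\<bar> / 2)"] k2 using W_increment[of "g r" "g' r"] by simp_all
  have bound0: "0 \<le> bound" unfolding bound_def by (rule Bochner_Integration.integral_nonneg) simp
  \<comment> \<open>2 + 3 |r| \<le> 6 (1 + |r| / 2) \<le> 6 exp(|r| / 2); squaring gives 36 exp |r|,
    and the factor exp(- |r|) / 4 turns this into 9.\<close>
  show K: "exp (- \<bar>r\<bar>) / 4 * (\<integral>u. (cmod (iexp ((g r - g' r) * u) - 1))\<^sup>2 \<partial>\<mu>) \<le> 9 * bound" for r
  proof -
    have "2 + \<bar>g r - g' r\<bar> \<le> 6 * (1 + \<bar>r\<bar> / 2)" using d[of r] by simp
    also have "\<dots> \<le> 6 * exp (\<bar>r\<bar> / 2)" by (intro mult_left_mono exp_ge_add_one_self) auto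
    finally have "(2 + \<bar>g r - g' r\<bar>)\<^sup>2 \<le> (6 * exp (\<bar>r\<bar> / 2))\<^sup>2" by (intro power_mono) auto
    also have "\<dots> = 36 * exp \<bar>r\<bar>" by (simp add: power_mult_distrib exp_double[symmetric])
    finally have "(2 + \<bar>g r - g' r\<bar>)\<^sup>2 * bound \<le> 36 * exp \<bar>r\<bar> * bound" using bound0 by (rule mult_right_mono)
    then have "(\<integral>u. (cmod (iexp ((g r - g' r) * u) - 1))\<^sup>2 \<partial>\<mu>) \<le> 36 * exp \<bar>r\<bar> * bound"
      using increment_bound[of "g r - g' r"] by linarith
    then have "exp (- \<bar>r\<bar>) / 4 * (\<integral>u. (cmod (iexp ((g r - g' r) * u) - 1))\<^sup>2 \<partial>\<mu>) \<le> exp (- \<bar>r\<bar>) / 4 * (36 * exp \<bar>r\<bar> * bound)"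
      by (rule mult_left_mono) simp
    also have "\<dots> = 9 * (exp (- \<bar>r\<bar>) * exp \<bar>r\<bar>) * bound" by simp
    also have "exp (- \<bar>r\<bar>) * exp \<bar>r\<bar> = 1" by (simp add: exp_add[symmetric])
    finally show ?thesis by simp
  qed
  have Zm: "(\<lambda>(r, \<omega>). Z r \<omega>) \<in> borel_measurable (N \<Otimes>\<^sub>M M)" unfolding Z_def by measurable
  note F = square_integral_Fubini[OF Nf finite_measure_axioms Zm Z2(1), of "9 * bound"]
  have conv: "(\<integral>r. Z r \<omega> \<partial>N) = (\<integral>r. k r * (W (g r) \<omega> - W (g' r) \<omega>) \<partial>lborel)"
    "integrable N (\<lambda>r. Z r \<omega>) \<longleftrightarrow> integrable lborel (\<lambda>r. k r * (W (g r) \<omega> - W (g' r) \<omega>))" if "\<omega> \<in> space M" for \<omega>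
  proof -
    have [measurable]: "(\<lambda>r. Z r \<omega>) \<in> borel_measurable borel" unfolding Z_def using that by measurable
    have z: "exp (- (1 / 2) * \<bar>r\<bar>) *\<^sub>R Z r \<omega> = k r * (W (g r) \<omega> - W (g' r) \<omega>)" for r
      by (simp only: Z_def real_scaleR_def w)
    show "(\<integral>r. Z r \<omega> \<partial>N) = (\<integral>r. k r * (W (g r) \<omega> - W (g' r) \<omega>) \<partial>lborel)"
      unfolding N_def z[symmetric] by (rule integral_density) auto
    show "integrable N (\<lambda>r. Z r \<omega>) \<longleftrightarrow> integrable lborel (\<lambda>r. k r * (W (g r) \<omega> - W (g' r) \<omega>))"
      unfolding N_def z[symmetric] by (rule integrable_density) auto
  qed
  have K': "(\<integral>\<omega>. (Z r \<omega>)\<^sup>2 \<partial>M) \<le> 9 * bound" for r unfolding Z2 by (rule K)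
  have "AE \<omega> in M. integrable N (\<lambda>r. Z r \<omega>)" by (rule F(2)) (rule K')
  then show "AE \<omega> in M. integrable lborel (\<lambda>r. k r * (W (g r) \<omega> - W (g' r) \<omega>))"
    using AE_space by eventually_elim (simp add: conv)
  have "integrable M (\<lambda>\<omega>. (\<integral>r. Z r \<omega> \<partial>N)\<^sup>2)" by (rule F(3)) (rule K')
  then show "integrable M (\<lambda>\<omega>. (\<integral>r. k r * (W (g r) \<omega> - W (g' r) \<omega>) \<partial>lborel)\<^sup>2)"
    by (rule Bochner_Integration.integrable_cong[THEN iffD1, rotated -1]) (simp_all add: conv)
  have "(\<integral>\<omega>. (\<integral>r. k r * (W (g r) \<omega> - W (g' r) \<omega>) \<partial>lborel)\<^sup>2 \<partial>M) = (\<integral>\<omega>. (\<integral>r. Z r \<omega> \<partial>N)\<^sup>2 \<partial>M)"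
    by (rule Bochner_Integration.integral_cong) (simp_all add: conv)
  also have "\<dots> \<le> measure N (space N) * (\<integral>r. (\<integral>\<omega>. (Z r \<omega>)\<^sup>2 \<partial>M) \<partial>N)" by (rule F(6)) (rule K')
  finally show "(\<integral>\<omega>. (\<integral>r. k r * (W (g r) \<omega> - W (g' r) \<omega>) \<partial>lborel)\<^sup>2 \<partial>M) \<le>
      measure N (space N) * (\<integral>r. exp (- \<bar>r\<bar>) / 4 * (\<integral>u. (cmod (iexp ((g r - g' r) * u) - 1))\<^sup>2 \<partial>\<mu>) \<partial>N)"
    unfolding Z2 .
qed

text \<open>The integration variable is rounded to finitely many values, which gives finite
  combinations \<open>Yk N\<close> with response \<open>H N\<close>. These converge in L2(M) by
  \<open>kernel_increment\<close> and in L2(\<mu>) by domination, so the limit belongs to the closed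
  span.\<close>

lemma represents_filtered:
  assumes k: "k \<in> {laplace_even, laplace_odd}"
  shows "represents (filtered k t) (\<lambda>u. iexp (t * u) * transfer k u)"
proof -
  have km[measurable]: "k \<in> borel_measurable borel" using k by auto
  obtain d :: "nat \<Rightarrow> real \<Rightarrow> real" where d[measurable]: "\<And>N. d N \<in> borel_measurable borel" and dfin: "\<And>N. finite (range (d N))"
    and dlim: "\<And>s. (\<lambda>N. d N s) \<longlonglongrightarrow> s" and dbound: "\<And>N s. \<bar>d N s\<bar> \<le> 2 * \<bar>s\<bar>"
    by (rule simple_approximation_of_identity) blast
  define Yk where "Yk N \<omega> = (\<integral>r. k r * (W (t + d N r) \<omega> - W t \<omega>) \<partial>lborel)" for N \<omega>
  define H where "H N u = (\<integral>r. k r *\<^sub>R (iexp (d N r * u) - 1) \<partial>lborel)" for N u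
  have ki: "integrable lborel k"
    using laplace_scaleR_integrable[OF k, of "\<lambda>_. 1::real" 1] by simp
  define c where "c N x = (\<integral>r. k r * indicator {x} (d N r) \<partial>lborel)" for N x
  have YkE: "Yk N \<omega> = (\<Sum>x\<in>range (d N). c N x * (W (t + x) \<omega> - W t \<omega>))" for N \<omega>
    unfolding Yk_def c_def using integral_simple_composition(2)[OF ki, of "d N" "range (d N)" "\<lambda>x. W (t + x) \<omega> - W t \<omega>"] dfin by simp
  have HE: "H N u = (\<Sum>x\<in>range (d N). complex_of_real (c N x) * (iexp (x * u) - 1))" for N u
    unfolding H_def c_def using integral_simple_composition(2)[OF ki, of "d N" "range (d N)" "\<lambda>x. iexp (x * u) - 1"] dfin
    by (simp add: scaleR_conv_of_real)
  have Hm[measurable]: "H N \<in> borel_measurable borel" for N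
    unfolding HE[abs_def] by measurable
  have rep: "represents (Yk N) (\<lambda>u. iexp (t * u) * H N u)" for N
  proof -
    have "represents (\<lambda>\<omega>. 1 *\<^sub>R W (t + x) \<omega> + (-1) *\<^sub>R W t \<omega>) (\<lambda>u. 1 *\<^sub>R (iexp ((t + x) * u) - 1) + (-1) *\<^sub>R (iexp (t * u) - 1))" for x
      by (rule represents_linear[OF represents_W represents_W])
    then have r: "represents (\<lambda>\<omega>. W (t + x) \<omega> - W t \<omega>) (\<lambda>u. iexp (t * u) * (iexp (x * u) - 1))" for x
      by (simp add: right_diff_distrib distrib_left distrib_right exp_add)
    have "(\<lambda>u. iexp (t * u) * H N u) = (\<lambda>u. \<Sum>x\<in>range (d N). complex_of_real (c N x) * (iexp (t * u) * (iexp (x * u) - 1)))"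
      unfolding HE sum_distrib_left by (simp add: mult_ac)
    then show ?thesis unfolding YkE[abs_def] using represents_sum[OF dfin[of N] r, of "c N"] by simp
  qed
  define C where "C = (\<integral>r. \<bar>k r\<bar> * (2 + 2 * \<bar>r\<bar>) \<partial>lborel)"
  have iC: "integrable lborel (\<lambda>r. \<bar>k r\<bar> * (2 + 2 * \<bar>r\<bar>))"
  proof -
    have "norm (2 + 2 * \<bar>r\<bar>) \<le> 4 * exp (\<bar>r\<bar> / 2)" for r :: real
      unfolding real_norm_def using exp_ge_add_one_self[of "\<bar>r\<bar> / 2"] by linarith
    from laplace_scaleR_integrable[OF k _ this] have "integrable lborel (\<lambda>r. \<bar>k r * (2 + 2 * \<bar>r\<bar>)\<bar>)" by simp
    then show ?thesis by (simp add: abs_mult)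
  qed
  have ie: "cmod (iexp (x * u) - 1) \<le> (2 + \<bar>x\<bar>) * min \<bar>u\<bar> 1" for x u
  proof -
    have "(cmod (iexp (x * u) - 1))\<^sup>2 \<le> ((2 + \<bar>x\<bar>) * min \<bar>u\<bar> 1)\<^sup>2"
      using iexp_minus_one_bound[of x u] by (auto simp: power_mult_distrib min_def abs_square_le_1 power2_eq_1_iff abs_if split: if_splits)
    then show ?thesis by (rule power2_le_imp_le) auto
  qed
  \<comment> \<open>One bound for the response and for all its rounded versions, from |f r| \<le> 2
    |r|; its square is integrable for \<mu>.\<close>
  have trb: "cmod (\<integral>r. k r *\<^sub>R (iexp (f r * u) - 1) \<partial>lborel) \<le> C * min \<bar>u\<bar> 1" if [measurable]: "f \<in> borel_measurable borel" and f: "\<And>r. \<bar>f r\<bar> \<le> 2 * \<bar>r\<bar>" for f u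
  proof -
    have b: "norm (k r *\<^sub>R (iexp (f r * u) - 1)) \<le> (\<bar>k r\<bar> * (2 + 2 * \<bar>r\<bar>)) * min \<bar>u\<bar> 1" for r
    proof -
      have "cmod (iexp (f r * u) - 1) \<le> (2 + \<bar>f r\<bar>) * min \<bar>u\<bar> 1" by (rule ie)
      also have "\<dots> \<le> (2 + 2 * \<bar>r\<bar>) * min \<bar>u\<bar> 1" using f[of r] by (intro mult_right_mono) auto
      finally show ?thesis by (simp add: mult.assoc mult_left_mono)
    qed
    have "norm (\<integral>r. k r *\<^sub>R (iexp (f r * u) - 1) \<partial>lborel) \<le> (\<integral>r. (\<bar>k r\<bar> * (2 + 2 * \<bar>r\<bar>)) * min \<bar>u\<bar> 1 \<partial>lborel)"
    proof (rule Bochner_Integration.integral_norm_bound_integral[OF _ _ b])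
      show i: "integrable lborel (\<lambda>r. (\<bar>k r\<bar> * (2 + 2 * \<bar>r\<bar>)) * min \<bar>u\<bar> 1)" using iC by simp
      show "integrable lborel (\<lambda>r. k r *\<^sub>R (iexp (f r * u) - 1))"
      proof (rule Bochner_Integration.integrable_bound[OF i])
        show "AE r in lborel. norm (k r *\<^sub>R (iexp (f r * u) - 1)) \<le> norm ((\<bar>k r\<bar> * (2 + 2 * \<bar>r\<bar>)) * min \<bar>u\<bar> 1)"
        proof (rule AE_I2)
          fix r
          have "x \<le> norm x" for x :: real by simp
          from order_trans[OF b this] show "norm (k r *\<^sub>R (iexp (f r * u) - 1)) \<le> norm ((\<bar>k r\<bar> * (2 + 2 * \<bar>r\<bar>)) * min \<bar>u\<bar> 1)" .
        qed
      qed measurable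
    qed
    then show ?thesis by (simp add: C_def)
  qed
  have tm[measurable]: "transfer k \<in> borel_measurable borel" unfolding transfer_def[abs_def] by measurable
  have Hlim: "(\<lambda>N. H N u) \<longlonglongrightarrow> transfer k u" for u
    unfolding H_def transfer_def
  proof (rule integral_dominated_convergence[where w="\<lambda>r. 2 * \<bar>k r\<bar>"])
    show "integrable lborel (\<lambda>r. 2 * \<bar>k r\<bar>)" using ki by simp
    show "AE r in lborel. (\<lambda>N. k r *\<^sub>R (iexp (d N r * u) - 1)) \<longlonglongrightarrow> k r *\<^sub>R (iexp (r * u) - 1)"
      by (intro AE_I2 tendsto_intros dlim)
    show "AE r in lborel. norm (k r *\<^sub>R (iexp (d N r * u) - 1)) \<le> 2 * \<bar>k r\<bar>" for N
    proof (rule AE_I2)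
      fix r
      have "cmod (iexp (d N r * u) - 1) \<le> 2" using norm_triangle_ineq4[of "iexp (d N r * u)" 1] by simp
      then have "\<bar>k r\<bar> * cmod (iexp (d N r * u) - 1) \<le> \<bar>k r\<bar> * 2" by (intro mult_left_mono) auto
      then show "norm (k r *\<^sub>R (iexp (d N r * u) - 1)) \<le> 2 * \<bar>k r\<bar>" by simp
    qed
  qed measurable
  show ?thesis
  proof (rule represents_limit[OF rep])
    show "filtered k t \<in> borel_measurable M" by measurable
    show "(\<lambda>u. iexp (t * u) * transfer k u) \<in> borel_measurable \<mu>" by (rule borel_measurable_\<mu>) measurable
    show "(\<lambda>N. \<integral>\<^sup>+\<omega>. ennreal ((norm (Yk N \<omega> - filtered k t \<omega>))\<^sup>2) \<partial>M) \<longlonglongrightarrow> 0"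
    proof -
      define L where "L = density lborel (\<lambda>r. ennreal (exp (- (1 / 2) * \<bar>r\<bar>)))"
      have gm: "(\<lambda>r. t + d N r) \<in> borel_measurable borel" "(\<lambda>r. t + r) \<in> borel_measurable borel" "(\<lambda>r. t) \<in> borel_measurable borel" for N by auto
      \<comment> \<open>The factor 3 is 2 |r| for the rounded time plus |r| for the exact
        one.\<close>
      have b1: "\<bar>(t + d N r) - t\<bar> \<le> 3 * \<bar>r\<bar>" "\<bar>(t + r) - t\<bar> \<le> 3 * \<bar>r\<bar>" "\<bar>(t + d N r) - (t + r)\<bar> \<le> 3 * \<bar>r\<bar>" for N r
        using dbound[of N r] by (auto simp: abs_le_iff)
      note k1 = kernel_increment[OF k gm(1) gm(3) b1(1)] and k2 = kernel_increment[OF k gm(2) gm(3) b1(2)] and k3 = kernel_increment[OF k gm(1) gm(2) b1(3), folded L_def]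
      define V where "V N r = exp (- \<bar>r\<bar>) / 4 * (\<integral>u. (cmod (iexp ((t + d N r - (t + r)) * u) - 1))\<^sup>2 \<partial>\<mu>)" for N r
      interpret L: finite_measure L by (rule k3(4))
      \<comment> \<open>The two kernel integrals are merged into one, which is justified where both
        exist, that is almost surely.\<close>
      have eq: "AE \<omega> in M. Yk N \<omega> - filtered k t \<omega> = (\<integral>r. k r * (W (t + d N r) \<omega> - W (t + r) \<omega>) \<partial>lborel)" for N
        using k1(1)[of N] k2(1)
      proof eventually_elim
        case (elim \<omega>)
        have "Yk N \<omega> - filtered k t \<omega> = (\<integral>r. k r * (W (t + d N r) \<omega> - W t \<omega>) - k r * (W (t + r) \<omega> - W t \<omega>) \<partial>lborel)"
          unfolding Yk_def filtered_def by (rule Bochner_Integration.integral_diff[OF elim, symmetric])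
        then show ?case by (simp add: algebra_simps)
      qed
      have "(\<integral>\<^sup>+\<omega>. ennreal ((norm (Yk N \<omega> - filtered k t \<omega>))\<^sup>2) \<partial>M) \<le> ennreal (measure L (space L) * (\<integral>r. V N r \<partial>L))" for N
      proof -
        have "(\<integral>\<^sup>+\<omega>. ennreal ((norm (Yk N \<omega> - filtered k t \<omega>))\<^sup>2) \<partial>M) = (\<integral>\<^sup>+\<omega>. ennreal ((\<integral>r. k r * (W (t + d N r) \<omega> - W (t + r) \<omega>) \<partial>lborel)\<^sup>2) \<partial>M)"
          using eq[of N] by (intro nn_integral_cong_AE) (auto elim!: eventually_mono)
        also have "\<dots> = ennreal (\<integral>\<omega>. (\<integral>r. k r * (W (t + d N r) \<omega> - W (t + r) \<omega>) \<partial>lborel)\<^sup>2 \<partial>M)"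
          by (intro nn_integral_eq_integral k3(2)) auto
        finally show ?thesis using k3(3)[of N] by (simp add: V_def ennreal_leI)
      qed
      moreover have "(\<lambda>N. ennreal (measure L (space L) * (\<integral>r. V N r \<partial>L))) \<longlonglongrightarrow> ennreal (measure L (space L) * (\<integral>r. 0 \<partial>L))"
      proof (intro tendsto_ennrealI tendsto_mult tendsto_const integral_dominated_convergence[where w="\<lambda>_. 9 * bound"])
        have [measurable_cong]: "sets L = sets borel" by (simp add: L_def)
        have "(\<lambda>r. \<integral>u. (cmod (iexp ((t + d N r - (t + r)) * u) - 1))\<^sup>2 \<partial>\<mu>) \<in> borel_measurable borel" for N
          by (rule measurable_compose[OF _ increment_measurable]) measurable
        then show "V N \<in> borel_measurable L" for N unfolding V_def[abs_def] by measurable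
        show "AE r in L. (\<lambda>N. V N r) \<longlonglongrightarrow> 0"
        proof (rule AE_I2)
          fix r
          have "(\<lambda>N. t + d N r - (t + r)) \<longlonglongrightarrow> t + r - (t + r)" by (intro tendsto_intros dlim)
          then have "(\<lambda>N. t + d N r - (t + r)) \<longlonglongrightarrow> 0" by simp
          from increment_tendsto[OF this] show "(\<lambda>N. V N r) \<longlonglongrightarrow> 0" unfolding V_def by (rule tendsto_mult_right_zero)
        qed
        show "AE r in L. norm (V N r) \<le> 9 * bound" for N
        proof (rule AE_I2)
          fix r
          have "0 \<le> V N r" unfolding V_def by (intro mult_nonneg_nonneg Bochner_Integration.integral_nonneg) auto
          then show "norm (V N r) \<le> 9 * bound" using k3(5)[of r N] by (simp add: V_def)
        qed
      qed auto
      ultimately show ?thesis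
        by (rule_tac tendsto_sandwich[OF _ _ tendsto_const, where h="\<lambda>N. ennreal (measure L (space L) * (\<integral>r. V N r \<partial>L))"]) auto
    qed
    show "(\<lambda>N. \<integral>\<^sup>+u. ennreal ((norm (iexp (t * u) * H N u - iexp (t * u) * transfer k u))\<^sup>2) \<partial>\<mu>) \<longlonglongrightarrow> 0"
    proof -
      have n: "norm (iexp (t * u) * H N u - iexp (t * u) * transfer k u) = norm (H N u - transfer k u)" for N u
        by (simp add: right_diff_distrib[symmetric] norm_mult)
      have "(\<lambda>N. \<integral>\<^sup>+u. ennreal ((norm (H N u - transfer k u))\<^sup>2) \<partial>\<mu>) \<longlonglongrightarrow> (\<integral>\<^sup>+u. ennreal 0 \<partial>\<mu>)"
      proof (rule nn_integral_dominated_convergence[where w="\<lambda>u. ennreal ((2 * C)\<^sup>2 * min (u\<^sup>2) 1)"])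
        show "(\<lambda>u. ennreal ((norm (H N u - transfer k u))\<^sup>2)) \<in> borel_measurable \<mu>" for N by (rule borel_measurable_\<mu>) measurable
        show "(\<integral>\<^sup>+u. ennreal ((2 * C)\<^sup>2 * min (u\<^sup>2) 1) \<partial>\<mu>) < \<infinity>"
          using min_integrable by (subst nn_integral_eq_integral) auto
        show "AE u in \<mu>. ennreal ((norm (H N u - transfer k u))\<^sup>2) \<le> ennreal ((2 * C)\<^sup>2 * min (u\<^sup>2) 1)" for N
        proof (rule AE_I2, rule ennreal_leI)
          fix u
          have "norm (H N u - transfer k u) \<le> norm (H N u) + norm (transfer k u)" by (rule norm_triangle_ineq4)
          also have "\<dots> \<le> C * min \<bar>u\<bar> 1 + C * min \<bar>u\<bar> 1"
            unfolding H_def transfer_def by (intro add_mono trb) (use dbound in auto)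
          finally have "(norm (H N u - transfer k u))\<^sup>2 \<le> (2 * C * min \<bar>u\<bar> 1)\<^sup>2" by (intro power_mono) auto
          also have "\<dots> = (2 * C)\<^sup>2 * min (u\<^sup>2) 1"
            by (auto simp: power_mult_distrib min_def abs_square_le_1 power2_eq_1_iff abs_if split: if_splits)
          finally show "(norm (H N u - transfer k u))\<^sup>2 \<le> (2 * C)\<^sup>2 * min (u\<^sup>2) 1" .
        qed
        show "AE u in \<mu>. (\<lambda>N. ennreal ((norm (H N u - transfer k u))\<^sup>2)) \<longlonglongrightarrow> ennreal 0"
        proof (rule AE_I2, rule tendsto_ennrealI)
          fix u
          have "(\<lambda>N. (norm (H N u - transfer k u))\<^sup>2) \<longlonglongrightarrow> (norm (transfer k u - transfer k u))\<^sup>2" by (intro tendsto_intros Hlim)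
          then show "(\<lambda>N. (norm (H N u - transfer k u))\<^sup>2) \<longlonglongrightarrow> 0" by simp
        qed
      qed measurable
      then show ?thesis unfolding n by simp
    qed
  qed
qed

text \<open>The measure is carried over to the Borel sets of the whole line, as
  \<open>atomless_measure\<close> expects, because \<mu> lives on the punctured line.\<close>

definition filtered_spectrum :: "(real \<Rightarrow> real) \<Rightarrow> real measure" where
  "filtered_spectrum k = distr (density \<mu> (\<lambda>u. ennreal ((cmod (transfer k u))\<^sup>2))) borel (\<lambda>u. u)"

text \<open>The mass is finite because the response is square integrable for \<mu>, and a density
  creates no atoms. The point 0 lies outside the space of \<mu> and receives no mass.\<close>

lemma filtered_stationary:
  assumes k: "k \<in> {laplace_even, laplace_odd}"
  shows "gaussian_stationary M (filtered_spectrum k) (filtered k)"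
    "measure (filtered_spectrum k) (space (filtered_spectrum k)) = (\<integral>u. (cmod (transfer k u))\<^sup>2 \<partial>\<mu>)"
    "integrable \<mu> (\<lambda>u. (cmod (transfer k u))\<^sup>2)"
proof -
  have km[measurable]: "k \<in> borel_measurable borel" using k by auto
  have tb: "transfer k \<in> borel_measurable borel" unfolding transfer_def[abs_def] by measurable
  have tm[measurable]: "transfer k \<in> borel_measurable \<mu>" by (rule borel_measurable_\<mu>[OF tb])
  have idm[measurable]: "(\<lambda>u. u) \<in> borel_measurable \<mu>" by (rule borel_measurable_\<mu>) simp
  show ti: "integrable \<mu> (\<lambda>u. (cmod (transfer k u))\<^sup>2)"
    using represents_properties(4)[OF represents_filtered[OF k, of 0]] by simp
  define m where "m = filtered_spectrum k"
  have em: "emeasure m A = (\<integral>\<^sup>+u. ennreal ((cmod (transfer k u))\<^sup>2) * indicator A u \<partial>\<mu>)" if [measurable]: "A \<in> sets borel" for A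
  proof -
    have "emeasure m A = emeasure (density \<mu> (\<lambda>u. ennreal ((cmod (transfer k u))\<^sup>2))) ((\<lambda>u. u) -` A \<inter> space \<mu>)"
      unfolding m_def filtered_spectrum_def by (subst emeasure_distr) auto
    also have "\<dots> = (\<integral>\<^sup>+u. ennreal ((cmod (transfer k u))\<^sup>2) * indicator ((\<lambda>u. u) -` A \<inter> space \<mu>) u \<partial>\<mu>)"
      by (subst emeasure_density) (auto intro: measurable_sets[OF idm])
    also have "\<dots> = (\<integral>\<^sup>+u. ennreal ((cmod (transfer k u))\<^sup>2) * indicator A u \<partial>\<mu>)"
      by (intro nn_integral_cong) (auto split: split_indicator)
    finally show ?thesis .
  qed
  have tot: "emeasure m (space m) = ennreal (\<integral>u. (cmod (transfer k u))\<^sup>2 \<partial>\<mu>)"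
  proof -
    have "emeasure m (space m) = (\<integral>\<^sup>+u. ennreal ((cmod (transfer k u))\<^sup>2) \<partial>\<mu>)"
      using em[of UNIV] by (simp add: m_def filtered_spectrum_def)
    also have "\<dots> = ennreal (\<integral>u. (cmod (transfer k u))\<^sup>2 \<partial>\<mu>)" by (rule nn_integral_eq_integral[OF ti]) simp
    finally show ?thesis .
  qed
  then show "measure (filtered_spectrum k) (space (filtered_spectrum k)) = (\<integral>u. (cmod (transfer k u))\<^sup>2 \<partial>\<mu>)"
    unfolding m_def by (simp add: measure_def)
  show "gaussian_stationary M (filtered_spectrum k) (filtered k)"
    unfolding m_def[symmetric]
  proof -
    interpret fm: finite_measure m by (rule finite_measureI) (simp add: tot)
    show "gaussian_stationary M m (filtered k)"
    proof
    show "sets m = sets borel" by (simp add: m_def filtered_spectrum_def)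
    show "emeasure m {u} = 0" for u
    proof -
      have "AE v in \<mu>. v \<noteq> u"
      proof (cases "u \<in> space \<mu>")
        case True
        have "{u} \<in> sets \<mu>"
          unfolding sets_\<mu> by (subst sets_restrict_space_iff) (use True space_\<mu> in auto)
        moreover have "emeasure \<mu> {u} = 0" using atomless True by (simp add: no_atoms_def)
        ultimately show ?thesis by (intro AE_I'[of "{u}"]) (auto simp: null_sets_def)
      qed (auto intro!: AE_I2)
      then have "(\<integral>\<^sup>+v. ennreal ((cmod (transfer k v))\<^sup>2) * indicator {u} v \<partial>\<mu>) = (\<integral>\<^sup>+v. 0 \<partial>\<mu>)"
        by (intro nn_integral_cong_AE) (auto elim!: eventually_mono)
      then show ?thesis by (simp add: em)
    qed
    show "(\<lambda>(t, \<omega>). filtered k t \<omega>) \<in> borel_measurable (borel \<Otimes>\<^sub>M M)" by measurable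
    show "(\<integral>\<omega>. filtered k t \<omega> \<partial>M) = 0" for t by (rule represents_properties(2)[OF represents_filtered[OF k]])
    fix I :: "real set" and a :: "real \<Rightarrow> real" assume I: "finite I"
    have "represents (\<lambda>\<omega>. \<Sum>t\<in>I. a t * filtered k t \<omega>) (\<lambda>u. \<Sum>t\<in>I. complex_of_real (a t) * (iexp (t * u) * transfer k u))"
      by (rule represents_sum[OF I]) (rule represents_filtered[OF k])
    note r = represents_properties[OF this]
    show "gaussian_char M (\<lambda>\<omega>. \<Sum>t\<in>I. a t * filtered k t \<omega>)" by (rule r)
    have e: "(cmod (\<Sum>t\<in>I. complex_of_real (a t) * (iexp (t * u) * transfer k u)))\<^sup>2 = (cmod (transfer k u))\<^sup>2 *\<^sub>R (cmod (\<Sum>t\<in>I. complex_of_real (a t) * iexp (t * u)))\<^sup>2" for u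
    proof -
      have "(\<Sum>t\<in>I. complex_of_real (a t) * (iexp (t * u) * transfer k u)) = (\<Sum>t\<in>I. complex_of_real (a t) * iexp (t * u)) * transfer k u"
        by (simp add: sum_distrib_right mult.assoc)
      then show ?thesis by (simp add: norm_mult power_mult_distrib)
    qed
    have pm[measurable]: "(\<lambda>u. (cmod (\<Sum>t\<in>I. complex_of_real (a t) * iexp (t * u)))\<^sup>2) \<in> borel_measurable borel" by measurable
    have "(\<integral>\<omega>. (\<Sum>t\<in>I. a t * filtered k t \<omega>)\<^sup>2 \<partial>M) = (\<integral>u. (cmod (transfer k u))\<^sup>2 *\<^sub>R (cmod (\<Sum>t\<in>I. complex_of_real (a t) * iexp (t * u)))\<^sup>2 \<partial>\<mu>)"
      using r(3) unfolding e .
    also have "\<dots> = (\<integral>u. (cmod (\<Sum>t\<in>I. complex_of_real (a t) * iexp (t * u)))\<^sup>2 \<partial>density \<mu> (\<lambda>u. ennreal ((cmod (transfer k u))\<^sup>2)))"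
      by (rule integral_density[symmetric]) (auto intro!: borel_measurable_\<mu>[OF pm])
    also have "\<dots> = (\<integral>u. (cmod (\<Sum>t\<in>I. complex_of_real (a t) * iexp (t * u)))\<^sup>2 \<partial>m)"
      unfolding m_def filtered_spectrum_def by (rule integral_distr[symmetric]) auto
    finally show "(\<integral>\<omega>. (\<Sum>t\<in>I. a t * filtered k t \<omega>)\<^sup>2 \<partial>M) = (\<integral>u. (cmod (\<Sum>t\<in>I. complex_of_real (a t) * iexp (t * u)))\<^sup>2 \<partial>m)" .
    qed
  qed
qed

subsection \<open>Convergence of the minimal energy\<close>

definition min_energy :: "real \<Rightarrow> 'a \<Rightarrow> real" where
  "min_energy T \<omega> = energy T (minimizer T (\<lambda>s. B s \<omega>)) (\<lambda>s. B s \<omega>)"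

lemma path_measurable[measurable]: "\<omega> \<in> space M \<Longrightarrow> (\<lambda>s. B s \<omega>) \<in> borel_measurable borel"
  by measurable

text \<open>The right-hand side is visibly measurable in \<omega>.\<close>

lemma square_path_integrable_iff:
  assumes "\<omega> \<in> space M"
  shows "integrable (lebesgue_on {0..T}) (\<lambda>s. (B s \<omega>)\<^sup>2) \<longleftrightarrow> (\<integral>\<^sup>+s. ennreal (indicator {0..T} s * (B s \<omega>)\<^sup>2) \<partial>lborel) < \<infinity>"
proof -
  have [measurable]: "(\<lambda>s. B s \<omega>) \<in> borel_measurable borel" using assms by measurable
  have "integrable (lebesgue_on {0..T}) (\<lambda>s. (B s \<omega>)\<^sup>2) \<longleftrightarrow> integrable lebesgue (\<lambda>s. indicator {0..T} s * (B s \<omega>)\<^sup>2)"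
    by (subst integrable_restrict_space) auto
  also have "\<dots> \<longleftrightarrow> integrable lborel (\<lambda>s. indicator {0..T} s * (B s \<omega>)\<^sup>2)" by (rule integrable_completion) measurable
  also have "\<dots> \<longleftrightarrow> (\<integral>\<^sup>+s. ennreal (indicator {0..T} s * (B s \<omega>)\<^sup>2) \<partial>lborel) < \<infinity>"
    by (simp add: integrable_iff_bounded)
  finally show ?thesis .
qed

text \<open>The choice operator in \<open>minimizer\<close> gives no hold on measurability. The
  explicit formula for the truncated path does, on the measurable set of paths in L2[0,T]; off this
  set the energy is 0.\<close>

lemma min_energy_measurable:
  assumes T: "T > 0"
  shows "min_energy T \<in> borel_measurable M"
proof -
  define v where "v \<omega> s = indicator {0..T} s * B s \<omega>" for \<omega> s
  have [measurable]: "(\<lambda>x. v (g x) (f x)) \<in> borel_measurable N" if "f \<in> borel_measurable N" "g \<in> measurable N M" for f g N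
    unfolding v_def using that by measurable
  have [measurable]: "(\<lambda>x. smooth (v (g x)) (f x)) \<in> borel_measurable N" "(\<lambda>x. smooth_deriv (v (g x)) (f x)) \<in> borel_measurable N"
    if "f \<in> borel_measurable N" "g \<in> measurable N M" for f g N
    unfolding smooth_def smooth_deriv_def using that by measurable
  define good where "good \<omega> \<longleftrightarrow> (\<integral>\<^sup>+s. ennreal (indicator {0..T} s * (B s \<omega>)\<^sup>2) \<partial>lborel) < \<infinity>" for \<omega>
  have [measurable]: "Measurable.pred M good" unfolding good_def by measurable
  define formula where "formula \<omega> = (\<integral>s. indicator {0..T} s * ((smooth (v \<omega>) s - v \<omega> s)\<^sup>2 + (smooth_deriv (v \<omega>) s)\<^sup>2) \<partial>lborel)
       - (((smooth_deriv (v \<omega>) T)\<^sup>2 + (smooth_deriv (v \<omega>) 0)\<^sup>2) * cosh T - 2 * smooth_deriv (v \<omega>) T * smooth_deriv (v \<omega>) 0) / sinh T" for \<omega>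
  have [measurable]: "formula \<in> borel_measurable M" unfolding formula_def by measurable
  have "min_energy T \<omega> = (if good \<omega> then formula \<omega> else 0)" if \<omega>: "\<omega> \<in> space M" for \<omega>
  proof (cases "good \<omega>")
    case True
    then have "integrable (lebesgue_on {0..T}) (\<lambda>s. (B s \<omega>)\<^sup>2)" using square_path_integrable_iff[OF \<omega>] by (simp add: good_def)
    note E = energy_minimizer_restrict(1)[OF T path_measurable[OF \<omega>] this]
    have "(\<lambda>s. indicator {0..T} s * B s \<omega>) = v \<omega>" by (simp add: v_def fun_eq_iff)
    from E[unfolded this] have "min_energy T \<omega> = formula \<omega>" unfolding min_energy_def formula_def v_def .
    then show ?thesis using True by simp
  next
    case False
    then have "\<not> integrable (lebesgue_on {0..T}) (\<lambda>s. (B s \<omega>)\<^sup>2)" using square_path_integrable_iff[OF \<omega>] by (simp add: good_def)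
    from energy_minimizer_not_L2[OF path_measurable[OF \<omega>] this] False show ?thesis by (simp add: min_energy_def)
  qed
  then show ?thesis by (subst measurable_cong) auto
qed

text \<open>Second moments of \<open>B\<close> grow at most quadratically, so the weight makes their
  integral finite. This gives one almost sure event on which the path is exponentially integrable
  and square integrable on {0..T} for all T at once.\<close>

lemma weighted_square_path: "AE \<omega> in M. integrable lborel (\<lambda>s. exp (- \<bar>s\<bar>) * (B s \<omega>)\<^sup>2)"
proof -
  define N where "N = density lborel (\<lambda>r. ennreal (exp (- (1 / 2) * \<bar>r\<bar>)))"
  have "(\<integral>\<^sup>+r. ennreal (exp (- (1 / 2) * \<bar>r\<bar>)) \<partial>lborel) < \<infinity>"
    using integrable_exp_abs[of "1/2"] by (simp add: integrable_iff_bounded)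
  then have Nf: "finite_measure N" unfolding N_def by (intro finite_measureI) (simp add: emeasure_density)
  have sN[measurable_cong]: "sets N = sets borel" by (simp add: N_def)
  \<comment> \<open>The weight exp(- |r|) is split into exp(- |r| / 2) for the finite measure
    \<open>N\<close> and the square of exp(- |r| / 4) for \<open>Z\<close>.\<close>
  define Z where "Z r \<omega> = exp (- \<bar>r\<bar> / 4) * B r \<omega>" for r \<omega>
  have Zm: "(\<lambda>(r, \<omega>). Z r \<omega>) \<in> borel_measurable (N \<Otimes>\<^sub>M M)" unfolding Z_def by measurable
  have B: "B r \<omega> = W r \<omega> + r * D\<^sub>0 \<omega>" for r \<omega> by (simp add: W_def)
  have B2: "integrable M (\<lambda>\<omega>. (B r \<omega>)\<^sup>2)" for r
    using integrable_square_add[of "W r" M "\<lambda>\<omega>. r * D\<^sub>0 \<omega>"] W_square(1) D0 by (simp add: B power_mult_distrib)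
  have EB: "(\<integral>\<omega>. (B r \<omega>)\<^sup>2 \<partial>M) \<le> (2 + \<bar>r\<bar>)\<^sup>2 * (2 * bound + 2 * (\<integral>\<omega>. (D\<^sub>0 \<omega>)\<^sup>2 \<partial>M))" for r
  proof -
    have "(\<integral>\<omega>. (B r \<omega>)\<^sup>2 \<partial>M) \<le> (\<integral>\<omega>. 2 * (W r \<omega>)\<^sup>2 + 2 * r\<^sup>2 * (D\<^sub>0 \<omega>)\<^sup>2 \<partial>M)"
    proof (rule integral_mono[OF B2])
      show "integrable M (\<lambda>\<omega>. 2 * (W r \<omega>)\<^sup>2 + 2 * r\<^sup>2 * (D\<^sub>0 \<omega>)\<^sup>2)" using W_square D0 by simp
      show "(B r \<omega>)\<^sup>2 \<le> 2 * (W r \<omega>)\<^sup>2 + 2 * r\<^sup>2 * (D\<^sub>0 \<omega>)\<^sup>2" for \<omega>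
        using norm_add_square_le[of 1 "W r \<omega>" r "D\<^sub>0 \<omega>"] by (simp add: B)
    qed
    also have "\<dots> = 2 * (\<integral>\<omega>. (W r \<omega>)\<^sup>2 \<partial>M) + 2 * r\<^sup>2 * (\<integral>\<omega>. (D\<^sub>0 \<omega>)\<^sup>2 \<partial>M)" using W_square(1) D0 by simp
    also have "\<dots> \<le> 2 * ((2 + \<bar>r\<bar>)\<^sup>2 * bound) + 2 * (2 + \<bar>r\<bar>)\<^sup>2 * (\<integral>\<omega>. (D\<^sub>0 \<omega>)\<^sup>2 \<partial>M)"
    proof (intro add_mono mult_left_mono mult_right_mono)
      show "(\<integral>\<omega>. (W r \<omega>)\<^sup>2 \<partial>M) \<le> (2 + \<bar>r\<bar>)\<^sup>2 * bound" unfolding W_square(2) by (rule increment_bound)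
      have "\<bar>r\<bar>\<^sup>2 \<le> (2 + \<bar>r\<bar>)\<^sup>2" by (intro power_mono) auto
      then show "r\<^sup>2 \<le> (2 + \<bar>r\<bar>)\<^sup>2" by simp
    qed auto
    finally show ?thesis by (simp add: algebra_simps)
  qed
  \<comment> \<open>16 is the square of the 4 in 2 + |r| \<le> 4 exp(|r| / 4).\<close>
  define K where "K = 16 * (2 * bound + 2 * (\<integral>\<omega>. (D\<^sub>0 \<omega>)\<^sup>2 \<partial>M))"
  have "0 \<le> 2 * bound + 2 * (\<integral>\<omega>. (D\<^sub>0 \<omega>)\<^sup>2 \<partial>M)" by (simp add: bound_def)
  then have K: "(\<integral>\<omega>. (Z r \<omega>)\<^sup>2 \<partial>M) \<le> K" for r
  proof -
    have "2 + \<bar>r\<bar> \<le> 4 * (1 + \<bar>r\<bar> / 4)" by simp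
    also have "\<dots> \<le> 4 * exp (\<bar>r\<bar> / 4)" by (intro mult_left_mono exp_ge_add_one_self) auto
    finally have "(exp (- \<bar>r\<bar> / 4) * (2 + \<bar>r\<bar>))\<^sup>2 \<le> (exp (- \<bar>r\<bar> / 4) * (4 * exp (\<bar>r\<bar> / 4)))\<^sup>2" by (intro power_mono mult_left_mono) auto
    also have "exp (- \<bar>r\<bar> / 4) * (4 * exp (\<bar>r\<bar> / 4)) = 4" by (simp add: exp_minus)
    finally have e: "(exp (- \<bar>r\<bar> / 4))\<^sup>2 * (2 + \<bar>r\<bar>)\<^sup>2 \<le> 16" by (simp add: power_mult_distrib)
    have "(\<integral>\<omega>. (Z r \<omega>)\<^sup>2 \<partial>M) = (exp (- \<bar>r\<bar> / 4))\<^sup>2 * (\<integral>\<omega>. (B r \<omega>)\<^sup>2 \<partial>M)" by (simp add: Z_def power_mult_distrib)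
    also have "\<dots> \<le> (exp (- \<bar>r\<bar> / 4))\<^sup>2 * ((2 + \<bar>r\<bar>)\<^sup>2 * (2 * bound + 2 * (\<integral>\<omega>. (D\<^sub>0 \<omega>)\<^sup>2 \<partial>M)))"
      by (intro mult_left_mono EB) auto
    also have "\<dots> = ((exp (- \<bar>r\<bar> / 4))\<^sup>2 * (2 + \<bar>r\<bar>)\<^sup>2) * (2 * bound + 2 * (\<integral>\<omega>. (D\<^sub>0 \<omega>)\<^sup>2 \<partial>M))" by (simp only: mult.assoc)
    also have "\<dots> \<le> K" unfolding K_def using e by (rule mult_right_mono) fact
    finally show ?thesis .
  qed
  have Z2: "integrable M (\<lambda>\<omega>. (Z r \<omega>)\<^sup>2)" for r unfolding Z_def power_mult_distrib using B2 by simp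
  have "AE \<omega> in M. integrable N (\<lambda>r. (Z r \<omega>)\<^sup>2)"
    by (rule square_integral_Fubini(1)[OF Nf finite_measure_axioms Zm Z2]) (rule K)
  then show ?thesis using AE_space
  proof eventually_elim
    case (elim \<omega>)
    have [measurable]: "(\<lambda>r. Z r \<omega>) \<in> borel_measurable borel" unfolding Z_def using elim by measurable
    have z: "exp (- (1 / 2) * \<bar>r\<bar>) *\<^sub>R (Z r \<omega>)\<^sup>2 = exp (- \<bar>r\<bar>) * (B r \<omega>)\<^sup>2" for r
    proof -
      have "exp (- (1 / 2) * \<bar>r\<bar>) * (exp (- \<bar>r\<bar> / 4))\<^sup>2 = exp (- \<bar>r\<bar>)" by (simp add: power2_eq_square exp_add[symmetric])
      then show ?thesis by (simp only: Z_def power_mult_distrib real_scaleR_def mult.assoc[symmetric])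
    qed
    have "integrable lborel (\<lambda>r. exp (- (1 / 2) * \<bar>r\<bar>) *\<^sub>R (Z r \<omega>)\<^sup>2)"
      using elim(1) unfolding N_def by (subst (asm) integrable_density) auto
    then show ?case unfolding z .
  qed
qed

text \<open>Around t the path is B(t) + \<open>D\<^sub>0\<close> r plus the increment of
  \<open>W\<close>; \<open>laplace_moments\<close> evaluates the first two terms, and the third is
  \<open>filtered\<close>.\<close>

lemma path_regularity:
  assumes \<omega>: "\<omega> \<in> space M" and i: "integrable lborel (\<lambda>s. exp (- \<bar>s\<bar>) * (B s \<omega>)\<^sup>2)"
  shows "exp_integrable_path (\<lambda>s. B s \<omega>)" "integrable (lebesgue_on {0..T}) (\<lambda>s. (B s \<omega>)\<^sup>2)"
    "smooth (\<lambda>s. B s \<omega>) t - B t \<omega> = filtered laplace_even t \<omega>"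
    "smooth_deriv (\<lambda>s. B s \<omega>) t = D\<^sub>0 \<omega> + filtered laplace_odd t \<omega>"
proof -
  have [measurable]: "(\<lambda>s. B s \<omega>) \<in> borel_measurable borel" by (rule path_measurable[OF \<omega>])
  show e: "exp_integrable_path (\<lambda>s. B s \<omega>)"
  proof
    have i1: "integrable lborel (\<lambda>s. exp (- 1 * \<bar>s\<bar>) + exp (- \<bar>s\<bar>) * (B s \<omega>)\<^sup>2)"
      by (intro Bochner_Integration.integrable_add i integrable_exp_abs) simp
    show "integrable lborel (\<lambda>s. exp (- \<bar>s\<bar>) * B s \<omega>)"
    proof (rule Bochner_Integration.integrable_bound[OF i1])
      have "\<bar>b\<bar> \<le> 1 + b\<^sup>2" for b :: real using sum_squares_bound[of 1 "\<bar>b\<bar>"] by simp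
      then have "exp (- \<bar>s\<bar>) * \<bar>B s \<omega>\<bar> \<le> exp (- \<bar>s\<bar>) * (1 + (B s \<omega>)\<^sup>2)" for s by (intro mult_left_mono) auto
      then show "AE s in lborel. norm (exp (- \<bar>s\<bar>) * B s \<omega>) \<le> norm (exp (- 1 * \<bar>s\<bar>) + exp (- \<bar>s\<bar>) * (B s \<omega>)\<^sup>2)"
        by (intro AE_I2) (simp add: abs_mult distrib_left)
    qed measurable
  qed measurable
  then interpret p: exp_integrable_path "\<lambda>s. B s \<omega>" .
  show "integrable (lebesgue_on {0..T}) (\<lambda>s. (B s \<omega>)\<^sup>2)"
  proof -
    have "integrable lborel (\<lambda>s. indicator {0..T} s * (B s \<omega>)\<^sup>2)"
    proof (rule Bochner_Integration.integrable_bound[OF integrable_mult_right[OF i, of "exp T"]])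
      have "1 * (B s \<omega>)\<^sup>2 \<le> (exp T * exp (- \<bar>s\<bar>)) * (B s \<omega>)\<^sup>2" if "s \<in> {0..T}" for s
        using that by (intro mult_right_mono) (auto simp: exp_add[symmetric])
      then show "AE s in lborel. norm (indicator {0..T} s * (B s \<omega>)\<^sup>2) \<le> norm (exp T * (exp (- \<bar>s\<bar>) * (B s \<omega>)\<^sup>2))"
        by (intro AE_I2) (auto simp: mult.assoc split: split_indicator)
    qed measurable
    then have "(\<integral>\<^sup>+s. ennreal (indicator {0..T} s * (B s \<omega>)\<^sup>2) \<partial>lborel) < \<infinity>"
      by (simp add: integrable_iff_bounded)
    then show ?thesis by (simp only: square_path_integrable_iff[OF \<omega>])
  qed
  have b1: "norm (1::real) \<le> 1 * exp (\<bar>r\<bar> / 2)" for r :: real by simp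
  have b2: "norm r \<le> 2 * exp (\<bar>r\<bar> / 2)" for r :: real
    unfolding real_norm_def using exp_ge_add_one_self[of "\<bar>r\<bar> / 2"] by linarith
  have key: "(\<integral>s. k (s - t) * B s \<omega> \<partial>lborel) = B t \<omega> * (\<integral>r. k r \<partial>lborel) + D\<^sub>0 \<omega> * (\<integral>r. k r * r \<partial>lborel) + filtered k t \<omega>"
    if k: "k \<in> {laplace_even, laplace_odd}" for k
  proof -
    have [measurable]: "k \<in> borel_measurable borel" using k by auto
    have a: "integrable lborel (\<lambda>r. k r * B (t + r) \<omega>)"
      using lborel_integrable_real_affine[OF p.laplace_integrable[OF k, of t], of 1 t] by simp
    have b: "integrable lborel (\<lambda>r. B t \<omega> * k r)" "integrable lborel (\<lambda>r. D\<^sub>0 \<omega> * (k r * r))"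
      using laplace_scaleR_integrable[OF k _ b1] laplace_scaleR_integrable[OF k _ b2] by simp_all
    have e: "k r * (W (t + r) \<omega> - W t \<omega>) = k r * B (t + r) \<omega> - B t \<omega> * k r - D\<^sub>0 \<omega> * (k r * r)" for r
      by (simp add: W_def algebra_simps)
    have "filtered k t \<omega> = (\<integral>r. k r * B (t + r) \<omega> \<partial>lborel) - B t \<omega> * (\<integral>r. k r \<partial>lborel) - D\<^sub>0 \<omega> * (\<integral>r. k r * r \<partial>lborel)"
      unfolding filtered_def e using a b by simp
    also have "(\<integral>r. k r * B (t + r) \<omega> \<partial>lborel) = (\<integral>s. k (s - t) * B s \<omega> \<partial>lborel)"
      by (subst (2) lborel_integral_real_affine[where c=1 and t=t]) auto
    finally show ?thesis by simp
  qed
  show "smooth (\<lambda>s. B s \<omega>) t - B t \<omega> = filtered laplace_even t \<omega>"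
    unfolding smooth_def by (subst key) (auto simp: laplace_moments)
  show "smooth_deriv (\<lambda>s. B s \<omega>) t = D\<^sub>0 \<omega> + filtered laplace_odd t \<omega>"
    unfolding smooth_deriv_def by (subst key) (auto simp: laplace_moments)
qed

text \<open>\<open>drift\<close> is the process p of the overview, \<open>residual\<close> the
  process q.\<close>

sublocale drift: gaussian_stationary M "filtered_spectrum laplace_odd" "filtered laplace_odd"
  by (rule filtered_stationary) simp

sublocale residual: gaussian_stationary M "filtered_spectrum laplace_even" "filtered laplace_even"
  by (rule filtered_stationary) simp

definition limit :: "'a \<Rightarrow> real" where
  "limit \<omega> = \<bar>D\<^sub>0 \<omega>\<bar>\<^sup>2 + (\<integral>u. u\<^sup>2 / (1 + u\<^sup>2) \<partial>\<mu>)"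

lemma total_sum: "residual.total + drift.total = (\<integral>u. u\<^sup>2 / (1 + u\<^sup>2) \<partial>\<mu>)"
proof -
  have t: "residual.total = (\<integral>u. (cmod (transfer laplace_even u))\<^sup>2 \<partial>\<mu>)" "drift.total = (\<integral>u. (cmod (transfer laplace_odd u))\<^sup>2 \<partial>\<mu>)"
    and i: "integrable \<mu> (\<lambda>u. (cmod (transfer laplace_even u))\<^sup>2)" "integrable \<mu> (\<lambda>u. (cmod (transfer laplace_odd u))\<^sup>2)"
    unfolding residual.total_def drift.total_def by (simp_all add: filtered_stationary)
  have e: "(cmod (transfer laplace_even u))\<^sup>2 + (cmod (transfer laplace_odd u))\<^sup>2 = u\<^sup>2 / (1 + u\<^sup>2)" for u
  proof -
    have "1 + u\<^sup>2 > 0" by (simp add: add_pos_nonneg)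
    have "(u\<^sup>2 / (1 + u\<^sup>2))\<^sup>2 + (u / (1 + u\<^sup>2))\<^sup>2 = ((u\<^sup>2)\<^sup>2 + u\<^sup>2) / (1 + u\<^sup>2)\<^sup>2"
      by (simp only: power_divide add_divide_distrib)
    also have "(u\<^sup>2)\<^sup>2 + u\<^sup>2 = u\<^sup>2 * (1 + u\<^sup>2)" unfolding power2_eq_square by algebra
    also have "u\<^sup>2 * (1 + u\<^sup>2) / (1 + u\<^sup>2)\<^sup>2 = u\<^sup>2 / (1 + u\<^sup>2)" using \<open>1 + u\<^sup>2 > 0\<close> unfolding power2_eq_square[of "1 + u\<^sup>2"] by simp
    finally show ?thesis unfolding transfer_laplace norm_minus_cancel norm_mult norm_of_real norm_ii mult_1 abs_divide power_divide power2_abs by simp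
  qed
  have "residual.total + drift.total = (\<integral>u. (cmod (transfer laplace_even u))\<^sup>2 + (cmod (transfer laplace_odd u))\<^sup>2 \<partial>\<mu>)"
    unfolding t using i by simp
  then show ?thesis unfolding e .
qed

text \<open>For T \<ge> 1, sinh T \<ge> 1 / 2 and cosh T \<le> sinh T + 1 \<le> 3 sinh T; the
  product term contributes another 2 sinh T, and 3 + 2 = 5.\<close>

lemma boundary_term_bound:
  fixes A C T :: real
  assumes T: "T \<ge> 1"
  shows "\<bar>((A\<^sup>2 + C\<^sup>2) * cosh T - 2 * A * C) / sinh T\<bar> \<le> 5 * (A\<^sup>2 + C\<^sup>2)"
proof -
  have "exp T \<ge> 2" using exp_ge_add_one_self[of T] T by linarith
  moreover have "exp (- T) \<le> 1" using T by simp
  moreover have "1 / 2 \<le> (a - b) / 2" if "2 \<le> a" "b \<le> 1" for a b :: real using that by simp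
  ultimately have s: "sinh T \<ge> 1 / 2" unfolding sinh_field_def by blast
  have c: "cosh T = sinh T + exp (- T)" using cosh_minus_sinh[of T] by linarith
  have "cosh T \<le> 3 * sinh T" using c s \<open>exp (- T) \<le> 1\<close> by linarith
  then have 1: "(A\<^sup>2 + C\<^sup>2) * cosh T \<le> (A\<^sup>2 + C\<^sup>2) * (3 * sinh T)" by (intro mult_left_mono) auto
  have "\<bar>2 * A * C\<bar> \<le> A\<^sup>2 + C\<^sup>2" using sum_squares_bound[of "\<bar>A\<bar>" "\<bar>C\<bar>"] by (simp add: abs_mult)
  also have "\<dots> \<le> (A\<^sup>2 + C\<^sup>2) * (2 * sinh T)" using s mult_left_mono[of 1 "2 * sinh T" "A\<^sup>2 + C\<^sup>2"] by simp
  finally have 2: "\<bar>2 * A * C\<bar> \<le> (A\<^sup>2 + C\<^sup>2) * (2 * sinh T)" .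
  have "0 \<le> (A\<^sup>2 + C\<^sup>2) * cosh T" by (intro mult_nonneg_nonneg) auto
  then have "\<bar>(A\<^sup>2 + C\<^sup>2) * cosh T - 2 * A * C\<bar> \<le> (A\<^sup>2 + C\<^sup>2) * (3 * sinh T) + (A\<^sup>2 + C\<^sup>2) * (2 * sinh T)"
    using 1 2 by linarith
  also have "\<dots> = 5 * (A\<^sup>2 + C\<^sup>2) * sinh T" by (simp add: algebra_simps)
  finally have "\<bar>(A\<^sup>2 + C\<^sup>2) * cosh T - 2 * A * C\<bar> / sinh T \<le> 5 * (A\<^sup>2 + C\<^sup>2)"
    using T by (subst pos_divide_le_eq) auto
  moreover have "\<bar>sinh T\<bar> = sinh T" using s by simp
  ultimately show ?thesis by (simp only: abs_divide)
qed

section \<open>The energy formula in terms of time averages\<close>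

definition sq_avg where "sq_avg n \<omega> = (\<integral>s. (filtered laplace_even s \<omega>)\<^sup>2 - residual.total \<partial>restrict_space lborel {0..<real n}) / n"
definition sq_avg' where "sq_avg' n \<omega> = (\<integral>s. (filtered laplace_odd s \<omega>)\<^sup>2 - drift.total \<partial>restrict_space lborel {0..<real n}) / n"
definition avg where "avg n \<omega> = (\<integral>s. filtered laplace_odd s \<omega> \<partial>restrict_space lborel {0..<real n}) / n"
text \<open>10 is the 5 of \<open>boundary_term_bound\<close> times the 2 of (a + b)^2 \<le> 2 a^2 +
  2 b^2.\<close>

definition edge where "edge n \<omega> = 10 * (2 * (D\<^sub>0 \<omega>)\<^sup>2 + (filtered laplace_odd (real n) \<omega>)\<^sup>2 + (filtered laplace_odd 0 \<omega>)\<^sup>2) / n"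

text \<open>Expanding (D + p)^2 and centring q^2 and p^2 at their means leaves three averages that
  vanish in the limit; \<open>D\<^sub>0\<close> is constant along each path and goes into
  \<open>limit\<close>.\<close>

lemma min_energy_decomposition:
  "AE \<omega> in M. \<forall>n\<ge>1. \<bar>min_energy (real n) \<omega> / n - limit \<omega>\<bar> \<le> \<bar>sq_avg n \<omega>\<bar> + \<bar>sq_avg' n \<omega>\<bar> + 2 * \<bar>D\<^sub>0 \<omega> * avg n \<omega>\<bar> + edge n \<omega>"
  using weighted_square_path residual.average_square(4) drift.average_square(4) drift.average_zero(4) AE_space
proof eventually_elim
  case (elim \<omega>)
  note reg = path_regularity[OF elim(5) elim(1)]
  interpret p: exp_integrable_path "\<lambda>s. B s \<omega>" by (rule reg)
  show ?case
  proof (intro allI impI)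
    fix n :: nat assume n: "n \<ge> 1"
    define L where "L = restrict_space lborel {0..<real n}"
    define q where "q s = filtered laplace_even s \<omega>" for s
    define r where "r s = filtered laplace_odd s \<omega>" for s
    define d where "d = D\<^sub>0 \<omega>"
    interpret L: finite_measure L unfolding L_def by (rule finite_measure_lborel_restrict)
    have mL: "measure L (space L) = n" by (simp add: L_def measure_restrict_space)
    define q' where "q' s = (q s)\<^sup>2 - residual.total" for s
    define r' where "r' s = (r s)\<^sup>2 - drift.total" for s
    have i: "integrable L q'" "integrable L r'" "integrable L r"
      using elim(2-4) unfolding L_def q'_def r'_def q_def r_def by auto
    define R where "R = (((d + r (real n))\<^sup>2 + (d + r 0)\<^sup>2) * cosh (real n) - 2 * (d + r (real n)) * (d + r 0)) / sinh (real n)"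
    have "min_energy (real n) \<omega> = (\<integral>s. indicator {0..real n} s * ((q s)\<^sup>2 + (d + r s)\<^sup>2) \<partial>lborel) - R"
      unfolding min_energy_def using p.energy_minimizer_formula(1)[of "real n", OF _ reg(2)] n
      by (simp add: reg(3,4) q_def r_def d_def R_def)
    \<comment> \<open>The formula uses the closed interval, the averages the half-open one; they
      differ by one point.\<close>
    also have "(\<integral>s. indicator {0..real n} s * ((q s)\<^sup>2 + (d + r s)\<^sup>2) \<partial>lborel) = (\<integral>s. indicator {0..<real n} s *\<^sub>R ((q s)\<^sup>2 + (d + r s)\<^sup>2) \<partial>lborel)"
    proof (rule integral_cong_AE)
      have [measurable]: "q \<in> borel_measurable borel" "r \<in> borel_measurable borel" unfolding q_def r_def using elim(5) by measurable
      show "(\<lambda>s. indicator {0..real n} s * ((q s)\<^sup>2 + (d + r s)\<^sup>2)) \<in> borel_measurable lborel"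
        "(\<lambda>s. indicator {0..<real n} s *\<^sub>R ((q s)\<^sup>2 + (d + r s)\<^sup>2)) \<in> borel_measurable lborel" by measurable
      show "AE s in lborel. indicator {0..real n} s * ((q s)\<^sup>2 + (d + r s)\<^sup>2) = indicator {0..<real n} s *\<^sub>R ((q s)\<^sup>2 + (d + r s)\<^sup>2)"
        using AE_lborel_singleton[of "real n"] by eventually_elim (auto split: split_indicator)
    qed
    also have "\<dots> = (\<integral>s. (q s)\<^sup>2 + (d + r s)\<^sup>2 \<partial>L)" unfolding L_def by (subst integral_restrict_space) auto
    also have "\<dots> = (\<integral>s. q' s + r' s + 2 * d * r s + (d\<^sup>2 + residual.total + drift.total) \<partial>L)"
      by (intro Bochner_Integration.integral_cong) (auto simp: q'_def r'_def power2_eq_square algebra_simps)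
    also have "\<dots> = (\<integral>s. q' s \<partial>L) + (\<integral>s. r' s \<partial>L) + 2 * d * (\<integral>s. r s \<partial>L) + n * (d\<^sup>2 + residual.total + drift.total)"
      using i mL by simp
    also have "\<dots> = n * (sq_avg n \<omega> + sq_avg' n \<omega> + 2 * (d * avg n \<omega>) + limit \<omega>)"
      using n total_sum[symmetric] unfolding sq_avg_def sq_avg'_def avg_def q'_def r'_def q_def r_def L_def limit_def d_def
      by (simp add: distrib_left add.assoc)
    finally have "min_energy (real n) \<omega> / n = (n * (sq_avg n \<omega> + sq_avg' n \<omega> + 2 * (d * avg n \<omega>) + limit \<omega>) - R) / n" by simp
    also have "\<dots> = sq_avg n \<omega> + sq_avg' n \<omega> + 2 * (d * avg n \<omega>) + limit \<omega> - R / n" using n by (simp add: diff_divide_distrib)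
    finally have eq: "min_energy (real n) \<omega> / n - limit \<omega> = sq_avg n \<omega> + sq_avg' n \<omega> + 2 * (d * avg n \<omega>) - R / n" by simp
    have "\<bar>R\<bar> \<le> 5 * ((d + r (real n))\<^sup>2 + (d + r 0)\<^sup>2)" unfolding R_def by (rule boundary_term_bound) (use n in simp)
    also have "\<dots> \<le> 5 * ((2 * d\<^sup>2 + 2 * (r (real n))\<^sup>2) + (2 * d\<^sup>2 + 2 * (r 0)\<^sup>2))"
      using norm_add_square_le[of 1 d 1 "r (real n)"] norm_add_square_le[of 1 d 1 "r 0"] by simp
    finally have "\<bar>R\<bar> / n \<le> edge n \<omega>" unfolding edge_def r_def d_def by (intro divide_right_mono) auto
    then have Rn: "\<bar>R / n\<bar> \<le> edge n \<omega>" by (simp add: abs_divide)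
    show "\<bar>min_energy (real n) \<omega> / n - limit \<omega>\<bar> \<le> \<bar>sq_avg n \<omega>\<bar> + \<bar>sq_avg' n \<omega>\<bar> + 2 * \<bar>D\<^sub>0 \<omega> * avg n \<omega>\<bar> + edge n \<omega>"
      unfolding eq d_def[symmetric]
      by (rule order_trans[OF abs_triangle_ineq4 add_mono[OF order_trans[OF abs_triangle_ineq add_mono[OF abs_triangle_ineq]] Rn]])
        (simp add: abs_mult)
  qed
qed

lemma discrete_AE: "AE \<omega> in M. (\<lambda>n. \<bar>min_energy (real n) \<omega> / n - limit \<omega>\<bar>) \<longlonglongrightarrow> 0"
  using min_energy_decomposition residual.average_square(1) drift.average_square(1) drift.average_zero(1) drift.boundary_small
proof eventually_elim
  case (elim \<omega>)
  have 1: "(\<lambda>n. sq_avg n \<omega>) \<longlonglongrightarrow> 0" "(\<lambda>n. sq_avg' n \<omega>) \<longlonglongrightarrow> 0" "(\<lambda>n. avg n \<omega>) \<longlonglongrightarrow> 0"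
    using elim(2-4) by (simp_all add: sq_avg_def sq_avg'_def avg_def)
  have "(\<lambda>n. 10 * ((2 * (D\<^sub>0 \<omega>)\<^sup>2 + (filtered laplace_odd 0 \<omega>)\<^sup>2) / real n + (filtered laplace_odd (real n) \<omega>)\<^sup>2 / n)) \<longlonglongrightarrow> 10 * (0 + 0)"
    by (intro tendsto_mult tendsto_add tendsto_const lim_const_over_n elim(5))
  then have e: "(\<lambda>n. edge n \<omega>) \<longlonglongrightarrow> 0" unfolding edge_def by (simp add: add_divide_distrib algebra_simps)
  have "(\<lambda>n. \<bar>sq_avg n \<omega>\<bar> + \<bar>sq_avg' n \<omega>\<bar> + 2 * \<bar>D\<^sub>0 \<omega> * avg n \<omega>\<bar> + edge n \<omega>) \<longlonglongrightarrow> \<bar>0\<bar> + \<bar>0\<bar> + 2 * \<bar>D\<^sub>0 \<omega> * 0\<bar> + 0"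
    by (intro tendsto_intros 1 e)
  then have g: "(\<lambda>n. \<bar>sq_avg n \<omega>\<bar> + \<bar>sq_avg' n \<omega>\<bar> + 2 * \<bar>D\<^sub>0 \<omega> * avg n \<omega>\<bar> + edge n \<omega>) \<longlonglongrightarrow> 0" by simp
  show ?case
    by (rule Lim_null_comparison[OF eventually_sequentiallyI[of 1] g]) (use elim(1) in simp)
qed

lemma limit_integrable: "integrable M limit"
  unfolding limit_def using D0 by simp

text \<open>The same pathwise bound, integrated: the averages converge in L2, and the product with
  \<open>D\<^sub>0\<close> is handled by Cauchy-Schwarz.\<close>

lemma discrete_L1:
  "n \<ge> 1 \<Longrightarrow> integrable M (\<lambda>\<omega>. \<bar>min_energy (real n) \<omega> / n - limit \<omega>\<bar>)"
  "(\<lambda>n. \<integral>\<omega>. \<bar>min_energy (real n) \<omega> / n - limit \<omega>\<bar> \<partial>M) \<longlonglongrightarrow> 0"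
proof -
  have sq: "integrable M (\<lambda>\<omega>. (sq_avg n \<omega>)\<^sup>2)" "integrable M (\<lambda>\<omega>. (sq_avg' n \<omega>)\<^sup>2)" "integrable M (\<lambda>\<omega>. (avg n \<omega>)\<^sup>2)" for n
    unfolding sq_avg_def sq_avg'_def avg_def by (rule residual.average_square(3) drift.average_square(3) drift.average_zero(3))+
  have lims: "(\<lambda>n. \<integral>\<omega>. (sq_avg n \<omega>)\<^sup>2 \<partial>M) \<longlonglongrightarrow> 0" "(\<lambda>n. \<integral>\<omega>. (sq_avg' n \<omega>)\<^sup>2 \<partial>M) \<longlonglongrightarrow> 0" "(\<lambda>n. \<integral>\<omega>. (avg n \<omega>)\<^sup>2 \<partial>M) \<longlonglongrightarrow> 0"
    unfolding sq_avg_def sq_avg'_def avg_def by (rule residual.average_square(2) drift.average_square(2) drift.average_zero(2))+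
  have fm: "(\<lambda>p. filtered k (snd p) (fst p)) \<in> borel_measurable (M \<Otimes>\<^sub>M restrict_space lborel {0..<real n})" if [measurable]: "k \<in> borel_measurable borel" for k n
  proof -
    have [measurable]: "(\<lambda>p. snd p) \<in> borel_measurable (M \<Otimes>\<^sub>M restrict_space lborel {0..<real n})"
      by (rule measurable_compose[OF measurable_snd]) (rule measurable_restrict_space1, simp)
    show ?thesis by measurable
  qed
  have [measurable]: "sq_avg n \<in> borel_measurable M" "sq_avg' n \<in> borel_measurable M" "avg n \<in> borel_measurable M" for n
  proof -
    interpret L: finite_measure "restrict_space lborel {0..<real n}" by (rule finite_measure_lborel_restrict)
    have fe: "(\<lambda>(\<omega>, s). filtered laplace_even s \<omega>) \<in> borel_measurable (M \<Otimes>\<^sub>M restrict_space lborel {0..<real n})"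
      and fo: "(\<lambda>(\<omega>, s). filtered laplace_odd s \<omega>) \<in> borel_measurable (M \<Otimes>\<^sub>M restrict_space lborel {0..<real n})"
      using fm[of laplace_even n] fm[of laplace_odd n] by (simp_all add: case_prod_unfold)
    show "sq_avg n \<in> borel_measurable M" "sq_avg' n \<in> borel_measurable M" "avg n \<in> borel_measurable M"
      unfolding sq_avg_def sq_avg'_def avg_def using fe fo by measurable
  qed
  have ied: "integrable M (edge n)" "(\<integral>\<omega>. edge n \<omega> \<partial>M) = 10 * (2 * (\<integral>\<omega>. (D\<^sub>0 \<omega>)\<^sup>2 \<partial>M) + 2 * drift.total) / n" for n
    unfolding edge_def using D0 drift.square_integrable_Y by simp_all
  have iD: "integrable M (\<lambda>\<omega>. D\<^sub>0 \<omega> * avg n \<omega>)" for n by (intro integrable_mult_of_squares sq D0) auto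
  have i: "integrable M (sq_avg n)" "integrable M (sq_avg' n)" for n
    by (rule square_integrable_imp_integrable; use sq in simp)+
  define G where "G n \<omega> = \<bar>sq_avg n \<omega>\<bar> + \<bar>sq_avg' n \<omega>\<bar> + 2 * \<bar>D\<^sub>0 \<omega> * avg n \<omega>\<bar> + edge n \<omega>" for n \<omega>
  have iG: "integrable M (G n)" for n unfolding G_def using i iD ied by simp
  have le: "AE \<omega> in M. \<bar>min_energy (real n) \<omega> / n - limit \<omega>\<bar> \<le> G n \<omega>" if "n \<ge> 1" for n
    using min_energy_decomposition unfolding G_def by eventually_elim (use that in blast)
  have [measurable]: "limit \<in> borel_measurable M" using limit_integrable by auto
  have im: "integrable M (\<lambda>\<omega>. \<bar>min_energy (real n) \<omega> / n - limit \<omega>\<bar>)" if n: "n \<ge> 1" for n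
  proof (rule Bochner_Integration.integrable_bound[OF iG[of n]])
    have [measurable]: "min_energy (real n) \<in> borel_measurable M" by (rule min_energy_measurable) (use n in simp)
    show "(\<lambda>\<omega>. \<bar>min_energy (real n) \<omega> / n - limit \<omega>\<bar>) \<in> borel_measurable M" by measurable
    show "AE \<omega> in M. norm \<bar>min_energy (real n) \<omega> / n - limit \<omega>\<bar> \<le> norm (G n \<omega>)"
      using le[OF n] by eventually_elim simp
  qed
  then show "n \<ge> 1 \<Longrightarrow> integrable M (\<lambda>\<omega>. \<bar>min_energy (real n) \<omega> / n - limit \<omega>\<bar>)" .
  define c where "c = 10 * (2 * (\<integral>\<omega>. (D\<^sub>0 \<omega>)\<^sup>2 \<partial>M) + 2 * drift.total)"
  define g where "g n = sqrt (\<integral>\<omega>. (sq_avg n \<omega>)\<^sup>2 \<partial>M) + sqrt (\<integral>\<omega>. (sq_avg' n \<omega>)\<^sup>2 \<partial>M)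
      + 2 * (sqrt (\<integral>\<omega>. (D\<^sub>0 \<omega>)\<^sup>2 \<partial>M) * sqrt (\<integral>\<omega>. (avg n \<omega>)\<^sup>2 \<partial>M)) + c / n" for n
  have "g \<longlonglongrightarrow> sqrt 0 + sqrt 0 + 2 * (sqrt (\<integral>\<omega>. (D\<^sub>0 \<omega>)\<^sup>2 \<partial>M) * sqrt 0) + 0"
    unfolding g_def by (intro tendsto_add tendsto_mult tendsto_const tendsto_real_sqrt lims lim_const_over_n)
  then have g0: "g \<longlonglongrightarrow> 0" by simp
  have "(\<integral>\<omega>. \<bar>min_energy (real n) \<omega> / n - limit \<omega>\<bar> \<partial>M) \<le> g n" if n: "n \<ge> 1" for n
  proof -
    have "(\<integral>\<omega>. \<bar>min_energy (real n) \<omega> / n - limit \<omega>\<bar> \<partial>M) \<le> (\<integral>\<omega>. G n \<omega> \<partial>M)"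
      by (rule integral_mono_AE[OF im[OF n] iG le[OF n]])
    also have "\<dots> = (\<integral>\<omega>. \<bar>sq_avg n \<omega>\<bar> \<partial>M) + (\<integral>\<omega>. \<bar>sq_avg' n \<omega>\<bar> \<partial>M) + 2 * (\<integral>\<omega>. \<bar>D\<^sub>0 \<omega> * avg n \<omega>\<bar> \<partial>M) + c / n"
      unfolding G_def using i iD ied by (simp add: c_def)
    also have "\<dots> \<le> g n" unfolding g_def
      by (intro add_mono mult_left_mono abs_expectation_le_L2 Cauchy_Schwarz_integral(1) sq D0) auto
    finally show ?thesis .
  qed
  then show "(\<lambda>n. \<integral>\<omega>. \<bar>min_energy (real n) \<omega> / n - limit \<omega>\<bar> \<partial>M) \<longlonglongrightarrow> 0"
    by (intro Lim_null_comparison[OF eventually_sequentiallyI[of 1] g0]) simp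
qed

text \<open>The minimal energy is nondecreasing in \<open>T\<close>, so integer times control all times.\<close>
lemma continuous_time_bound:
  "AE \<omega> in M. \<forall>T\<ge>1. \<bar>inverse T * min_energy T \<omega> - limit \<omega>\<bar> \<le>
      \<bar>min_energy (real (nat \<lfloor>T\<rfloor>)) \<omega> / real (nat \<lfloor>T\<rfloor>) - limit \<omega>\<bar>
      + 2 * \<bar>min_energy (real (Suc (nat \<lfloor>T\<rfloor>))) \<omega> / real (Suc (nat \<lfloor>T\<rfloor>)) - limit \<omega>\<bar> + 2 * \<bar>limit \<omega>\<bar> / real (nat \<lfloor>T\<rfloor>)
    \<and> 0 \<le> min_energy T \<omega> \<and> min_energy T \<omega> \<le> min_energy (real (Suc (nat \<lfloor>T\<rfloor>))) \<omega>"
  using weighted_square_path AE_space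
proof eventually_elim
  case (elim \<omega>)
  note reg = path_regularity[OF elim(2,1)]
  note mono = energy_minimizer_mono[OF _ _ path_measurable[OF elim(2)] reg(2), folded min_energy_def]
  show ?case
  proof (intro allI impI)
    fix T :: real assume T: "T \<ge> 1"
    define n where "n = nat \<lfloor>T\<rfloor>"
    have n: "n \<ge> 1" "real n \<le> T" "T \<le> real (Suc n)" using T by (auto simp: n_def le_nat_iff; linarith)+
    define a b c l where "a = min_energy (real n) \<omega>" and "b = min_energy (real (Suc n)) \<omega>" and "c = min_energy T \<omega>" and "l = limit \<omega>"
    have ac: "a \<le> c" "c \<le> b" "0 \<le> a" "0 \<le> c" unfolding a_def b_def c_def
      using mono(1)[of "real n" T] mono(1)[of T "real (Suc n)"] mono(2)[of "real n" T] mono(2)[of T T] n T by auto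
    define k where "k = real n"
    have k: "k \<ge> 1" "k \<le> T" "T \<le> k + 1" using n by (auto simp: k_def)
    \<comment> \<open>From c \<le> b and T \<ge> k the quotient c / T is at most b / k, which is the
      normalized value at k + 1 times (k + 1) / k \<le> 2; this is the factor 2.\<close>
    have up: "c / T - l \<le> 2 * \<bar>b / (k + 1) - l\<bar> + \<bar>l\<bar> / k"
    proof -
      have "c / T \<le> b / k" using ac k by (intro frac_le) auto
      also have "b / k = (b / (k + 1)) * ((k + 1) / k)" using k by simp
      also have "(k + 1) / k = 1 + 1 / k" using k by (simp add: add_divide_distrib)
      finally have "c / T - l \<le> (b / (k + 1) - l) * (1 + 1 / k) + l / k" by (simp add: algebra_simps)
      also have "(b / (k + 1) - l) * (1 + 1 / k) \<le> \<bar>b / (k + 1) - l\<bar> * 2" using k by (intro mult_mono) auto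
      also have "l / k \<le> \<bar>l\<bar> / k" using k by (intro divide_right_mono) auto
      finally show ?thesis by simp
    qed
    \<comment> \<open>Here a \<le> c and T \<le> k + 1; the mismatch of the denominators k and k + 1
      costs at most |l| / k.\<close>
    have lo: "l - c / T \<le> \<bar>a / k - l\<bar> + \<bar>l\<bar> / k"
    proof -
      have f: "0 \<le> k / (k + 1)" "k / (k + 1) \<le> 1" "k / (k + 1) = 1 - 1 / (k + 1)" using k by (auto simp: field_simps)
      have "a / (k + 1) \<le> c / T" using ac k by (intro frac_le) auto
      then have "l - c / T \<le> l - (a / k) * (k / (k + 1))" using k by simp
      also have "\<dots> = (l - a / k) * (k / (k + 1)) + l * (1 - k / (k + 1))" by (simp only: left_diff_distrib right_diff_distrib)
      also have "l * (1 - k / (k + 1)) = l / (k + 1)" unfolding f(3) by simp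
      also have "(l - a / k) * (k / (k + 1)) \<le> \<bar>a / k - l\<bar> * 1" using f(1,2) by (intro mult_mono) auto
      also have "l / (k + 1) \<le> \<bar>l\<bar> / k" using k by (intro frac_le) auto
      finally show ?thesis by simp
    qed
    have "\<bar>c / T - l\<bar> \<le> \<bar>a / k - l\<bar> + 2 * \<bar>b / (k + 1) - l\<bar> + 2 * (\<bar>l\<bar> / k)"
    proof -
      define u v w where "u = \<bar>a / k - l\<bar>" and "v = \<bar>b / (k + 1) - l\<bar>" and "w = \<bar>l\<bar> / k"
      have "0 \<le> u" "0 \<le> v" "0 \<le> w" using k by (auto simp: u_def v_def w_def)
      moreover have "c / T - l \<le> 2 * v + w" "l - c / T \<le> u + w" using up lo by (auto simp: u_def v_def w_def)
      ultimately show ?thesis unfolding u_def[symmetric] v_def[symmetric] w_def[symmetric] by (intro abs_leI) linarith+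
    qed
    then show "\<bar>inverse T * min_energy T \<omega> - limit \<omega>\<bar> \<le>
      \<bar>min_energy (real (nat \<lfloor>T\<rfloor>)) \<omega> / real (nat \<lfloor>T\<rfloor>) - limit \<omega>\<bar>
      + 2 * \<bar>min_energy (real (Suc (nat \<lfloor>T\<rfloor>))) \<omega> / real (Suc (nat \<lfloor>T\<rfloor>)) - limit \<omega>\<bar> + 2 * \<bar>limit \<omega>\<bar> / real (nat \<lfloor>T\<rfloor>)
    \<and> 0 \<le> min_energy T \<omega> \<and> min_energy T \<omega> \<le> min_energy (real (Suc (nat \<lfloor>T\<rfloor>))) \<omega>"
      using ac unfolding n_def[symmetric] a_def b_def c_def l_def k_def by (simp add: divide_inverse mult.commute add.commute)
  qed
qed

lemma filterlim_nat_floor: "filterlim (\<lambda>T::real. nat \<lfloor>T\<rfloor>) sequentially at_top"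
  by (rule filterlim_compose[OF filterlim_nat_sequentially filterlim_floor_sequentially])

lemma convergence_AE: "AE \<omega> in M. ((\<lambda>T. inverse T * min_energy T \<omega>) \<longlongrightarrow> limit \<omega>) at_top"
  using discrete_AE continuous_time_bound
proof eventually_elim
  case (elim \<omega>)
  define e where "e n = \<bar>min_energy (real n) \<omega> / n - limit \<omega>\<bar>" for n
  have "e \<longlonglongrightarrow> 0" using elim(1) by (simp add: e_def[abs_def])
  then have "(\<lambda>n. e n + 2 * e (Suc n) + 2 * \<bar>limit \<omega>\<bar> / real n) \<longlonglongrightarrow> 0 + 2 * 0 + 0"
    by (intro tendsto_add tendsto_mult tendsto_const lim_const_over_n) (simp_all add: LIMSEQ_Suc)
  then have "(\<lambda>n. e n + 2 * e (Suc n) + 2 * \<bar>limit \<omega>\<bar> / real n) \<longlonglongrightarrow> 0" by simp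
  from filterlim_compose[OF this filterlim_nat_floor]
  have g: "((\<lambda>T. e (nat \<lfloor>T\<rfloor>) + 2 * e (Suc (nat \<lfloor>T\<rfloor>)) + 2 * \<bar>limit \<omega>\<bar> / real (nat \<lfloor>T\<rfloor>)) \<longlongrightarrow> 0) (at_top :: real filter)" .
  have "((\<lambda>T. inverse T * min_energy T \<omega> - limit \<omega>) \<longlongrightarrow> 0) at_top"
  proof (rule Lim_null_comparison[OF _ g])
    show "\<forall>\<^sub>F T in at_top. norm (inverse T * min_energy T \<omega> - limit \<omega>) \<le> e (nat \<lfloor>T\<rfloor>) + 2 * e (Suc (nat \<lfloor>T\<rfloor>)) + 2 * \<bar>limit \<omega>\<bar> / real (nat \<lfloor>T\<rfloor>)"
      using eventually_ge_at_top[of "1::real"]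
      by eventually_elim (use elim(2) in \<open>unfold e_def real_norm_def, blast\<close>)
  qed
  then show ?case by (simp add: LIM_zero_iff)
qed

lemma convergence_L1: "tendsto_L1 M (\<lambda>T \<omega>. inverse T * min_energy T \<omega>) limit at_top"
  unfolding tendsto_L1_def
proof (intro conjI limit_integrable)
  define e where "e n \<omega> = \<bar>min_energy (real n) \<omega> / n - limit \<omega>\<bar>" for n \<omega>
  have ie: "integrable M (e n)" if "n \<ge> 1" for n using discrete_L1(1)[OF that] by (simp add: e_def[abs_def])
  have [measurable]: "limit \<in> borel_measurable M" using limit_integrable by auto
  have imn: "integrable M (min_energy (real n))" if n: "n \<ge> 1" for n
  proof -
    have [measurable]: "min_energy (real n) \<in> borel_measurable M" by (rule min_energy_measurable) (use n in simp)
    have "integrable M (\<lambda>\<omega>. real n * ((min_energy (real n) \<omega> / n - limit \<omega>) + limit \<omega>))"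
      using ie[OF n] limit_integrable unfolding e_def
      by (intro integrable_mult_right Bochner_Integration.integrable_add) (simp_all add: integrable_abs_iff)
    then show ?thesis using n by simp
  qed
  \<comment> \<open>For real T integrability comes from domination by the minimal energy at the
    integer \<open>Suc (nat \<lfloor>T\<rfloor>)\<close>.\<close>
  have iT: "integrable M (min_energy T)" if T: "T \<ge> 1" for T
  proof (rule Bochner_Integration.integrable_bound[OF imn[of "Suc (nat \<lfloor>T\<rfloor>)"]])
    show "min_energy T \<in> borel_measurable M" by (rule min_energy_measurable) (use T in simp)
    show "AE \<omega> in M. norm (min_energy T \<omega>) \<le> norm (min_energy (real (Suc (nat \<lfloor>T\<rfloor>))) \<omega>)"
      using continuous_time_bound
    proof eventually_elim
      case (elim \<omega>)
      then have "0 \<le> min_energy T \<omega>" "min_energy T \<omega> \<le> min_energy (real (Suc (nat \<lfloor>T\<rfloor>))) \<omega>" using T by blast+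
      then show ?case by simp
    qed
  qed simp
  then show "\<forall>\<^sub>F T in at_top. integrable M (\<lambda>\<omega>. inverse T * min_energy T \<omega>)"
    by (intro eventually_mono[OF eventually_ge_at_top[of "1::real"]]) simp
  define c where "c = (\<integral>\<omega>. \<bar>limit \<omega>\<bar> \<partial>M)"
  define Ee where "Ee n = (\<integral>\<omega>. e n \<omega> \<partial>M)" for n
  have "Ee \<longlonglongrightarrow> 0" using discrete_L1(2) by (simp add: Ee_def[abs_def] e_def[abs_def])
  then have "(\<lambda>n. Ee n + 2 * Ee (Suc n) + 2 * c / real n) \<longlonglongrightarrow> 0 + 2 * 0 + 0"
    by (intro tendsto_add tendsto_mult tendsto_const lim_const_over_n) (simp_all add: LIMSEQ_Suc)
  then have "(\<lambda>n. Ee n + 2 * Ee (Suc n) + 2 * c / real n) \<longlonglongrightarrow> 0" by simp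
  from filterlim_compose[OF this filterlim_nat_floor]
  have g: "((\<lambda>T. Ee (nat \<lfloor>T\<rfloor>) + 2 * Ee (Suc (nat \<lfloor>T\<rfloor>)) + 2 * c / real (nat \<lfloor>T\<rfloor>)) \<longlongrightarrow> 0) (at_top :: real filter)" .
  show "((\<lambda>T. \<integral>\<omega>. \<bar>inverse T * min_energy T \<omega> - limit \<omega>\<bar> \<partial>M) \<longlongrightarrow> 0) at_top"
  proof (rule Lim_null_comparison[OF _ g])
    show "\<forall>\<^sub>F T in at_top. norm (\<integral>\<omega>. \<bar>inverse T * min_energy T \<omega> - limit \<omega>\<bar> \<partial>M) \<le> Ee (nat \<lfloor>T\<rfloor>) + 2 * Ee (Suc (nat \<lfloor>T\<rfloor>)) + 2 * c / real (nat \<lfloor>T\<rfloor>)"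
      using eventually_ge_at_top[of "1::real"]
    proof eventually_elim
      case (elim T)
      define n where "n = nat \<lfloor>T\<rfloor>"
      have n: "n \<ge> 1" using elim by (simp add: n_def le_nat_iff)
      have "(\<integral>\<omega>. \<bar>inverse T * min_energy T \<omega> - limit \<omega>\<bar> \<partial>M) \<le> (\<integral>\<omega>. e n \<omega> + 2 * e (Suc n) \<omega> + 2 * \<bar>limit \<omega>\<bar> / real n \<partial>M)"
      proof (rule integral_mono_AE)
        show "integrable M (\<lambda>\<omega>. \<bar>inverse T * min_energy T \<omega> - limit \<omega>\<bar>)" using iT[OF elim] limit_integrable by simp
        show "integrable M (\<lambda>\<omega>. e n \<omega> + 2 * e (Suc n) \<omega> + 2 * \<bar>limit \<omega>\<bar> / real n)" using ie[OF n] ie[of "Suc n"] limit_integrable by simp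
        show "AE \<omega> in M. \<bar>inverse T * min_energy T \<omega> - limit \<omega>\<bar> \<le> e n \<omega> + 2 * e (Suc n) \<omega> + 2 * \<bar>limit \<omega>\<bar> / real n"
          using continuous_time_bound by eventually_elim (use elim in \<open>unfold e_def n_def, blast\<close>)
      qed
      also have "\<dots> = Ee n + 2 * Ee (Suc n) + 2 * c / real n"
        using ie[OF n] ie[of "Suc n"] limit_integrable by (simp add: Ee_def c_def)
      finally show ?case unfolding n_def by simp
    qed
  qed
qed

end

theorem proposition3p7:
  fixes M :: "'a measure"
    and B :: "real \<Rightarrow> 'a \<Rightarrow> real"
    and D\<^sub>0 :: "'a \<Rightarrow> real"
    and X :: "real set \<Rightarrow> 'a \<Rightarrow> complex"
    and \<mu> :: "real measure"
  assumes "prob_space M"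
    and "measurable_process M B"
    and "stochastically_continuous M B"
    and "wide_sense_stationary_increments M B"
    and "AE \<omega> in M. B 0 \<omega> = 0"
    and "spectral_representation M B D\<^sub>0 X \<mu>"
    and "gaussian_process M B"
    and "no_atoms \<mu>"
  shows "let Z = (\<lambda>\<omega>. \<bar>D\<^sub>0 \<omega>\<bar>\<^sup>2 + (\<integral>u. u\<^sup>2 / (1 + u\<^sup>2) \<partial>\<mu>));
             f = (\<lambda>T \<omega>. minimizer T (\<lambda>s. B s \<omega>));
             E = (\<lambda>T \<omega>. inverse T * energy T (f T \<omega>) (\<lambda>s. B s \<omega>))
         in tendsto_L1 M E Z at_top \<and> (AE \<omega> in M. ((\<lambda>T. E T \<omega>) \<longlongrightarrow> Z \<omega>) at_top)"
proof -
  interpret prob_space M by fact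
  interpret atomless_spectral_process M B D\<^sub>0 X \<mu>
    by unfold_locales (use assms in auto)
  show ?thesis
    using convergence_L1 convergence_AE unfolding Let_def min_energy_def limit_def by blast
qed

end
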